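(* Let $1\le p_0\le p_1<\infty$, let $A\in\mathcal{Y}(p_0,p_1)$ be a Young function with complementary function $\overline{A}$, let $T$ be an $\overline{A}$-Hörmander operator on $\mathbb{R}^n$ with kernel $K$, and let $m$ be a non-negative integer. Then there are constants $c_{n,m}$ (depending only on $n,m$) and $c_{n,p_0,p_1}$ (depending only on $n,p_0,p_1$) such that, for every $f\in\mathcal{C}_c^\infty(\mathbb{R}^n)$ and every $b\in L^1_{\mathrm{loc}}(\mathbb{R}^n)$, there exist $3^n$ sparse families $\mathcal{S}_1,\dots,\mathcal{S}_{3^n}$ of cubes such that for almost every $x\in\mathbb{R}^n$ $$|T_b^m f(x)|\le c_{n,m}\,C_T\sum_{j=1}^{3^n}\sum_{h=0}^m\binom{m}{h}\mathcal{A}^{m,h}_{A,\mathcal{S}_j}(b,f)(x),$$ where $$\mathcal{A}^{m,h}_{A,\mathcal{S}}(b,f)(x)=\sum_{Q\in\mathcal{S}}|b(x)-b_Q|^{m-h}\,\big\|f|b-b_Q|^h\big\|_{A,Q}\,\chi_Q(x)$$ (for $m=h=0$ this is $\sum_{Q\in\mathcal{S}}\|f\|_{A,Q}\chi_Q(x)$) and $$C_T=c_{n,p_0,p_1}\max\{c_{A,p_0},c_{A,p_1}\}\left(H_{K,\overline{A}}+\|T\|_{L^2\to L^2}\right).$$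
   Context: Cubes $Q\subset\mathbb{R}^n$ have sides parallel to the axes, $l(Q)$ is the side length, $cQ$ is the cube with the same center and side length $c\,l(Q)$, and $b_Q=\frac1{|Q|}\int_Q b$. Young functions: a Young function is a continuous, convex, increasing $A:[0,\infty)\to[0,\infty)$ with $A(0)=0$; its complementary function is $\overline{A}(t)=\sup_{s>0}\{st-A(s)\}$. The Luxemburg average is $\|f\|_{A,Q}=\inf\{\lambda>0:\frac1{|Q|}\int_Q A(|f|/\lambda)\,dx\le1\}$. For $A(t)=t$, $\|\cdot\|_{\overline{A},Q}$ is understood as the $L^\infty(Q)$ norm. $\mathcal{Y}(p_0,p_1)$ is the class of functions $A$ for which there are constants $c_{A,p_0},c_{A,p_1},t_A\ge1$ with $t^{p_0}\le c_{A,p_0}A(t)$ for all $t>t_A$ and $t^{p_1}\le c_{A,p_1}A(t)$ for all $t\le t_A$. For a Young function $E$, an $E$-Hörmander operator is a linear operator $T$ bounded on $L^2(\mathbb{R}^n)$ such that $Tf(x)=\int K(x,y)f(y)\,dy$ for $f\in\mathcal{C}_c^\infty$, $x\notin\operatorname{supp}f$, where $K:\mathbb{R}^n\times\mathbb{R}^n\setminus\{(x,x)\}\to\mathbb{R}$ is locally integrable away from the diagonal, satisfies a size condition $|K(x,y)|\le c_K|x-y|^{-n}$, and satisfies $H_{K,E}=\max\{H_{K,E,1},H_{K,E,2}\}<\infty$, with $$H_{K,E,1}=\sup_Q\sup_{x,z\in\frac12Q}\sum_{k=1}^\infty(2^kl(Q))^n\big\|(K(x,\cdot)-K(z,\cdot))\chi_{2^kQ\setminus2^{k-1}Q}\big\|_{E,2^kQ},$$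 and $H_{K,E,2}$ defined in the same way with $K(\cdot,x)-K(\cdot,z)$ in place of $K(x,\cdot)-K(z,\cdot)$. Commutators: $T_b^0=T$ and $T_b^mf=[b,T_b^{m-1}]f=b\,T_b^{m-1}f-T_b^{m-1}(bf)$ for $m\ge1$. A family $\mathcal{S}$ of cubes from a dyadic lattice is $\eta$-sparse, $\eta\in(0,1)$, if for each $Q\in\mathcal{S}$ there is a measurable $E_Q\subseteq Q$ with $\eta|Q|\le|E_Q|$ and the sets $E_Q$ are pairwise disjoint; it is sparse if it is $\eta$-sparse for some $\eta\in(0,1)$. (A dyadic lattice is a family $\mathcal D$ of cubes closed under taking dyadic children, in which any two cubes have a common dyadic ancestor in $\mathcal D$, and such that every compact set is contained in some cube of $\mathcal D$.) *)

theory Defs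
  imports "HOL-Analysis.Analysis"
begin

section \<open>Cubes, dyadic lattices, sparse families\<close>

text \<open>
  A cube is the pair of its centre and its side length (positive for genuine cubes, see
  \<open>is_cube\<close>). Cubes are half-open, so that the dyadic children of a cube partition it.
\<close>

type_synonym 'n cube = "(real ^ 'n) \<times> real"

abbreviation side :: "('n::finite) cube \<Rightarrow> real"
  where "side Q \<equiv> snd Q"

definition is_cube :: "('n::finite) cube \<Rightarrow> bool"
  where "is_cube Q \<longleftrightarrow> side Q > 0"

definition cube_set :: "('n::finite) cube \<Rightarrow> (real ^ 'n) set"
  where "cube_set Q = {x. \<forall>i. fst Q $ i - side Q / 2 \<le> x $ i \<and> x $ i < fst Q $ i + side Q / 2}"

definition dilate :: "real \<Rightarrow> ('n::finite) cube \<Rightarrow> 'n cube"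
  where "dilate c Q = (fst Q, c * side Q)"

definition dyadic_children :: "('n::finite) cube \<Rightarrow> 'n cube set"
  where "dyadic_children Q =
    {(fst Q + (side Q / 4) *\<^sub>R e, side Q / 2) | e. \<forall>i. e $ i \<in> {-1, 1}}"

inductive_set dyadic_descendants :: "('n::finite) cube \<Rightarrow> 'n cube set" for Q where
  self: "Q \<in> dyadic_descendants Q"
| child: "R \<in> dyadic_descendants Q \<Longrightarrow> P \<in> dyadic_children R \<Longrightarrow> P \<in> dyadic_descendants Q"

definition dyadic_lattice :: "('n::finite) cube set \<Rightarrow> bool"
  where "dyadic_lattice D \<longleftrightarrow>
    (\<forall>Q\<in>D. is_cube Q) \<and>
    (\<forall>Q\<in>D. dyadic_children Q \<subseteq> D) \<and>
    (\<forall>Q\<in>D. \<forall>R\<in>D. \<exists>P\<in>D. Q \<in> dyadic_descendants P \<and> R \<in> dyadic_descendants P) \<and>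
    (\<forall>C. compact C \<longrightarrow> (\<exists>Q\<in>D. C \<subseteq> cube_set Q))"

definition eta_sparse :: "real \<Rightarrow> ('n::finite) cube set \<Rightarrow> bool"
  where "eta_sparse \<eta> S \<longleftrightarrow>
    (\<exists>D. dyadic_lattice D \<and> S \<subseteq> D) \<and>
    (\<exists>E. (\<forall>Q\<in>S. E Q \<in> sets lebesgue \<and> E Q \<subseteq> cube_set Q \<and>
                 \<eta> * measure lebesgue (cube_set Q) \<le> measure lebesgue (E Q)) \<and>
         (\<forall>Q\<in>S. \<forall>R\<in>S. Q \<noteq> R \<longrightarrow> E Q \<inter> E R = {}))"

definition sparse_family :: "('n::finite) cube set \<Rightarrow> bool"
  where "sparse_family S \<longleftrightarrow> (\<exists>\<eta>. 0 < \<eta> \<and> \<eta> < 1 \<and> eta_sparse \<eta> S)"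

section \<open>Function classes\<close>

fun C_k :: "nat \<Rightarrow> (real ^ ('n::finite) \<Rightarrow> real) \<Rightarrow> bool" where
  "C_k 0 f \<longleftrightarrow> continuous_on UNIV f"
| "C_k (Suc k) f \<longleftrightarrow>
    (\<exists>g. (\<forall>x. (f has_derivative (\<lambda>h. g x \<bullet> h)) (at x)) \<and> (\<forall>i. C_k k (\<lambda>x. g x $ i)))"

definition supp :: "(real ^ ('n::finite) \<Rightarrow> real) \<Rightarrow> (real ^ 'n) set"
  where "supp f = closure {x. f x \<noteq> 0}"

definition Cc_infinity :: "(real ^ ('n::finite) \<Rightarrow> real) set"
  where "Cc_infinity = {f. (\<forall>k. C_k k f) \<and> compact (supp f)}"

definition L1_loc :: "(real ^ ('n::finite) \<Rightarrow> real) set"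
  where "L1_loc = {b. \<forall>C. compact C \<longrightarrow> b absolutely_integrable_on C}"

definition L2 :: "(real ^ ('n::finite) \<Rightarrow> real) set"
  where "L2 = {f. f \<in> borel_measurable lebesgue \<and> integrable lebesgue (\<lambda>x. (f x)\<^sup>2)}"

definition norm_L2 :: "(real ^ ('n::finite) \<Rightarrow> real) \<Rightarrow> real"
  where "norm_L2 f = sqrt (LINT x|lebesgue. (f x)\<^sup>2)"

definition avg :: "(real ^ ('n::finite) \<Rightarrow> real) \<Rightarrow> 'n cube \<Rightarrow> real"
  where "avg b Q = (LINT x:cube_set Q|lebesgue. b x) / measure lebesgue (cube_set Q)"

section \<open>Young functions and Luxemburg averages\<close>

definition young :: "(real \<Rightarrow> real) \<Rightarrow> bool"
  where "young A \<longleftrightarrow>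
    continuous_on {0..} A \<and> convex_on {0..} A \<and> mono_on {0..} A \<and> A 0 = 0"

text \<open>
  The complementary function may take the value \<open>\<infinity>\<close> (when \<open>A\<close> grows linearly). Truncating
  \<open>s * t - A s\<close> at \<open>0\<close> does not change the supremum, because \<open>s * t - A s\<close> tends to \<open>0\<close> as
  \<open>s\<close> tends to \<open>0\<close>.
\<close>

definition complementary :: "(real \<Rightarrow> real) \<Rightarrow> real \<Rightarrow> ennreal"
  where "complementary A t = (SUP s\<in>{0<..}. ennreal (s * t - A s))"

text \<open>
  \<open>E\<close> is extended-valued, so the same definition covers both \<open>A\<close> and its complementary
  function. The infimum of the empty set is \<open>\<infinity>\<close>.
\<close>

definition luxemburg ::
  "(real \<Rightarrow> ennreal) \<Rightarrow> ('n::finite) cube \<Rightarrow> (real ^ 'n \<Rightarrow> real) \<Rightarrow> ennreal"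
  where "luxemburg E Q f =
    (INF r\<in>{r. 0 < r \<and>
        (\<integral>\<^sup>+x\<in>cube_set Q. E (\<bar>f x\<bar> / r) \<partial>lebesgue) / emeasure lebesgue (cube_set Q) \<le> 1}.
      ennreal r)"

definition class_Y ::
  "real \<Rightarrow> real \<Rightarrow> real \<Rightarrow> real \<Rightarrow> real \<Rightarrow> (real \<Rightarrow> real) \<Rightarrow> bool"
  where "class_Y p0 p1 c0 c1 tA A \<longleftrightarrow>
    c0 \<ge> 1 \<and> c1 \<ge> 1 \<and> tA \<ge> 1 \<and>
    (\<forall>t>tA. t powr p0 \<le> c0 * A t) \<and>
    (\<forall>t. 0 \<le> t \<and> t \<le> tA \<longrightarrow> t powr p1 \<le> c1 * A t)"

text \<open>
  For \<open>A t = t\<close> the Luxemburg average of the complementary function is the \<open>L\<^sup>\<infinity>\<close> norm on the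
  cube, so this case needs no separate convention.
\<close>

lemma complementary_id:
  "complementary (\<lambda>t. t) t = (if t \<le> 1 then 0 else \<infinity>)"
proof (cases "t \<le> 1")
  case True
  have "ennreal (s * t - s) = 0" if "s > 0" for s
    using that True by (intro ennreal_neg) (simp add: mult_left_le)
  then show ?thesis
    using True by (auto simp: complementary_def intro!: antisym SUP_least)
next
  case False
  have le: "ennreal r \<le> complementary (\<lambda>t. t) t" for r
  proof -
    define s where "s = max 1 (r / (t - 1))"
    have "r / (t - 1) * (t - 1) \<le> s * (t - 1)"
      using False by (intro mult_right_mono) (auto simp: s_def)
    then have "r \<le> s * (t - 1)" using False by simp
    then have "ennreal r \<le> ennreal (s * t - s)"
      by (intro ennreal_leI) (simp add: algebra_simps)
    also have "\<dots> \<le> complementary (\<lambda>t. t) t"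
      unfolding complementary_def by (intro SUP_upper) (simp add: s_def)
    finally show ?thesis .
  qed
  have "complementary (\<lambda>t. t) t = \<infinity>"
  proof (cases "complementary (\<lambda>t. t) t")
    case (real r)
    then have "ennreal (r + 1) \<le> ennreal r" using le[of "r + 1"] by simp
    then show ?thesis using real by simp
  qed simp
  then show ?thesis using False by simp
qed

lemma luxemburg_complementary_id:
  fixes f :: "real ^ ('n::finite) \<Rightarrow> real"
  assumes [measurable]: "f \<in> borel_measurable lebesgue"
  shows "luxemburg (complementary (\<lambda>t. t)) Q f =
    (INF r\<in>{r. 0 < r \<and> (AE x in lebesgue. x \<in> cube_set Q \<longrightarrow> \<bar>f x\<bar> \<le> r)}. ennreal r)"
proof -
  have [measurable]: "cube_set Q \<in> sets lebesgue"
  proof -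
    have "cube_set Q \<in> sets borel" unfolding cube_set_def by measurable
    then show ?thesis by simp
  qed
  have "cube_set Q \<subseteq> cbox (\<chi> i. fst Q $ i - side Q / 2) (\<chi> i. fst Q $ i + side Q / 2)"
    by (auto simp: cube_set_def mem_box_cart less_eq_real_def)
  then have "emeasure lebesgue (cube_set Q) \<le> emeasure lebesgue
      (cbox (\<chi> i. fst Q $ i - side Q / 2) (\<chi> i. fst Q $ i + side Q / 2))"
    by (intro emeasure_mono) auto
  also have "\<dots> < \<infinity>" using emeasure_lborel_cbox_finite by simp
  finally have fin: "emeasure lebesgue (cube_set Q) < \<infinity>" .
  have "(\<integral>\<^sup>+x\<in>cube_set Q. complementary (\<lambda>t. t) (\<bar>f x\<bar> / r) \<partial>lebesgue) /
      emeasure lebesgue (cube_set Q) \<le> 1 \<longleftrightarrow>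
      (AE x in lebesgue. x \<in> cube_set Q \<longrightarrow> \<bar>f x\<bar> \<le> r)" (is "?I / _ \<le> 1 \<longleftrightarrow> ?R")
    if "r > 0" for r
  proof
    assume ?R
    then have "AE x in lebesgue.
        complementary (\<lambda>t. t) (\<bar>f x\<bar> / r) * indicator (cube_set Q) x = 0"
      by eventually_elim (use that in \<open>auto simp: complementary_id split: split_indicator\<close>)
    from nn_integral_cong_AE[OF this] show "?I / emeasure lebesgue (cube_set Q) \<le> 1" by simp
  next
    assume "?I / emeasure lebesgue (cube_set Q) \<le> 1"
    then have "?I \<noteq> \<infinity>"
      using fin by (auto simp: ennreal_top_divide top_unique split: if_splits)
    moreover have "(\<lambda>x. complementary (\<lambda>t. t) (\<bar>f x\<bar> / r) * indicator (cube_set Q) x)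
        \<in> borel_measurable lebesgue"
      unfolding complementary_id by measurable
    ultimately have "AE x in lebesgue.
        complementary (\<lambda>t. t) (\<bar>f x\<bar> / r) * indicator (cube_set Q) x \<noteq> \<infinity>"
      by (intro nn_integral_noteq_infinite)
    then show ?R
      by eventually_elim
        (use that in \<open>auto simp: complementary_id split: split_indicator_asm if_splits\<close>)
  qed
  then show ?thesis
    unfolding luxemburg_def by (intro arg_cong[where f = Inf] image_cong) auto
qed

section \<open>Hoermander operators\<close>

definition L2_bounded_linear :: "((real ^ ('n::finite) \<Rightarrow> real) \<Rightarrow> real ^ 'n \<Rightarrow> real) \<Rightarrow> bool"
  where "L2_bounded_linear T \<longleftrightarrow>
    (\<forall>f\<in>L2. T f \<in> L2) \<and>
    (\<forall>f\<in>L2. \<forall>g\<in>L2. AE x in lebesgue. T (\<lambda>y. f y + g y) x = T f x + T g x) \<and>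
    (\<forall>c. \<forall>f\<in>L2. AE x in lebesgue. T (\<lambda>y. c * f y) x = c * T f x) \<and>
    (\<exists>C. \<forall>f\<in>L2. norm_L2 (T f) \<le> C * norm_L2 f)"

definition opnorm_L2 :: "((real ^ ('n::finite) \<Rightarrow> real) \<Rightarrow> real ^ 'n \<Rightarrow> real) \<Rightarrow> real"
  where "opnorm_L2 T = (SUP f\<in>{f\<in>L2. norm_L2 f \<le> 1}. norm_L2 (T f))"

definition H1 ::
  "(real ^ ('n::finite) \<Rightarrow> real ^ 'n \<Rightarrow> real) \<Rightarrow> (real \<Rightarrow> ennreal) \<Rightarrow> ennreal"
  where "H1 K E =
    (SUP Q\<in>{Q. is_cube Q}.
      SUP x\<in>cube_set (dilate (1/2) Q). SUP z\<in>cube_set (dilate (1/2) Q).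
        (\<Sum>j. let k = Suc j in
          ennreal ((2 ^ k * side Q) ^ CARD('n)) *
          luxemburg E (dilate (2 ^ k) Q)
            (\<lambda>y. (K x y - K z y) *
              indicator (cube_set (dilate (2 ^ k) Q) - cube_set (dilate (2 ^ (k - 1)) Q)) y)))"

definition H2 ::
  "(real ^ ('n::finite) \<Rightarrow> real ^ 'n \<Rightarrow> real) \<Rightarrow> (real \<Rightarrow> ennreal) \<Rightarrow> ennreal"
  where "H2 K E = H1 (\<lambda>x y. K y x) E"

definition H ::
  "(real ^ ('n::finite) \<Rightarrow> real ^ 'n \<Rightarrow> real) \<Rightarrow> (real \<Rightarrow> ennreal) \<Rightarrow> ennreal"
  where "H K E = max (H1 K E) (H2 K E)"

text \<open>The values of \<open>K\<close> on the diagonal are irrelevant.\<close>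

definition hormander_operator ::
  "(real \<Rightarrow> ennreal) \<Rightarrow> (real ^ ('n::finite) \<Rightarrow> real ^ 'n \<Rightarrow> real) \<Rightarrow>
    ((real ^ 'n \<Rightarrow> real) \<Rightarrow> real ^ 'n \<Rightarrow> real) \<Rightarrow> bool"
  where "hormander_operator E K T \<longleftrightarrow>
    L2_bounded_linear T \<and>
    (\<forall>f\<in>Cc_infinity. AE x in lebesgue. x \<notin> supp f \<longrightarrow> T f x = (LINT y|lebesgue. K x y * f y)) \<and>
    (\<forall>C. compact C \<and> C \<subseteq> {(x, y). x \<noteq> y} \<longrightarrow> (\<lambda>(x, y). K x y) absolutely_integrable_on C) \<and>
    (\<exists>cK. \<forall>x y. x \<noteq> y \<longrightarrow> \<bar>K x y\<bar> \<le> cK / norm (x - y) ^ CARD('n)) \<and>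
    H K E < \<infinity>"

section \<open>Commutators\<close>

text \<open>
  For \<open>b\<close> merely locally integrable the products \<open>b ^ k * f\<close> need not lie in \<open>L2\<close>. On
  integrable functions outside \<open>L2\<close>, \<open>T\<close> denotes its continuous extension: the limit in measure
  of \<open>T\<close> along every approximating sequence from \<open>L1 \<inter> L2\<close>. For Hoermander operators it exists
  and is unique almost everywhere, by the weak type (1,1) inequality. Where neither applies the
  value is set to \<open>0\<close>.
\<close>

definition L1_extension_value ::
  "((real ^ ('n::finite) \<Rightarrow> real) \<Rightarrow> real ^ 'n \<Rightarrow> real) \<Rightarrow>
    (real ^ 'n \<Rightarrow> real) \<Rightarrow> (real ^ 'n \<Rightarrow> real) \<Rightarrow> bool"
  where "L1_extension_value T g u \<longleftrightarrow>
    integrable lebesgue g \<and> u \<in> borel_measurable lebesgue \<and>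
    (\<forall>G. (\<forall>k. G k \<in> L2 \<and> integrable lebesgue (G k)) \<and>
         (\<lambda>k. LINT x|lebesgue. \<bar>G k x - g x\<bar>) \<longlonglongrightarrow> 0 \<longrightarrow>
         (\<forall>\<epsilon>>0. (\<lambda>k. emeasure lebesgue {x. \<bar>T (G k) x - u x\<bar> > \<epsilon>}) \<longlonglongrightarrow> 0))"

definition extend ::
  "((real ^ ('n::finite) \<Rightarrow> real) \<Rightarrow> real ^ 'n \<Rightarrow> real) \<Rightarrow>
    (real ^ 'n \<Rightarrow> real) \<Rightarrow> real ^ 'n \<Rightarrow> real"
  where "extend T g =
    (if g \<in> L2 then T g
     else if \<exists>u. L1_extension_value T g u then SOME u. L1_extension_value T g u
     else (\<lambda>_. 0))"

primrec commutator ::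
  "((real ^ ('n::finite) \<Rightarrow> real) \<Rightarrow> real ^ 'n \<Rightarrow> real) \<Rightarrow> (real ^ 'n \<Rightarrow> real) \<Rightarrow> nat \<Rightarrow>
    (real ^ 'n \<Rightarrow> real) \<Rightarrow> real ^ 'n \<Rightarrow> real" where
  "commutator T b 0 = extend T"
| "commutator T b (Suc m) =
    (\<lambda>f x. b x * commutator T b m f x - commutator T b m (\<lambda>y. b y * f y) x)"

section \<open>Sparse operators\<close>

text \<open>
  An unconditional sum in \<open>[0, \<infinity>]\<close>, with \<open>0 ^ 0 = 1\<close>. The products may be \<open>0 * \<infinity> = 0\<close>; this
  cannot make the sum over \<open>h\<close> of the sparse operators finite, because if the average with the
  \<open>h\<close>-th power is infinite for a bounded \<open>f\<close>, then so is the one with the \<open>m\<close>-th power, whose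
  prefactor is \<open>1\<close>.
\<close>

definition sparse_op ::
  "(real \<Rightarrow> real) \<Rightarrow> nat \<Rightarrow> nat \<Rightarrow> ('n::finite) cube set \<Rightarrow>
    (real ^ 'n \<Rightarrow> real) \<Rightarrow> (real ^ 'n \<Rightarrow> real) \<Rightarrow> real ^ 'n \<Rightarrow> ennreal"
  where "sparse_op A m h S b f x =
    (\<Sum>\<^sub>\<infinity>Q\<in>S. ennreal (\<bar>b x - avg b Q\<bar> ^ (m - h)) *
       luxemburg (\<lambda>t. ennreal (A t)) Q (\<lambda>y. f y * \<bar>b y - avg b Q\<bar> ^ h) *
       indicator (cube_set Q) x)"

end

(* Let sigma be the point with A(sigma) = 1 and let N dominate both the norm of T on L^2 and H_K / sigma.
   A Calderon-Zygmund decomposition bounds T from L^1 to weak L^1 by a multiple of N, so T extends to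
   integrable functions. For a cube Q of a base grid and g supported in 3Q with Luxemburg average u over 3Q,
   there is a small exceptional set E in Q such that |T g| is at most a multiple of sigma N u off E, and so is
   |T(g 1_{3Q - 3P})| on every smaller grid cube P that is not mostly filled by E: by the Hoermander condition
   this function varies little on P, and at a typical point of P it is the difference of T g and T(g 1_{3P}).

   The commutator does not change when b is replaced by b - c. With c the average of b over 3Q, the binomial
   expansion reduces T_b^m(f 1_{3Q}) to T applied to f (b - c)^h 1_{3Q}. The maximal cubes P in which the union
   of the m + 1 exceptional sets has density above a threshold fill at most half of Q; off their union the
   commutator is bounded by the term of 3Q, and on P by this term plus the commutator of f 1_{3P}. Iterating
   inside P reaches almost every point after finitely many steps. The triples of all cubes met on the way are
   distributed over 3^n dyadic lattices, and the parts of the cubes outside their successors are disjoint. *)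

theory Submission
  imports Defs
begin

text \<open>Two normalisations produce the constants. As A(\<sigma>) = 1, the constant function 1
  has Luxemburg radius 1 / \<sigma>, so the Hoermander condition tested against it is the classical
  L^1 condition with constant 2 H_K / \<sigma>; hence one N governs both the L^2 and the weak L^1
  bound. Conversely L^1 averages are at most 2 \<sigma> times Luxemburg averages, which restores the
  factor \<sigma>, and \<sigma> N is finally at most max {c_{A,p0}, c_{A,p1}} times the sum of H_K
  and the norm, because \<sigma> \<le> c_{A,p1}.

  The exceptional set does the work of a maximal function: it also contains the cubes, taken from
  all 3^n lattices, on which the modular of g has large mean. The annuli around P in the Hoermander
  condition are not grid cubes, but triples of ancestors of P cover them, and those belong to the
  lattices.

  The obstacle is low regularity. The products f (b - c)^h need not be square integrable, identities
  for T hold only almost everywhere, and sections of K need not be measurable. So T is extended in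
  measure, K is replaced by a Borel version, and all cubes are drawn from countable grids so that
  null sets can be united.\<close>

declare emeasure_completion [simp del]

section \<open>Cubes and Luxemburg averages\<close>

lemma cube_set_sets [measurable, simp]: "cube_set Q \<in> sets borel"
  unfolding cube_set_def by measurable

lemma cube_set_lebesgue [measurable, simp]: "cube_set Q \<in> sets lebesgue"
  by (simp add: sets_completionI_sets)

text \<open>The half-open cube lies between the open and the closed box with the same corners, and
  these have equal volume.\<close>

lemma emeasure_cube_set:
  fixes Q :: "('n::finite) cube"
  assumes "is_cube Q"
  shows "emeasure lebesgue (cube_set Q) = ennreal (side Q ^ CARD('n))"
proof -
  define a b :: "real ^ 'n" where "a = (\<chi> i. fst Q $ i - side Q / 2)" and "b = (\<chi> i. fst Q $ i + side Q / 2)"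
  have ab: "\<And>i. a $ i \<le> b $ i" "\<And>i. b $ i - a $ i = side Q"
    using assms by (auto simp: a_def b_def is_cube_def)
  have 1: "box a b \<subseteq> cube_set Q" "cube_set Q \<subseteq> cbox a b"
    by (auto simp: a_def b_def cube_set_def mem_box_cart less_eq_real_def)
  have ne: "cbox a b \<noteq> {}" using ab by (auto simp: interval_ne_empty_cart)
  have "measure lborel (cbox a b) = side Q ^ CARD('n)"
    using ne by (simp add: content_cbox_if_cart ab)
  moreover have "emeasure lebesgue (cbox a b) = emeasure lborel (cbox a b)"
    by (simp add: emeasure_completion)
  moreover have "emeasure lborel (cbox a b) = ennreal (measure lborel (cbox a b))"
    by (intro emeasure_eq_ennreal_measure) (use emeasure_lborel_cbox_finite[of a b] in auto)
  ultimately have c: "emeasure lebesgue (cbox a b) = ennreal (side Q ^ CARD('n))" by simp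
  have "emeasure lebesgue (box a b) = emeasure lebesgue (cbox a b)"
    by (simp add: emeasure_completion emeasure_lborel_box_eq emeasure_lborel_cbox_eq)
  then show ?thesis
    using emeasure_mono[OF 1(1), of lebesgue] emeasure_mono[OF 1(2), of lebesgue] c by simp
qed

lemma measure_cube_set:
  fixes Q :: "('n::finite) cube"
  assumes "is_cube Q"
  shows "measure lebesgue (cube_set Q) = side Q ^ CARD('n)"
  by (rule measure_eq_emeasure_eq_ennreal) (use emeasure_cube_set[OF assms] assms in \<open>auto simp: is_cube_def\<close>)

lemma emeasure_cube_finite [simp]:
  assumes "is_cube Q"
  shows "emeasure lebesgue (cube_set Q) < top" "emeasure lebesgue (cube_set Q) \<noteq> top"
    "emeasure lebesgue (cube_set Q) \<noteq> 0"
  using assms by (simp_all add: emeasure_cube_set is_cube_def)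

lemma is_cube_dilate [simp]: "0 < c \<Longrightarrow> is_cube Q \<Longrightarrow> is_cube (dilate c Q)"
  by (simp add: is_cube_def dilate_def)

lemma emeasure_dilate:
  fixes Q :: "('n::finite) cube"
  assumes "0 < c" "is_cube Q"
  shows "emeasure lebesgue (cube_set (dilate c Q)) = ennreal (c ^ CARD('n)) * emeasure lebesgue (cube_set Q)"
proof -
  have "emeasure lebesgue (cube_set (dilate c Q)) = ennreal (side (dilate c Q) ^ CARD('n))"
    using assms by (intro emeasure_cube_set) auto
  then show ?thesis using assms
    by (simp add: emeasure_cube_set dilate_def power_mult_distrib ennreal_mult')
qed

lemma dilate_mono:
  assumes "a \<le> b" "is_cube Q" shows "cube_set (dilate a Q) \<subseteq> cube_set (dilate b Q)"
proof -
  have "a * side Q \<le> b * side Q" using assms by (simp add: is_cube_def)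
  then have "fst Q $ i - b * side Q / 2 \<le> x \<and> x < fst Q $ i + b * side Q / 2"
    if "fst Q $ i - a * side Q / 2 \<le> x \<and> x < fst Q $ i + a * side Q / 2" for x i
    using that by argo
  then show ?thesis unfolding cube_set_def dilate_def by auto
qed

lemma dilate_1 [simp]: "dilate 1 Q = Q" by (simp add: dilate_def)

lemma dilate_dilate [simp]: "dilate a (dilate b Q) = dilate (a * b) Q" by (simp add: dilate_def)

section \<open>Convexity estimates for Young functions\<close>

lemma young_measurable:
  assumes "young A"
  shows "(\<lambda>t. A \<bar>t\<bar>) \<in> borel_measurable borel"
proof -
  have "continuous_on {0..} A" using assms by (simp add: young_def)
  then have "continuous_on UNIV (\<lambda>t::real. A \<bar>t\<bar>)"
    by (rule continuous_on_compose2[of "{0..}" A]) (auto intro!: continuous_intros)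
  then show ?thesis by (rule borel_measurable_continuous_onI)
qed

lemma young_measurable_comp:
  assumes "young A" and [measurable]: "f \<in> borel_measurable M"
  shows "(\<lambda>x. A (\<bar>f x\<bar> / \<bar>r\<bar>)) \<in> borel_measurable M"
proof -
  note [measurable] = young_measurable[OF assms(1)]
  have "(\<lambda>x. A \<bar>f x / r\<bar>) \<in> borel_measurable M" by measurable
  then show ?thesis by simp
qed

lemma young_nonneg: "young A \<Longrightarrow> 0 \<le> t \<Longrightarrow> 0 \<le> A t"
  by (metis atLeast_iff mono_onD order_refl young_def)

lemma young_mono: "young A \<Longrightarrow> 0 \<le> s \<Longrightarrow> s \<le> t \<Longrightarrow> A s \<le> A t"
  by (auto simp: young_def intro: mono_onD)

lemma young_scale:
  assumes "young A" "0 \<le> t" "0 \<le> c" "c \<le> 1" shows "A (c * t) \<le> c * A t"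
proof -
  have "A ((1 - c) *\<^sub>R 0 + c *\<^sub>R t) \<le> (1 - c) * A 0 + c * A t"
    by (rule convex_onD[of "{0..}"]) (use assms in \<open>auto simp: young_def\<close>)
  then show ?thesis using assms by (simp add: young_def)
qed

text \<open>At 1 the class condition gives A(1) \<ge> 1 / c1, and convexity through the origin turns
  this into A(c1) \<ge> 1; the intermediate value theorem yields the unit point. The bound
  \<open>s \<le> c1\<close> is the source of the class constant in the final estimate.\<close>

lemma young_unit:
  assumes "young A" "class_Y p0 p1 c0 c1 tA A"
  obtains s where "0 < s" "s \<le> c1" "A s = 1"
proof -
  have "1 powr p1 \<le> c1 * A 1" and c1: "1 \<le> c1"
  proof -
    have Y: "1 \<le> c1" "1 \<le> tA" "\<And>t. 0 \<le> t \<Longrightarrow> t \<le> tA \<Longrightarrow> t powr p1 \<le> c1 * A t"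
      using assms(2) unfolding class_Y_def by auto
    show "1 powr p1 \<le> c1 * A 1" by (rule Y(3)) (use Y(2) in auto)
    show "1 \<le> c1" by (rule Y(1))
  qed
  moreover have "A (1 / c1 * c1) \<le> 1 / c1 * A c1"
    by (rule young_scale) (use assms c1 in auto)
  ultimately have "1 \<le> A c1" using c1 by (simp add: field_simps)
  moreover have "continuous_on {0..c1} A"
    using assms(1) by (auto simp: young_def intro: continuous_on_subset)
  ultimately obtain s where s: "0 \<le> s" "s \<le> c1" "A s = 1"
    using IVT'[of A 0 1 c1] assms(1) c1 by (auto simp: young_def)
  moreover have "s \<noteq> 0" using s assms(1) by (auto simp: young_def)
  ultimately show ?thesis using that[of s] by simp
qed

text \<open>Above \<open>s\<close> the graph of \<open>A\<close> lies over the line from the origin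
  through (s, 1), so A(t) \<ge> t / s; below \<open>s\<close> the summand 1 suffices. Integrated,
  this passes from modular bounds to L^1 bounds.\<close>

lemma young_linear:
  assumes "young A" "A s = 1" "0 < s" "0 \<le> t" shows "t \<le> s * (1 + A t)"
proof (cases "t \<le> s")
  case True
  have "s * 1 \<le> s * (1 + A t)"
    using assms young_nonneg[of A t] by (intro mult_left_mono) auto
  then show ?thesis using True by simp
next
  case False
  have "A (s / t * t) \<le> s / t * A t" by (rule young_scale) (use assms False in auto)
  then have "t \<le> s * A t" using assms False by (simp add: field_simps)
  then show ?thesis using assms by (simp add: algebra_simps)
qed

text \<open>Young's inequality is immediate from the supremum, except at \<open>s = 0\<close>, which
  the supremum omits, and where \<open>s * t - A s\<close> is negative and truncated by
  \<open>ennreal\<close>.\<close>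

lemma complementary_young:
  assumes "young A" "0 \<le> s" "0 \<le> t"
  shows "ennreal (s * t) \<le> ennreal (A s) + complementary A t"
proof (cases "s = 0")
  case False
  have "ennreal (s * t) \<le> ennreal (A s + (s * t - A s))" by simp
  also have "\<dots> \<le> ennreal (A s) + ennreal (s * t - A s)"
  proof (cases "0 \<le> s * t - A s")
    case True
    then show ?thesis using young_nonneg[OF assms(1,2)] by (simp flip: ennreal_plus)
  next
    case False
    then have "ennreal (A s + (s * t - A s)) \<le> ennreal (A s)" by (intro ennreal_leI) simp
    then show ?thesis using False by (simp add: ennreal_neg)
  qed
  also have "ennreal (s * t - A s) \<le> complementary A t"
    unfolding complementary_def by (rule SUP_upper) (use False assms in auto)
  finally show ?thesis by (simp add: add_left_mono)
qed simp

text \<open>A supremum of continuous functions is lower semicontinuous: its strict superlevel sets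
  are open.\<close>

lemma complementary_measurable [measurable]: "complementary A \<in> borel_measurable borel"
proof (rule borel_measurableI_greater)
  fix y
  have "{x. y < complementary A x} = (\<Union>s\<in>{0<..}. {x. y < ennreal (s * x - A s)})"
    unfolding complementary_def by (auto simp: less_SUP_iff)
  moreover have "open (\<Union>s\<in>{0<..}. {x. y < ennreal (s * x - A s)})"
    by (intro open_UN ballI open_Collect_less continuous_on_ennreal continuous_intros)
  ultimately have "{x. y < complementary A x} \<in> sets borel" by simp
  then show "{x \<in> space borel. y < complementary A x} \<in> sets borel" by simp
qed

text \<open>Admissibility of the radius \<open>r\<close> in the infimum of \<open>luxemburg\<close>,
  with the division by the volume cleared. Estimates are proved for admissible real radii, which
  avoids the question whether the infimum is attained, positive or finite.\<close>

definition modular_le :: "(real \<Rightarrow> real) \<Rightarrow> ('n::finite) cube \<Rightarrow> (real ^ 'n \<Rightarrow> real) \<Rightarrow> real \<Rightarrow> bool"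
  where "modular_le A Q g r \<longleftrightarrow> 0 < r \<and>
    (\<integral>\<^sup>+x\<in>cube_set Q. ennreal (A (\<bar>g x\<bar> / r)) \<partial>lebesgue) \<le> emeasure lebesgue (cube_set Q)"

lemma divide_le_1_ennreal:
  fixes a b :: ennreal
  assumes "b \<noteq> 0" "b \<noteq> top" shows "a / b \<le> 1 \<longleftrightarrow> a \<le> b"
proof
  assume "a \<le> b"
  then have "a / b \<le> b / b" by (rule divide_right_mono_ennreal)
  then show "a / b \<le> 1" using assms by (simp add: top.not_eq_extremum)
next
  assume "a / b \<le> 1"
  then have "b * (a / b) \<le> b * 1" by (rule mult_left_mono) simp
  moreover have "b * (a / b) = a"
    using assms by (simp add: ennreal_times_divide top.not_eq_extremum mult.commute[of b] ennreal_mult_divide_eq)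
  ultimately show "a \<le> b" by simp
qed

lemma luxemburg_alt:
  assumes "is_cube Q"
  shows "luxemburg (\<lambda>t. ennreal (A t)) Q g = (INF r\<in>{r. modular_le A Q g r}. ennreal r)"
  unfolding luxemburg_def modular_le_def by (subst divide_le_1_ennreal) (use assms in auto)

lemma modular_le_mono:
  assumes "young A" "modular_le A Q g r" "r \<le> r'"
  shows "modular_le A Q g r'"
proof -
  have "(\<integral>\<^sup>+x\<in>cube_set Q. ennreal (A (\<bar>g x\<bar> / r')) \<partial>lebesgue) \<le> (\<integral>\<^sup>+x\<in>cube_set Q. ennreal (A (\<bar>g x\<bar> / r)) \<partial>lebesgue)"
    using assms by (intro nn_integral_mono mult_right_mono ennreal_leI young_mono[OF assms(1)])
      (auto simp: modular_le_def intro!: divide_left_mono mult_pos_pos)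
  then show ?thesis using assms by (auto simp: modular_le_def)
qed

lemma luxemburg_modular:
  assumes "is_cube Q" "young A" "luxemburg (\<lambda>t. ennreal (A t)) Q g < ennreal r"
  shows "modular_le A Q g r"
proof -
  obtain r' where "modular_le A Q g r'" "ennreal r' < ennreal r"
    using assms(3) unfolding luxemburg_alt[OF assms(1)] INF_less_iff by auto
  moreover from this have "r' \<le> r" by (simp add: ennreal_less_iff modular_le_def)
  ultimately show ?thesis using modular_le_mono[OF assms(2)] by blast
qed

lemma modular_le_luxemburg:
  assumes "is_cube Q" "modular_le A Q g r"
  shows "luxemburg (\<lambda>t. ennreal (A t)) Q g \<le> ennreal r"
  unfolding luxemburg_alt[OF assms(1)] by (rule INF_lower) (use assms in simp)

lemma modular_le_abs_mono:
  assumes "young A" "modular_le A Q g r" "\<And>x. \<bar>f x\<bar> \<le> \<bar>g x\<bar>"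
  shows "modular_le A Q f r"
proof -
  have "(\<integral>\<^sup>+x\<in>cube_set Q. ennreal (A (\<bar>f x\<bar> / r)) \<partial>lebesgue) \<le> (\<integral>\<^sup>+x\<in>cube_set Q. ennreal (A (\<bar>g x\<bar> / r)) \<partial>lebesgue)"
    using assms by (intro nn_integral_mono mult_right_mono ennreal_leI young_mono[OF assms(1)])
      (auto simp: modular_le_def intro!: divide_right_mono)
  then show ?thesis using assms by (auto simp: modular_le_def)
qed

text \<open>Midpoint convexity: the modular of half the sum of f / r and g / r is at most the mean
  of the two modulars.\<close>

lemma modular_le_add:
  assumes A: "young A" and r: "modular_le A Q f r" "modular_le A Q g r"
    and [measurable]: "f \<in> borel_measurable lebesgue" "g \<in> borel_measurable lebesgue"
  shows "modular_le A Q (\<lambda>x. f x + g x) (2 * r)"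
proof -
  have r0: "0 < r" using r by (simp add: modular_le_def)
  have [measurable]: "(\<lambda>x. A (\<bar>h x\<bar> / r)) \<in> borel_measurable lebesgue" if "h \<in> borel_measurable lebesgue" for h :: "real^'a \<Rightarrow> real"
    using young_measurable_comp[OF A that, of r] r0 by simp
  let ?I = "\<lambda>h. (\<integral>\<^sup>+x\<in>cube_set Q. ennreal (A (\<bar>h x\<bar> / r)) \<partial>lebesgue)"
  have pw: "ennreal (A (\<bar>f x + g x\<bar> / (2 * r))) \<le> ennreal (1/2) * (ennreal (A (\<bar>f x\<bar> / r)) + ennreal (A (\<bar>g x\<bar> / r)))" for x
  proof -
    let ?m = "max (\<bar>f x\<bar> / r) (\<bar>g x\<bar> / r)"
    have "\<bar>f x + g x\<bar> / (2 * r) \<le> (1/2) * (\<bar>f x\<bar> / r) + (1/2) * (\<bar>g x\<bar> / r)"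
      using r0 by (simp add: field_simps)
    then have "A (\<bar>f x + g x\<bar> / (2 * r)) \<le> A ((1 - 1/2) *\<^sub>R (\<bar>f x\<bar> / r) + (1/2) *\<^sub>R (\<bar>g x\<bar> / r))"
      using r0 by (intro young_mono[OF A]) auto
    also have "\<dots> \<le> (1 - 1/2) * A (\<bar>f x\<bar> / r) + (1/2) * A (\<bar>g x\<bar> / r)"
      by (rule convex_onD[of "{0..}"]) (use A r0 in \<open>auto simp: young_def\<close>)
    finally have "A (\<bar>f x + g x\<bar> / (2 * r)) \<le> (1/2) * (A (\<bar>f x\<bar> / r) + A (\<bar>g x\<bar> / r))" by simp
    then have "ennreal (A (\<bar>f x + g x\<bar> / (2 * r))) \<le> ennreal ((1/2) * (A (\<bar>f x\<bar> / r) + A (\<bar>g x\<bar> / r)))"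
      by (rule ennreal_leI)
    then show ?thesis using young_nonneg[OF A, of "\<bar>f x\<bar> / r"] young_nonneg[OF A, of "\<bar>g x\<bar> / r"] r0
      by (subst (asm) ennreal_mult') (auto simp: ennreal_plus)
  qed
  have "(\<integral>\<^sup>+x\<in>cube_set Q. ennreal (A (\<bar>f x + g x\<bar> / (2 * r))) \<partial>lebesgue)
    \<le> (\<integral>\<^sup>+x. ennreal (1/2) * (ennreal (A (\<bar>f x\<bar> / r)) * indicator (cube_set Q) x + ennreal (A (\<bar>g x\<bar> / r)) * indicator (cube_set Q) x) \<partial>lebesgue)"
    using pw by (intro nn_integral_mono) (auto split: split_indicator)
  also have "\<dots> = ennreal (1/2) * (?I f + ?I g)"
    by (simp add: nn_integral_cmult nn_integral_add)
  also have "\<dots> \<le> ennreal (1/2) * (emeasure lebesgue (cube_set Q) + emeasure lebesgue (cube_set Q))"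
    using r by (intro mult_left_mono add_mono) (auto simp: modular_le_def)
  also have "\<dots> = (ennreal (1/2) * ennreal 2) * emeasure lebesgue (cube_set Q)"
    by (simp add: mult.assoc flip: mult_2)
  also have "ennreal (1/2) * ennreal 2 = 1" by (subst ennreal_mult'[symmetric]) auto
  finally show ?thesis using r0 by (simp add: modular_le_def)
qed

text \<open>The radius \<open>M / s\<close> scales the bound \<open>M\<close> to the unit point
  \<open>s\<close>, where the integrand is at most 1. For the constant function 1 it produces the
  factor 1 / \<sigma> in the weak type estimate.\<close>

lemma modular_le_bounded:
  assumes A: "young A" "A s = 1" "0 < s" and M: "\<And>x. \<bar>g x\<bar> \<le> M" "0 < M"
  shows "modular_le A Q g (M / s)"
proof -
  have "(\<integral>\<^sup>+x\<in>cube_set Q. ennreal (A (\<bar>g x\<bar> / (M / s))) \<partial>lebesgue) \<le> (\<integral>\<^sup>+x\<in>cube_set Q. 1 \<partial>lebesgue)"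
  proof (intro nn_integral_mono mult_right_mono)
    fix x
    have "\<bar>g x\<bar> * s \<le> M * s" by (rule mult_right_mono) (use M A in auto)
    then have "A (\<bar>g x\<bar> / (M / s)) \<le> A s"
      using A M by (intro young_mono[OF A(1)]) (auto simp: field_simps)
    then show "ennreal (A (\<bar>g x\<bar> / (M / s))) \<le> 1" using A by (metis ennreal_1 ennreal_leI)
  qed auto
  then show ?thesis using A M by (simp add: modular_le_def)
qed

text \<open>A modular that is too large by a factor \<open>c\<close> is repaired by a radius larger
  by the same factor, because A(t / c) \<le> A(t) / c by convexity.\<close>

lemma modular_le_scale:
  assumes A: "young A" and c: "1 \<le> c" "0 < r" and [measurable]: "g \<in> borel_measurable lebesgue"
    and le: "(\<integral>\<^sup>+x\<in>cube_set Q. ennreal (A (\<bar>g x\<bar> / r)) \<partial>lebesgue) \<le> ennreal c * emeasure lebesgue (cube_set Q)"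
  shows "modular_le A Q g (c * r)"
proof -
  have [measurable]: "(\<lambda>x. A (\<bar>g x\<bar> / r)) \<in> borel_measurable lebesgue"
    using young_measurable_comp[OF A assms(4), of r] c by simp
  have "(\<integral>\<^sup>+x\<in>cube_set Q. ennreal (A (\<bar>g x\<bar> / (c * r))) \<partial>lebesgue)
     \<le> (\<integral>\<^sup>+x. ennreal (1/c) * (ennreal (A (\<bar>g x\<bar> / r)) * indicator (cube_set Q) x) \<partial>lebesgue)"
  proof (intro nn_integral_mono)
    fix x
    have "A (1/c * (\<bar>g x\<bar> / r)) \<le> 1/c * A (\<bar>g x\<bar> / r)" by (rule young_scale) (use A c in auto)
    then have "ennreal (A (\<bar>g x\<bar> / (c * r))) \<le> ennreal (1/c) * ennreal (A (\<bar>g x\<bar> / r))"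
      using c by (subst ennreal_mult'[symmetric]) (auto intro!: ennreal_leI)
    then show "ennreal (A (\<bar>g x\<bar> / (c * r))) * indicator (cube_set Q) x \<le> ennreal (1/c) * (ennreal (A (\<bar>g x\<bar> / r)) * indicator (cube_set Q) x)"
      by (auto split: split_indicator)
  qed
  also have "\<dots> = ennreal (1/c) * (\<integral>\<^sup>+x\<in>cube_set Q. ennreal (A (\<bar>g x\<bar> / r)) \<partial>lebesgue)"
    by (simp add: nn_integral_cmult)
  also have "\<dots> \<le> ennreal (1/c) * (ennreal c * emeasure lebesgue (cube_set Q))"
    by (intro mult_left_mono le) auto
  also have "\<dots> = emeasure lebesgue (cube_set Q)"
    using c by (simp flip: mult.assoc ennreal_mult')
  finally show ?thesis using c by (simp add: modular_le_def)
qed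

lemma modular_le_L1:
  assumes A: "young A" "A s = 1" "0 < s" and [measurable]: "g \<in> borel_measurable lebesgue" and c: "0 \<le> c" "0 < r"
    and le: "(\<integral>\<^sup>+x\<in>cube_set Q. ennreal (A (\<bar>g x\<bar> / r)) \<partial>lebesgue) \<le> ennreal c * emeasure lebesgue (cube_set Q)"
  shows "(\<integral>\<^sup>+x\<in>cube_set Q. ennreal \<bar>g x\<bar> \<partial>lebesgue) \<le> ennreal (s * r * (1 + c)) * emeasure lebesgue (cube_set Q)"
proof -
  have [measurable]: "(\<lambda>x. A (\<bar>g x\<bar> / r)) \<in> borel_measurable lebesgue"
    using young_measurable_comp[OF A(1) assms(4), of r] c by simp
  have "(\<integral>\<^sup>+x\<in>cube_set Q. ennreal \<bar>g x\<bar> \<partial>lebesgue) \<le> (\<integral>\<^sup>+x. ennreal (s * r) * (indicator (cube_set Q) x + ennreal (A (\<bar>g x\<bar> / r)) * indicator (cube_set Q) x) \<partial>lebesgue)"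
  proof (intro nn_integral_mono)
    fix x
    have "\<bar>g x\<bar> / r \<le> s * (1 + A (\<bar>g x\<bar> / r))" by (rule young_linear) (use A c in auto)
    then have "\<bar>g x\<bar> \<le> (s * r) * (1 + A (\<bar>g x\<bar> / r))" using c by (simp add: field_simps)
    then have "ennreal \<bar>g x\<bar> \<le> ennreal (s * r) * ennreal (1 + A (\<bar>g x\<bar> / r))"
      using A c by (subst ennreal_mult'[symmetric]) (auto intro!: ennreal_leI)
    also have "ennreal (1 + A (\<bar>g x\<bar> / r)) = 1 + ennreal (A (\<bar>g x\<bar> / r))"
      using young_nonneg[OF A(1), of "\<bar>g x\<bar> / r"] c by (subst ennreal_plus) auto
    finally show "ennreal \<bar>g x\<bar> * indicator (cube_set Q) x \<le> ennreal (s * r) * (indicator (cube_set Q) x + ennreal (A (\<bar>g x\<bar> / r)) * indicator (cube_set Q) x)"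
      by (auto split: split_indicator)
  qed
  also have "\<dots> = ennreal (s * r) * (emeasure lebesgue (cube_set Q) + (\<integral>\<^sup>+x\<in>cube_set Q. ennreal (A (\<bar>g x\<bar> / r)) \<partial>lebesgue))"
    by (simp add: nn_integral_cmult nn_integral_add)
  also have "\<dots> \<le> ennreal (s * r) * (emeasure lebesgue (cube_set Q) + ennreal c * emeasure lebesgue (cube_set Q))"
    by (intro mult_left_mono add_mono le) auto
  also have "\<dots> = ennreal (s * r * (1 + c)) * emeasure lebesgue (cube_set Q)"
    using A c by (simp add: ennreal_mult' ennreal_plus distrib_right mult.assoc)
  finally show ?thesis .
qed

text \<open>Hoelder's inequality in Orlicz form: Young's inequality is applied to g / r and \<phi> /
  \<rho>, and both modulars are at most the volume, hence the factor 2.\<close>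

lemma modular_le_hoelder:
  assumes A: "young A" and Q: "is_cube Q" and [measurable]: "g \<in> borel_measurable lebesgue" "\<phi> \<in> borel_measurable lebesgue"
    and m: "modular_le A Q g r"
  shows "(\<integral>\<^sup>+x\<in>cube_set Q. ennreal (\<bar>g x\<bar> * \<bar>\<phi> x\<bar>) \<partial>lebesgue)
    \<le> ennreal (2 * r) * emeasure lebesgue (cube_set Q) * luxemburg (complementary A) Q \<phi>" (is "?X \<le> ?C * _")
proof -
  let ?V = "emeasure lebesgue (cube_set Q)"
  have r0: "0 < r" using m by (simp add: modular_le_def)
  have [measurable]: "(\<lambda>x. A (\<bar>g x\<bar> / r)) \<in> borel_measurable lebesgue"
    using young_measurable_comp[OF A assms(3), of r] r0 by simp
  have *: "?X \<le> ?C * ennreal \<rho>" if \<rho>: "0 < \<rho>" "(\<integral>\<^sup>+x\<in>cube_set Q. complementary A (\<bar>\<phi> x\<bar> / \<rho>) \<partial>lebesgue) / ?V \<le> 1" for \<rho>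
  proof -
    have "?X \<le> (\<integral>\<^sup>+x. ennreal (r * \<rho>) * (ennreal (A (\<bar>g x\<bar> / r)) * indicator (cube_set Q) x + complementary A (\<bar>\<phi> x\<bar> / \<rho>) * indicator (cube_set Q) x) \<partial>lebesgue)"
    proof (intro nn_integral_mono)
      fix x
      have "ennreal (r * \<rho>) * ennreal (\<bar>g x\<bar> / r * (\<bar>\<phi> x\<bar> / \<rho>)) \<le> ennreal (r * \<rho>) * (ennreal (A (\<bar>g x\<bar> / r)) + complementary A (\<bar>\<phi> x\<bar> / \<rho>))"
        using r0 \<rho> by (intro mult_left_mono complementary_young A) auto
      moreover have "ennreal (r * \<rho>) * ennreal (\<bar>g x\<bar> / r * (\<bar>\<phi> x\<bar> / \<rho>)) = ennreal (\<bar>g x\<bar> * \<bar>\<phi> x\<bar>)"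
        using r0 \<rho> by (subst ennreal_mult'[symmetric]) auto
      ultimately show "ennreal (\<bar>g x\<bar> * \<bar>\<phi> x\<bar>) * indicator (cube_set Q) x \<le> ennreal (r * \<rho>) * (ennreal (A (\<bar>g x\<bar> / r)) * indicator (cube_set Q) x + complementary A (\<bar>\<phi> x\<bar> / \<rho>) * indicator (cube_set Q) x)"
        by (auto split: split_indicator)
    qed
    also have "\<dots> = ennreal (r * \<rho>) * ((\<integral>\<^sup>+x\<in>cube_set Q. ennreal (A (\<bar>g x\<bar> / r)) \<partial>lebesgue) + (\<integral>\<^sup>+x\<in>cube_set Q. complementary A (\<bar>\<phi> x\<bar> / \<rho>) \<partial>lebesgue))"
      by (simp add: nn_integral_cmult nn_integral_add)
    also have "\<dots> \<le> ennreal (r * \<rho>) * (?V + ?V)"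
      using \<rho> m Q by (intro mult_left_mono add_mono) (auto simp: modular_le_def divide_le_1_ennreal)
    also have "\<dots> = ?C * ennreal \<rho>"
      using r0 \<rho> by (simp add: ennreal_mult' mult_2[symmetric] mult_ac)
    finally show ?thesis .
  qed
  have C: "?C \<noteq> 0" "?C < top" using r0 Q by (auto simp: ennreal_mult_less_top)
  \<comment> \<open>The estimate holds for every admissible \<rho>. After division by the positive
    finite \<open>?C\<close> it is a lower bound for the infimum, including the infinite infimum
    when no \<rho> is admissible.\<close>
  have "?X / ?C \<le> luxemburg (complementary A) Q \<phi>"
    unfolding luxemburg_def
  proof (rule INF_greatest, clarsimp)
    fix \<rho> :: real assume "0 < \<rho>" "(\<integral>\<^sup>+x\<in>cube_set Q. complementary A (\<bar>\<phi> x\<bar> / \<rho>) \<partial>lebesgue) / ?V \<le> 1"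
    from *[OF this] have "?X / ?C \<le> ?C * ennreal \<rho> / ?C" by (rule divide_right_mono_ennreal)
    also have "\<dots> = ennreal \<rho>" using C by (subst mult.commute) (simp add: ennreal_mult_divide_eq)
    finally show "?X / ?C \<le> ennreal \<rho>" .
  qed
  then have "?C * (?X / ?C) \<le> ?C * luxemburg (complementary A) Q \<phi>" by (intro mult_left_mono) auto
  moreover have "?C * (?X / ?C) = ?X"
    using C by (simp add: ennreal_times_divide mult.commute[of ?C] ennreal_mult_divide_eq)
  ultimately show ?thesis by simp
qed

section \<open>Grids of dyadic cubes\<close>

text \<open>Tonelli for the sum of the indicators. A sum over an arbitrary countable index set is an
  integral over \<open>count_space\<close>, which avoids enumerating the cubes.\<close>

lemma emeasure_UN_le_count:
  assumes "countable I" "\<And>i. i \<in> I \<Longrightarrow> X i \<in> sets M"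
  shows "emeasure M (\<Union>i\<in>I. X i) \<le> (\<integral>\<^sup>+i. emeasure M (X i) \<partial>count_space I)"
proof -
  have m: "(\<Union>i\<in>I. X i) \<in> sets M" using assms by auto
  have "emeasure M (\<Union>i\<in>I. X i) = (\<integral>\<^sup>+x. indicator (\<Union>i\<in>I. X i) x \<partial>M)"
    using m by simp
  also have "\<dots> \<le> (\<integral>\<^sup>+x. \<integral>\<^sup>+i. indicator (X i) x \<partial>count_space I \<partial>M)"
  proof (rule nn_integral_mono)
    fix x
    show "indicator (\<Union>i\<in>I. X i) x \<le> (\<integral>\<^sup>+i. indicator (X i) x \<partial>count_space I :: ennreal)"
    proof (cases "x \<in> (\<Union>i\<in>I. X i)")
      case True
      then obtain i where i: "i \<in> I" "x \<in> X i" by auto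
      have "(1::ennreal) = (\<integral>\<^sup>+j. indicator {i} j \<partial>count_space I)" using i by simp
      also have "\<dots> \<le> (\<integral>\<^sup>+j. indicator (X j) x \<partial>count_space I)"
        by (intro nn_integral_mono) (use i in \<open>auto split: split_indicator\<close>)
      finally show ?thesis using True by simp
    qed simp
  qed
  also have "\<dots> = (\<integral>\<^sup>+i. \<integral>\<^sup>+x. indicator (X i) x \<partial>M \<partial>count_space I)"
    using assms by (intro nn_integral_count_space_nn_integral) auto
  also have "\<dots> = (\<integral>\<^sup>+i. emeasure M (X i) \<partial>count_space I)"
    using assms by (intro nn_integral_cong) auto
  finally show ?thesis .
qed

text \<open>The sets \<open>X i\<close> may overlap, only the \<open>Y i\<close> are disjoint. With
  \<open>N\<close> a weighted measure this gives the Calderon-Zygmund bound; with \<open>Y i\<close>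
  a cube or a part of a cube it gives the bounds for dilated and for selected cubes.\<close>

lemma emeasure_UN_packing:
  assumes "countable I" "\<And>i. i \<in> I \<Longrightarrow> X i \<in> sets M" "\<And>i. i \<in> I \<Longrightarrow> Y i \<in> sets N"
    and "disjoint_family_on Y I" "\<And>i. i \<in> I \<Longrightarrow> emeasure M (X i) \<le> c * emeasure N (Y i)"
  shows "emeasure M (\<Union>i\<in>I. X i) \<le> c * emeasure N (\<Union>i\<in>I. Y i)"
proof -
  have "emeasure M (\<Union>i\<in>I. X i) \<le> (\<integral>\<^sup>+i. c * emeasure N (Y i) \<partial>count_space I)"
    using emeasure_UN_le_count[OF assms(1,2)] assms(5)
    by (rule order_trans[OF _ nn_integral_mono]) auto
  also have "\<dots> = c * (\<integral>\<^sup>+i. emeasure N (Y i) \<partial>count_space I)" by (simp add: nn_integral_cmult)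
  also have "(\<integral>\<^sup>+i. emeasure N (Y i) \<partial>count_space I) = emeasure N (\<Union>i\<in>I. Y i)"
    using assms by (intro emeasure_UN_countable[symmetric]) auto
  finally show ?thesis .
qed

lemma cube_subset_bounds:
  assumes "cube_set Q \<subseteq> cube_set R" "is_cube Q"
  shows "fst R $ i - side R / 2 \<le> fst Q $ i - side Q / 2" "fst Q $ i + side Q / 2 \<le> fst R $ i + side R / 2"
proof -
  have s: "side Q > 0" using assms by (simp add: is_cube_def)
  have "(\<chi> i. fst Q $ i - side Q / 2) \<in> cube_set Q" using s by (simp add: cube_set_def)
  then have "(\<chi> i. fst Q $ i - side Q / 2) \<in> cube_set R" using assms by blast
  then show "fst R $ i - side R / 2 \<le> fst Q $ i - side Q / 2" by (auto simp: cube_set_def)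
  show "fst Q $ i + side Q / 2 \<le> fst R $ i + side R / 2"
  proof (rule ccontr)
    assume h: "\<not> ?thesis"
    \<comment> \<open>This point of \<open>Q\<close> has its i-th coordinate at or beyond the upper
      face of \<open>R\<close>, which the half-open cube excludes.\<close>
    define y where "y = (\<chi> j. if j = i then max (fst Q $ i - side Q / 2) (fst R $ i + side R / 2) else fst Q $ j - side Q / 2)"
    have "y \<in> cube_set Q" using s h by (auto simp: cube_set_def y_def)
    then have "y $ i < fst R $ i + side R / 2" using assms by (auto simp: cube_set_def)
    then show False by (simp add: y_def)
  qed
qed

lemma cube_set_dist:
  fixes Q :: "('n::finite) cube"
  assumes "x \<in> cube_set Q" "y \<in> cube_set Q"
  shows "norm (x - y) \<le> real CARD('n) * side Q"
proof -
  have "norm (x - y) \<le> (\<Sum>i\<in>UNIV. \<bar>(x - y) $ i\<bar>)" by (rule norm_le_l1_cart)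
  also have "\<dots> \<le> (\<Sum>i\<in>(UNIV::'n set). side Q)"
  proof (rule sum_mono)
    fix i
    have "fst Q $ i - side Q / 2 \<le> x $ i" "x $ i < fst Q $ i + side Q / 2"
      "fst Q $ i - side Q / 2 \<le> y $ i" "y $ i < fst Q $ i + side Q / 2"
      using assms by (auto simp: cube_set_def)
    then show "\<bar>(x - y) $ i\<bar> \<le> side Q" by (simp add: abs_if)
  qed
  finally show ?thesis by simp
qed

lemma bounded_cube_set [simp]: "bounded (cube_set (Q :: ('n::finite) cube))"
proof (cases "cube_set Q = {}")
  case False
  then obtain x where "x \<in> cube_set Q" by auto
  then show ?thesis
    unfolding bounded_def using cube_set_dist[of x Q] by (auto simp: dist_norm)
qed simp

lemma powi_2_unbounded: "\<exists>K::int. \<forall>k\<ge>K. (R::real) < 2 powi k"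
proof -
  obtain m where m: "R < 2 ^ m" using real_arch_pow[of 2 R] by auto
  have "R < 2 powi k" if "k \<ge> int m" for k
  proof -
    have "(2::real) powi int m \<le> 2 powi k" using that by (intro power_int_increasing) auto
    then show ?thesis using m by simp
  qed
  then show ?thesis by blast
qed

text \<open>Cells are indexed by a generation and a point, so the ancestors of
  \<open>cell k x\<close> are the \<open>cell l x\<close> with larger \<open>l\<close>, and large
  generations are large cubes. \<open>cell_bounded\<close> rules out boundaries shared by all
  generations, such as the coordinate hyperplanes of the standard grid: every bounded set ends up in
  one cell.\<close>

locale grid =
  fixes cell :: "int \<Rightarrow> real ^ 'n::finite \<Rightarrow> 'n cube" and L :: real
  assumes L_pos: "0 < L"
    and side_cell: "side (cell k x) = L * 2 powi k"
    and self_cell: "x \<in> cube_set (cell k x)"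
    and cell_eq: "y \<in> cube_set (cell k x) \<Longrightarrow> cell k y = cell k x"
    and cell_up: "cell k x = cell k y \<Longrightarrow> cell (k + 1) x = cell (k + 1) y"
    and cell_bounded: "bounded C \<Longrightarrow> \<exists>k. \<forall>x\<in>C. \<forall>y\<in>C. cell k x = cell k y"
    and countable_cells: "countable (range (\<lambda>(k, x). cell k x))"
begin

definition cubes :: "'n cube set" where "cubes = range (\<lambda>(k, x). cell k x)"

lemma countable_cubes: "countable cubes" using countable_cells by (simp add: cubes_def)

lemma cell_in_cubes [simp]: "cell k x \<in> cubes" by (auto simp: cubes_def)

lemma cubesE: assumes "Q \<in> cubes" obtains k x where "Q = cell k x"
  using assms by (auto simp: cubes_def)

lemma is_cube_cell [simp]: "is_cube (cell k x)"
  using L_pos by (simp add: is_cube_def side_cell)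

lemma is_cube_cubes: "Q \<in> cubes \<Longrightarrow> is_cube Q" by (auto elim: cubesE)

lemma cube_eq_cell: "Q \<in> cubes \<Longrightarrow> x \<in> cube_set Q \<Longrightarrow> \<exists>k. Q = cell k x"
  by (metis cubesE cell_eq)

lemma cell_up_le:
  assumes "k \<le> l" "cell k x = cell k y" shows "cell l x = cell l y"
  using assms(1)
proof (induction l rule: int_ge_induct)
  case base
  then show ?case by (rule assms(2))
next
  case (step l)
  then show ?case by (intro cell_up)
qed

lemma cell_mono:
  assumes "k \<le> l" shows "cube_set (cell k x) \<subseteq> cube_set (cell l x)"
proof
  fix y assume "y \<in> cube_set (cell k x)"
  then have "cell l y = cell l x" using cell_up_le[OF assms cell_eq] by simp
  then show "y \<in> cube_set (cell l x)" using self_cell[of y l] by simp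
qed

lemma cell_side_mono: "side (cell k x) \<le> side (cell l y) \<longleftrightarrow> k \<le> l"
proof -
  have "(2::real) powi k \<le> 2 powi l \<longleftrightarrow> k \<le> l"
    using power_int_increasing[of k l "2::real"] power_int_strict_increasing[of l k "2::real"] by force
  then show ?thesis using L_pos by (simp add: side_cell)
qed

lemma cell_inj: "cell k x = cell l y \<Longrightarrow> k = l"
  by (metis cell_side_mono order_antisym order_refl)

lemma cube_side_le: "cube_set Q \<subseteq> cube_set R \<Longrightarrow> is_cube Q \<Longrightarrow> side Q \<le> side R"
  using cube_subset_bounds[of Q R undefined] by simp

lemma cell_subset_le: "cube_set (cell k x) \<subseteq> cube_set (cell l y) \<Longrightarrow> k \<le> l"
  using cube_side_le[of "cell k x" "cell l y"] by (simp add: cell_side_mono)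

lemma cubes_cases:
  assumes "Q \<in> cubes" "R \<in> cubes"
  shows "cube_set Q \<inter> cube_set R = {} \<or> (side Q \<le> side R \<and> cube_set Q \<subseteq> cube_set R) \<or> (side R < side Q \<and> cube_set R \<subset> cube_set Q)"
proof (cases "cube_set Q \<inter> cube_set R = {}")
  case False
  then obtain z where z: "z \<in> cube_set Q" "z \<in> cube_set R" by auto
  obtain k l where kl: "Q = cell k z" "R = cell l z" using cube_eq_cell assms z by blast
  show ?thesis
  proof (cases "k \<le> l")
    case True
    then show ?thesis using kl cell_mono[OF True, of z] cell_side_mono by auto
  next
    case False
    then have "cube_set R \<noteq> cube_set Q" using kl cell_subset_le[of k z l z] by auto
    then show ?thesis using kl cell_mono[of l k z] False cell_side_mono[of k z l z] by auto
  qed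
qed simp

lemma cubes_subset_antisym:
  assumes "Q \<in> cubes" "R \<in> cubes" "cube_set Q \<subseteq> cube_set R" "side R \<le> side Q"
  shows "Q = R"
proof -
  obtain k z where z: "Q = cell k z" using assms cubesE by blast
  then have "z \<in> cube_set R" using self_cell assms by blast
  then obtain l where l: "R = cell l z" using cube_eq_cell assms by blast
  have "k \<le> l" using cell_subset_le z l assms by blast
  moreover have "l \<le> k" using assms(4) z l cell_side_mono by blast
  ultimately show ?thesis using z l by simp
qed

definition maximal_cubes :: "('n cube \<Rightarrow> bool) \<Rightarrow> 'n cube set" where
  "maximal_cubes P = {Q \<in> cubes. P Q \<and> (\<forall>R\<in>cubes. P R \<longrightarrow> cube_set Q \<subseteq> cube_set R \<longrightarrow> R = Q)}"

lemma maximal_cubesD: "Q \<in> maximal_cubes P \<Longrightarrow> Q \<in> cubes" "Q \<in> maximal_cubes P \<Longrightarrow> P Q"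
  by (auto simp: maximal_cubes_def)

lemma maximal_cubes_max: "Q \<in> maximal_cubes P \<Longrightarrow> R \<in> cubes \<Longrightarrow> P R \<Longrightarrow> cube_set Q \<subseteq> cube_set R \<Longrightarrow> R = Q"
  by (auto simp: maximal_cubes_def)

lemma countable_maximal: "countable (maximal_cubes P)"
  by (rule countable_subset[OF _ countable_cubes]) (auto simp: maximal_cubes_def)

lemma disjoint_maximal: "disjoint_family_on cube_set (maximal_cubes P)"
  unfolding disjoint_family_on_def
proof (intro ballI impI)
  fix Q R assume h: "Q \<in> maximal_cubes P" "R \<in> maximal_cubes P" "Q \<noteq> R"
  then show "cube_set Q \<inter> cube_set R = {}"
    using cubes_cases[of Q R] maximal_cubes_max[of Q P R] maximal_cubes_max[of R P Q] maximal_cubesD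
    by (metis less_imp_le psubset_imp_subset)
qed

text \<open>The bound \<open>K\<close> leaves finitely many ancestors of \<open>Q\<close> with
  property \<open>P\<close>. The largest is maximal among all cubes, since a grid cube containing it
  is again an ancestor.\<close>

lemma maximal_cubes_cover:
  assumes "\<And>k x. P (cell k x) \<Longrightarrow> k \<le> K" "Q \<in> cubes" "P Q"
  shows "\<exists>R\<in>maximal_cubes P. cube_set Q \<subseteq> cube_set R"
proof -
  obtain k x where Q: "Q = cell k x" using assms cubesE by blast
  define m where "m = Max {l \<in> {k..K}. P (cell l x)}"
  have fin: "finite {l \<in> {k..K}. P (cell l x)}" by (rule finite_subset[of _ "{k..K}"]) auto
  have "k \<in> {l \<in> {k..K}. P (cell l x)}" using assms Q by auto
  then have m: "m \<in> {l \<in> {k..K}. P (cell l x)}" unfolding m_def using fin by (intro Max_in) auto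
  have "cell m x \<in> maximal_cubes P"
    unfolding maximal_cubes_def
  proof (clarsimp, intro conjI ballI impI)
    show "P (cell m x)" using m by simp
    fix R assume R: "R \<in> cubes" "P R" "cube_set (cell m x) \<subseteq> cube_set R"
    then have "x \<in> cube_set R" using self_cell by blast
    then obtain l where l: "R = cell l x" using cube_eq_cell R by blast
    then have "m \<le> l" using R cell_subset_le by blast
    moreover have "l \<le> m"
      unfolding m_def by (rule Max_ge[OF fin]) (use R l m \<open>m \<le> l\<close> assms(1) in auto)
    ultimately show "R = cell m x" using l by simp
  qed
  then show ?thesis using Q cell_mono[of k m x] m by (intro bexI[of _ "cell m x"]) auto
qed

lemma small_cell:
  assumes "open U" "x \<in> U"
  shows "\<exists>k\<le>K. cube_set (cell k x) \<subseteq> U"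
proof -
  obtain e where e: "e > 0" "ball x e \<subseteq> U" using assms open_contains_ball by blast
  obtain J where J: "\<And>k. k \<ge> J \<Longrightarrow> real CARD('n) * L / e < 2 powi k" using powi_2_unbounded by blast
  define k where "k = min K (- J)"
  have "real CARD('n) * L / e < 2 powi (- k)" by (rule J) (simp add: k_def)
  then have *: "real CARD('n) * (L * 2 powi k) < e"
    using e by (simp add: power_int_minus field_simps)
  have "cube_set (cell k x) \<subseteq> ball x e"
  proof
    fix y assume "y \<in> cube_set (cell k x)"
    then have "norm (x - y) \<le> real CARD('n) * (L * 2 powi k)"
      using cube_set_dist[of x "cell k x" y] self_cell by (simp add: side_cell)
    then show "y \<in> ball x e" using * by (simp add: dist_norm)
  qed
  then show ?thesis using e by (intro exI[of _ k]) (auto simp: k_def)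
qed

lemma bounded_in_cell:
  assumes "bounded C" shows "\<exists>k. \<forall>l\<ge>k. \<forall>x\<in>C. C \<subseteq> cube_set (cell l x)"
proof -
  obtain k where "\<forall>x\<in>C. \<forall>y\<in>C. cell k x = cell k y" using cell_bounded[OF assms] by blast
  then have "\<forall>l\<ge>k. \<forall>x\<in>C. \<forall>y\<in>C. cell l x = cell l y" using cell_up_le by blast
  then show ?thesis using self_cell by (metis subsetI)
qed

text \<open>The cubes of \<open>maximal_cubes\<close> inside a nearly optimal open superset of \<open>N\<close> show that \<open>N\<close>
  fills at most the proportion \<open>\<theta>\<close> of itself.\<close>

lemma density_null:
  assumes N [measurable]: "N \<in> sets lebesgue" and \<theta>: "\<theta> < 1" "0 \<le> \<theta>"
    and le: "\<And>k x. x \<in> N \<Longrightarrow> k \<le> K \<Longrightarrow> emeasure lebesgue (N \<inter> cube_set (cell k x)) \<le> ennreal \<theta> * emeasure lebesgue (cube_set (cell k x))"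
  shows "emeasure lebesgue N = 0"
proof -
  \<comment> \<open>Inside one cell of generation \<open>K\<close> the measure is finite, so that it
    can be compared with that of an open superset; countably many such cells cover the
    space.\<close>
  have Q: "emeasure lebesgue (N \<inter> cube_set (cell K x0)) = 0" for x0
  proof -
    define M where "M = N \<inter> cube_set (cell K x0)"
    have M [measurable]: "M \<in> sets lebesgue" by (simp add: M_def)
    have Mfin: "emeasure lebesgue M < top"
      by (rule le_less_trans[OF emeasure_mono[of M "cube_set (cell K x0)"]]) (auto simp: M_def)
    have *: "measure lebesgue M \<le> \<theta> * (measure lebesgue M + e)" if e: "e > 0" for e
    proof -
      obtain U where U: "open U" "M \<subseteq> U" "emeasure lebesgue (U - M) < e"
        using sets_lebesgue_outer_open[OF M e] by (metis (no_types, lifting))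
      have Ub [measurable]: "U \<in> sets lebesgue" using U(1) by auto
      \<comment> \<open>The side condition keeps the generation at most \<open>K\<close>, where the
        density hypothesis applies; meeting \<open>M\<close> supplies the point at which it is
        applied.\<close>
      define P where "P R \<longleftrightarrow> cube_set R \<subseteq> U \<and> cube_set R \<inter> M \<noteq> {} \<and> side R \<le> L * 2 powi K" for R :: "'n cube"
      let ?F = "maximal_cubes P"
      have PK: "P (cell k x) \<Longrightarrow> k \<le> K" for k x
        unfolding P_def using cell_side_mono[of k x K x0] by (simp add: side_cell)
      have cov: "M \<subseteq> (\<Union>R\<in>?F. M \<inter> cube_set R)"
      proof
        fix x assume x: "x \<in> M"
        obtain k where k: "k \<le> K" "cube_set (cell k x) \<subseteq> U" using small_cell[OF U(1)] U(2) x by blast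
        then have "P (cell k x)" using x self_cell[of x k] cell_side_mono[of k x K x0] by (auto simp: P_def side_cell)
        then obtain R where "R \<in> ?F" "cube_set (cell k x) \<subseteq> cube_set R"
          using maximal_cubes_cover[where P = P and K = K and Q = "cell k x"] PK by auto
        then show "x \<in> (\<Union>R\<in>?F. M \<inter> cube_set R)" using x self_cell[of x k] by auto
      qed
      have "emeasure lebesgue M \<le> emeasure lebesgue (\<Union>R\<in>?F. M \<inter> cube_set R)"
        by (rule emeasure_mono[OF cov]) (intro sets.countable_UN' countable_maximal, auto)
      also have "\<dots> \<le> ennreal \<theta> * emeasure lebesgue (\<Union>R\<in>?F. cube_set R)"
      proof (rule emeasure_UN_packing)
        fix R assume R: "R \<in> ?F"
        then obtain y where y: "y \<in> cube_set R" "y \<in> M" using maximal_cubesD(2)[OF R] by (auto simp: P_def)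
        obtain k where k: "R = cell k y" using cube_eq_cell y maximal_cubesD(1)[OF R] by blast
        have "emeasure lebesgue (M \<inter> cube_set R) \<le> emeasure lebesgue (N \<inter> cube_set (cell k y))"
          by (rule emeasure_mono) (auto simp: M_def k)
        also have "\<dots> \<le> ennreal \<theta> * emeasure lebesgue (cube_set R)"
          unfolding k by (rule le) (use y PK maximal_cubesD(2)[OF R] k in \<open>auto simp: M_def\<close>)
        finally show "emeasure lebesgue (M \<inter> cube_set R) \<le> ennreal \<theta> * emeasure lebesgue (cube_set R)" .
      qed (auto simp: countable_maximal disjoint_maximal)
      also have "emeasure lebesgue (\<Union>R\<in>?F. cube_set R) \<le> emeasure lebesgue U"
        by (rule emeasure_mono) (auto simp: P_def dest!: maximal_cubesD(2))
      also have "emeasure lebesgue U \<le> emeasure lebesgue M + emeasure lebesgue (U - M)"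
        using emeasure_subadditive[of M lebesgue "U - M"] U(2) by (simp add: Un_absorb1)
      also have "\<dots> \<le> ennreal (measure lebesgue M) + ennreal e"
        using U(3) Mfin by (intro add_mono) (auto simp: emeasure_eq_ennreal_measure)
      finally have "ennreal (measure lebesgue M) \<le> ennreal (\<theta> * (measure lebesgue M + e))"
        using Mfin e \<theta> by (simp add: mult_left_mono emeasure_eq_ennreal_measure ennreal_mult)
      then show ?thesis using e \<theta> by (simp add: ennreal_le_iff)
    qed
    have "measure lebesgue M = 0"
    proof (rule ccontr)
      assume "\<not> ?thesis"
      then have p: "measure lebesgue M > 0" by (simp add: zero_less_measure_iff)
      \<comment> \<open>With this error the estimate becomes e \<le> \<theta> e, which contradicts
        \<theta> < 1.\<close>
      define e where "e = (1 - \<theta>) * measure lebesgue M"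
      have e0: "e > 0" using p \<theta> by (simp add: e_def)
      have "measure lebesgue M - \<theta> * measure lebesgue M \<le> \<theta> * e" using *[OF e0] by (simp add: algebra_simps)
      moreover have "measure lebesgue M - \<theta> * measure lebesgue M = e" by (simp add: e_def algebra_simps)
      moreover have "\<theta> * e < 1 * e" using e0 \<theta> by (intro mult_strict_right_mono) auto
      ultimately show False by simp
    qed
    then show ?thesis using Mfin by (simp add: emeasure_eq_ennreal_measure flip: M_def)
  qed
  let ?C = "range (cell K)"
  have cC: "countable ?C" by (rule countable_subset[OF _ countable_cubes]) auto
  have "emeasure lebesgue N \<le> emeasure lebesgue (\<Union>R\<in>?C. N \<inter> cube_set R)"
  proof (rule emeasure_mono)
    show "N \<subseteq> (\<Union>R\<in>?C. N \<inter> cube_set R)" using self_cell by auto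
    show "(\<Union>R\<in>?C. N \<inter> cube_set R) \<in> sets lebesgue" by (rule sets.countable_UN'[OF cC]) auto
  qed
  also have "\<dots> \<le> (\<integral>\<^sup>+R. emeasure lebesgue (N \<inter> cube_set R) \<partial>count_space ?C)"
    by (rule emeasure_UN_le_count[OF cC]) auto
  also have "\<dots> = (\<integral>\<^sup>+R. 0 \<partial>count_space ?C)"
    by (rule nn_integral_cong) (use Q in auto)
  finally show ?thesis by simp
qed

text \<open>A selected cube has volume below I / \<alpha>, where I is the total integral, and this
  bounds its generation. The disjoint maximal cubes are packed against the measure with density
  \<open>G\<close>.\<close>

lemma calderon_zygmund_cubes:
  fixes G :: "real ^ 'n \<Rightarrow> ennreal"
  assumes [measurable]: "G \<in> borel_measurable lebesgue" and fin: "(\<integral>\<^sup>+x. G x \<partial>lebesgue) < top" and \<alpha>: "0 < \<alpha>"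
  defines "P \<equiv> (\<lambda>R. (\<integral>\<^sup>+x\<in>cube_set R. G x \<partial>lebesgue) > ennreal \<alpha> * emeasure lebesgue (cube_set R))"
  shows "\<exists>K. \<forall>k x. P (cell k x) \<longrightarrow> k \<le> K"
    and "ennreal \<alpha> * emeasure lebesgue (\<Union>R\<in>maximal_cubes P. cube_set R) \<le> (\<integral>\<^sup>+x. G x \<partial>lebesgue)"
proof -
  obtain I where I: "(\<integral>\<^sup>+x. G x \<partial>lebesgue) = ennreal I" "0 \<le> I" using fin by (cases "\<integral>\<^sup>+x. G x \<partial>lebesgue") auto
  \<comment> \<open>The \<open>max 1\<close> makes the side at least 1, so that the volume is at
    least the side and hence reaches I / \<alpha>.\<close>
  obtain K where K: "\<And>k. k \<ge> K \<Longrightarrow> max 1 (I / \<alpha>) / L < 2 powi k" using powi_2_unbounded by blast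
  have "k \<le> K" if P: "P (cell k x)" for k x
  proof (rule ccontr)
    assume "\<not> k \<le> K"
    then have "max 1 (I / \<alpha>) / L < 2 powi k" using K by simp
    then have s: "max 1 (I / \<alpha>) \<le> L * 2 powi k" using L_pos by (simp add: field_simps)
    then have "L * 2 powi k \<le> (L * 2 powi k) ^ CARD('n)" by (intro self_le_power) auto
    then have "I / \<alpha> \<le> (L * 2 powi k) ^ CARD('n)" using s by simp
    then have "I \<le> \<alpha> * (L * 2 powi k) ^ CARD('n)" using \<alpha> by (simp add: field_simps)
    then have "ennreal I \<le> ennreal \<alpha> * emeasure lebesgue (cube_set (cell k x))"
      using \<alpha> L_pos by (simp add: emeasure_cube_set side_cell flip: ennreal_mult')
    moreover have "(\<integral>\<^sup>+x\<in>cube_set (cell k x). G x \<partial>lebesgue) \<le> (\<integral>\<^sup>+x. G x \<partial>lebesgue)"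
      by (intro nn_integral_mono) (auto split: split_indicator)
    ultimately show False using P by (auto simp: P_def I)
  qed
  then show "\<exists>K. \<forall>k x. P (cell k x) \<longrightarrow> k \<le> K" by blast
  let ?F = "maximal_cubes P"
  have "emeasure lebesgue (\<Union>R\<in>?F. cube_set R) \<le> ennreal (1 / \<alpha>) * emeasure (density lebesgue G) (\<Union>R\<in>?F. cube_set R)"
  proof (rule emeasure_UN_packing)
    fix R assume R: "R \<in> ?F"
    have "ennreal (1 / \<alpha>) * (ennreal \<alpha> * emeasure lebesgue (cube_set R)) \<le> ennreal (1 / \<alpha>) * (\<integral>\<^sup>+x\<in>cube_set R. G x \<partial>lebesgue)"
      using maximal_cubesD(2)[OF R] by (intro mult_left_mono) (auto simp: P_def)
    then show "emeasure lebesgue (cube_set R) \<le> ennreal (1 / \<alpha>) * emeasure (density lebesgue G) (cube_set R)"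
      using \<alpha> by (simp add: emeasure_density flip: mult.assoc ennreal_mult')
  qed (auto simp: countable_maximal disjoint_maximal)
  then have "ennreal \<alpha> * emeasure lebesgue (\<Union>R\<in>?F. cube_set R) \<le> ennreal \<alpha> * (ennreal (1 / \<alpha>) * emeasure (density lebesgue G) (\<Union>R\<in>?F. cube_set R))"
    by (intro mult_left_mono) auto
  also have "\<dots> = emeasure (density lebesgue G) (\<Union>R\<in>?F. cube_set R)"
    using \<alpha> by (simp flip: mult.assoc ennreal_mult')
  also have "\<dots> \<le> emeasure (density lebesgue G) UNIV" by (rule emeasure_mono) auto
  also have "\<dots> = (\<integral>\<^sup>+x. G x \<partial>lebesgue)" by (subst emeasure_density) auto
  finally show "ennreal \<alpha> * emeasure lebesgue (\<Union>R\<in>?F. cube_set R) \<le> (\<integral>\<^sup>+x. G x \<partial>lebesgue)" .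
qed

text \<open>The parent contains the cube and has twice its side, so it extends beyond the cube by at
  most one side length in each direction.\<close>

lemma cell_parent_triple: "cube_set (cell (k + 1) x) \<subseteq> cube_set (dilate 3 (cell k x))"
proof
  fix y assume y: "y \<in> cube_set (cell (k + 1) x)"
  have s: "side (cell (k + 1) x) = 2 * side (cell k x)" by (simp add: side_cell power_int_add)
  have "cube_set (cell k x) \<subseteq> cube_set (cell (k + 1) x)" by (rule cell_mono) simp
  note b = cube_subset_bounds[OF this is_cube_cell]
  show "y \<in> cube_set (dilate 3 (cell k x))"
    unfolding cube_set_def dilate_def
  proof (clarsimp)
    fix i
    have "fst (cell (k+1) x) $ i - side (cell (k+1) x) / 2 \<le> y $ i" "y $ i < fst (cell (k+1) x) $ i + side (cell (k+1) x) / 2"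
      using y by (auto simp: cube_set_def)
    then show "fst (cell k x) $ i - 3 * side (cell k x) / 2 \<le> y $ i \<and> y $ i < fst (cell k x) $ i + 3 * side (cell k x) / 2"
      using b[of i] s by auto
  qed
qed

text \<open>\<open>st x\<close> is the child containing \<open>x\<close> of the first cell around
  \<open>x\<close>, from generation \<open>k0\<close> on, that contains \<open>C\<close>; its triple
  contains this parent. Being the largest such cell that does not contain all of \<open>C\<close>,
  it is the same for all its points, so distinct starting cubes are disjoint. For the parents
  themselves this would fail.\<close>

lemma starting_cubes:
  assumes "bounded C"
  shows "\<exists>st. (\<forall>x. st x \<in> cubes \<and> x \<in> cube_set (st x) \<and> C \<subseteq> cube_set (dilate 3 (st x))) \<and>
     (\<forall>x y. y \<in> cube_set (st x) \<longrightarrow> st y = st x)"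
proof -
  obtain k0 where k0: "\<And>l x. l \<ge> k0 \<Longrightarrow> x \<in> C \<Longrightarrow> C \<subseteq> cube_set (cell l x)" using bounded_in_cell[OF assms] by blast
  have ex: "\<exists>j::nat. C \<subseteq> cube_set (cell (k0 + int j) x)" for x
  proof -
    have "bounded (insert x C)" using assms by simp
    then obtain k where k: "\<And>l y. l \<ge> k \<Longrightarrow> y \<in> insert x C \<Longrightarrow> insert x C \<subseteq> cube_set (cell l y)"
      using bounded_in_cell by meson
    have "C \<subseteq> cube_set (cell (k0 + int (nat (k - k0))) x)" using k[of "k0 + int (nat (k - k0))" x] by auto
    then show ?thesis by blast
  qed
  define j where "j x = (LEAST j. C \<subseteq> cube_set (cell (k0 + int j) x))" for x
  \<comment> \<open>Truncated subtraction: if the cell of generation \<open>k0\<close> already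
    contains \<open>C\<close>, that cell itself is taken.\<close>
  define st where "st x = cell (k0 + int (j x - 1)) x" for x
  have j: "C \<subseteq> cube_set (cell (k0 + int (j x)) x)" for x unfolding j_def by (rule LeastI_ex[OF ex])
  have j_least: "j x \<le> m" if "C \<subseteq> cube_set (cell (k0 + int m) x)" for x m
    unfolding j_def using that by (rule Least_le)
  have "C \<subseteq> cube_set (dilate 3 (st x))" for x
  proof (cases "j x")
    case 0
    then have "C \<subseteq> cube_set (st x)" using j[of x] by (simp add: st_def)
    also have "\<dots> \<subseteq> cube_set (dilate 3 (st x))" using dilate_mono[of 1 3 "st x"] by (simp add: st_def)
    finally show ?thesis .
  next
    case (Suc i)
    then have "C \<subseteq> cube_set (cell (k0 + int i + 1) x)" using j[of x] by (simp add: algebra_simps)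
    also have "\<dots> \<subseteq> cube_set (dilate 3 (st x))" using cell_parent_triple[of "k0 + int i" x] Suc by (simp add: st_def)
    finally show ?thesis .
  qed
  moreover have "st y = st x" if y: "y \<in> cube_set (st x)" for x y
  proof -
    have c: "cell (k0 + int (j x - 1)) y = cell (k0 + int (j x - 1)) x" using y cell_eq by (simp add: st_def)
    then have up: "cell (k0 + int m) y = cell (k0 + int m) x" if "m \<ge> j x - 1" for m
      by (rule cell_up_le[rotated]) (use that in simp)
    have "j y \<le> j x" by (rule j_least) (use up[of "j x"] j[of x] in auto)
    moreover have "j x - 1 \<le> j y - 1"
    proof (rule ccontr)
      assume h: "\<not> j x - 1 \<le> j y - 1"
      have "C \<subseteq> cube_set (cell (k0 + int (j x - 1)) y)"
        by (rule order_trans[OF j[of y] cell_mono]) (use h in linarith)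
      then have "j x \<le> j x - 1" unfolding c by (rule j_least)
      then show False using h by simp
    qed
    ultimately have "j y - 1 = j x - 1" by simp
    then show ?thesis using c by (simp add: st_def)
  qed
  ultimately show ?thesis using self_cell by (intro exI[of _ st]) (auto simp: st_def)
qed

end

section \<open>Grids with shifted corners\<close>

definition cell_index :: "real \<Rightarrow> (int \<Rightarrow> 'n \<Rightarrow> real) \<Rightarrow> int \<Rightarrow> real ^ 'n \<Rightarrow> 'n::finite \<Rightarrow> int" where
  "cell_index L s k x i = \<lfloor>x $ i / (L * 2 powi k) - s k i\<rfloor>"

definition shifted_cell :: "real \<Rightarrow> (int \<Rightarrow> 'n \<Rightarrow> real) \<Rightarrow> int \<Rightarrow> real ^ 'n \<Rightarrow> 'n::finite cube" where
  "shifted_cell L s k x =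
    ((\<chi> i. L * 2 powi k * (of_int (cell_index L s k x i) + s k i + 1 / 2)), L * 2 powi k)"

text \<open>The corners at generation \<open>k\<close> are \<open>L * 2 powi k * (j + s k)\<close> with \<open>j\<close> integral. That \<open>s k\<close> stays
  away from the integers keeps the origin away from all boundaries at a distance comparable with
  the side length.\<close>

locale shifted_grid =
  fixes L :: real and s :: "int \<Rightarrow> 'n::finite \<Rightarrow> real" and d :: "int \<Rightarrow> 'n \<Rightarrow> int"
  assumes L: "0 < L" and d: "2 * s (k + 1) i - s k i = of_int (d k i)"
    and away: "\<exists>j::int. 1 / 9 \<le> s k i + of_int j \<and> s k i + of_int j \<le> 8 / 9"
begin

abbreviation "cel \<equiv> shifted_cell L s"
abbreviation "idx \<equiv> cell_index L s"

lemma cell_eq_iff: "cel k x = cel k y \<longleftrightarrow> (\<forall>i. idx k x i = idx k y i)"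
  using L by (simp add: shifted_cell_def vec_eq_iff)

lemma in_cell_iff: "y \<in> cube_set (cel k x) \<longleftrightarrow> (\<forall>i. idx k y i = idx k x i)"
proof -
  have p: "0 < L * 2 powi k" using L by simp
  have "fst (cel k x) $ i - side (cel k x) / 2 \<le> y $ i \<and> y $ i < fst (cel k x) $ i + side (cel k x) / 2
    \<longleftrightarrow> idx k y i = idx k x i" for i
  proof -
    let ?J = "real_of_int (idx k x i)" and ?p = "L * 2 powi k"
    have "idx k y i = idx k x i \<longleftrightarrow> ?J \<le> y $ i / ?p - s k i \<and> y $ i / ?p - s k i < ?J + 1"
      unfolding cell_index_def[of L s k y] by (rule floor_eq_iff)
    also have "\<dots> \<longleftrightarrow> ?J + s k i \<le> y $ i / ?p \<and> y $ i / ?p < ?J + s k i + 1" by linarith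
    also have "\<dots> \<longleftrightarrow> ?p * (?J + s k i) \<le> y $ i \<and> y $ i < ?p * (?J + s k i + 1)"
      using p by (simp only: pos_le_divide_eq pos_divide_less_eq mult.commute)
    also have "\<dots> \<longleftrightarrow> fst (cel k x) $ i - side (cel k x) / 2 \<le> y $ i \<and> y $ i < fst (cel k x) $ i + side (cel k x) / 2"
    proof -
      have "fst (cel k x) $ i - side (cel k x) / 2 = ?p * (?J + s k i)" "fst (cel k x) $ i + side (cel k x) / 2 = ?p * (?J + s k i + 1)"
        by (simp_all add: shifted_cell_def algebra_simps)
      then show ?thesis by simp
    qed
    finally show ?thesis by simp
  qed
  then show ?thesis by (simp add: cube_set_def)
qed

text \<open>Nestedness of the grid: because \<open>2 * s (k + 1) - s k\<close> is an integer, the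
  parent index arises by halving an integer translate of the scaled coordinate, and the floor of a
  half depends only on the floor.\<close>

lemma idx_up: "idx (k + 1) x i = (idx k x i - d k i) div 2"
proof -
  have "x $ i / (L * 2 powi (k + 1)) - s (k + 1) i = (x $ i / (L * 2 powi k) - s k i - of_int (d k i)) / real_of_int 2"
    using L by (simp add: power_int_add d[symmetric] field_simps)
  then have "idx (k + 1) x i = \<lfloor>x $ i / (L * 2 powi k) - s k i - of_int (d k i)\<rfloor> div 2"
    unfolding cell_index_def by (simp only:) (rule floor_divide_real_eq_div, simp)
  then show ?thesis by (simp add: cell_index_def)
qed

text \<open>Once the side exceeds nine times a bound for the norms in \<open>C\<close>, every scaled
  coordinate is below 1 / 9 in absolute value. The shift stays at least that far from the integers,
  so no boundary separates two points of \<open>C\<close>.\<close>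

lemma cel_bounded:
  assumes "bounded C" shows "\<exists>k. \<forall>x\<in>C. \<forall>y\<in>C. cel k x = cel k y"
proof -
  obtain R where R: "\<And>x. x \<in> C \<Longrightarrow> norm x \<le> R" using assms bounded_iff by blast
  obtain k where k: "9 * R / L < 2 powi k" using powi_2_unbounded[of "9 * R / L"] by auto
  have "\<exists>J. \<forall>x\<in>C. idx k x i = J" for i
  proof -
    obtain j :: int where j: "1 / 9 \<le> s k i + of_int j" "s k i + of_int j \<le> 8 / 9" using away by blast
    have "idx k x i = j - 1" if "x \<in> C" for x
    proof -
      have p: "0 < L * 2 powi k" using L by simp
      have "\<bar>x $ i\<bar> \<le> R" using R[OF that] component_le_norm_cart[of x i] by linarith
      moreover have "9 * R < L * 2 powi k" using k L by (simp add: field_simps)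
      ultimately have "9 * \<bar>x $ i\<bar> < L * 2 powi k" by linarith
      then have "\<bar>x $ i / (L * 2 powi k)\<bar> < 1 / 9" using p by (simp add: field_simps)
      then have "x $ i / (L * 2 powi k) < 1 / 9" "- (1 / 9) < x $ i / (L * 2 powi k)" by linarith+
      then have "real_of_int (j - 1) \<le> x $ i / (L * 2 powi k) - s k i" "x $ i / (L * 2 powi k) - s k i < real_of_int (j - 1) + 1"
        unfolding of_int_diff of_int_1 using j by linarith+
      then show ?thesis unfolding cell_index_def by (rule floor_unique)
    qed
    then show ?thesis by blast
  qed
  then have "\<forall>x\<in>C. \<forall>y\<in>C. cel k x = cel k y" unfolding cell_eq_iff by metis
  then show ?thesis by blast
qed

lemma cel_countable: "countable (range (\<lambda>(k, x). cel k x))"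
proof -
  have "range (\<lambda>(k, x). cel k x) \<subseteq> range (\<lambda>(k, j::'n \<Rightarrow> int). ((\<chi> i. L * 2 powi k * (of_int (j i) + s k i + 1 / 2)), L * 2 powi k))"
  proof (rule image_subsetI)
    fix z :: "int \<times> (real ^ 'n)"
    obtain k x where z: "z = (k, x)" by (cases z)
    show "(case z of (k, x) \<Rightarrow> cel k x) \<in> range (\<lambda>(k, j::'n \<Rightarrow> int). ((\<chi> i. L * 2 powi k * (of_int (j i) + s k i + 1 / 2)), L * 2 powi k))"
      by (rule range_eqI[of _ _ "(k, idx k x)"]) (simp add: z shifted_cell_def)
  qed
  then show ?thesis by (rule countable_subset) simp
qed

sublocale grid cel L
proof
  fix k x y and C :: "(real ^ 'n) set"
  show "0 < L" by (rule L)
  show "side (cel k x) = L * 2 powi k" by (simp add: shifted_cell_def)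
  show "x \<in> cube_set (cel k x)" by (simp add: in_cell_iff)
  show "y \<in> cube_set (cel k x) \<Longrightarrow> cel k y = cel k x" by (simp add: in_cell_iff cell_eq_iff)
  show "cel k x = cel k y \<Longrightarrow> cel (k + 1) x = cel (k + 1) y" by (simp add: cell_eq_iff idx_up)
  show "bounded C \<Longrightarrow> \<exists>k. \<forall>x\<in>C. \<forall>y\<in>C. cel k x = cel k y" by (rule cel_bounded)
  show "countable (range (\<lambda>(k, x). cel k x))" by (rule cel_countable)
qed

text \<open>The children of a cell of index J have indices 2 J + d and 2 J + d + 1 in each
  coordinate, and the sign -1 or 1 selects between them.\<close>

lemma children_in_cubes:
  assumes "Q \<in> cubes" shows "dyadic_children Q \<subseteq> cubes"
proof
  fix R assume "R \<in> dyadic_children Q"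
  obtain k' x where Q': "Q = cel k' x" using assms cubesE by blast
  define k where "k = k' - 1"
  have Q: "Q = cel (k + 1) x" by (simp add: Q' k_def)
  have p: "0 < L * 2 powi k" using L by simp
  have pe: "L * 2 powi (k + 1) = 2 * (L * 2 powi k)" by (simp add: power_int_add)
  obtain e where e: "R = (fst Q + (side Q / 4) *\<^sub>R e, side Q / 2)" "\<And>i. e $ i \<in> {-1, 1}"
    using \<open>R \<in> dyadic_children Q\<close> unfolding dyadic_children_def by auto
  let ?z = "fst R"
  have sR: "side R = L * 2 powi k" using e by (simp add: Q side_cell pe)
  have "?z $ i = L * 2 powi k * (of_int (idx k ?z i) + s k i + 1 / 2)" for i
  proof -
    let ?J = "idx (k + 1) x i"
    have "?z $ i = 2 * (L * 2 powi k) * (of_int ?J + s (k + 1) i + 1 / 2) + (L * 2 powi k) / 2 * e $ i"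
      using e by (simp add: Q shifted_cell_def pe)
    also have "\<dots> = (L * 2 powi k) * (2 * of_int ?J + (2 * s (k + 1) i - s k i) + s k i + 1 + e $ i / 2)"
      by (simp add: algebra_simps)
    finally have z: "?z $ i = (L * 2 powi k) * (of_int (2 * ?J + d k i + 1) + s k i + e $ i / 2)"
      unfolding d by (simp add: algebra_simps)
    then have zi: "?z $ i / (L * 2 powi k) - s k i = of_int (2 * ?J + d k i + 1) + e $ i / 2"
    proof -
      have ne: "L * 2 powi k \<noteq> 0" using L by simp
      show ?thesis unfolding z nonzero_mult_div_cancel_left[OF ne] by simp
    qed
    show ?thesis
    proof (cases "e $ i = 1")
      case True
      have "idx k ?z i = 2 * ?J + d k i + 1"
        unfolding cell_index_def[of L s k ?z i] zi True by (rule floor_unique) auto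
      then show ?thesis using z True by simp
    next
      case False
      then have e1: "e $ i = -1" using e(2)[of i] by auto
      have "idx k ?z i = 2 * ?J + d k i"
        unfolding cell_index_def[of L s k ?z i] zi e1 by (rule floor_unique) auto
      then show ?thesis using z e1 by (simp add: algebra_simps)
    qed
  qed
  then have "R = cel k ?z" using sR by (intro prod_eqI) (simp_all add: shifted_cell_def vec_eq_iff)
  then show "R \<in> cubes" using cell_in_cubes by metis
qed

text \<open>The sign vector of a cell inside its parent is read off from the parity of its index
  minus \<open>d\<close>.\<close>

lemma cell_in_children: "cel k x \<in> dyadic_children (cel (k + 1) x)"
proof -
  let ?Q = "cel (k + 1) x"
  have pe: "L * 2 powi (k + 1) = 2 * (L * 2 powi k)" by (simp add: power_int_add)
  define e :: "real ^ 'n" where "e = (\<chi> i. if even (idx k x i - d k i) then -1 else 1)"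
  have "fst (cel k x) $ i = (fst ?Q + (side ?Q / 4) *\<^sub>R e) $ i" for i
  proof -
    let ?J = "idx (k + 1) x i"
    have J: "idx k x i = d k i + 2 * ?J + (if even (idx k x i - d k i) then 0 else 1)"
    proof -
      have "a = 2 * (a div 2) + (if even a then 0 else 1)" for a :: int by presburger
      from this[of "idx k x i - d k i"] show ?thesis unfolding idx_up by linarith
    qed
    have "fst (cel k x) $ i = L * 2 powi k * (of_int (idx k x i) + s k i + 1 / 2)"
      by (simp add: shifted_cell_def)
    also have "\<dots> = L * 2 powi k * (2 * of_int ?J + (of_int (d k i) + s k i) + 1 + e $ i / 2)"
      by (subst J) (simp add: e_def)
    also have "of_int (d k i) + s k i = 2 * s (k + 1) i" by (simp add: d[symmetric])
    also have "L * 2 powi k * (2 * of_int ?J + 2 * s (k + 1) i + 1 + e $ i / 2)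
       = (2 * (L * 2 powi k)) * (of_int ?J + s (k + 1) i + 1 / 2) + (2 * (L * 2 powi k)) / 4 * e $ i"
      by (simp add: algebra_simps)
    also have "\<dots> = (fst ?Q + (side ?Q / 4) *\<^sub>R e) $ i"
      unfolding pe[symmetric] by (simp add: shifted_cell_def)
    finally show ?thesis .
  qed
  then have "cel k x = (fst ?Q + (side ?Q / 4) *\<^sub>R e, side ?Q / 2)"
    by (intro prod_eqI) (simp_all add: vec_eq_iff side_cell pe)
  moreover have "\<forall>i. e $ i \<in> {-1, 1}" by (simp add: e_def)
  ultimately show ?thesis unfolding dyadic_children_def by blast
qed

lemma cell_in_descendants: "k \<le> m \<Longrightarrow> cel k x \<in> dyadic_descendants (cel m x)"
proof (induction k rule: int_le_induct)
  case base
  then show ?case by (rule dyadic_descendants.self)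
next
  case (step k)
  then show ?case using cell_in_children[of "k - 1" x] dyadic_descendants.child by fastforce
qed

lemma dyadic_lattice_cubes: "dyadic_lattice cubes"
  unfolding dyadic_lattice_def
proof (intro conjI ballI allI impI)
  show "is_cube Q" if "Q \<in> cubes" for Q using that by (rule is_cube_cubes)
  show "dyadic_children Q \<subseteq> cubes" if "Q \<in> cubes" for Q using that by (rule children_in_cubes)
  show "\<exists>P\<in>cubes. Q \<in> dyadic_descendants P \<and> R \<in> dyadic_descendants P" if "Q \<in> cubes" "R \<in> cubes" for Q R
  proof -
    obtain k x where Q: "Q = cel k x" by (rule cubesE[OF \<open>Q \<in> cubes\<close>])
    obtain l y where R: "R = cel l y" by (rule cubesE[OF \<open>R \<in> cubes\<close>])
    note QR = Q R
    have fb: "bounded {x, y}" by (intro finite_imp_bounded) simp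
    obtain m0 where m0: "\<forall>l\<ge>m0. \<forall>u\<in>{x, y}. {x, y} \<subseteq> cube_set (cel l u)"
      using bounded_in_cell[OF fb] by (elim exE) (rule that)
    have "{x, y} \<subseteq> cube_set (cel (max m0 (max k l)) x)"
      by (rule m0[rule_format]) auto
    then have "y \<in> cube_set (cel (max m0 (max k l)) x)" by blast
    then have e: "cel (max m0 (max k l)) y = cel (max m0 (max k l)) x" by (rule cell_eq)
    have "Q \<in> dyadic_descendants (cel (max m0 (max k l)) x)"
      unfolding QR by (rule cell_in_descendants) simp
    moreover have "R \<in> dyadic_descendants (cel (max m0 (max k l)) x)"
      unfolding QR e[symmetric] by (rule cell_in_descendants) simp
    ultimately show ?thesis using cell_in_cubes by blast
  qed
  show "\<exists>Q\<in>cubes. C \<subseteq> cube_set Q" if \<open>compact C\<close> for C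
  proof (cases "C = {}")
    case False
    then obtain x where "x \<in> C" by auto
    moreover obtain k where "\<forall>l\<ge>k. \<forall>x\<in>C. C \<subseteq> cube_set (cel l x)"
      using bounded_in_cell[OF compact_imp_bounded[OF \<open>compact C\<close>]] by (elim exE) (rule that)
    ultimately have "C \<subseteq> cube_set (cel k x)" by simp
    then show ?thesis using cell_in_cubes by blast
  qed (use cell_in_cubes in blast)
qed

end

section \<open>The base grid and the lattices of its triples\<close>

definition base_shift :: "int \<Rightarrow> real" where "base_shift k = (if even k then - 1 / 3 else - 2 / 3)"

text \<open>An integer j that solves l = j + k for even \<open>k\<close> and l = k - j for odd
  \<open>k\<close>, as a representative modulo 3. The sign alternates because passing to the parent
  halves the index, and 2 is -1 modulo 3; this makes the triples with one label nested.\<close>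

definition residue_rep :: "int \<Rightarrow> int \<Rightarrow> int" where "residue_rep k l = (if even k then l - k else k - l)"

text \<open>In each coordinate the triple of a base cube of index j starts at 2^k times j - 1 +
  base_shift k. With j = r + 3 q this is 3 times 2^k times q + (r - 1 + base_shift k) / 3: the
  integer q is the index and the fraction is the shift.\<close>

definition triple_shift :: "('n \<Rightarrow> int) \<Rightarrow> int \<Rightarrow> 'n \<Rightarrow> real" where
  "triple_shift l k i = (of_int (residue_rep k (l i)) - 1 + base_shift k) / 3"

text \<open>Modulo 1 the shifts 1/3 and 2/3 are exchanged by doubling, so alternating them gives
  nested generations while both stay 1/3 away from the integers.\<close>

interpretation base: shifted_grid 1 "\<lambda>k i. base_shift k" "\<lambda>k i. if even k then -1 else 0"
proof
  fix k
  show "2 * base_shift (k + 1) - base_shift k = of_int (if even k then -1 else 0)" by (simp add: base_shift_def)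
  show "\<exists>j::int. 1 / 9 \<le> base_shift k + of_int j \<and> base_shift k + of_int j \<le> 8 / 9"
    by (rule exI[of _ 1]) (simp add: base_shift_def)
qed simp

text \<open>The shifts are chosen so that the triple of the base cube of generation \<open>k\<close> and index \<open>j\<close> lies in
  the lattice labelled \<open>l\<close> when, modulo 3, every \<open>l i\<close> is \<open>j i + k\<close> (\<open>k\<close> even) or \<open>k - j i\<close> (\<open>k\<close> odd).\<close>

interpretation triple: shifted_grid 3 "triple_shift l" "\<lambda>k i. if even k then k - l i else l i - k - 1" for l :: "'n::finite \<Rightarrow> int"
proof
  fix k i
  show "2 * triple_shift l (k + 1) i - triple_shift l k i = of_int (if even k then k - l i else l i - k - 1)"
    by (simp add: triple_shift_def base_shift_def residue_rep_def field_simps)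
  \<comment> \<open>Modulo 1 the shift is (r + 1/3) / 3 or (r + 2/3) / 3 with r one of 0, 1, 2. The
    extreme values 1/9 and 8/9 are the bounds demanded in \<open>shifted_grid\<close>.\<close>
  let ?m = "residue_rep k (l i) - 2"
  have "real_of_int ?m = 3 * real_of_int (?m div 3) + real_of_int (?m mod 3)"
    by (metis mult_div_mod_eq of_int_add of_int_mult of_int_numeral)
  moreover have "0 \<le> real_of_int (?m mod 3)" "real_of_int (?m mod 3) \<le> 2"
  proof -
    have "0 \<le> ?m mod 3" "?m mod 3 \<le> 2" using pos_mod_bound[of 3 ?m] by auto
    then show "0 \<le> real_of_int (?m mod 3)" "real_of_int (?m mod 3) \<le> 2" by linarith+
  qed
  moreover have "triple_shift l k i = (real_of_int ?m + 1 + base_shift k) / 3" by (simp add: triple_shift_def)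
  ultimately show "\<exists>j::int. 1 / 9 \<le> triple_shift l k i + of_int j \<and> triple_shift l k i + of_int j \<le> 8 / 9"
    by (intro exI[of _ "- (?m div 3)"]) (cases "even k"; simp add: base_shift_def; argo)
qed simp

text \<open>The one-third trick: the label records, up to the shift by the generation, the index
  modulo 3 in every coordinate, and the quotient by 3 is the index of the triple in the lattice with
  that label.\<close>

lemma triple_base_cube:
  fixes Q :: "'n::finite cube"
  assumes "Q \<in> base.cubes"
  shows "\<exists>l. (\<forall>i. l i \<in> {0, 1, 2}) \<and> dilate 3 Q \<in> triple.cubes l"
proof -
  obtain k x where Q: "Q = base.cel k x" using assms base.cubesE by blast
  let ?j = "\<lambda>i. base.idx k x i"
  define l :: "'n \<Rightarrow> int" where "l i = (if even k then ?j i + k else k - ?j i) mod 3" for i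
  have l: "\<forall>i. l i \<in> {0, 1, 2}"
  proof
    fix i
    have "0 \<le> l i" "l i < 3" unfolding l_def by auto
    then show "l i \<in> {0, 1, 2}" by auto
  qed
  have J3: "3 * cell_index 3 (triple_shift l) k x i + residue_rep k (l i) = ?j i" for i
  proof -
    let ?r = "residue_rep k (l i)"
    have "3 dvd ?j i - ?r"
      unfolding residue_rep_def l_def by (simp add: mod_eq_dvd_iff[symmetric] mod_simps)
    then obtain q where "?j i - ?r = 3 * q" by (rule dvdE)
    then have q: "?j i = ?r + 3 * q" by linarith
    have "x $ i / (3 * 2 powi k) - triple_shift l k i = (x $ i / (1 * 2 powi k) - base_shift k - of_int (?r - 1)) / real_of_int 3"
      by (simp add: triple_shift_def field_simps)
    then have "cell_index 3 (triple_shift l) k x i = \<lfloor>x $ i / (1 * 2 powi k) - base_shift k - of_int (?r - 1)\<rfloor> div 3"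
      unfolding cell_index_def by (simp only:) (rule floor_divide_real_eq_div, simp)
    also have "\<lfloor>x $ i / (1 * 2 powi k) - base_shift k - of_int (?r - 1)\<rfloor> = ?j i - (?r - 1)"
      unfolding cell_index_def floor_diff_of_int by simp
    also have "\<dots> div 3 = q" unfolding q by simp
    finally show ?thesis using q by simp
  qed
  then have r: "real_of_int (?j i) = 3 * real_of_int (cell_index 3 (triple_shift l) k x i) + real_of_int (residue_rep k (l i))" for i
  proof -
    have "real_of_int (3 * cell_index 3 (triple_shift l) k x i + residue_rep k (l i)) = real_of_int (?j i)"
      by (simp only: J3)
    then show ?thesis by simp
  qed
  have "dilate 3 Q = triple.cel l k x"
    unfolding Q by (intro prod_eqI) (simp_all add: dilate_def shifted_cell_def vec_eq_iff r triple_shift_def field_simps)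
  then show ?thesis using l triple.cell_in_cubes by metis
qed

lemma triple_index_enumeration:
  "\<exists>\<beta> :: nat \<Rightarrow> 'n::finite \<Rightarrow> int. \<beta> ` {1..3 ^ CARD('n)} = {l. \<forall>i. l i \<in> {0, 1, 2}}"
proof -
  let ?M = "PiE (UNIV :: 'n set) (\<lambda>_. {0, 1, 2 :: int})"
  have "card ?M = 3 ^ CARD('n)" by (simp add: card_PiE numeral_3_eq_3)
  moreover have "finite ?M" by (intro finite_PiE) auto
  ultimately obtain h where "bij_betw h {1..(3::nat) ^ CARD('n)} ?M" using ex_bij_betw_nat_finite_1[of ?M] by metis
  then have "h ` {1..3 ^ CARD('n)} = ?M" by (rule bij_betw_imp_surj_on)
  also have "?M = {l. \<forall>i. l i \<in> {0, 1, 2}}" by (auto simp: PiE_UNIV_domain Pi_def)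
  finally show ?thesis by blast
qed

section \<open>Smooth bump functions\<close>

lemma C_k_const: "C_k k (\<lambda>_. c)"
proof (induction k arbitrary: c)
  case (Suc k)
  show ?case
    unfolding C_k.simps by (rule exI[of _ "\<lambda>_. 0"]) (auto simp: Suc intro!: derivative_eq_intros)
qed simp

lemma C_k_SucD: "C_k (Suc k) f \<Longrightarrow> C_k k f"
proof (induction k arbitrary: f)
  case 0
  then obtain g where "\<And>x. (f has_derivative (\<lambda>h. g x \<bullet> h)) (at x)" by auto
  then show ?case
    unfolding C_k.simps continuous_on_eq_continuous_at[OF open_UNIV] using has_derivative_continuous by blast
next
  case (Suc k)
  obtain g where g: "\<And>x. (f has_derivative (\<lambda>h. g x \<bullet> h)) (at x)" "\<And>i. C_k (Suc k) (\<lambda>x. g x $ i)"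
    using Suc.prems unfolding C_k.simps(2)[of "Suc k"] by blast
  show ?case unfolding C_k.simps(2) by (rule exI[of _ g]) (use g(1) Suc.IH[OF g(2)] in blast)
qed

lemma C_k_add: "C_k k f \<Longrightarrow> C_k k g \<Longrightarrow> C_k k (\<lambda>x. f x + g x)"
proof (induction k arbitrary: f g)
  case 0
  then show ?case by (auto intro: continuous_intros)
next
  case (Suc k)
  obtain df where df: "\<And>x. (f has_derivative (\<lambda>h. df x \<bullet> h)) (at x)" "\<And>i. C_k k (\<lambda>x. df x $ i)"
    using Suc.prems(1) by auto
  obtain dg where dg: "\<And>x. (g has_derivative (\<lambda>h. dg x \<bullet> h)) (at x)" "\<And>i. C_k k (\<lambda>x. dg x $ i)"
    using Suc.prems(2) by auto
  show ?case unfolding C_k.simps(2)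
  proof (intro exI[of _ "\<lambda>x. df x + dg x"] conjI allI)
    show "((\<lambda>x. f x + g x) has_derivative (\<lambda>h. (df x + dg x) \<bullet> h)) (at x)" for x
      using has_derivative_add[OF df(1) dg(1)] by (simp add: inner_add_left)
    show "C_k k (\<lambda>x. (df x + dg x) $ i)" for i
      using Suc.IH[OF df(2) dg(2)] by simp
  qed
qed

lemma C_k_mult: "C_k k f \<Longrightarrow> C_k k g \<Longrightarrow> C_k k (\<lambda>x. f x * g x)"
proof (induction k arbitrary: f g)
  case 0
  then show ?case by (auto intro: continuous_intros)
next
  case (Suc k)
  obtain df where df: "\<And>x. (f has_derivative (\<lambda>h. df x \<bullet> h)) (at x)" "\<And>i. C_k k (\<lambda>x. df x $ i)"
    using Suc.prems(1) by auto
  obtain dg where dg: "\<And>x. (g has_derivative (\<lambda>h. dg x \<bullet> h)) (at x)" "\<And>i. C_k k (\<lambda>x. dg x $ i)"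
    using Suc.prems(2) by auto
  note lower = C_k_SucD[OF Suc.prems(1)] C_k_SucD[OF Suc.prems(2)]
  show ?case unfolding C_k.simps(2)
  proof (intro exI[of _ "\<lambda>x. f x *\<^sub>R dg x + g x *\<^sub>R df x"] conjI allI)
    show "((\<lambda>x. f x * g x) has_derivative (\<lambda>h. (f x *\<^sub>R dg x + g x *\<^sub>R df x) \<bullet> h)) (at x)" for x
      using has_derivative_mult[OF df(1) dg(1)] by (simp add: inner_add_left mult.commute)
    show "C_k k (\<lambda>x. (f x *\<^sub>R dg x + g x *\<^sub>R df x) $ i)" for i
      using C_k_add[OF Suc.IH[OF lower(1) dg(2)] Suc.IH[OF lower(2) df(2)]] by simp
  qed
qed

lemma C_k_prod: "finite I \<Longrightarrow> (\<And>i. i \<in> I \<Longrightarrow> C_k k (f i)) \<Longrightarrow> C_k k (\<lambda>x. \<Prod>i\<in>I. f i x)"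
  by (induction I rule: finite_induct) (auto intro: C_k_const C_k_mult)

text \<open>Differentiation moves one step up the sequence \<open>F\<close>, so the induction over
  \<open>C_k\<close> runs on a whole tower of derivatives with arbitrary starting index
  \<open>m\<close>.\<close>

lemma C_k_coordinate:
  assumes "\<And>k t. (F k has_real_derivative F (Suc k) t) (at t)"
  shows "C_k k (\<lambda>x. F m (x $ i))"
proof (induction k arbitrary: m)
  case 0
  have "continuous_on UNIV (F m)"
    using assms DERIV_isCont continuous_at_imp_continuous_on by blast
  then have "continuous_on UNIV (\<lambda>x::real^'a. F m (x $ i))"
    by (rule continuous_on_compose2) (auto intro: continuous_intros)
  then show ?case by simp
next
  case (Suc k)
  show ?case unfolding C_k.simps(2)
  proof (intro exI[of _ "\<lambda>x. axis i (F (Suc m) (x $ i))"] conjI allI)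
    show "((\<lambda>x. F m (x $ i)) has_derivative (\<lambda>h. axis i (F (Suc m) (x $ i)) \<bullet> h)) (at x)" for x :: "real^'a"
    proof -
      have "(F m has_derivative (\<lambda>h. F (Suc m) (x $ i) * h)) (at (x $ i))"
        using assms[of m "x $ i"] by (simp add: has_field_derivative_def)
      moreover have "((\<lambda>x::real^'a. x $ i) has_derivative (\<lambda>h. h $ i)) (at x)"
        by (rule bounded_linear.has_derivative[OF bounded_linear_vec_nth has_derivative_ident])
      ultimately have "((\<lambda>x. F m (x $ i)) has_derivative (\<lambda>h. F (Suc m) (x $ i) * h $ i)) (at x)"
        using has_derivative_compose[of "\<lambda>x. x $ i" "\<lambda>h. h $ i" x UNIV "F m"] by simp
      then show ?thesis by (simp add: inner_axis' )
    qed
    show "C_k k (\<lambda>x. axis i (F (Suc m) (x $ i)) $ j)" for j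
      using Suc[of "Suc m"] C_k_const[of k 0] by (cases "j = i") (simp_all add: axis_def)
  qed
qed

text \<open>The functions p(1/t) exp(-1/t), extended by 0, are closed under differentiation and
  include the standard flat function exp(-1/t).\<close>

definition exp_poly :: "real poly \<Rightarrow> real \<Rightarrow> real" where
  "exp_poly p t = (if t > 0 then poly p (1 / t) * exp (- (1 / t)) else 0)"

lemma poly_exp_tendsto_0: "((\<lambda>s. poly p s * exp (- s)) \<longlongrightarrow> (0::real)) at_top"
proof -
  have "((\<lambda>s. \<Sum>i\<le>degree p. coeff p i * (s ^ i / exp s)) \<longlongrightarrow> (\<Sum>i\<le>degree p. coeff p i * 0)) at_top"
    by (intro tendsto_sum tendsto_mult tendsto_const tendsto_power_div_exp_0)
  then show ?thesis by (simp add: poly_altdef exp_minus divide_inverse sum_distrib_right mult.assoc)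
qed

text \<open>For t > 0 the derivative is t^(-2) (p - p')(1/t) exp(-1/t). At 0 the difference quotient
  is again of this kind: with s = 1/t it is s p(s) exp(-s), which tends to 0 as s grows.\<close>

lemma exp_poly_derivative:
  "(exp_poly p has_real_derivative exp_poly ([:0, 0, 1:] * (p - pderiv p)) t) (at t)"
proof -
  consider "t > 0" | "t < 0" | "t = 0" by linarith
  then show ?thesis
  proof cases
    case 1
    have "((\<lambda>t. poly p (1 / t) * exp (- (1 / t))) has_real_derivative exp_poly ([:0, 0, 1:] * (p - pderiv p)) t) (at t)"
      using 1 by (auto intro!: derivative_eq_intros DERIV_chain'[OF _ poly_DERIV] simp: exp_poly_def field_simps power2_eq_square)
    then show ?thesis
      by (rule has_field_derivative_transform_within_open[of _ _ _ "{0<..}"]) (use 1 in \<open>auto simp: exp_poly_def\<close>)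
  next
    case 2
    have "((\<lambda>t. 0) has_real_derivative exp_poly ([:0, 0, 1:] * (p - pderiv p)) t) (at t)"
      using 2 by (simp add: exp_poly_def)
    then show ?thesis
      by (rule has_field_derivative_transform_within_open[of _ _ _ "{..<0}"]) (use 2 in \<open>auto simp: exp_poly_def\<close>)
  next
    case 3
    have r: "((\<lambda>t. exp_poly p t / t) \<longlongrightarrow> 0) (at_right 0)"
    proof -
      have "((\<lambda>t. poly ([:0, 1:] * p) (inverse t) * exp (- (inverse t))) \<longlongrightarrow> 0) (at_right 0)"
        by (rule filterlim_compose[OF poly_exp_tendsto_0 filterlim_inverse_at_top_right])
      then show ?thesis
        by (rule Lim_transform_eventually)
          (auto simp: exp_poly_def eventually_at_filter inverse_eq_divide)
    qed
    have l: "((\<lambda>t. exp_poly p t / t) \<longlongrightarrow> 0) (at_left 0)"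
      by (rule Lim_transform_eventually[of "\<lambda>_. 0"]) (auto simp: exp_poly_def eventually_at_filter)
    have "((\<lambda>t. exp_poly p t / t) \<longlongrightarrow> 0) (at 0)" using filterlim_split_at[OF l r] .
    then show ?thesis using 3 by (simp add: has_field_derivative_iff exp_poly_def)
  qed
qed

definition bump_poly :: "nat \<Rightarrow> real poly" where
  "bump_poly k = ((\<lambda>p. [:0, 0, 1:] * (p - pderiv p)) ^^ k) 1"

lemma C_k_exp_coordinate: "C_k k (\<lambda>x. exp_poly 1 (c * x $ i + d))"
proof -
  let ?F = "\<lambda>k t. c ^ k * exp_poly (bump_poly k) (c * t + d)"
  have "(?F k has_real_derivative ?F (Suc k) t) (at t)" for k t
  proof -
    have "((\<lambda>t. exp_poly (bump_poly k) (c * t + d)) has_real_derivative exp_poly (bump_poly (Suc k)) (c * t + d) * c) (at t)"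
    proof (rule DERIV_chain'[where g = "exp_poly (bump_poly k)"])
      show "((\<lambda>t. c * t + d) has_real_derivative c) (at t)" by (auto intro!: derivative_eq_intros)
      have "bump_poly (Suc k) = [:0, 0, 1:] * (bump_poly k - pderiv (bump_poly k))" unfolding bump_poly_def by simp
      then show "(exp_poly (bump_poly k) has_real_derivative exp_poly (bump_poly (Suc k)) (c * t + d)) (at (c * t + d))"
        using exp_poly_derivative[of "bump_poly k" "c * t + d"] by simp
    qed
    from DERIV_cmult[OF this, of "c ^ k"] show ?thesis by (simp add: mult_ac)
  qed
  then have "C_k k (\<lambda>x. ?F 0 (x $ i))" by (rule C_k_coordinate)
  then show ?thesis by (simp add: bump_poly_def)
qed

text \<open>The factors exp(-1 / (m (x_i - a_i))) and exp(-1 / (m (b_i - x_i))) tend to 1 inside the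
  box, and outside it one of them is replaced by 0. The kernel formula is given only for test
  functions, and these ones start its extension to L^2.\<close>

lemma bump_approximation:
  fixes a b :: "real ^ 'n::finite"
  shows "\<exists>f. (\<forall>m. f m \<in> Cc_infinity \<and> supp (f m) \<subseteq> cbox a b \<and> (\<forall>x. 0 \<le> f m x \<and> f m x \<le> 1)) \<and>
    (\<forall>x. (\<lambda>m::nat. f m x) \<longlonglongrightarrow> indicat_real (box a b) x)"
proof -
  define u where "u m x i = exp_poly 1 (real m * x $ i + - (real m * a $ i)) * exp_poly 1 (- real m * x $ i + real m * b $ i)"
    for m :: nat and x :: "real ^ 'n" and i
  define f where "f m x = (\<Prod>i\<in>UNIV. u m x i)" for m x
  have e01: "0 \<le> exp_poly 1 t" "exp_poly 1 t \<le> 1" for t by (auto simp: exp_poly_def)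
  have u01: "0 \<le> u m x i" "u m x i \<le> 1" for m x i
    using e01 by (auto simp: u_def intro!: mult_le_one)
  have u0: "x $ i \<le> a $ i \<or> b $ i \<le> x $ i \<Longrightarrow> u m x i = 0" for m x i
    using mult_left_mono[of "x $ i" "a $ i" "real m"] mult_left_mono[of "b $ i" "x $ i" "real m"]
    by (auto simp: u_def exp_poly_def)
  have Ck: "C_k k (f m)" for k m
    unfolding f_def u_def by (intro C_k_prod C_k_mult C_k_exp_coordinate) auto
  have out: "f m x = 0" if "x \<notin> box a b" for m x
  proof -
    obtain i where "x $ i \<le> a $ i \<or> b $ i \<le> x $ i" using \<open>x \<notin> box a b\<close> by (force simp: mem_box_cart not_less)
    then show ?thesis unfolding f_def using u0 by (intro prod_zero) auto
  qed
  have supp: "supp (f m) \<subseteq> cbox a b" for m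
  proof -
    have "{x. f m x \<noteq> 0} \<subseteq> cbox a b" using out box_subset_cbox by blast
    then show ?thesis unfolding supp_def by (rule closure_minimal) auto
  qed
  have "compact (supp (f m))" for m
    using compact_Int_closed[OF compact_cbox[of a b], of "supp (f m)"] supp[of m]
    by (simp add: supp_def inf.absorb2)
  then have "f m \<in> Cc_infinity" for m using Ck by (simp add: Cc_infinity_def)
  moreover have "0 \<le> f m x" "f m x \<le> 1" for m x
    unfolding f_def using u01 by (auto intro!: prod_nonneg prod_le_1)
  moreover have "(\<lambda>m. f m x) \<longlonglongrightarrow> indicat_real (box a b) x" for x
  proof (cases "x \<in> box a b")
    case False
    then show ?thesis using out by simp
  next
    case True
    have e1: "(\<lambda>m. exp_poly 1 (real m * t)) \<longlonglongrightarrow> 1" if t: "t > 0" for t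
    proof -
      have "(\<lambda>m. exp (- (1 / t * inverse (real m)))) \<longlonglongrightarrow> exp (- (1 / t * 0))"
        by (intro tendsto_intros lim_inverse_n)
      then have "(\<lambda>m. exp (- (1 / t * inverse (real m)))) \<longlonglongrightarrow> 1" by simp
      then show ?thesis
      proof (rule Lim_transform_eventually)
        show "\<forall>\<^sub>F m in sequentially. exp (- (1 / t * inverse (real m))) = exp_poly 1 (real m * t)"
          using eventually_gt_at_top[of 0] by eventually_elim (use t in \<open>simp add: exp_poly_def field_simps\<close>)
      qed
    qed
    have "(\<lambda>m. u m x i) \<longlonglongrightarrow> 1" for i
    proof -
      have "a $ i < x $ i" "x $ i < b $ i" using True by (auto simp: mem_box_cart)
      then have "(\<lambda>m. exp_poly 1 (real m * (x $ i - a $ i)) * exp_poly 1 (real m * (b $ i - x $ i))) \<longlonglongrightarrow> 1 * 1"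
        by (intro tendsto_mult e1) auto
      then show ?thesis by (simp add: u_def algebra_simps)
    qed
    then have "(\<lambda>m. f m x) \<longlonglongrightarrow> (\<Prod>i\<in>(UNIV::'n set). 1)" unfolding f_def by (intro tendsto_prod)
    then show ?thesis using True by simp
  qed
  ultimately show ?thesis using supp by blast
qed

section \<open>Bounded operators on $L^2$ with a kernel\<close>

lemma sets_lebesgue_gt:
  fixes f :: "'a::euclidean_space \<Rightarrow> 'b::{second_countable_topology, linorder_topology}"
  assumes "f \<in> borel_measurable lebesgue" shows "{x. t < f x} \<in> sets lebesgue"
proof -
  have "{x \<in> space lebesgue. t < f x} \<in> sets lebesgue" using assms by measurable
  then show ?thesis by simp
qed

lemma L2D: "g \<in> L2 \<Longrightarrow> g \<in> borel_measurable lebesgue" "g \<in> L2 \<Longrightarrow> integrable lebesgue (\<lambda>x. (g x)\<^sup>2)"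
  by (auto simp: L2_def)

lemma L2_bound:
  assumes "h \<in> L2" "g \<in> borel_measurable lebesgue" "\<And>x. \<bar>g x\<bar> \<le> \<bar>h x\<bar>"
  shows "g \<in> L2"
proof -
  have "integrable lebesgue (\<lambda>x. (g x)\<^sup>2)"
  proof (rule Bochner_Integration.integrable_bound[OF L2D(2)[OF assms(1)]])
    show "(\<lambda>x. (g x)\<^sup>2) \<in> borel_measurable lebesgue" using assms(2) by measurable
    show "AE x in lebesgue. norm ((g x)\<^sup>2) \<le> norm ((h x)\<^sup>2)"
      using assms(3) by (intro AE_I2) (simp add: abs_le_square_iff)
  qed
  then show ?thesis using assms(2) by (simp add: L2_def)
qed

lemma L2_lincomb:
  assumes "f \<in> L2" "g \<in> L2" shows "(\<lambda>x. f x + c * g x) \<in> L2"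
proof -
  note [measurable] = L2D(1)[OF assms(1)] L2D(1)[OF assms(2)]
  have "integrable lebesgue (\<lambda>x. (f x + c * g x)\<^sup>2)"
  proof (rule Bochner_Integration.integrable_bound)
    show "integrable lebesgue (\<lambda>x. 2 * (f x)\<^sup>2 + 2 * c\<^sup>2 * (g x)\<^sup>2)"
      using L2D(2)[OF assms(1)] L2D(2)[OF assms(2)] by simp
    have "(f x + c * g x)\<^sup>2 \<le> 2 * (f x)\<^sup>2 + 2 * c\<^sup>2 * (g x)\<^sup>2" for x
    proof -
      have "2 * (f x)\<^sup>2 + 2 * c\<^sup>2 * (g x)\<^sup>2 - (f x + c * g x)\<^sup>2 = (f x - c * g x)\<^sup>2"
        by (simp add: power2_eq_square algebra_simps)
      then show ?thesis using zero_le_power2[of "f x - c * g x"] by linarith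
    qed
    then show "AE x in lebesgue. norm ((f x + c * g x)\<^sup>2) \<le> norm (2 * (f x)\<^sup>2 + 2 * c\<^sup>2 * (g x)\<^sup>2)"
      by (intro AE_I2) simp
  qed measurable
  then show ?thesis by (simp add: L2_def)
qed

lemma L2_diff: "f \<in> L2 \<Longrightarrow> g \<in> L2 \<Longrightarrow> (\<lambda>x. f x - g x) \<in> L2"
  using L2_lincomb[of f g "-1"] by simp

lemma L2_finite_support_L1:
  assumes "g \<in> L2" "S \<in> sets lebesgue" "emeasure lebesgue S < top" "\<And>y. y \<notin> S \<Longrightarrow> g y = 0"
  shows "integrable lebesgue g"
proof (rule Bochner_Integration.integrable_bound)
  show "integrable lebesgue (\<lambda>x. indicat_real S x + (g x)\<^sup>2)"
    using assms L2D by (intro Bochner_Integration.integrable_add) auto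
  have "\<bar>g x\<bar> \<le> 1 + (g x)\<^sup>2" for x
  proof -
    have "0 \<le> (\<bar>g x\<bar> - 1)\<^sup>2" by (rule zero_le_power2)
    moreover have "(\<bar>g x\<bar> - 1)\<^sup>2 = (g x)\<^sup>2 - 2 * \<bar>g x\<bar> + 1"
      by (simp add: power2_eq_square algebra_simps)
    ultimately have "2 * \<bar>g x\<bar> \<le> 1 + (g x)\<^sup>2" by linarith
    then show ?thesis by linarith
  qed
  then show "AE x in lebesgue. norm (g x) \<le> norm (indicat_real S x + (g x)\<^sup>2)"
    using assms(4) by (intro AE_I2) (auto split: split_indicator)
qed (use assms L2D in auto)

definition meas_tendsto :: "(nat \<Rightarrow> real ^ 'n::finite \<Rightarrow> real) \<Rightarrow> (real ^ 'n \<Rightarrow> real) \<Rightarrow> bool" where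
  "meas_tendsto F u \<longleftrightarrow> (\<forall>\<epsilon>>0. (\<lambda>k. emeasure lebesgue {x. \<bar>F k x - u x\<bar> > \<epsilon>}) \<longlonglongrightarrow> 0)"

text \<open>Where \<open>u\<close> and the pointwise limit \<open>v\<close> differ by more than 2
  \<epsilon>, all late \<open>F k\<close> stay \<epsilon> away from \<open>u\<close>. Such points
  lie in sets whose measure tends to 0, so no subsequence has to be extracted.\<close>

lemma meas_tendsto_pointwise:
  assumes [measurable]: "\<And>k. F k \<in> borel_measurable lebesgue" "u \<in> borel_measurable lebesgue"
    and F: "meas_tendsto F u"
    and ptw: "AE x in lebesgue. x \<in> V \<longrightarrow> (\<lambda>k. F k x) \<longlonglongrightarrow> v x"
  shows "AE x in lebesgue. x \<in> V \<longrightarrow> u x = v x"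
proof -
  define W where "W \<epsilon> m = {x. \<forall>k\<ge>m. \<bar>F k x - u x\<bar> > \<epsilon>}" for \<epsilon> :: real and m :: nat
  have null: "emeasure lebesgue (W \<epsilon> m) = 0" if "\<epsilon> > 0" for \<epsilon> m
  proof -
    have l: "(\<lambda>k. emeasure lebesgue {x. \<bar>F k x - u x\<bar> > \<epsilon>}) \<longlonglongrightarrow> 0"
      using F that by (simp add: meas_tendsto_def)
    have "emeasure lebesgue (W \<epsilon> m) \<le> emeasure lebesgue {x. \<bar>F k x - u x\<bar> > \<epsilon>}" if "k \<ge> m" for k
    proof (rule emeasure_mono)
      show "W \<epsilon> m \<subseteq> {x. \<bar>F k x - u x\<bar> > \<epsilon>}" using that by (auto simp: W_def)
      show "{x. \<bar>F k x - u x\<bar> > \<epsilon>} \<in> sets lebesgue" by (intro sets_lebesgue_gt) measurable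
    qed
    then have "emeasure lebesgue (W \<epsilon> m) \<le> 0"
      by (intro LIMSEQ_le_const[OF l]) blast
    then show ?thesis by simp
  qed
  have "AE x in lebesgue. \<forall>m j. x \<notin> W (1 / real (Suc j)) m"
    unfolding AE_all_countable
  proof (intro allI)
    fix m j
    have "W (1 / real (Suc j)) m = (\<Inter>k\<in>{m..}. {x. \<bar>F k x - u x\<bar> > 1 / real (Suc j)})"
      unfolding W_def by blast
    also have "\<dots> \<in> sets lebesgue"
      by (rule sets.countable_INT') (auto intro!: sets_lebesgue_gt)
    finally have "W (1 / real (Suc j)) m \<in> sets lebesgue" .
    then have "W (1 / real (Suc j)) m \<in> null_sets lebesgue" using null[of "1 / real (Suc j)" m] by auto
    then show "AE x in lebesgue. x \<notin> W (1 / real (Suc j)) m" by (rule AE_not_in)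
  qed
  then show ?thesis using ptw
  proof eventually_elim
    case (elim x)
    show ?case
    proof
      assume "x \<in> V"
      then have lim: "(\<lambda>k. F k x) \<longlonglongrightarrow> v x" using elim by simp
      show "u x = v x"
      proof (rule ccontr)
        assume "u x \<noteq> v x"
        then obtain j where j: "1 / real (Suc j) < \<bar>v x - u x\<bar> / 2"
          using reals_Archimedean[of "\<bar>v x - u x\<bar> / 2"] by (auto simp: inverse_eq_divide)
        obtain m where m: "\<And>k. k \<ge> m \<Longrightarrow> \<bar>F k x - v x\<bar> < \<bar>v x - u x\<bar> / 2"
          using LIMSEQ_D[OF lim, of "\<bar>v x - u x\<bar> / 2"] \<open>u x \<noteq> v x\<close> by auto
        have "x \<in> W (1 / real (Suc j)) m"
          unfolding W_def
        proof (clarsimp)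
          fix k assume "m \<le> k"
          from m[OF this] j show "1 / (1 + real j) < \<bar>F k x - u x\<bar>" by (simp only: of_nat_Suc) argo
        qed
        then show False using elim by blast
      qed
    qed
  qed
qed

lemma meas_tendsto_unique:
  assumes [measurable]: "\<And>k. F k \<in> borel_measurable lebesgue" "u \<in> borel_measurable lebesgue" "v \<in> borel_measurable lebesgue"
    and F: "meas_tendsto F u" "meas_tendsto F v"
  shows "AE x in lebesgue. u x = v x"
proof -
  have "AE x in lebesgue. \<bar>u x - v x\<bar> \<le> 1 / real (Suc j)" for j
  proof -
    define r where "r = 1 / real (Suc j)"
    define e where "e = r / 2"
    have "r > 0" by (simp add: r_def)
    then have e: "e > 0" by (simp add: e_def)
    have "r = 2 * e" by (simp add: e_def)
    then have e2: "1 / real (Suc j) = 2 * e" unfolding r_def .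
    have m: "{x. \<bar>u x - v x\<bar> > 1 / real (Suc j)} \<in> sets lebesgue" by (intro sets_lebesgue_gt) measurable
    have "(\<lambda>k. emeasure lebesgue {x. \<bar>F k x - u x\<bar> > e} + emeasure lebesgue {x. \<bar>F k x - v x\<bar> > e}) \<longlonglongrightarrow> 0 + 0"
      using F e unfolding meas_tendsto_def by (intro tendsto_add) blast+
    moreover have "emeasure lebesgue {x. \<bar>u x - v x\<bar> > 1 / real (Suc j)}
      \<le> emeasure lebesgue {x. \<bar>F k x - u x\<bar> > e} + emeasure lebesgue {x. \<bar>F k x - v x\<bar> > e}" for k
    proof -
      have "emeasure lebesgue {x. \<bar>u x - v x\<bar> > 1 / real (Suc j)} \<le> emeasure lebesgue ({x. \<bar>F k x - u x\<bar> > e} \<union> {x. \<bar>F k x - v x\<bar> > e})"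
      proof (rule emeasure_mono)
        show "{x. \<bar>u x - v x\<bar> > 1 / real (Suc j)} \<subseteq> {x. \<bar>F k x - u x\<bar> > e} \<union> {x. \<bar>F k x - v x\<bar> > e}"
          unfolding e2 by (rule subsetI, unfold mem_Collect_eq Un_iff) argo
        show "{x. \<bar>F k x - u x\<bar> > e} \<union> {x. \<bar>F k x - v x\<bar> > e} \<in> sets lebesgue"
          by (rule sets.Un; intro sets_lebesgue_gt; measurable)
      qed
      also have "\<dots> \<le> emeasure lebesgue {x. \<bar>F k x - u x\<bar> > e} + emeasure lebesgue {x. \<bar>F k x - v x\<bar> > e}"
        by (rule emeasure_subadditive; intro sets_lebesgue_gt) measurable
      finally show ?thesis .
    qed
    ultimately have "emeasure lebesgue {x. \<bar>u x - v x\<bar> > 1 / real (Suc j)} \<le> 0 + 0"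
      by (intro LIMSEQ_le_const) auto
    then have "{x. \<bar>u x - v x\<bar> > 1 / real (Suc j)} \<in> null_sets lebesgue" using m by auto
    from AE_not_in[OF this] show ?thesis by eventually_elim auto
  qed
  then have "AE x in lebesgue. \<forall>j. \<bar>u x - v x\<bar> \<le> 1 / real (Suc j)" unfolding AE_all_countable by blast
  then show ?thesis
  proof eventually_elim
    case (elim x)
    show ?case
    proof (rule ccontr)
      assume "u x \<noteq> v x"
      then obtain j where "inverse (real (Suc j)) < \<bar>u x - v x\<bar>" using reals_Archimedean[of "\<bar>u x - v x\<bar>"] by auto
      then show False using elim[rule_format, of j] by (simp add: inverse_eq_divide)
    qed
  qed
qed

lemma chebyshev_L2:
  assumes "g \<in> L2" "0 < t"
  shows "emeasure lebesgue {x. \<bar>g x\<bar> > t} \<le> ennreal ((LINT x|lebesgue. (g x)\<^sup>2) / t\<^sup>2)"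
proof -
  note [measurable] = L2D(1)[OF assms(1)]
  have "emeasure lebesgue {x. \<bar>g x\<bar> > t} \<le> emeasure lebesgue {x \<in> space lebesgue. 1 \<le> ennreal (1 / t\<^sup>2) * ennreal ((g x)\<^sup>2)}"
  proof (rule emeasure_mono)
    show "{x. \<bar>g x\<bar> > t} \<subseteq> {x \<in> space lebesgue. 1 \<le> ennreal (1 / t\<^sup>2) * ennreal ((g x)\<^sup>2)}"
    proof clarsimp
      fix x assume "t < \<bar>g x\<bar>"
      then have "t\<^sup>2 \<le> (g x)\<^sup>2" using assms by (simp add: abs_le_square_iff[symmetric])
      then have "1 \<le> 1 / t\<^sup>2 * (g x)\<^sup>2" using assms by (simp add: field_simps)
      then have "ennreal 1 \<le> ennreal (1 / t\<^sup>2 * (g x)\<^sup>2)" by (rule ennreal_leI)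
      then show "1 \<le> ennreal (1 / t\<^sup>2) * ennreal ((g x)\<^sup>2)" by (subst ennreal_mult'[symmetric]) auto
    qed
  qed measurable
  also have "\<dots> \<le> ennreal (1 / t\<^sup>2) * (\<integral>\<^sup>+x. ennreal ((g x)\<^sup>2) * indicator (space lebesgue) x \<partial>lebesgue)"
    by (rule nn_integral_Markov_inequality) measurable
  also have "\<dots> = ennreal (1 / t\<^sup>2) * ennreal (LINT x|lebesgue. (g x)\<^sup>2)"
    using nn_integral_eq_integral[OF L2D(2)[OF assms(1)]] by simp
  also have "\<dots> = ennreal ((LINT x|lebesgue. (g x)\<^sup>2) / t\<^sup>2)"
    by (subst ennreal_mult'[symmetric]) auto
  finally show ?thesis .
qed

locale L2_operator =
  fixes T :: "(real ^ 'n::finite \<Rightarrow> real) \<Rightarrow> real ^ 'n \<Rightarrow> real" and N :: real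
  assumes T_L2: "g \<in> L2 \<Longrightarrow> T g \<in> L2"
    and T_add: "f \<in> L2 \<Longrightarrow> g \<in> L2 \<Longrightarrow> AE x in lebesgue. T (\<lambda>y. f y + g y) x = T f x + T g x"
    and T_scale: "f \<in> L2 \<Longrightarrow> AE x in lebesgue. T (\<lambda>y. c * f y) x = c * T f x"
    and T_bound: "g \<in> L2 \<Longrightarrow> (LINT x|lebesgue. (T g x)\<^sup>2) \<le> N\<^sup>2 * (LINT x|lebesgue. (g x)\<^sup>2)"
begin

lemma T_lincomb:
  assumes "f \<in> L2" "g \<in> L2"
  shows "AE x in lebesgue. T (\<lambda>y. f y + c * g y) x = T f x + c * T g x"
proof -
  have "(\<lambda>y. c * g y) \<in> L2" using L2_lincomb[of "\<lambda>_. 0" g c] assms by (simp add: L2_def)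
  from T_add[OF assms(1) this] T_scale[OF assms(2), of c] show ?thesis by eventually_elim simp
qed

lemma T_diff: "f \<in> L2 \<Longrightarrow> g \<in> L2 \<Longrightarrow> AE x in lebesgue. T (\<lambda>y. f y - g y) x = T f x - T g x"
  using T_lincomb[of f g "-1"] by simp

lemma T_zero:
  assumes "g \<in> L2" "AE x in lebesgue. g x = 0" shows "AE x in lebesgue. T g x = 0"
proof -
  have "(LINT x|lebesgue. (g x)\<^sup>2) = (LINT x|(lebesgue :: (real ^ 'n) measure). 0)"
    using assms L2D(2)[OF assms(1)] by (intro integral_cong_AE) auto
  then have "(LINT x|lebesgue. (T g x)\<^sup>2) \<le> 0" using T_bound[OF assms(1)] by simp
  moreover have "0 \<le> (LINT x|lebesgue. (T g x)\<^sup>2)" by simp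
  ultimately have "(LINT x|lebesgue. (T g x)\<^sup>2) = 0" by linarith
  then have "AE x in lebesgue. (T g x)\<^sup>2 = 0"
    using integral_nonneg_eq_0_iff_AE[OF L2D(2)[OF T_L2[OF assms(1)]]] by simp
  then show ?thesis by simp
qed

lemma T_cong:
  assumes "f \<in> L2" "g \<in> L2" "AE x in lebesgue. f x = g x"
  shows "AE x in lebesgue. T f x = T g x"
proof -
  have "AE x in lebesgue. T (\<lambda>y. f y - g y) x = 0"
    by (rule T_zero[OF L2_diff[OF assms(1,2)]]) (use assms(3) in auto)
  with T_diff[OF assms(1,2)] show ?thesis by eventually_elim simp
qed

lemma T_weak_L2:
  assumes "g \<in> L2" "0 < t"
  shows "emeasure lebesgue {x. \<bar>T g x\<bar> > t} \<le> ennreal (N\<^sup>2 * (LINT x|lebesgue. (g x)\<^sup>2) / t\<^sup>2)"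
  by (rule order_trans[OF chebyshev_L2[OF T_L2[OF assms(1)] assms(2)]])
    (intro ennreal_leI divide_right_mono T_bound assms zero_le_power2)

lemma T_meas_tendsto:
  assumes g: "\<And>k. g k \<in> L2" "h \<in> L2" and l: "(\<lambda>k. LINT x|lebesgue. (g k x - h x)\<^sup>2) \<longlonglongrightarrow> 0"
  shows "meas_tendsto (\<lambda>k. T (g k)) (T h)"
  unfolding meas_tendsto_def
proof (intro allI impI)
  fix \<epsilon> :: real assume \<epsilon>: "\<epsilon> > 0"
  have m[measurable]: "T (g k) \<in> borel_measurable lebesgue" "T h \<in> borel_measurable lebesgue"
      "T (\<lambda>y. g k y - h y) \<in> borel_measurable lebesgue" for k
    using T_L2[OF g(1)[of k]] T_L2[OF g(2)] T_L2[OF L2_diff[OF g(1)[of k] g(2)]] L2D by auto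
  have e: "emeasure lebesgue {x. \<bar>T (g k) x - T h x\<bar> > \<epsilon>} \<le> ennreal (N\<^sup>2 * (LINT x|lebesgue. (g k x - h x)\<^sup>2) / \<epsilon>\<^sup>2)" for k
  proof -
    have "emeasure lebesgue {x. \<bar>T (g k) x - T h x\<bar> > \<epsilon>} = emeasure lebesgue {x. \<bar>T (\<lambda>y. g k y - h y) x\<bar> > \<epsilon>}"
    proof (rule emeasure_eq_AE)
      show "AE x in lebesgue. x \<in> {x. \<bar>T (g k) x - T h x\<bar> > \<epsilon>} \<longleftrightarrow> x \<in> {x. \<bar>T (\<lambda>y. g k y - h y) x\<bar> > \<epsilon>}"
        using T_diff[OF g(1)[of k] g(2)] by eventually_elim simp
    qed (intro sets_lebesgue_gt; measurable)+
    also have "\<dots> \<le> ennreal (N\<^sup>2 * (LINT x|lebesgue. (g k x - h x)\<^sup>2) / \<epsilon>\<^sup>2)"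
      using T_weak_L2[OF L2_diff[OF g(1)[of k] g(2)] \<epsilon>] by simp
    finally show ?thesis .
  qed
  have "(\<lambda>k. ennreal (N\<^sup>2 * (LINT x|lebesgue. (g k x - h x)\<^sup>2) / \<epsilon>\<^sup>2)) \<longlonglongrightarrow> ennreal (N\<^sup>2 * 0 / \<epsilon>\<^sup>2)"
    using \<epsilon> by (intro tendsto_ennrealI tendsto_intros l) auto
  then have u: "(\<lambda>k. ennreal (N\<^sup>2 * (LINT x|lebesgue. (g k x - h x)\<^sup>2) / \<epsilon>\<^sup>2)) \<longlonglongrightarrow> 0" by simp
  show "(\<lambda>k. emeasure lebesgue {x. \<bar>T (g k) x - T h x\<bar> > \<epsilon>}) \<longlonglongrightarrow> 0"
    by (rule tendsto_sandwich[OF _ _ tendsto_const u]) (use e in auto)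
qed

end

locale kernel_operator = L2_operator T N for T :: "(real ^ 'n::finite \<Rightarrow> real) \<Rightarrow> real ^ 'n \<Rightarrow> real" and N +
  fixes k :: "real ^ 'n \<Rightarrow> real ^ 'n \<Rightarrow> real" and ck :: real
  assumes k_measurable [measurable]: "(\<lambda>(x, y). k x y) \<in> borel_measurable (borel \<Otimes>\<^sub>M borel)"
    and k_size: "x \<noteq> y \<Longrightarrow> \<bar>k x y\<bar> \<le> ck / norm (x - y) ^ CARD('n)"
    and k_smooth: "\<phi> \<in> Cc_infinity \<Longrightarrow> AE x in lebesgue. x \<notin> supp \<phi> \<longrightarrow> T \<phi> x = (LINT y|lebesgue. k x y * \<phi> y)"
begin

lemma k_measurable1 [measurable]: "k x \<in> borel_measurable lebesgue"
proof -
  have "k x \<in> borel_measurable borel" using measurable_Pair2[OF k_measurable, of x] by simp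
  then show ?thesis by (simp add: measurable_completion)
qed

lemma k_measurable2 [measurable]: "(\<lambda>x. k x y) \<in> borel_measurable lebesgue"
proof -
  have "(\<lambda>x. k x y) \<in> borel_measurable borel" using measurable_Pair1[OF k_measurable, of y] by simp
  then show ?thesis by (simp add: measurable_completion)
qed

lemma k_bounded_off_box:
  assumes "x \<notin> cbox a b" shows "\<exists>M\<ge>0. \<forall>y\<in>cbox a b. \<bar>k x y\<bar> \<le> M"
proof (cases "cbox a b = {}")
  case False
  define \<delta> where "\<delta> = setdist {x} (cbox a b)"
  have \<delta>: "\<delta> > 0"
    unfolding \<delta>_def using assms False setdist_gt_0_compact_closed[of "{x}" "cbox a b"] by auto
  have "\<bar>k x y\<bar> \<le> \<bar>ck\<bar> / \<delta> ^ CARD('n)" if y: "y \<in> cbox a b" for y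
  proof -
    have d: "\<delta> \<le> norm (x - y)" using setdist_le_dist[of x "{x}" y "cbox a b"] y by (simp add: \<delta>_def dist_norm)
    have "x \<noteq> y" using y assms by auto
    then have "\<bar>k x y\<bar> \<le> ck / norm (x - y) ^ CARD('n)" by (rule k_size)
    also have "\<dots> \<le> \<bar>ck\<bar> / norm (x - y) ^ CARD('n)" by (intro divide_right_mono) auto
    also have "\<dots> \<le> \<bar>ck\<bar> / \<delta> ^ CARD('n)"
      using d \<delta> by (intro divide_left_mono power_mono mult_pos_pos zero_less_power) auto
    finally show ?thesis .
  qed
  then show ?thesis using \<delta> by (intro exI[of _ "\<bar>ck\<bar> / \<delta> ^ CARD('n)"]) auto
qed auto

lemma k_integrable:
  assumes "integrable lebesgue g" "\<And>y. y \<notin> cbox a b \<Longrightarrow> g y = 0" "x \<notin> cbox a b"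
  shows "integrable lebesgue (\<lambda>y. k x y * g y)"
proof -
  obtain M where M: "M \<ge> 0" "\<And>y. y \<in> cbox a b \<Longrightarrow> \<bar>k x y\<bar> \<le> M" using k_bounded_off_box[OF assms(3)] by blast
  show ?thesis
  proof (rule Bochner_Integration.integrable_bound)
    show "integrable lebesgue (\<lambda>y. M * g y)" using assms by simp
    show "AE y in lebesgue. norm (k x y * g y) \<le> norm (M * g y)"
    proof (intro AE_I2)
      fix y show "norm (k x y * g y) \<le> norm (M * g y)"
        using M assms(2)[of y] by (cases "y \<in> cbox a b") (auto simp: abs_mult intro!: mult_right_mono)
    qed
    show "(\<lambda>y. k x y * g y) \<in> borel_measurable lebesgue"
      using borel_measurable_integrable[OF assms(1)] by measurable
  qed
qed

text \<open>The box is fixed so that, at each point off it, the kernel is bounded on the supports of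
  all functions concerned; the class is then linear and closed under dominated limits.\<close>

definition represented :: "real ^ 'n \<Rightarrow> real ^ 'n \<Rightarrow> (real ^ 'n \<Rightarrow> real) \<Rightarrow> bool" where
  "represented a b g \<longleftrightarrow> g \<in> L2 \<and> (\<forall>y. y \<notin> cbox a b \<longrightarrow> g y = 0) \<and>
     (AE x in lebesgue. x \<notin> cbox a b \<longrightarrow> T g x = (LINT y|lebesgue. k x y * g y))"

lemma box_support_L1: "g \<in> L2 \<Longrightarrow> (\<And>y. y \<notin> cbox a b \<Longrightarrow> g y = 0) \<Longrightarrow> integrable lebesgue g"
  by (rule L2_finite_support_L1[of g "cbox a b"])
    (use emeasure_lborel_cbox_finite[of a b] in \<open>simp_all add: emeasure_completion\<close>)

lemma represented_lincomb:
  assumes "represented a b f" "represented a b g"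
  shows "represented a b (\<lambda>y. f y + c * g y)"
proof -
  have L: "f \<in> L2" "g \<in> L2" and s: "\<And>y. y \<notin> cbox a b \<Longrightarrow> f y = 0" "\<And>y. y \<notin> cbox a b \<Longrightarrow> g y = 0"
    using assms by (auto simp: represented_def)
  have "AE x in lebesgue. x \<notin> cbox a b \<longrightarrow> T f x = (LINT y|lebesgue. k x y * f y)"
    "AE x in lebesgue. x \<notin> cbox a b \<longrightarrow> T g x = (LINT y|lebesgue. k x y * g y)"
    using assms by (auto simp: represented_def)
  then have "AE x in lebesgue. x \<notin> cbox a b \<longrightarrow> T (\<lambda>y. f y + c * g y) x = (LINT y|lebesgue. k x y * (f y + c * g y))"
    using T_lincomb[OF L, of c]
  proof eventually_elim
    case (elim x)
    show ?case
    proof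
      assume x: "x \<notin> cbox a b"
      have i: "integrable lebesgue (\<lambda>y. k x y * f y)" "integrable lebesgue (\<lambda>y. k x y * g y)"
        using k_integrable[OF box_support_L1[OF L(1) s(1)] s(1) x] k_integrable[OF box_support_L1[OF L(2) s(2)] s(2) x] by auto
      have "(LINT y|lebesgue. k x y * (f y + c * g y)) = (LINT y|lebesgue. k x y * f y + c * (k x y * g y))"
        by (simp add: algebra_simps)
      also have "\<dots> = (LINT y|lebesgue. k x y * f y) + c * (LINT y|lebesgue. k x y * g y)" using i by simp
      finally show "T (\<lambda>y. f y + c * g y) x = (LINT y|lebesgue. k x y * (f y + c * g y))" using elim x by simp
    qed
  qed
  then show ?thesis using L2_lincomb[OF L, of c] s by (simp add: represented_def)
qed

text \<open>Dominated convergence acts twice: in L^2, which gives convergence of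
  \<open>T (g j)\<close> in measure, and in the kernel integrals at points off the box. The two
  limits agree almost everywhere.\<close>

lemma represented_limit:
  assumes g: "\<And>j. represented a b (g j)" and h: "h \<in> L2" "\<And>y. y \<notin> cbox a b \<Longrightarrow> h y = 0"
    and le: "\<And>j y. \<bar>g j y\<bar> \<le> h y" and l: "\<And>y. (\<lambda>j. g j y) \<longlonglongrightarrow> u y"
  shows "represented a b u"
proof -
  have gL: "g j \<in> L2" for j using g by (simp add: represented_def)
  note [measurable] = L2D(1)[OF gL] L2D(1)[OF h(1)]
  have u_le: "\<bar>u y\<bar> \<le> h y" for y
    by (rule LIMSEQ_le_const2[OF tendsto_rabs[OF l]]) (use le in auto)
  have um [measurable]: "u \<in> borel_measurable lebesgue"
    by (rule borel_measurable_LIMSEQ_real[OF l]) measurable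
  have h0: "0 \<le> h y" for y using u_le[of y] by linarith
  have uL: "u \<in> L2" by (rule L2_bound[OF h(1) um]) (use u_le h0 in auto)
  have us: "u y = 0" if "y \<notin> cbox a b" for y using u_le[of y] h(2)[OF that] by simp
  have "(\<lambda>j. LINT x|lebesgue. (g j x - u x)\<^sup>2) \<longlonglongrightarrow> (LINT x|(lebesgue :: (real ^ 'n) measure). (0::real))"
  proof (rule integral_dominated_convergence[where w = "\<lambda>x. 4 * (h x)\<^sup>2"])
    show "integrable lebesgue (\<lambda>x. 4 * (h x)\<^sup>2)" using L2D(2)[OF h(1)] by simp
    show "AE x in lebesgue. (\<lambda>j. (g j x - u x)\<^sup>2) \<longlonglongrightarrow> 0"
    proof (intro AE_I2)
      fix x
      have "(\<lambda>j. (g j x - u x)\<^sup>2) \<longlonglongrightarrow> (u x - u x)\<^sup>2" by (intro tendsto_intros l)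
      then show "(\<lambda>j. (g j x - u x)\<^sup>2) \<longlonglongrightarrow> 0" by simp
    qed
    show "AE x in lebesgue. norm ((g j x - u x)\<^sup>2) \<le> 4 * (h x)\<^sup>2" for j
    proof (intro AE_I2)
      fix x
      have "\<bar>g j x - u x\<bar> \<le> \<bar>2 * h x\<bar>" using le[of j x] u_le[of x] by linarith
      then have "(g j x - u x)\<^sup>2 \<le> (2 * h x)\<^sup>2" by (simp add: abs_le_square_iff)
      then show "norm ((g j x - u x)\<^sup>2) \<le> 4 * (h x)\<^sup>2" by (simp add: power_mult_distrib)
    qed
  qed measurable
  then have "(\<lambda>j. LINT x|lebesgue. (g j x - u x)\<^sup>2) \<longlonglongrightarrow> 0" by simp
  then have mt: "meas_tendsto (\<lambda>j. T (g j)) (T u)" by (intro T_meas_tendsto gL uL)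
  have "AE x in lebesgue. \<forall>j. x \<notin> cbox a b \<longrightarrow> T (g j) x = (LINT y|lebesgue. k x y * g j y)"
    unfolding AE_all_countable using g by (auto simp: represented_def)
  then have "AE x in lebesgue. x \<in> - cbox a b \<longrightarrow> (\<lambda>j. T (g j) x) \<longlonglongrightarrow> (LINT y|lebesgue. k x y * u y)"
  proof eventually_elim
    case (elim x)
    show ?case
    proof
      assume "x \<in> - cbox a b"
      then have x: "x \<notin> cbox a b" by simp
      have "(\<lambda>j. LINT y|lebesgue. k x y * g j y) \<longlonglongrightarrow> (LINT y|lebesgue. k x y * u y)"
      proof (rule integral_dominated_convergence[where w = "\<lambda>y. \<bar>k x y * h y\<bar>"])
        show "integrable lebesgue (\<lambda>y. \<bar>k x y * h y\<bar>)"
          using k_integrable[OF box_support_L1[OF h] h(2) x] by simp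
        show "AE y in lebesgue. (\<lambda>j. k x y * g j y) \<longlonglongrightarrow> k x y * u y" by (intro AE_I2 tendsto_intros l)
        show "AE y in lebesgue. norm (k x y * g j y) \<le> \<bar>k x y * h y\<bar>" for j
          using le h0 by (intro AE_I2) (auto simp: abs_mult intro!: mult_left_mono)
      qed measurable
      then show "(\<lambda>j. T (g j) x) \<longlonglongrightarrow> (LINT y|lebesgue. k x y * u y)" using elim x by simp
    qed
  qed
  from meas_tendsto_pointwise[OF _ _ mt this]
  have "AE x in lebesgue. x \<in> - cbox a b \<longrightarrow> T u x = (LINT y|lebesgue. k x y * u y)"
    using L2D(1)[OF T_L2[OF gL]] L2D(1)[OF T_L2[OF uL]] by blast
  then show ?thesis using uL us by (simp add: represented_def)
qed

lemma represented_cong: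
  assumes "represented a b f" "g \<in> L2" "\<And>y. y \<notin> cbox a b \<Longrightarrow> g y = 0" "AE y in lebesgue. f y = g y"
  shows "represented a b g"
proof -
  have fL: "f \<in> L2" using assms(1) by (simp add: represented_def)
  note [measurable] = L2D(1)[OF fL] L2D(1)[OF assms(2)]
  have "(LINT y|lebesgue. k x y * f y) = (LINT y|lebesgue. k x y * g y)" for x
    using assms(4) by (intro integral_cong_AE) auto
  moreover have "AE x in lebesgue. x \<notin> cbox a b \<longrightarrow> T f x = (LINT y|lebesgue. k x y * f y)"
    using assms(1) by (simp add: represented_def)
  ultimately have "AE x in lebesgue. x \<notin> cbox a b \<longrightarrow> T f x = (LINT y|lebesgue. k x y * g y)" by simp
  with T_cong[OF fL assms(2,4)] have "AE x in lebesgue. x \<notin> cbox a b \<longrightarrow> T g x = (LINT y|lebesgue. k x y * g y)"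
    by eventually_elim simp
  then show ?thesis unfolding represented_def using assms(2,3) by blast
qed

lemma indicator_L2: "M \<in> sets lebesgue \<Longrightarrow> M \<subseteq> cbox a b \<Longrightarrow> indicat_real M \<in> L2"
proof -
  assume M: "M \<in> sets lebesgue" "M \<subseteq> cbox a b"
  have "emeasure lebesgue M \<le> emeasure lebesgue (cbox a b)" by (rule emeasure_mono[OF M(2)]) auto
  also have "\<dots> < top" using emeasure_lborel_cbox_finite[of a b] by (simp add: emeasure_completion)
  finally have "integrable lebesgue (indicat_real M)" using M by simp
  moreover have "(\<lambda>x. (indicat_real M x)\<^sup>2) = indicat_real M" by (auto simp: indicator_def)
  ultimately show "indicat_real M \<in> L2" using M by (simp add: L2_def)
qed

lemma represented_box:
  assumes "box c d \<subseteq> cbox a b" shows "represented a b (indicat_real (box c d))"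
proof -
  obtain f :: "nat \<Rightarrow> real ^ 'n \<Rightarrow> real" where f: "\<And>m. f m \<in> Cc_infinity" "\<And>m. supp (f m) \<subseteq> cbox c d" "\<And>m x. 0 \<le> f m x \<and> f m x \<le> 1"
      "\<And>x. (\<lambda>m. f m x) \<longlonglongrightarrow> indicat_real (box c d) x"
    using bump_approximation[of c d] by metis
  show ?thesis
  \<comment> \<open>An empty open box says nothing about where its closed version lies, so it is
    treated separately.\<close>
  proof (cases "box c d = {}")
    case True
    have "(\<lambda>_. 0) \<in> (L2 :: (real^'n \<Rightarrow> real) set)" by (simp add: L2_def)
    then have "AE x in lebesgue. T (\<lambda>_. 0) x = 0" by (rule T_zero) simp
    moreover have "indicat_real (box c d) = (\<lambda>_. 0)" using True by (auto simp: indicator_def)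
    ultimately show ?thesis using \<open>(\<lambda>_. 0) \<in> L2\<close> by (auto simp: represented_def elim: eventually_mono)
  next
    case False
    have cd: "cbox c d \<subseteq> cbox a b"
      using assms False closure_box[of c d] closure_minimal[of "box c d" "cbox a b"] by auto
    have out: "f m y = 0" if "y \<notin> cbox a b" for m y
      using that f(2)[of m] cd closure_subset[of "{x. f m x \<noteq> 0}"] unfolding supp_def by blast
    have meas: "f m \<in> borel_measurable lebesgue" for m
    proof -
      have "C_k 0 (f m)" using f(1) unfolding Cc_infinity_def by blast
      then have "f m \<in> borel_measurable borel" by (simp add: borel_measurable_continuous_onI)
      then show ?thesis by (simp add: measurable_completion)
    qed
    have iL: "indicat_real (cbox a b) \<in> L2" by (rule indicator_L2) auto
    have le: "\<bar>f m y\<bar> \<le> indicat_real (cbox a b) y" for m y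
      using f(3)[of m y] out[of y m] by (auto split: split_indicator)
    have "represented a b (f m)" for m
    proof -
      have "f m \<in> L2" by (rule L2_bound[OF iL meas]) (use le in \<open>auto intro: order_trans\<close>)
      moreover have "AE x in lebesgue. x \<notin> cbox a b \<longrightarrow> T (f m) x = (LINT y|lebesgue. k x y * f m y)"
        using k_smooth[OF f(1)[of m]] by eventually_elim (use f(2)[of m] cd in blast)
      ultimately show ?thesis using out by (simp add: represented_def)
    qed
    then show ?thesis by (rule represented_limit[OF _ iL _ le f(4)]) auto
  qed
qed

text \<open>Open boxes are stable under intersection, so Dynkin's argument applies; complements and
  disjoint unions are taken inside the fixed box.\<close>

lemma represented_borel:
  assumes "M \<in> sets borel" shows "represented a b (indicat_real (M \<inter> box a b))"
proof -
  let ?G = "range (\<lambda>(a, b). box a b :: (real ^ 'n) set)"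
  have st: "Int_stable ?G"
    unfolding Int_stable_def
  proof (clarsimp)
    fix a b c d :: "real ^ 'n"
    have "box a b \<inter> box c d = box (\<Sum>i\<in>Basis. max (a \<bullet> i) (c \<bullet> i) *\<^sub>R i) (\<Sum>i\<in>Basis. min (b \<bullet> i) (d \<bullet> i) *\<^sub>R i)" by (rule box_Int_box)
    then show "box a b \<inter> box c d \<in> ?G" by auto
  qed
  have bx: "represented a b (indicat_real (box a b))" by (rule represented_box) (rule box_subset_cbox)
  have "M \<in> sigma_sets UNIV ?G" using assms unfolding borel_eq_box by simp
  then show ?thesis
  proof (induction rule: sigma_sets_induct_disjoint[OF st subset_UNIV[of ?G, folded Pow_UNIV], consumes 1, case_names basic empty compl union])
    case (basic A)
    then obtain c d where "A \<inter> box a b = box c d" using st unfolding Int_stable_def by (metis (no_types, lifting) case_prod_conv image_iff rangeI surj_pair)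
    moreover have "A \<inter> box a b \<subseteq> cbox a b" using box_subset_cbox by blast
    ultimately show ?case using represented_box by simp
  next
    case empty
    then show ?case using represented_lincomb[OF bx bx, of "-1"] by (simp add: indicator_def[abs_def])
  next
    case (compl A)
    have "indicat_real ((UNIV - A) \<inter> box a b) = (\<lambda>y. indicat_real (box a b) y + (-1) * indicat_real (A \<inter> box a b) y)"
      by (auto simp: indicator_def)
    then show ?case using represented_lincomb[OF bx compl(2), of "-1"] by simp
  next
    case (union A)
    let ?g = "\<lambda>m y. \<Sum>i<m. indicat_real (A i \<inter> box a b) y"
    have g: "represented a b (?g m)" for m
    proof (induction m)
      case 0
      then show ?case using represented_lincomb[OF bx bx, of "-1"] by simp
    next
      case (Suc m)
      then show ?case using represented_lincomb[OF Suc union(3)[of m], of 1] by simp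
    qed
    have ge: "?g m y = indicat_real ((\<Union>i<m. A i) \<inter> box a b) y" for m y
    proof -
      have "(\<Sum>i<m. indicat_real (A i) y) = indicat_real (\<Union>i<m. A i) y"
        using union(1) by (intro indicator_UN_disjoint[symmetric]) (auto simp: disjoint_family_on_def)
      then show ?thesis by (simp add: indicator_inter_arith sum_distrib_right[symmetric])
    qed
    have iL: "indicat_real (cbox a b) \<in> L2" by (rule indicator_L2) auto
    show ?case
    proof (rule represented_limit[OF g iL])
      show "\<bar>?g m y\<bar> \<le> indicat_real (cbox a b) y" for m y
        unfolding ge using box_subset_cbox[of a b] by (auto split: split_indicator)
      show "(\<lambda>m. ?g m y) \<longlonglongrightarrow> indicat_real (\<Union> (range A) \<inter> box a b) y" for y
      proof (cases "y \<in> \<Union> (range A)")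
        case True
        then obtain i where "y \<in> A i" by auto
        then have "?g m y = indicat_real (\<Union> (range A) \<inter> box a b) y" if "m \<ge> Suc i" for m
          unfolding ge using that by (auto split: split_indicator)
        then show ?thesis by (intro tendsto_eventually) (auto simp: eventually_sequentially)
      qed auto
    qed auto
  qed
qed

lemma represented_zero: "represented a b (\<lambda>_. 0)"
  using represented_lincomb[of a b "indicat_real (box a b)" "indicat_real (box a b)" "-1"]
    represented_box[OF box_subset_cbox] by simp

text \<open>All functions met in the approximation stay below \<open>u\<close>, so \<open>u\<close>
  cut to the box serves as the dominating L^2 function in the monotone limit.\<close>

lemma represented_nonneg:
  assumes "u \<in> borel_measurable lborel" "\<And>x. 0 \<le> u x" "(\<lambda>y. u y * indicator (box a b) y) \<in> L2"
  shows "represented a b (\<lambda>y. u y * indicator (box a b) y)"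
  using assms
proof (induction rule: borel_measurable_induct_real)
  case (set A)
  moreover have "indicat_real (A \<inter> box a b) = (\<lambda>y. indicat_real A y * indicat_real (box a b) y)"
    by (auto simp: indicator_def)
  ultimately show ?case using represented_borel[of A a b] by simp
next
  case (mult u c)
  show ?case
  proof (cases "c = 0")
    case True
    then show ?thesis using represented_zero by simp
  next
    case False
    have bx: "represented a b (\<lambda>_. 0)" by (rule represented_zero)
    have "(\<lambda>y. u y * indicator (box a b) y) \<in> L2"
      using L2_lincomb[of "\<lambda>_. 0" _ "1 / c", OF _ mult.prems] False by (simp add: L2_def mult.assoc)
    from represented_lincomb[OF bx mult.IH[OF this], of c] show ?thesis by (simp add: mult.assoc)
  qed
next
  case (add u v)
  have m: "(\<lambda>y. u y * indicat_real (box a b) y) \<in> borel_measurable lebesgue" "(\<lambda>y. v y * indicat_real (box a b) y) \<in> borel_measurable lebesgue"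
    using add by (auto intro!: borel_measurable_times simp: measurable_completion)
  have "(\<lambda>y. u y * indicat_real (box a b) y) \<in> L2" "(\<lambda>y. v y * indicat_real (box a b) y) \<in> L2"
    by (rule L2_bound[OF add.prems m(1)] L2_bound[OF add.prems m(2)], use add in \<open>auto split: split_indicator\<close>)+
  from represented_lincomb[OF add.IH(2)[OF this(2)] add.IH(1)[OF this(1)], of 1] show ?case
    by (simp add: distrib_right)
next
  case (seq U)
  have Ule: "U i y \<le> u y" for i y
    using seq.hyps(3,4) by (intro incseq_le) (auto simp: incseq_def le_fun_def)
  have m: "(\<lambda>y. U i y * indicat_real (box a b) y) \<in> borel_measurable lebesgue" for i
    using seq by (auto intro!: borel_measurable_times simp: measurable_completion)
  have pos: "0 \<le> U i y" for i y by (rule seq.hyps)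
  have UL: "(\<lambda>y. U i y * indicat_real (box a b) y) \<in> L2" for i
    by (rule L2_bound[OF seq.prems m]) (use pos Ule in \<open>auto split: split_indicator simp: abs_of_nonneg intro: order_trans[OF Ule abs_ge_self]\<close>)
  show ?case
  proof (rule represented_limit[OF seq.IH[OF UL] seq.prems])
    show "\<bar>U j y * indicat_real (box a b) y\<bar> \<le> u y * indicat_real (box a b) y" for j y
      using pos Ule by (auto split: split_indicator)
    show "(\<lambda>j. U j y * indicat_real (box a b) y) \<longlonglongrightarrow> u y * indicat_real (box a b) y" for y
      using seq.hyps(4) by (intro tendsto_intros) auto
  qed (use box_subset_cbox[of a b] in \<open>auto split: split_indicator\<close>)
qed

text \<open>A Borel version of \<open>g\<close> is split into positive and negative parts, to which
  monotone approximation by simple functions applies; passing from the closed to the open box loses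
  only a null set.\<close>

theorem kernel_representation:
  assumes g: "g \<in> L2" and s: "\<And>y. y \<notin> cbox a b \<Longrightarrow> g y = 0"
  shows "AE x in lebesgue. x \<notin> cbox a b \<longrightarrow> T g x = (LINT y|lebesgue. k x y * g y)"
proof -
  obtain g' where g' [measurable]: "g' \<in> borel_measurable lborel" and ae: "AE x in lborel. g x = g' x"
    using completion_ex_borel_measurable_real[OF L2D(1)[OF g]] by blast
  note [measurable] = L2D(1)[OF g]
  define p where "p y = max 0 (g' y)" for y
  define q where "q y = max 0 (- g' y)" for y
  have pq [measurable]: "p \<in> borel_measurable lborel" "q \<in> borel_measurable lborel"
    unfolding p_def q_def by measurable
  have ae': "AE y in lebesgue. g y = g' y" by (rule AE_completion[OF ae])
  have g'L: "(\<lambda>y. g' y * indicat_real (box a b) y) \<in> L2"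
  proof -
    have m: "(\<lambda>y. g' y * indicat_real (box a b) y) \<in> borel_measurable lebesgue"
      by (intro measurable_completion) measurable
    have "(\<lambda>y. g y * indicat_real (box a b) y) \<in> L2"
    proof (rule L2_bound[OF g])
      show "(\<lambda>y. g y * indicat_real (box a b) y) \<in> borel_measurable lebesgue"
        by (intro borel_measurable_times borel_measurable_indicator L2D(1)[OF g]) auto
    qed (auto split: split_indicator)
    then have "integrable lebesgue (\<lambda>y. (g y * indicat_real (box a b) y)\<^sup>2)" by (rule L2D)
    then have "integrable lebesgue (\<lambda>y. (g' y * indicat_real (box a b) y)\<^sup>2)"
      by (rule integrable_cong_AE_imp) (use m ae' in \<open>auto elim: eventually_mono\<close>)
    then show ?thesis using m by (simp add: L2_def)
  qed
  have mp: "(\<lambda>y. p y * indicat_real (box a b) y) \<in> borel_measurable lebesgue" "(\<lambda>y. q y * indicat_real (box a b) y) \<in> borel_measurable lebesgue"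
    by (intro measurable_completion; measurable)+
  have "represented a b (\<lambda>y. p y * indicator (box a b) y)"
    by (rule represented_nonneg[OF pq(1)]) (auto simp: p_def intro!: L2_bound[OF g'L mp(1)[unfolded p_def]] split: split_indicator)
  moreover have "represented a b (\<lambda>y. q y * indicator (box a b) y)"
    by (rule represented_nonneg[OF pq(2)]) (auto simp: q_def intro!: L2_bound[OF g'L mp(2)[unfolded q_def]] split: split_indicator)
  ultimately have "represented a b (\<lambda>y. p y * indicator (box a b) y + (-1) * (q y * indicator (box a b) y))"
    by (rule represented_lincomb)
  then have "represented a b g"
  proof (rule represented_cong[OF _ g s])
    have "cbox a b - box a b \<in> null_sets lborel"
      using emeasure_lborel_cbox_eq[of a b] emeasure_lborel_box_eq[of a b] emeasure_lborel_cbox_finite[of a b]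
        emeasure_Diff[of lborel "box a b" "cbox a b"] box_subset_cbox[of a b] by (auto intro!: null_setsI)
    then have "AE y in lebesgue. y \<notin> cbox a b - box a b" by (intro AE_completion AE_not_in)
    with ae' show "AE y in lebesgue. p y * indicator (box a b) y + (-1) * (q y * indicator (box a b) y) = g y"
      by eventually_elim (use s in \<open>auto simp: p_def q_def split: split_indicator\<close>)
  qed auto
  then show ?thesis by (simp add: represented_def)
qed

end

section \<open>Hoermander kernels\<close>

text \<open>For functions of nonzero norm the bound follows by scaling. The supremum in
  \<open>opnorm_L2\<close> is one of reals, so the a priori constant \<open>C\<close> is needed to
  know that it is an upper bound; \<open>C\<close> also settles functions of norm 0.\<close>

lemma L2_operator_of_bounded_linear:
  fixes T :: "(real ^ 'n::finite \<Rightarrow> real) \<Rightarrow> real ^ 'n \<Rightarrow> real"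
  assumes T: "L2_bounded_linear T" and N: "opnorm_L2 T \<le> N"
  shows "L2_operator T N"
proof
  show TL: "T g \<in> L2" if "g \<in> L2" for g using T that by (simp add: L2_bounded_linear_def)
  show "AE x in lebesgue. T (\<lambda>y. f y + g y) x = T f x + T g x" if "f \<in> L2" "g \<in> L2" for f g
    using T that by (simp add: L2_bounded_linear_def)
  show Ts: "AE x in lebesgue. T (\<lambda>y. c * f y) x = c * T f x" if "f \<in> L2" for f c
    using T that by (simp add: L2_bounded_linear_def)
  obtain C where C: "\<And>f. f \<in> L2 \<Longrightarrow> norm_L2 (T f) \<le> C * norm_L2 f"
    using T unfolding L2_bounded_linear_def by blast
  have bdd: "bdd_above ((\<lambda>f. norm_L2 (T f)) ` {f \<in> L2. norm_L2 f \<le> 1})"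
  proof (rule bdd_aboveI2)
    fix f :: "real ^ 'n \<Rightarrow> real" assume "f \<in> {f \<in> L2. norm_L2 f \<le> 1}"
    then have f: "f \<in> L2" "norm_L2 f \<le> 1" by auto
    have "C * norm_L2 f \<le> \<bar>C\<bar> * norm_L2 f" by (intro mult_right_mono) (auto simp: norm_L2_def)
    also have "\<dots> \<le> \<bar>C\<bar> * 1" by (intro mult_left_mono f) auto
    finally show "norm_L2 (T f) \<le> \<bar>C\<bar>" using C[OF f(1)] by simp
  qed
  fix g :: "real ^ 'n \<Rightarrow> real" assume g: "g \<in> L2"
  have sq: "(norm_L2 h)\<^sup>2 = (LINT x|lebesgue. (h x)\<^sup>2)" for h :: "real ^ 'n \<Rightarrow> real"
    by (simp add: norm_L2_def)
  have n0: "0 \<le> norm_L2 h" for h :: "real ^ 'n \<Rightarrow> real" by (simp add: norm_L2_def)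
  have "norm_L2 (T g) \<le> N * norm_L2 g"
  proof (cases "norm_L2 g = 0")
    case True
    then show ?thesis using C[OF g] by simp
  next
    case False
    define a where "a = norm_L2 g"
    have a: "a > 0" using False n0[of g] by (simp add: a_def)
    let ?h = "\<lambda>y. (1 / a) * g y"
    have hL: "?h \<in> L2" using L2_lincomb[of "\<lambda>_. 0" g "1 / a"] g by (simp add: L2_def)
    have "(LINT x|lebesgue. (?h x)\<^sup>2) = (1 / a)\<^sup>2 * (LINT x|lebesgue. (g x)\<^sup>2)"
      by (simp only: power_mult_distrib integral_mult_right_zero)
    then have "norm_L2 ?h = 1" using a by (simp add: norm_L2_def real_sqrt_mult real_sqrt_divide a_def)
    then have "norm_L2 (T ?h) \<le> opnorm_L2 T"
      unfolding opnorm_L2_def using hL by (intro cSUP_upper bdd) auto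
    moreover have "norm_L2 (T ?h) = norm_L2 (T g) / a"
    proof -
      have "(LINT x|lebesgue. (T ?h x)\<^sup>2) = (LINT x|lebesgue. ((1 / a) * T g x)\<^sup>2)"
        using Ts[OF g, of "1 / a"] L2D(1)[OF TL[OF hL]] L2D(1)[OF TL[OF g]]
        by (intro integral_cong_AE) auto
      also have "\<dots> = (1 / a)\<^sup>2 * (LINT x|lebesgue. (T g x)\<^sup>2)"
        by (simp only: power_mult_distrib integral_mult_right_zero)
      finally show ?thesis using a by (simp add: norm_L2_def real_sqrt_mult real_sqrt_divide)
    qed
    ultimately have "norm_L2 (T g) / a \<le> N" using N by simp
    then show ?thesis using a by (simp add: field_simps a_def)
  qed
  then have "(norm_L2 (T g))\<^sup>2 \<le> (N * norm_L2 g)\<^sup>2" using n0 by (intro power_mono) auto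
  then show "(LINT x|lebesgue. (T g x)\<^sup>2) \<le> N\<^sup>2 * (LINT x|lebesgue. (g x)\<^sup>2)"
    by (simp add: sq power_mult_distrib)
qed

lemma open_off_diagonal: "open {z :: (real ^ 'n::finite) \<times> (real ^ 'n). fst z \<noteq> snd z}"
  by (rule open_Collect_neq) (intro continuous_intros)+

text \<open>Integrability on compact sets exhausting the off-diagonal region makes \<open>K\<close>
  Lebesgue measurable there, hence almost everywhere equal to a Borel function. Fubini turns this
  into agreement on almost all sections in each variable.\<close>

lemma ex_borel_kernel:
  fixes K :: "real ^ 'n::finite \<Rightarrow> real ^ 'n \<Rightarrow> real"
  assumes K: "\<And>C. compact C \<Longrightarrow> C \<subseteq> {(x, y). x \<noteq> y} \<Longrightarrow> (\<lambda>(x, y). K x y) absolutely_integrable_on C"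
    and size: "\<And>x y. x \<noteq> y \<Longrightarrow> \<bar>K x y\<bar> \<le> ck / norm (x - y) ^ CARD('n)"
  shows "\<exists>k. (\<lambda>(x, y). k x y) \<in> borel_measurable (borel \<Otimes>\<^sub>M borel) \<and>
    (\<forall>x y. x \<noteq> y \<longrightarrow> \<bar>k x y\<bar> \<le> ck / norm (x - y) ^ CARD('n)) \<and>
    (AE x in lebesgue. AE y in lebesgue. K x y = k x y) \<and> (AE y in lebesgue. AE x in lebesgue. K x y = k x y)"
proof -
  let ?D = "{z :: (real ^ 'n) \<times> (real ^ 'n). fst z \<noteq> snd z}"
  obtain C where C: "\<And>n. compact (C n)" "\<And>n. C n \<subseteq> ?D" "\<And>n. C n \<subseteq> interior (C (Suc n))" "\<Union> (range C) = ?D"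
    by (rule open_Union_compact_subsets[OF open_off_diagonal]) (rule that, assumption+)
  have mono: "C n \<subseteq> C (n + j)" for n j
  proof (induction j)
    case (Suc j)
    have "C (n + j) \<subseteq> C (n + Suc j)" using C(3)[of "n + j"] interior_subset[of "C (n + Suc j)"] by auto
    with Suc show ?case by (rule order_trans)
  qed simp
  define K0 where "K0 z = (if z \<in> ?D then case_prod K z else 0)" for z
  have "K0 \<in> borel_measurable lebesgue"
  proof (rule borel_measurable_LIMSEQ_real)
    fix i
    have "(\<lambda>(x, y). K x y) absolutely_integrable_on C i"
    proof (rule K)
      show "compact (C i)" by (rule C)
      show "C i \<subseteq> {(x, y). x \<noteq> y}" using C(2)[of i] by (auto simp: case_prod_beta)
    qed
    then show "(\<lambda>z. indicat_real (C i) z *\<^sub>R case_prod K z) \<in> borel_measurable lebesgue"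
      unfolding set_integrable_def by (rule borel_measurable_integrable)
  next
    fix z
    show "(\<lambda>i. indicat_real (C i) z *\<^sub>R case_prod K z) \<longlonglongrightarrow> K0 z"
    proof (cases "z \<in> ?D")
      case True
      then obtain n where "z \<in> C n" using C(4) by blast
      then have "z \<in> C i" if "i \<ge> n" for i using mono[of n "i - n"] that by auto
      then have "\<forall>\<^sub>F i in sequentially. indicat_real (C i) z *\<^sub>R case_prod K z = K0 z"
        using True unfolding eventually_sequentially by (intro exI[of _ n]) (simp add: K0_def)
      then show ?thesis by (rule tendsto_eventually)
    next
      case False
      then have "z \<notin> C i" for i using C(2) by blast
      then show ?thesis using False by (simp add: K0_def)
    qed
  qed
  then obtain k0 where k0: "k0 \<in> borel_measurable lborel" "AE z in lborel. K0 z = k0 z"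
    using completion_ex_borel_measurable_real by blast
  \<comment> \<open>Setting the kernel to 0 where the size estimate fails makes the estimate hold at
    every point; agreement with \<open>K\<close> survives because \<open>K\<close> obeys it.\<close>
  define k where "k x y = (if x \<noteq> y \<and> \<bar>k0 (x, y)\<bar> \<le> ck / norm (x - y) ^ CARD('n) then k0 (x, y) else 0)" for x y
  have k0m [measurable]: "k0 \<in> borel_measurable (borel \<Otimes>\<^sub>M borel)" using k0(1) by (simp add: borel_prod)
  have km: "(\<lambda>(x, y). k x y) \<in> borel_measurable (borel \<Otimes>\<^sub>M borel)" unfolding k_def by measurable
  have eq: "K x y = k x y" if "x \<noteq> y" "K0 (x, y) = k0 (x, y)" for x y
    using that size[of x y] by (auto simp: k_def K0_def)
  have "AE z in lborel \<Otimes>\<^sub>M lborel. K0 z = k0 z" unfolding lborel_prod by (rule k0(2))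
  then obtain Z where Z: "{z \<in> space (lborel \<Otimes>\<^sub>M lborel). K0 z \<noteq> k0 z} \<subseteq> Z" "emeasure (lborel \<Otimes>\<^sub>M lborel) Z = 0" "Z \<in> sets (lborel \<Otimes>\<^sub>M lborel)"
    by (rule AE_E)
  have "AE z in lborel \<Otimes>\<^sub>M lborel. z \<notin> Z" using Z(2,3) by (intro AE_not_in) auto
  then have 1: "AE x in lborel. AE y in lborel. (x, y) \<notin> Z" by (rule lborel_pair.AE_pair)
  moreover have "{z \<in> space (lborel \<Otimes>\<^sub>M lborel). (fst z, snd z) \<notin> Z} \<in> sets (lborel \<Otimes>\<^sub>M lborel)"
  proof -
    have "{z \<in> space (lborel \<Otimes>\<^sub>M lborel). (fst z, snd z) \<notin> Z} = space (lborel \<Otimes>\<^sub>M lborel) - Z" by auto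
    then show ?thesis using Z(3) by (simp only: sets.compl_sets)
  qed
  ultimately have 2: "AE y in lborel. AE x in lborel. (x, y) \<notin> Z"
    using lborel_pair.AE_commute[where P = "\<lambda>x y. (x, y) \<notin> Z"] by simp
  have Zc: "K0 z = k0 z" if "z \<notin> Z" for z using Z(1) that by (auto simp: space_pair_measure)
  have "AE x in lebesgue. AE y in lebesgue. K x y = k x y"
    using AE_completion[OF 1]
  proof eventually_elim
    case (elim x)
    have "AE y in lborel. y \<noteq> x" by (rule AE_lborel_singleton)
    with elim have "AE y in lborel. K x y = k x y" by eventually_elim (use eq Zc in auto)
    then show ?case by (rule AE_completion)
  qed
  moreover have "AE y in lebesgue. AE x in lebesgue. K x y = k x y"
    using AE_completion[OF 2]
  proof eventually_elim
    case (elim y)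
    have "AE x in lborel. x \<noteq> y" by (rule AE_lborel_singleton)
    with elim have "AE x in lborel. K x y = k x y" by eventually_elim (use eq Zc in auto)
    then show ?case by (rule AE_completion)
  qed
  ultimately show ?thesis
  proof (intro exI[of _ k] conjI km allI impI)
    fix x y :: "real ^ 'n" assume "x \<noteq> y"
    then have "0 \<le> ck / norm (x - y) ^ CARD('n)" using size[of x y] by linarith
    then show "\<bar>k x y\<bar> \<le> ck / norm (x - y) ^ CARD('n)" by (simp add: k_def)
  qed
qed

section \<open>Kernel differences on annuli\<close>

lemma luxemburg_cong_AE:
  assumes "AE x in lebesgue. f x = g x" shows "luxemburg E Q f = luxemburg E Q g"
proof -
  have "(\<integral>\<^sup>+x\<in>cube_set Q. E (\<bar>f x\<bar> / r) \<partial>lebesgue) = (\<integral>\<^sup>+x\<in>cube_set Q. E (\<bar>g x\<bar> / r) \<partial>lebesgue)" for r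
    using assms by (intro nn_integral_cong_AE) (auto elim: eventually_mono)
  then show ?thesis by (simp add: luxemburg_def)
qed

lemma dilate_cover:
  assumes "is_cube Q" shows "\<exists>j. x \<in> cube_set (dilate (2 ^ j) Q)"
proof -
  have s: "side Q > 0" using assms by (simp add: is_cube_def)
  define R where "R = 2 * norm (x - fst Q) + 1"
  obtain j where j: "R / side Q < 2 ^ j" using real_arch_pow[of 2 "R / side Q"] by auto
  then have R: "R < 2 ^ j * side Q" using s by (simp add: field_simps)
  have "fst Q $ i - 2 ^ j * side Q / 2 \<le> x $ i \<and> x $ i < fst Q $ i + 2 ^ j * side Q / 2" for i
  proof -
    have "\<bar>x $ i - fst Q $ i\<bar> \<le> norm (x - fst Q)" using component_le_norm_cart[of "x - fst Q" i] by simp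
    then show ?thesis using R unfolding R_def by linarith
  qed
  then show ?thesis by (intro exI[of _ j]) (auto simp: cube_set_def dilate_def)
qed

lemma annuli_indicator:
  assumes Q: "is_cube Q"
  shows "indicator (- cube_set Q) y = (\<Sum>j. indicator (cube_set (dilate (2 ^ Suc j) Q) - cube_set (dilate (2 ^ j) Q)) y :: ennreal)"
proof -
  let ?A = "\<lambda>j. cube_set (dilate (2 ^ Suc j) Q) - cube_set (dilate (2 ^ j) Q)"
  have mono: "cube_set (dilate (2 ^ i) Q) \<subseteq> cube_set (dilate (2 ^ j) Q)" if "i \<le> j" for i j
    using that by (intro dilate_mono[OF _ Q]) simp
  have "disjoint_family ?A"
    unfolding disjoint_family_on_def
  proof (intro ballI impI)
    fix i j :: nat assume "i \<noteq> j"
    then show "?A i \<inter> ?A j = {}" using mono[of "Suc i" j] mono[of "Suc j" i] by (cases "i < j") auto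
  qed
  then have "(\<Sum>j. indicator (?A j) y :: ennreal) = indicator (\<Union>j. ?A j) y" by (rule suminf_indicator)
  also have "(\<Union>j. ?A j) = - cube_set Q"
  proof
    show "(\<Union>j. ?A j) \<subseteq> - cube_set Q" using mono[of 0] by auto
    show "- cube_set Q \<subseteq> (\<Union>j. ?A j)"
    proof
      fix x assume x: "x \<in> - cube_set Q"
      define j where "j = (LEAST j. x \<in> cube_set (dilate (2 ^ j) Q))"
      have j: "x \<in> cube_set (dilate (2 ^ j) Q)" unfolding j_def by (rule LeastI_ex[OF dilate_cover[OF Q]])
      have "j \<noteq> 0" using j x by (auto intro: ccontr)
      then obtain i where i: "j = Suc i" by (cases j) auto
      have "x \<notin> cube_set (dilate (2 ^ i) Q)" using not_less_Least[of i "\<lambda>j. x \<in> cube_set (dilate (2 ^ j) Q)"] i j_def by simp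
      then show "x \<in> (\<Union>j. ?A j)" using j i by auto
    qed
  qed
  finally show ?thesis by simp
qed

text \<open>Hoelder's inequality on each annulus: the volume of the enclosing cube is exactly the
  weight (2^k l(Q))^n of the Hoermander sum, provided that one radius \<open>r\<close> serves all
  dilates. The functions \<open>kx\<close> and \<open>kz\<close> supply the measurability that
  sections of \<open>K\<close> may lack.\<close>

lemma hormander_oscillation:
  fixes K :: "real ^ 'n::finite \<Rightarrow> real ^ 'n \<Rightarrow> real"
  assumes A: "young A" and Q: "is_cube Q" and xz: "x \<in> cube_set (dilate (1/2) Q)" "z \<in> cube_set (dilate (1/2) Q)"
    and meas [measurable]: "kx \<in> borel_measurable lebesgue" "kz \<in> borel_measurable lebesgue" "g \<in> borel_measurable lebesgue"
    and ae: "AE y in lebesgue. K x y = kx y" "AE y in lebesgue. K z y = kz y"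
    and m: "\<And>j. modular_le A (dilate (2 ^ Suc j) Q) g r"
  shows "(\<integral>\<^sup>+y\<in>- cube_set Q. ennreal (\<bar>g y\<bar> * \<bar>kx y - kz y\<bar>) \<partial>lebesgue) \<le> ennreal (2 * r) * H1 K (complementary A)"
proof -
  let ?A = "\<lambda>j. cube_set (dilate (2 ^ Suc j) Q) - cube_set (dilate (2 ^ j) Q)"
  let ?\<psi> = "\<lambda>j y. (K x y - K z y) * indicator (?A j) y"
  let ?\<phi> = "\<lambda>j y. (kx y - kz y) * indicator (?A j) y"
  have "(\<integral>\<^sup>+y\<in>- cube_set Q. ennreal (\<bar>g y\<bar> * \<bar>kx y - kz y\<bar>) \<partial>lebesgue)
     = (\<integral>\<^sup>+y. (\<Sum>j. ennreal (\<bar>g y\<bar> * \<bar>kx y - kz y\<bar>) * indicator (?A j) y) \<partial>lebesgue)"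
    unfolding annuli_indicator[OF Q] by (simp add: ennreal_suminf_cmult)
  also have "\<dots> = (\<Sum>j. \<integral>\<^sup>+y. ennreal (\<bar>g y\<bar> * \<bar>kx y - kz y\<bar>) * indicator (?A j) y \<partial>lebesgue)"
    by (rule nn_integral_suminf) measurable
  also have "\<dots> \<le> (\<Sum>j. ennreal (2 * r) * (ennreal ((2 ^ Suc j * side Q) ^ CARD('n)) * luxemburg (complementary A) (dilate (2 ^ Suc j) Q) (?\<psi> j)))"
  proof (rule suminf_le[OF _ summableI summableI])
    fix j
    have c: "is_cube (dilate (2 ^ Suc j) Q)" using Q by (intro is_cube_dilate) auto
    have "(\<integral>\<^sup>+y. ennreal (\<bar>g y\<bar> * \<bar>kx y - kz y\<bar>) * indicator (?A j) y \<partial>lebesgue)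
       = (\<integral>\<^sup>+y\<in>cube_set (dilate (2 ^ Suc j) Q). ennreal (\<bar>g y\<bar> * \<bar>?\<phi> j y\<bar>) \<partial>lebesgue)"
      by (intro nn_integral_cong) (auto split: split_indicator)
    also have "\<dots> \<le> ennreal (2 * r) * emeasure lebesgue (cube_set (dilate (2 ^ Suc j) Q)) * luxemburg (complementary A) (dilate (2 ^ Suc j) Q) (?\<phi> j)"
      by (rule modular_le_hoelder[OF A c _ _ m]) measurable
    also have "luxemburg (complementary A) (dilate (2 ^ Suc j) Q) (?\<phi> j) = luxemburg (complementary A) (dilate (2 ^ Suc j) Q) (?\<psi> j)"
      by (rule luxemburg_cong_AE) (use ae in eventually_elim, simp)
    also have "emeasure lebesgue (cube_set (dilate (2 ^ Suc j) Q)) = ennreal ((2 ^ Suc j * side Q) ^ CARD('n))"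
      using emeasure_cube_set[OF c] by (simp add: dilate_def)
    finally show "(\<integral>\<^sup>+y. ennreal (\<bar>g y\<bar> * \<bar>kx y - kz y\<bar>) * indicator (?A j) y \<partial>lebesgue)
      \<le> ennreal (2 * r) * (ennreal ((2 ^ Suc j * side Q) ^ CARD('n)) * luxemburg (complementary A) (dilate (2 ^ Suc j) Q) (?\<psi> j))"
      by (simp add: mult.assoc)
  qed
  also have "\<dots> = ennreal (2 * r) * (\<Sum>j. ennreal ((2 ^ Suc j * side Q) ^ CARD('n)) * luxemburg (complementary A) (dilate (2 ^ Suc j) Q) (?\<psi> j))"
    by (rule ennreal_suminf_cmult)
  also have "\<dots> \<le> ennreal (2 * r) * H1 K (complementary A)"
  proof (rule mult_left_mono)
    have "(\<Sum>j. ennreal ((2 ^ Suc j * side Q) ^ CARD('n)) * luxemburg (complementary A) (dilate (2 ^ Suc j) Q) (?\<psi> j)) \<le>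
      (SUP x\<in>cube_set (dilate (1/2) Q). SUP z\<in>cube_set (dilate (1/2) Q).
        (\<Sum>j. let k = Suc j in ennreal ((2 ^ k * side Q) ^ CARD('n)) *
          luxemburg (complementary A) (dilate (2 ^ k) Q)
            (\<lambda>y. (K x y - K z y) * indicator (cube_set (dilate (2 ^ k) Q) - cube_set (dilate (2 ^ (k - 1)) Q)) y)))"
      by (rule SUP_upper2[OF xz(1)], rule SUP_upper2[OF xz(2)]) simp
    also have "\<dots> \<le> H1 K (complementary A)"
      unfolding H1_def by (rule SUP_upper) (use Q in simp)
    finally show "(\<Sum>j. ennreal ((2 ^ Suc j * side Q) ^ CARD('n)) * luxemburg (complementary A) (dilate (2 ^ Suc j) Q) (?\<psi> j)) \<le> H1 K (complementary A)" .
  qed simp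
  finally show ?thesis .
qed

lemma AE_ex_in_set:
  assumes "AE x in lebesgue. P x" "emeasure lebesgue S \<noteq> 0" "S \<in> sets lebesgue"
  shows "\<exists>x\<in>S. P x"
proof (rule ccontr)
  assume "\<not> ?thesis"
  then have "AE x in lebesgue. x \<notin> S" using assms(1) by (auto elim: eventually_mono)
  then have "S \<in> null_sets lebesgue" using assms(3) by (simp add: AE_iff_null_sets)
  then show False using assms(2) by auto
qed

text \<open>The kernel \<open>K\<close> of the statement is only locally integrable, which does not make all its sections
  measurable; \<open>k\<close> is a Borel version of it. The number \<open>N\<close> bounds the operator norm and
  \<open>H K (complementary A) / \<sigma>\<close> simultaneously.\<close>

locale hormander_setting = kernel_operator T N k ck
  for T :: "(real ^ 'n::finite \<Rightarrow> real) \<Rightarrow> real ^ 'n \<Rightarrow> real" and N k ck +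
  fixes K :: "real ^ 'n \<Rightarrow> real ^ 'n \<Rightarrow> real" and A :: "real \<Rightarrow> real" and \<sigma> :: real
  assumes A: "young A" and \<sigma>: "A \<sigma> = 1" "0 < \<sigma>"
    and Kk: "AE x in lebesgue. AE y in lebesgue. K x y = k x y" "AE y in lebesgue. AE x in lebesgue. K x y = k x y"
    and H_le: "H K (complementary A) \<le> ennreal (\<sigma> * N)" and N_pos: "0 < N"
begin

text \<open>Mean zero permits subtracting k(x, z) in the kernel formula. After Fubini the inner
  integral over x is the Hoermander condition for the transposed kernel, tested against the constant
  1 of radius 1 / \<sigma>, which gives 2 / \<sigma> times \<sigma> N.\<close>

lemma atom_bound:
  assumes R: "is_cube R" and a: "a \<in> L2" "\<And>y. y \<notin> cube_set R \<Longrightarrow> a y = 0" "(LINT y|lebesgue. a y) = 0"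
  shows "(\<integral>\<^sup>+x\<in>- cube_set (dilate 2 R). ennreal \<bar>T a x\<bar> \<partial>lebesgue) \<le> ennreal (2 * N) * (\<integral>\<^sup>+y. ennreal \<bar>a y\<bar> \<partial>lebesgue)"
proof -
  define lo hi :: "real ^ 'n" where "lo = (\<chi> i. fst R $ i - side R / 2)" and "hi = (\<chi> i. fst R $ i + side R / 2)"
  have s: "side R > 0" using R by (simp add: is_cube_def)
  have sub: "cube_set R \<subseteq> cbox lo hi" by (auto simp: cube_set_def lo_def hi_def mem_box_cart less_eq_real_def)
  have sub2: "cbox lo hi \<subseteq> cube_set (dilate 2 R)"
  proof
    fix x assume "x \<in> cbox lo hi"
    then have "fst R $ i - side R / 2 \<le> x $ i" "x $ i \<le> fst R $ i + side R / 2" for i by (auto simp: mem_box_cart lo_def hi_def)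
    then have "fst R $ i - side R \<le> x $ i \<and> x $ i < fst R $ i + side R" for i using s by (smt (verit) field_sum_of_halves)
    then show "x \<in> cube_set (dilate 2 R)" by (simp add: cube_set_def dilate_def)
  qed
  have aL1: "integrable lebesgue a" by (rule box_support_L1[OF a(1)]) (use a(2) sub in blast)
  note [measurable] = borel_measurable_integrable[OF aL1]
  have R0: "emeasure lebesgue (cube_set R) \<noteq> 0" using R by simp
  \<comment> \<open>A prescribed point such as the centre of \<open>R\<close> might have a bad
    section of \<open>K\<close>; almost every point of \<open>R\<close> is good.\<close>
  obtain z where z: "z \<in> cube_set R" "AE x in lebesgue. K x z = k x z"
    using AE_ex_in_set[OF Kk(2) R0] by auto
  obtain a' where a' [measurable]: "a' \<in> borel_measurable lborel" and aa: "AE y in lborel. a y = a' y"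
    using completion_ex_borel_measurable_real[OF L2D(1)[OF a(1)]] by blast
  let ?S = "cube_set (dilate 2 R)"
  have Sm [measurable]: "?S \<in> sets borel" by simp
  have rep: "AE x in lebesgue. x \<notin> ?S \<longrightarrow> T a x = (LINT y|lebesgue. (k x y - k x z) * a y)"
  proof -
    have "AE x in lebesgue. x \<notin> cbox lo hi \<longrightarrow> T a x = (LINT y|lebesgue. k x y * a y)"
      by (rule kernel_representation[OF a(1)]) (use a(2) sub in blast)
    then show ?thesis
    proof eventually_elim
      case (elim x)
      show ?case
      proof
        assume "x \<notin> ?S"
        then have x: "x \<notin> cbox lo hi" using sub2 by blast
        have "(LINT y|lebesgue. (k x y - k x z) * a y) = (LINT y|lebesgue. k x y * a y - k x z * a y)"
          by (simp add: left_diff_distrib)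
        also have "\<dots> = (LINT y|lebesgue. k x y * a y) - (LINT y|lebesgue. k x z * a y)"
          using k_integrable[OF aL1 _ x] a(2) sub aL1 by (intro Bochner_Integration.integral_diff) auto
        finally show "T a x = (LINT y|lebesgue. (k x y - k x z) * a y)" using elim x a(3) by simp
      qed
    qed
  qed
  have "(\<integral>\<^sup>+x\<in>- ?S. ennreal \<bar>T a x\<bar> \<partial>lebesgue) \<le> (\<integral>\<^sup>+x. (\<integral>\<^sup>+y. ennreal (\<bar>k x y - k x z\<bar> * \<bar>a' y\<bar>) * indicator (- ?S) x \<partial>lborel) \<partial>lebesgue)"
  proof (rule nn_integral_mono_AE, use rep in eventually_elim)
    fix x assume x: "x \<notin> ?S \<longrightarrow> T a x = (LINT y|lebesgue. (k x y - k x z) * a y)"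
    show "ennreal \<bar>T a x\<bar> * indicator (- ?S) x \<le> (\<integral>\<^sup>+y. ennreal (\<bar>k x y - k x z\<bar> * \<bar>a' y\<bar>) * indicator (- ?S) x \<partial>lborel)"
    proof (cases "x \<in> ?S")
      case False
      have "ennreal \<bar>T a x\<bar> = ennreal (norm (LINT y|lebesgue. (k x y - k x z) * a y))" using x False by simp
      also have "\<dots> \<le> (\<integral>\<^sup>+y. norm ((k x y - k x z) * a y) \<partial>lebesgue)"
      \<comment> \<open>Without integrability the Bochner integral is 0 and the bound is
        trivial.\<close>
      proof (cases "integrable lebesgue (\<lambda>y. (k x y - k x z) * a y)")
        case True
        then show ?thesis by (rule integral_norm_bound_ennreal)
      qed (simp add: not_integrable_integral_eq)
      also have "\<dots> = (\<integral>\<^sup>+y. ennreal (\<bar>k x y - k x z\<bar> * \<bar>a' y\<bar>) \<partial>lborel)"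
        unfolding nn_integral_completion using aa by (intro nn_integral_cong_AE) (auto simp: abs_mult elim: eventually_mono)
      finally show ?thesis using False by simp
    qed simp
  qed
  also have "\<dots> = (\<integral>\<^sup>+y. (\<integral>\<^sup>+x. ennreal (\<bar>k x y - k x z\<bar> * \<bar>a' y\<bar>) * indicator (- ?S) x \<partial>lborel) \<partial>lborel)"
    unfolding nn_integral_completion by (rule lborel_pair.Fubini') measurable
  also have "\<dots> \<le> (\<integral>\<^sup>+y. ennreal (2 * N) * ennreal \<bar>a y\<bar> \<partial>lebesgue)"
    unfolding nn_integral_completion[of lborel, symmetric]
  proof (rule nn_integral_mono_AE)
    show "AE y in lebesgue. (\<integral>\<^sup>+x. ennreal (\<bar>k x y - k x z\<bar> * \<bar>a' y\<bar>) * indicator (- ?S) x \<partial>lebesgue) \<le> ennreal (2 * N) * ennreal \<bar>a y\<bar>"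
      using Kk(2) AE_completion[OF aa]
    proof eventually_elim
      case (elim y)
      show ?case
      proof (cases "y \<in> cube_set R")
        case False
        then show ?thesis by (simp flip: elim(2) add: a(2)[OF False])
      next
        case True
        have mod: "modular_le A (dilate (2 ^ Suc j) (dilate 2 R)) (\<lambda>_. 1) (1 / \<sigma>)" for j
          by (rule modular_le_bounded[OF A \<sigma>]) auto
        have "(\<integral>\<^sup>+x\<in>- ?S. ennreal (\<bar>1\<bar> * \<bar>k x y - k x z\<bar>) \<partial>lebesgue) \<le> ennreal (2 * (1 / \<sigma>)) * H1 (\<lambda>x y. K y x) (complementary A)"
        proof (rule hormander_oscillation[OF A _ _ _ _ _ _ _ _ mod])
          show "is_cube (dilate 2 R)" using R by simp
          show "y \<in> cube_set (dilate (1/2) (dilate 2 R))" using True by simp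
          show "z \<in> cube_set (dilate (1/2) (dilate 2 R))" using z(1) by simp
          show "AE x in lebesgue. K x y = k x y" by (rule elim(1))
          show "AE x in lebesgue. K x z = k x z" by (rule z(2))
        qed measurable
        also have "\<dots> \<le> ennreal (2 * (1 / \<sigma>)) * ennreal (\<sigma> * N)"
          using H_le by (intro mult_left_mono) (auto simp: H_def H2_def)
        also have "\<dots> = ennreal (2 * N)" using \<sigma> by (subst ennreal_mult'[symmetric]) auto
        finally have o: "(\<integral>\<^sup>+x. ennreal \<bar>k x y - k x z\<bar> * indicator (- ?S) x \<partial>lebesgue) \<le> ennreal (2 * N)" by simp
        have "(\<integral>\<^sup>+x. ennreal (\<bar>k x y - k x z\<bar> * \<bar>a' y\<bar>) * indicator (- ?S) x \<partial>lebesgue)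
          = (\<integral>\<^sup>+x. (ennreal \<bar>k x y - k x z\<bar> * indicator (- ?S) x) * ennreal \<bar>a' y\<bar> \<partial>lebesgue)"
          by (intro nn_integral_cong) (simp add: ennreal_mult' mult_ac)
        also have "\<dots> = (\<integral>\<^sup>+x. ennreal \<bar>k x y - k x z\<bar> * indicator (- ?S) x \<partial>lebesgue) * ennreal \<bar>a' y\<bar>"
          by (rule nn_integral_multc) measurable
        also have "\<dots> \<le> ennreal (2 * N) * ennreal \<bar>a y\<bar>" using o elim by (intro mult_mono) auto
        finally show ?thesis .
      qed
    qed
  qed
  also have "\<dots> = ennreal (2 * N) * (\<integral>\<^sup>+y. ennreal \<bar>a y\<bar> \<partial>lebesgue)" by (rule nn_integral_cmult) measurable
  finally show ?thesis .
qed

end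

declare measure_completion [simp del]

section \<open>Weak type (1,1)\<close>

lemma countable_finite_exhaustion:
  assumes "countable F"
  shows "\<exists>E :: nat \<Rightarrow> 'a set. (\<forall>m. finite (E m) \<and> E m \<subseteq> F) \<and> (\<forall>Q\<in>F. \<exists>m0. \<forall>m\<ge>m0. Q \<in> E m)"
proof -
  define E where "E m = {Q \<in> F. to_nat_on F Q < m}" for m
  have "finite (E m)" for m
  proof (rule finite_imageD[of "to_nat_on F"])
    show "finite (to_nat_on F ` E m)" by (rule finite_subset[of _ "{..<m}"]) (auto simp: E_def)
    show "inj_on (to_nat_on F) (E m)" by (rule inj_on_subset[OF inj_on_to_nat_on[OF assms]]) (auto simp: E_def)
  qed
  moreover have "\<forall>m\<ge>Suc (to_nat_on F Q). Q \<in> E m" if "Q \<in> F" for Q using that by (auto simp: E_def)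
  moreover have "E m \<subseteq> F" for m by (auto simp: E_def)
  ultimately show ?thesis by blast
qed

lemma sum_disjoint_indicator:
  assumes "finite E" "disjoint_family_on X E" "Q \<in> E" "y \<in> X Q"
  shows "(\<Sum>R\<in>E. c R * indicat_real (X R) y) = c Q"
proof -
  have "(\<Sum>R\<in>E. c R * indicat_real (X R) y) = (\<Sum>R\<in>E. if R = Q then c Q else 0)"
    using assms by (intro sum.cong) (auto simp: disjoint_family_on_def split: split_indicator)
  then show ?thesis using assms by simp
qed

lemma avg_eq_integral: "is_cube Q \<Longrightarrow> avg g Q * measure lebesgue (cube_set Q) = (LINT x|lebesgue. indicat_real (cube_set Q) x * g x)"
  by (simp add: avg_def set_lebesgue_integral_def measure_cube_set is_cube_def)

lemma abs_avg_le:
  assumes "integrable lebesgue g" "is_cube Q"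
  shows "\<bar>avg g Q\<bar> * measure lebesgue (cube_set Q) \<le> (LINT x|lebesgue. indicat_real (cube_set Q) x * \<bar>g x\<bar>)"
proof -
  have "\<bar>avg g Q\<bar> * measure lebesgue (cube_set Q) = \<bar>LINT x|lebesgue. indicat_real (cube_set Q) x * g x\<bar>"
    by (simp add: avg_eq_integral[OF assms(2), symmetric] abs_mult)
  also have "\<dots> \<le> (LINT x|lebesgue. \<bar>indicat_real (cube_set Q) x * g x\<bar>)" by (rule integral_abs_bound)
  finally show ?thesis by (simp add: abs_mult)
qed

context hormander_setting
begin

lemma T_sum:
  assumes "finite E" "\<And>Q. Q \<in> E \<Longrightarrow> f Q \<in> L2"
  shows "(\<lambda>y. \<Sum>Q\<in>E. f Q y) \<in> L2 \<and> (AE x in lebesgue. T (\<lambda>y. \<Sum>Q\<in>E. f Q y) x = (\<Sum>Q\<in>E. T (f Q) x))"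
  using assms
proof (induction E rule: finite_induct)
  case empty
  have "(\<lambda>_. 0) \<in> (L2 :: (real^'n \<Rightarrow> real) set)" by (simp add: L2_def)
  moreover from this have "AE x in lebesgue. T (\<lambda>_. 0) x = 0" by (rule T_zero) simp
  ultimately show ?case by simp
next
  case (insert R E)
  have IH: "(\<lambda>y. \<Sum>Q\<in>E. f Q y) \<in> L2" "AE x in lebesgue. T (\<lambda>y. \<Sum>Q\<in>E. f Q y) x = (\<Sum>Q\<in>E. T (f Q) x)"
    using insert by auto
  have R: "f R \<in> L2" using insert by simp
  have "(\<lambda>y. f R y + 1 * (\<Sum>Q\<in>E. f Q y)) \<in> L2" by (rule L2_lincomb[OF R IH(1)])
  moreover have "AE x in lebesgue. T (\<lambda>y. f R y + (\<Sum>Q\<in>E. f Q y)) x = T (f R) x + (\<Sum>Q\<in>E. T (f Q) x)"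
    using T_add[OF R IH(1)] IH(2) by eventually_elim simp
  ultimately show ?case using insert by simp
qed

text \<open>Calderon-Zygmund decomposition, with only finitely many cubes treated as bad at a time
  because \<open>T\<close> is only finitely additive. The remainder tends to 0 in L^2 and disappears
  in the limit, but it claims a third share of the level, hence \<open>3 * t\<close>.\<close>

lemma weak_type_L2_three:
  assumes g: "g \<in> L2" "integrable lebesgue g" and t: "0 < t"
  shows "emeasure lebesgue {x. \<bar>T g x\<bar> > 3 * t} \<le> ennreal (4 * 2 ^ CARD('n) * N * (LINT x|lebesgue. \<bar>g x\<bar>) / t)"
proof -
  \<comment> \<open>The height t / N balances the parts: the L^2 estimate of the good part and the
    measure of the doubled cubes both become multiples of N I / t.\<close>
  define \<alpha> where "\<alpha> = t / N"
  have \<alpha>: "\<alpha> > 0" using t N_pos by (simp add: \<alpha>_def)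
  define I where "I = (LINT x|lebesgue. \<bar>g x\<bar>)"
  define c where "c = (2 ^ CARD('n) :: real)"
  have c2: "2 \<le> c" unfolding c_def using self_le_power[of "2::real" "CARD('n)"] by simp
  note gm [measurable] = L2D(1)[OF g(1)]
  have gi: "integrable lebesgue (\<lambda>x. \<bar>g x\<bar>)" using g(2) by simp
  have I: "(\<integral>\<^sup>+x. ennreal \<bar>g x\<bar> \<partial>lebesgue) = ennreal I" "0 \<le> I"
    unfolding I_def using nn_integral_eq_integral[OF gi] by auto
  define P where "P R \<longleftrightarrow> (\<integral>\<^sup>+x\<in>cube_set R. ennreal \<bar>g x\<bar> \<partial>lebesgue) > ennreal \<alpha> * emeasure lebesgue (cube_set R)" for R :: "'n cube"
  define F where "F = base.maximal_cubes P"
  define \<Omega> where "\<Omega> = (\<Union>Q\<in>F. cube_set Q)"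
  have cF: "countable F" unfolding F_def by (rule base.countable_maximal)
  have dF: "disjoint_family_on cube_set F" unfolding F_def by (rule base.disjoint_maximal)
  have F_cubes: "Q \<in> base.cubes" "is_cube Q" if "Q \<in> F" for Q
    using that base.maximal_cubesD(1) base.is_cube_cubes unfolding F_def by blast+
  have fin: "(\<integral>\<^sup>+x. ennreal \<bar>g x\<bar> \<partial>lebesgue) < top" by (simp add: I)
  have Gm: "(\<lambda>x. ennreal \<bar>g x\<bar>) \<in> borel_measurable lebesgue" by measurable
  note cz = base.calderon_zygmund_cubes[OF Gm fin \<alpha>]
  have \<Omega>m [measurable]: "\<Omega> \<in> sets lebesgue" unfolding \<Omega>_def using cF by (intro sets.countable_UN') auto
  have n\<Omega>: "- \<Omega> \<in> sets lebesgue" using sets.compl_sets[OF \<Omega>m] by (simp add: Compl_eq_Diff_UNIV)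
  have \<Omega>_le: "ennreal \<alpha> * emeasure lebesgue \<Omega> \<le> ennreal I"
    using cz(2) unfolding I \<Omega>_def F_def P_def[abs_def] .
  obtain K0 where K0: "\<And>k x. P (base.cel k x) \<Longrightarrow> k \<le> K0" using cz(1) unfolding P_def by blast
  have off: "\<not> P (base.cel k x)" if "x \<notin> \<Omega>" for k x
  proof
    assume P: "P (base.cel k x)"
    have "\<exists>R\<in>base.maximal_cubes P. cube_set (base.cel k x) \<subseteq> cube_set R"
      by (rule base.maximal_cubes_cover[where P = P and K = K0]) (use K0 P in auto)
    then obtain R where "R \<in> F" "cube_set (base.cel k x) \<subseteq> cube_set R" unfolding F_def by blast
    then show False using that base.self_cell[of x k] unfolding \<Omega>_def by blast
  qed
  \<comment> \<open>\<open>density_null\<close> stands in for Lebesgue's differentiation theorem at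
    the price of a factor 2: where |g| > 2 \<alpha>, means at most \<alpha> leave density at most
    1/2.\<close>
  have g_off: "AE y in lebesgue. y \<notin> \<Omega> \<longrightarrow> \<bar>g y\<bar> \<le> 2 * \<alpha>"
  proof -
    define Z where "Z = {y. \<bar>g y\<bar> > 2 * \<alpha>} - \<Omega>"
    have Zm [measurable]: "Z \<in> sets lebesgue" unfolding Z_def by (intro sets.Diff sets_lebesgue_gt) measurable
    have "emeasure lebesgue Z = 0"
    proof (rule base.density_null[OF Zm, of "1/2" 0])
      fix k x assume x: "x \<in> Z"
      let ?Q = "base.cel k x"
      have "ennreal (2 * \<alpha>) * emeasure lebesgue (Z \<inter> cube_set ?Q) = (\<integral>\<^sup>+y. ennreal (2 * \<alpha>) * indicator (Z \<inter> cube_set ?Q) y \<partial>lebesgue)"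
        by (simp add: nn_integral_cmult)
      also have "\<dots> \<le> (\<integral>\<^sup>+y\<in>cube_set ?Q. ennreal \<bar>g y\<bar> \<partial>lebesgue)"
        by (intro nn_integral_mono) (auto simp: Z_def split: split_indicator intro!: ennreal_leI)
      also have "\<dots> \<le> ennreal \<alpha> * emeasure lebesgue (cube_set ?Q)"
        using off[of x k] x unfolding Z_def P_def by auto
      finally have "ennreal (1 / (2 * \<alpha>)) * (ennreal (2 * \<alpha>) * emeasure lebesgue (Z \<inter> cube_set ?Q)) \<le> ennreal (1 / (2 * \<alpha>)) * (ennreal \<alpha> * emeasure lebesgue (cube_set ?Q))"
        by (intro mult_left_mono) auto
      then show "emeasure lebesgue (Z \<inter> cube_set ?Q) \<le> ennreal (1 / 2) * emeasure lebesgue (cube_set ?Q)"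
        using \<alpha> by (simp flip: mult.assoc ennreal_mult')
    qed auto
    then have "Z \<in> null_sets lebesgue" using Zm by auto
    from AE_not_in[OF this] show ?thesis by eventually_elim (auto simp: Z_def)
  qed
  \<comment> \<open>The parent of a selected cube was not selected, and its volume is larger by the
    factor \<open>c\<close> = 2^n.\<close>
  have Q_le: "(\<integral>\<^sup>+x\<in>cube_set Q. ennreal \<bar>g x\<bar> \<partial>lebesgue) \<le> ennreal (c * \<alpha>) * emeasure lebesgue (cube_set Q)" if Q: "Q \<in> F" for Q
  proof -
    obtain k x where k: "Q = base.cel k x" using F_cubes(1)[OF Q] by (rule base.cubesE)
    let ?R = "base.cel (k + 1) x"
    have sub: "cube_set Q \<subseteq> cube_set ?R" unfolding k by (rule base.cell_mono) simp
    have "?R \<noteq> Q" unfolding k using base.cell_inj by fastforce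
    then have "\<not> P ?R" using base.maximal_cubes_max[of Q P ?R] Q sub unfolding F_def by auto
    have "(\<integral>\<^sup>+x\<in>cube_set Q. ennreal \<bar>g x\<bar> \<partial>lebesgue) \<le> (\<integral>\<^sup>+x\<in>cube_set ?R. ennreal \<bar>g x\<bar> \<partial>lebesgue)"
      using sub by (intro nn_integral_mono) (auto split: split_indicator)
    also have "\<dots> \<le> ennreal \<alpha> * emeasure lebesgue (cube_set ?R)" using \<open>\<not> P ?R\<close> unfolding P_def by simp
    also have "emeasure lebesgue (cube_set ?R) = ennreal c * emeasure lebesgue (cube_set Q)"
      unfolding k by (simp add: emeasure_cube_set base.side_cell power_int_add c_def power_mult_distrib flip: ennreal_mult')
    finally show ?thesis using \<alpha> c2 by (simp add: ennreal_mult' mult_ac)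
  qed
  have Qi: "(LINT x|lebesgue. indicat_real (cube_set Q) x * \<bar>g x\<bar>) = enn2real (\<integral>\<^sup>+x\<in>cube_set Q. ennreal \<bar>g x\<bar> \<partial>lebesgue)" for Q :: "'n cube"
    by (subst integral_eq_nn_integral) (auto intro!: arg_cong[where f = enn2real] nn_integral_cong split: split_indicator)
  have e2r: "ennreal (enn2real x) \<le> x" for x :: ennreal by (cases x) auto
  have avg_le: "\<bar>avg g Q\<bar> \<le> c * \<alpha>" if Q: "Q \<in> F" for Q
  proof -
    note cu = F_cubes(2)[OF Q]
    have m0: "measure lebesgue (cube_set Q) > 0" using cu by (simp add: measure_cube_set is_cube_def)
    have "(LINT x|lebesgue. indicat_real (cube_set Q) x * \<bar>g x\<bar>) \<le> enn2real (ennreal (c * \<alpha>) * emeasure lebesgue (cube_set Q))"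
      unfolding Qi by (rule enn2real_mono[OF Q_le[OF Q]]) (use cu in \<open>simp add: ennreal_mult_less_top\<close>)
    also have "\<dots> = c * \<alpha> * measure lebesgue (cube_set Q)"
      using \<alpha> c2 by (simp add: enn2real_mult measure_def)
    finally show ?thesis using abs_avg_le[OF g(2) cu] m0 by (smt (verit) mult_le_cancel_right_pos)
  qed
  define \<Omega>' where "\<Omega>' = (\<Union>Q\<in>F. cube_set (dilate 2 Q))"
  have \<Omega>'m [measurable]: "\<Omega>' \<in> sets lebesgue" unfolding \<Omega>'_def using cF by (intro sets.countable_UN') auto
  have n\<Omega>' [measurable]: "- \<Omega>' \<in> sets lebesgue" using sets.compl_sets[OF \<Omega>'m] by (simp add: Compl_eq_Diff_UNIV)
  have \<Omega>'_le: "emeasure lebesgue \<Omega>' \<le> ennreal (c * N * I / t)"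
  proof -
    have "emeasure lebesgue \<Omega>' \<le> ennreal c * emeasure lebesgue \<Omega>"
      unfolding \<Omega>'_def \<Omega>_def by (rule emeasure_UN_packing) (auto simp: cF dF emeasure_dilate F_cubes c_def)
    also have "emeasure lebesgue \<Omega> = ennreal (1 / \<alpha>) * (ennreal \<alpha> * emeasure lebesgue \<Omega>)"
      using \<alpha> by (simp flip: mult.assoc ennreal_mult')
    also have "ennreal c * (ennreal (1 / \<alpha>) * (ennreal \<alpha> * emeasure lebesgue \<Omega>)) \<le> ennreal c * (ennreal (1 / \<alpha>) * ennreal I)"
      by (intro mult_left_mono \<Omega>_le) auto
    also have "\<dots> = ennreal (c * N * I / t)"
      using \<alpha> c2 I(2) N_pos t by (simp add: \<alpha>_def flip: ennreal_mult')
    finally show ?thesis .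
  qed
  obtain E :: "nat \<Rightarrow> 'n cube set" where E': "(\<forall>m. finite (E m) \<and> E m \<subseteq> F) \<and> (\<forall>Q\<in>F. \<exists>m0. \<forall>m\<ge>m0. Q \<in> E m)"
    using countable_finite_exhaustion[OF cF] by (elim exE) (rule that)
  have E: "finite (E m)" "E m \<subseteq> F" "Q \<in> F \<Longrightarrow> \<exists>m0. \<forall>m\<ge>m0. Q \<in> E m" for m Q
    using E' by (blast, blast, blast)
  have dE: "disjoint_family_on cube_set (E m)" for m by (rule disjoint_family_on_mono[OF E(2) dF])
  \<comment> \<open>On the selected cubes outside \<open>E m\<close> the good part is 0 and
    \<open>rest m\<close> carries all of g.\<close>
  define good where "good m y = g y * indicat_real (- \<Omega>) y + (\<Sum>Q\<in>E m. avg g Q * indicat_real (cube_set Q) y)" for m y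
  define bad where "bad Q y = g y * indicat_real (cube_set Q) y - avg g Q * indicat_real (cube_set Q) y" for Q :: "'n cube" and y
  define rest where "rest m y = g y * indicat_real (\<Omega> - (\<Union>Q\<in>E m. cube_set Q)) y" for m y
  have UEm [measurable]: "(\<Union>Q\<in>E m. cube_set Q) \<in> sets lebesgue" for m using E(1) by auto
  have dec: "g y = good m y + (\<Sum>Q\<in>E m. bad Q y) + rest m y" for m y
  proof (cases "y \<in> (\<Union>Q\<in>E m. cube_set Q)")
    case True
    then obtain Q where Q: "Q \<in> E m" "y \<in> cube_set Q" by blast
    have "(\<Sum>Q\<in>E m. bad Q y) = (\<Sum>Q\<in>E m. (g y - avg g Q) * indicat_real (cube_set Q) y)" by (simp add: bad_def left_diff_distrib)
    also have "\<dots> = g y - avg g Q" by (rule sum_disjoint_indicator[OF E(1) dE Q])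
    finally have 1: "(\<Sum>Q\<in>E m. bad Q y) = g y - avg g Q" .
    have "(\<Sum>Q\<in>E m. avg g Q * indicat_real (cube_set Q) y) = avg g Q" by (rule sum_disjoint_indicator[OF E(1) dE Q])
    moreover have "y \<in> \<Omega>" using Q E(2) by (auto simp: \<Omega>_def)
    ultimately have "good m y = avg g Q" "rest m y = 0" using True by (auto simp: good_def rest_def)
    then show ?thesis using 1 by simp
  next
    case False
    then have "(\<Sum>Q\<in>E m. bad Q y) = 0" "(\<Sum>Q\<in>E m. avg g Q * indicat_real (cube_set Q) y) = 0"
      by (auto simp: bad_def intro!: sum.neutral)
    then show ?thesis using False by (auto simp: good_def rest_def split: split_indicator)
  qed
  have cubeL2: "(\<lambda>y. a * indicat_real (cube_set Q) y) \<in> L2" if "is_cube Q" for Q :: "'n cube" and a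
  proof -
    have "(\<lambda>y. (a * indicat_real (cube_set Q) y)\<^sup>2) = (\<lambda>y. a\<^sup>2 * indicat_real (cube_set Q) y)"
      by (auto simp: indicator_def)
    then show ?thesis using that by (simp add: L2_def)
  qed
  have gL2: "(\<lambda>y. g y * indicat_real S y) \<in> L2" if "S \<in> sets lebesgue" for S
    by (rule L2_bound[OF g(1)]) (use that in \<open>auto split: split_indicator\<close>)
  have badL: "bad Q \<in> L2" if "Q \<in> F" for Q
    unfolding bad_def by (intro L2_diff gL2 cubeL2 F_cubes that) auto
  have restL: "rest m \<in> L2" for m unfolding rest_def by (intro gL2) auto
  have goodL: "good m \<in> L2" for m
  proof -
    have "(\<lambda>y. \<Sum>Q\<in>E m. avg g Q * indicat_real (cube_set Q) y) \<in> L2"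
      using T_sum[OF E(1), of m "\<lambda>Q y. avg g Q * indicat_real (cube_set Q) y"] cubeL2 F_cubes(2) E(2) by blast
    from L2_lincomb[OF gL2[OF n\<Omega>] this, of 1] show ?thesis by (simp add: good_def[abs_def])
  qed
  have good_sq: "(LINT y|lebesgue. (good m y)\<^sup>2) \<le> c * \<alpha> * I" for m
  proof -
    let ?w = "\<lambda>y. \<bar>g y\<bar> * indicat_real (- \<Omega>) y + (\<Sum>Q\<in>E m. \<bar>avg g Q\<bar> * indicat_real (cube_set Q) y)"
    have i1: "integrable lebesgue (\<lambda>y. \<bar>g y\<bar> * indicat_real S y)" if "S \<in> sets lebesgue" for S
      using gi that by (intro integrable_real_mult_indicator) auto
    have i2: "integrable lebesgue (\<lambda>y. a * indicat_real (cube_set Q) y)" if "Q \<in> E m" for Q a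
    proof -
      have "is_cube Q" using F_cubes(2) E(2) that by blast
      then show ?thesis by simp
    qed
    have "(LINT y|lebesgue. (good m y)\<^sup>2) \<le> (LINT y|lebesgue. (c * \<alpha>) * ?w y)"
    proof (rule integral_mono_AE)
      show "integrable lebesgue (\<lambda>y. (good m y)\<^sup>2)" using goodL L2D by blast
      show "integrable lebesgue (\<lambda>y. (c * \<alpha>) * ?w y)"
        by (rule integrable_mult_right, rule Bochner_Integration.integrable_add, rule i1[OF n\<Omega>],
            rule Bochner_Integration.integrable_sum, rule i2)
      show "AE y in lebesgue. (good m y)\<^sup>2 \<le> (c * \<alpha>) * ?w y"
        using g_off
      proof eventually_elim
        case (elim y)
        have "\<bar>good m y\<bar> \<le> c * \<alpha> \<and> \<bar>good m y\<bar> = ?w y"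
        proof (cases "y \<in> (\<Union>Q\<in>E m. cube_set Q)")
          case True
          then obtain Q where Q: "Q \<in> E m" "y \<in> cube_set Q" by blast
          then have "y \<in> \<Omega>" "Q \<in> F" using E(2) by (auto simp: \<Omega>_def)
          then show ?thesis
            using sum_disjoint_indicator[OF E(1) dE Q, of "avg g"] sum_disjoint_indicator[OF E(1) dE Q, of "\<lambda>Q. \<bar>avg g Q\<bar>"] avg_le
            by (simp add: good_def)
        next
          case False
          then have z: "(\<Sum>Q\<in>E m. \<bar>avg g Q\<bar> * indicat_real (cube_set Q) y) = 0" "(\<Sum>Q\<in>E m. avg g Q * indicat_real (cube_set Q) y) = 0"
            by (auto intro!: sum.neutral)
          have "2 * \<alpha> \<le> c * \<alpha>" using c2 \<alpha> by simp
          then have "\<bar>g y\<bar> \<le> c * \<alpha>" if "y \<notin> \<Omega>" using elim that by linarith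
          then show ?thesis using \<alpha> c2 unfolding good_def z by (auto split: split_indicator)
        qed
        then have "\<bar>good m y\<bar> * \<bar>good m y\<bar> \<le> (c * \<alpha>) * ?w y" by (metis abs_ge_zero mult_right_mono)
        then show ?case by (simp add: power2_eq_square)
      qed
    qed
    also have "\<dots> = c * \<alpha> * ((LINT y|lebesgue. \<bar>g y\<bar> * indicat_real (- \<Omega>) y) + (\<Sum>Q\<in>E m. LINT y|lebesgue. \<bar>avg g Q\<bar> * indicat_real (cube_set Q) y))"
      using i1[OF n\<Omega>] i2 by (simp add: Bochner_Integration.integral_add Bochner_Integration.integrable_sum Bochner_Integration.integral_sum)
    also have "\<dots> \<le> c * \<alpha> * ((LINT y|lebesgue. \<bar>g y\<bar> * indicat_real (- \<Omega>) y) + (\<Sum>Q\<in>E m. LINT y|lebesgue. \<bar>g y\<bar> * indicat_real (cube_set Q) y))"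
    proof (intro mult_left_mono add_left_mono sum_mono)
      fix Q assume "Q \<in> E m"
      then have "is_cube Q" using F_cubes(2) E(2) by blast
      from abs_avg_le[OF g(2) this] show "(LINT y|lebesgue. \<bar>avg g Q\<bar> * indicat_real (cube_set Q) y) \<le> (LINT y|lebesgue. \<bar>g y\<bar> * indicat_real (cube_set Q) y)"
        by (simp add: mult.commute)
    qed (use \<alpha> c2 in auto)
    also have "\<dots> = c * \<alpha> * (LINT y|lebesgue. \<bar>g y\<bar> * indicat_real (- \<Omega>) y + (\<Sum>Q\<in>E m. \<bar>g y\<bar> * indicat_real (cube_set Q) y))"
      using i1[OF n\<Omega>] i1 by (simp add: Bochner_Integration.integral_add Bochner_Integration.integrable_sum Bochner_Integration.integral_sum)
    also have "\<dots> \<le> c * \<alpha> * I"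
      unfolding I_def
    proof (intro mult_left_mono integral_mono gi)
      show "integrable lebesgue (\<lambda>y. \<bar>g y\<bar> * indicat_real (- \<Omega>) y + (\<Sum>Q\<in>E m. \<bar>g y\<bar> * indicat_real (cube_set Q) y))"
        by (rule Bochner_Integration.integrable_add, rule i1[OF n\<Omega>], rule Bochner_Integration.integrable_sum, rule i1) simp
      fix y
      show "\<bar>g y\<bar> * indicat_real (- \<Omega>) y + (\<Sum>Q\<in>E m. \<bar>g y\<bar> * indicat_real (cube_set Q) y) \<le> \<bar>g y\<bar>"
      proof (cases "y \<in> (\<Union>Q\<in>E m. cube_set Q)")
        case True
        then obtain Q where Q: "Q \<in> E m" "y \<in> cube_set Q" by blast
        then have "y \<in> \<Omega>" using E(2) by (auto simp: \<Omega>_def)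
        then show ?thesis using sum_disjoint_indicator[OF E(1) dE Q, of "\<lambda>_. \<bar>g y\<bar>"] by simp
      next
        case False
        then have "(\<Sum>Q\<in>E m. \<bar>g y\<bar> * indicat_real (cube_set Q) y) = 0" by (auto intro!: sum.neutral)
        then show ?thesis by (simp split: split_indicator)
      qed
    qed (use \<alpha> c2 in auto)
    finally show ?thesis .
  qed
  have good_w: "emeasure lebesgue {x. \<bar>T (good m) x\<bar> > t} \<le> ennreal (c * N * I / t)" for m
  proof -
    have "emeasure lebesgue {x. \<bar>T (good m) x\<bar> > t} \<le> ennreal (N\<^sup>2 * (LINT x|lebesgue. (good m x)\<^sup>2) / t\<^sup>2)"
      by (rule T_weak_L2[OF goodL t])
    also have "\<dots> \<le> ennreal (N\<^sup>2 * (c * \<alpha> * I) / t\<^sup>2)"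
      by (intro ennreal_leI divide_right_mono mult_left_mono good_sq) auto
    also have "N\<^sup>2 * (c * \<alpha> * I) / t\<^sup>2 = c * N * I / t"
      using t N_pos by (simp add: \<alpha>_def power2_eq_square)
    finally show ?thesis .
  qed
  have bad1: "(\<integral>\<^sup>+y. ennreal \<bar>bad Q y\<bar> \<partial>lebesgue) \<le> 2 * (\<integral>\<^sup>+x\<in>cube_set Q. ennreal \<bar>g x\<bar> \<partial>lebesgue)" if Q: "Q \<in> F" for Q
  proof -
    note cu = F_cubes(2)[OF Q]
    have "(\<integral>\<^sup>+y. ennreal \<bar>bad Q y\<bar> \<partial>lebesgue) \<le> (\<integral>\<^sup>+y. ennreal \<bar>g y\<bar> * indicator (cube_set Q) y + ennreal \<bar>avg g Q\<bar> * indicator (cube_set Q) y \<partial>lebesgue)"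
      by (intro nn_integral_mono) (auto simp: bad_def simp flip: ennreal_plus split: split_indicator intro!: ennreal_leI)
    also have "\<dots> = (\<integral>\<^sup>+x\<in>cube_set Q. ennreal \<bar>g x\<bar> \<partial>lebesgue) + ennreal \<bar>avg g Q\<bar> * emeasure lebesgue (cube_set Q)"
      by (subst nn_integral_add) (auto simp: nn_integral_cmult)
    also have "ennreal \<bar>avg g Q\<bar> * emeasure lebesgue (cube_set Q) = ennreal (\<bar>avg g Q\<bar> * measure lebesgue (cube_set Q))"
      using cu by (simp add: emeasure_eq_ennreal_measure ennreal_mult')
    also have "\<dots> \<le> ennreal (LINT x|lebesgue. indicat_real (cube_set Q) x * \<bar>g x\<bar>)"
      by (intro ennreal_leI abs_avg_le g cu)
    also have "\<dots> \<le> (\<integral>\<^sup>+x\<in>cube_set Q. ennreal \<bar>g x\<bar> \<partial>lebesgue)" unfolding Qi by (rule e2r)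
    finally show ?thesis by (simp add: mult_2 add_left_mono)
  qed
  have atom: "(\<integral>\<^sup>+x\<in>- \<Omega>'. ennreal \<bar>T (bad Q) x\<bar> \<partial>lebesgue) \<le> ennreal (2 * N) * (2 * (\<integral>\<^sup>+x\<in>cube_set Q. ennreal \<bar>g x\<bar> \<partial>lebesgue))" if Q: "Q \<in> F" for Q
  proof -
    note cu = F_cubes(2)[OF Q]
    have "(LINT y|lebesgue. bad Q y) = (LINT y|lebesgue. indicat_real (cube_set Q) y * g y) - avg g Q * measure lebesgue (cube_set Q)"
    proof -
      have "integrable lebesgue (\<lambda>y. g y * indicat_real (cube_set Q) y)" using g(2) by (intro integrable_real_mult_indicator) auto
      moreover have "integrable lebesgue (\<lambda>y. avg g Q * indicat_real (cube_set Q) y)" using cu by (intro integrable_mult_right) auto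
      ultimately show ?thesis unfolding bad_def by (subst Bochner_Integration.integral_diff) (auto simp: mult.commute)
    qed
    then have 0: "(LINT y|lebesgue. bad Q y) = 0" using avg_eq_integral[OF cu, of g] by simp
    have "(\<integral>\<^sup>+x\<in>- \<Omega>'. ennreal \<bar>T (bad Q) x\<bar> \<partial>lebesgue) \<le> (\<integral>\<^sup>+x\<in>- cube_set (dilate 2 Q). ennreal \<bar>T (bad Q) x\<bar> \<partial>lebesgue)"
      using Q by (intro nn_integral_mono) (auto simp: \<Omega>'_def split: split_indicator)
    also have "\<dots> \<le> ennreal (2 * N) * (\<integral>\<^sup>+y. ennreal \<bar>bad Q y\<bar> \<partial>lebesgue)"
      by (rule atom_bound[OF cu badL[OF Q] _ 0]) (simp add: bad_def)
    also have "\<dots> \<le> ennreal (2 * N) * (2 * (\<integral>\<^sup>+x\<in>cube_set Q. ennreal \<bar>g x\<bar> \<partial>lebesgue))"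
      by (intro mult_left_mono bad1 Q) auto
    finally show ?thesis .
  qed
  have bad_w: "emeasure lebesgue ({x. \<bar>T (\<lambda>y. \<Sum>Q\<in>E m. bad Q y) x\<bar> > t} - \<Omega>') \<le> ennreal (4 * N * I / t)" for m
  proof -
    let ?b = "\<lambda>y. \<Sum>Q\<in>E m. bad Q y"
    have bL: "?b \<in> L2" and bT: "AE x in lebesgue. T ?b x = (\<Sum>Q\<in>E m. T (bad Q) x)"
      using T_sum[OF E(1), of m bad] badL E(2) by blast+
    note bm [measurable] = L2D(1)[OF T_L2[OF bL]]
    have Tm: "T (bad Q) \<in> borel_measurable lebesgue" if "Q \<in> E m" for Q using L2D(1)[OF T_L2[OF badL]] E(2) that by blast
    have "emeasure lebesgue ({x. \<bar>T ?b x\<bar> > t} - \<Omega>') \<le> emeasure lebesgue {x \<in> - \<Omega>'. 1 \<le> ennreal (1 / t) * ennreal \<bar>T ?b x\<bar>}"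
    proof (rule emeasure_mono)
      show "{x. \<bar>T ?b x\<bar> > t} - \<Omega>' \<subseteq> {x \<in> - \<Omega>'. 1 \<le> ennreal (1 / t) * ennreal \<bar>T ?b x\<bar>}"
        using t by (auto simp flip: ennreal_mult' ennreal_1 simp: ennreal_le_iff field_simps simp del: ennreal_1)
      have "{x \<in> space lebesgue. 1 \<le> ennreal (1 / t) * ennreal \<bar>T ?b x\<bar>} \<inter> - \<Omega>' \<in> sets lebesgue"
        by (intro sets.Int n\<Omega>') measurable
      also have "{x \<in> space lebesgue. 1 \<le> ennreal (1 / t) * ennreal \<bar>T ?b x\<bar>} \<inter> - \<Omega>' = {x \<in> - \<Omega>'. 1 \<le> ennreal (1 / t) * ennreal \<bar>T ?b x\<bar>}" by auto
      finally show "{x \<in> - \<Omega>'. 1 \<le> ennreal (1 / t) * ennreal \<bar>T ?b x\<bar>} \<in> sets lebesgue" .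
    qed
    also have "\<dots> \<le> ennreal (1 / t) * (\<integral>\<^sup>+x. ennreal \<bar>T ?b x\<bar> * indicator (- \<Omega>') x \<partial>lebesgue)"
      by (rule nn_integral_Markov_inequality) measurable
    also have "(\<integral>\<^sup>+x. ennreal \<bar>T ?b x\<bar> * indicator (- \<Omega>') x \<partial>lebesgue) \<le> (\<integral>\<^sup>+x. (\<Sum>Q\<in>E m. ennreal \<bar>T (bad Q) x\<bar> * indicator (- \<Omega>') x) \<partial>lebesgue)"
      using bT by (intro nn_integral_mono_AE, eventually_elim)
        (auto simp: sum_ennreal split: split_indicator intro!: ennreal_leI sum_abs)
    also have "\<dots> = (\<Sum>Q\<in>E m. \<integral>\<^sup>+x\<in>- \<Omega>'. ennreal \<bar>T (bad Q) x\<bar> \<partial>lebesgue)"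
      using Tm by (intro nn_integral_sum) auto
    also have "\<dots> \<le> (\<Sum>Q\<in>E m. ennreal (2 * N) * (2 * (\<integral>\<^sup>+x\<in>cube_set Q. ennreal \<bar>g x\<bar> \<partial>lebesgue)))"
      using E(2) by (intro sum_mono atom) blast
    also have "\<dots> = ennreal (2 * N) * (2 * (\<Sum>Q\<in>E m. \<integral>\<^sup>+x\<in>cube_set Q. ennreal \<bar>g x\<bar> \<partial>lebesgue))"
      by (simp add: sum_distrib_left)
    also have "(\<Sum>Q\<in>E m. \<integral>\<^sup>+x\<in>cube_set Q. ennreal \<bar>g x\<bar> \<partial>lebesgue) = (\<integral>\<^sup>+x. (\<Sum>Q\<in>E m. ennreal \<bar>g x\<bar> * indicator (cube_set Q) x) \<partial>lebesgue)"
      by (rule nn_integral_sum[symmetric]) auto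
    also have "\<dots> \<le> (\<integral>\<^sup>+x. ennreal \<bar>g x\<bar> \<partial>lebesgue)"
    proof (rule nn_integral_mono)
      fix x
      show "(\<Sum>Q\<in>E m. ennreal \<bar>g x\<bar> * indicator (cube_set Q) x) \<le> ennreal \<bar>g x\<bar>"
      proof (cases "x \<in> (\<Union>Q\<in>E m. cube_set Q)")
        case True
        then obtain Q where Q: "Q \<in> E m" "x \<in> cube_set Q" by blast
        have "(\<Sum>R\<in>E m. ennreal \<bar>g x\<bar> * indicator (cube_set R) x) = (\<Sum>R\<in>E m. if R = Q then ennreal \<bar>g x\<bar> else 0)"
          using Q dE[of m] by (intro sum.cong) (auto simp: disjoint_family_on_def split: split_indicator)
        then show ?thesis using Q E(1) by simp
      next
        case False
        then have "(\<Sum>Q\<in>E m. ennreal \<bar>g x\<bar> * indicator (cube_set Q) x) = 0" by (intro sum.neutral) (auto split: split_indicator)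
        then show ?thesis by simp
      qed
    qed
    also have "\<dots> = ennreal I" by (rule I)
    finally have "emeasure lebesgue ({x. \<bar>T ?b x\<bar> > t} - \<Omega>') \<le> ennreal (1 / t) * (ennreal (2 * N) * (2 * ennreal I))"
      by (simp add: mult_left_mono)
    also have "\<dots> = ennreal (1 / t * (2 * N * (2 * I)))"
    proof -
      have "2 * ennreal I = ennreal (2 * I)" using ennreal_mult'[of 2 I] by simp
      then show ?thesis using t N_pos I(2) by (simp only:) (simp flip: ennreal_mult' )
    qed
    finally show ?thesis by (simp add: mult_ac)
  qed
  have "(\<lambda>m. LINT x|lebesgue. (rest m x)\<^sup>2) \<longlonglongrightarrow> (LINT x|(lebesgue :: (real ^ 'n) measure). (0::real))"
  proof (rule integral_dominated_convergence[where w = "\<lambda>x. (g x)\<^sup>2"])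
    show "integrable lebesgue (\<lambda>x. (g x)\<^sup>2)" by (rule L2D(2)[OF g(1)])
    show "(\<lambda>x. (rest m x)\<^sup>2) \<in> borel_measurable lebesgue" for m using L2D(1)[OF restL[of m]] by measurable
    show "AE x in lebesgue. norm ((rest m x)\<^sup>2) \<le> (g x)\<^sup>2" for m
      by (intro AE_I2) (auto simp: rest_def split: split_indicator)
    show "AE x in lebesgue. (\<lambda>m. (rest m x)\<^sup>2) \<longlonglongrightarrow> 0"
    proof (intro AE_I2)
      fix x
      have "\<exists>m0. \<forall>m\<ge>m0. rest m x = 0"
      proof (cases "x \<in> \<Omega>")
        case True
        then obtain Q where Q: "Q \<in> F" "x \<in> cube_set Q" by (auto simp: \<Omega>_def)
        then obtain m0 where "\<forall>m\<ge>m0. Q \<in> E m" using E(3) by blast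
        then have "\<forall>m\<ge>m0. rest m x = 0" using Q by (auto simp: rest_def split: split_indicator)
        then show ?thesis by blast
      qed (auto simp: rest_def)
      then have "\<forall>\<^sub>F m in sequentially. (rest m x)\<^sup>2 = 0" by (auto simp: eventually_sequentially)
      then show "(\<lambda>m. (rest m x)\<^sup>2) \<longlonglongrightarrow> 0" by (rule tendsto_eventually)
    qed
  qed measurable
  then have lim: "(\<lambda>m. LINT x|lebesgue. (rest m x)\<^sup>2) \<longlonglongrightarrow> 0" by simp
  have main: "emeasure lebesgue {x. \<bar>T g x\<bar> > 3 * t} \<le> ennreal (c * N * I / t) + ennreal (4 * N * I / t) + ennreal (c * N * I / t) + ennreal (N\<^sup>2 * (LINT x|lebesgue. (rest m x)\<^sup>2) / t\<^sup>2)" for m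
  proof -
    let ?b = "\<lambda>y. \<Sum>Q\<in>E m. bad Q y"
    have bL: "?b \<in> L2" using T_sum[OF E(1), of m bad] badL E(2) by blast
    have gb: "(\<lambda>y. good m y + ?b y) \<in> L2" using L2_lincomb[OF goodL bL, of m 1] by simp
    note Tm [measurable] = L2D(1)[OF T_L2[OF g(1)]] L2D(1)[OF T_L2[OF goodL[of m]]] L2D(1)[OF T_L2[OF bL]] L2D(1)[OF T_L2[OF restL[of m]]]
    have eq: "AE x in lebesgue. T g x = T (good m) x + T ?b x + T (rest m) x"
    proof -
      have "g = (\<lambda>y. (good m y + ?b y) + rest m y)" using dec[of _ m] by auto
      then have "AE x in lebesgue. T g x = T (\<lambda>y. good m y + ?b y) x + T (rest m) x" using T_add[OF gb restL[of m]] by simp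
      with T_add[OF goodL[of m] bL] show ?thesis by eventually_elim simp
    qed
    let ?A = "{x. \<bar>T (good m) x\<bar> > t}" and ?B = "{x. \<bar>T ?b x\<bar> > t} - \<Omega>'" and ?D = "{x. \<bar>T (rest m) x\<bar> > t}"
    have sets: "?A \<in> sets lebesgue" "?B \<in> sets lebesgue" "?D \<in> sets lebesgue"
      by (intro sets_lebesgue_gt sets.Diff; measurable)+
    have "emeasure lebesgue {x. \<bar>T g x\<bar> > 3 * t} \<le> emeasure lebesgue (?A \<union> ?B \<union> \<Omega>' \<union> ?D)"
    proof (rule emeasure_mono_AE)
      show "AE x in lebesgue. x \<in> {x. \<bar>T g x\<bar> > 3 * t} \<longrightarrow> x \<in> ?A \<union> ?B \<union> \<Omega>' \<union> ?D"
        using eq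
      proof eventually_elim
        case (elim x)
        then show ?case by (auto simp: abs_if split: if_splits)
      qed
      show "?A \<union> ?B \<union> \<Omega>' \<union> ?D \<in> sets lebesgue" by (intro sets.Un sets \<Omega>'m)
    qed
    also have "\<dots> \<le> emeasure lebesgue (?A \<union> ?B \<union> \<Omega>') + emeasure lebesgue ?D"
      by (intro emeasure_subadditive sets.Un sets \<Omega>'m)
    also have "emeasure lebesgue (?A \<union> ?B \<union> \<Omega>') \<le> emeasure lebesgue (?A \<union> ?B) + emeasure lebesgue \<Omega>'"
      by (intro emeasure_subadditive sets.Un sets \<Omega>'m)
    also have "emeasure lebesgue (?A \<union> ?B) \<le> emeasure lebesgue ?A + emeasure lebesgue ?B"
      by (intro emeasure_subadditive sets)
    also have "emeasure lebesgue ?A \<le> ennreal (c * N * I / t)" by (rule good_w)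
    also have "emeasure lebesgue ?B \<le> ennreal (4 * N * I / t)" by (rule bad_w)
    also have "emeasure lebesgue \<Omega>' \<le> ennreal (c * N * I / t)" by (rule \<Omega>'_le)
    also have "emeasure lebesgue ?D \<le> ennreal (N\<^sup>2 * (LINT x|lebesgue. (rest m x)\<^sup>2) / t\<^sup>2)" by (rule T_weak_L2[OF restL t])
    finally show ?thesis by (simp add: add_mono)
  qed
  have "(\<lambda>m. ennreal (c * N * I / t) + ennreal (4 * N * I / t) + ennreal (c * N * I / t) + ennreal (N\<^sup>2 * (LINT x|lebesgue. (rest m x)\<^sup>2) / t\<^sup>2))
    \<longlonglongrightarrow> ennreal (c * N * I / t) + ennreal (4 * N * I / t) + ennreal (c * N * I / t) + ennreal (N\<^sup>2 * 0 / t\<^sup>2)"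
    using t by (intro tendsto_add tendsto_const tendsto_ennrealI tendsto_divide tendsto_mult lim) auto
  then have "emeasure lebesgue {x. \<bar>T g x\<bar> > 3 * t} \<le> ennreal (c * N * I / t) + ennreal (4 * N * I / t) + ennreal (c * N * I / t) + ennreal (N\<^sup>2 * 0 / t\<^sup>2)"
    by (rule LIMSEQ_le_const) (use main in blast)
  also have "\<dots> = ennreal (c * N * I / t + 4 * N * I / t + c * N * I / t)"
    using c2 N_pos I(2) t by (simp flip: ennreal_plus)
  \<comment> \<open>The middle term is absorbed by 4 \<le> 2 c, which holds because c = 2^n \<ge>
    2.\<close>
  also have "\<dots> \<le> ennreal (4 * c * N * I / t)"
  proof (rule ennreal_leI)
    define z where "z = N * I / t"
    have "2 * z \<le> c * z" using c2 N_pos I(2) t by (intro mult_right_mono) (auto simp: z_def)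
    moreover have e: "c * N * I / t = c * z" "4 * N * I / t = 4 * z" "4 * c * N * I / t = 4 * (c * z)"
      by (simp_all add: z_def)
    ultimately show "c * N * I / t + 4 * N * I / t + c * N * I / t \<le> 4 * c * N * I / t" unfolding e by linarith
  qed
  finally show ?thesis by (simp add: c_def I_def)
qed

text \<open>The weak type constant: 4 times 2^n comes from the decomposition, and another 3 from
  dividing the level into three shares.\<close>

definition W :: real where "W = 12 * 2 ^ CARD('n) * N"

lemma W_pos: "0 < W" using N_pos by (simp add: W_def)

lemma weak_type_L2:
  assumes "g \<in> L2" "integrable lebesgue g" "0 < t"
  shows "emeasure lebesgue {x. \<bar>T g x\<bar> > t} \<le> ennreal (W * (LINT x|lebesgue. \<bar>g x\<bar>) / t)"
  using weak_type_L2_three[OF assms(1,2), of "t / 3"] assms(3) by (simp add: W_def field_simps)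

end

section \<open>Extension to integrable functions\<close>

lemma geometric_increments:
  fixes f :: "nat \<Rightarrow> real"
  assumes "\<And>i. i \<ge> j \<Longrightarrow> \<bar>f (Suc i) - f i\<bar> \<le> (1/2) ^ i"
  shows "convergent f" "\<bar>lim f - f j\<bar> \<le> 2 * (1/2) ^ j"
proof -
  have d: "\<bar>f (p + m) - f p\<bar> \<le> 2 * (1/2) ^ p - 2 * (1/2) ^ (p + m)" if "p \<ge> j" for p m
  proof (induction m)
    case (Suc m)
    have "\<bar>f (Suc (p + m)) - f (p + m)\<bar> \<le> (1/2) ^ (p + m)" by (rule assms) (use that in simp)
    with Suc show ?case by simp
  qed simp
  have d': "\<bar>f (p + m) - f p\<bar> \<le> 2 * (1/2) ^ p" if "p \<ge> j" for p m
  proof -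
    have "(0::real) \<le> (1/2) ^ (p + m)" by simp
    then show ?thesis using d[OF that, of m] by linarith
  qed
  have "Cauchy f"
  proof (rule CauchyI)
    fix e :: real assume e: "e > 0"
    obtain q where q: "(1/2::real) ^ q < e / 4" using real_arch_pow_inv[of "e / 4" "1/2"] e by auto
    define p where "p = max j q"
    have "(1/2::real) ^ p \<le> (1/2) ^ q" by (rule power_decreasing) (auto simp: p_def)
    then have pe: "2 * (1/2::real) ^ p < e / 2" using q by linarith
    have "norm (f m - f n) < e" if "m \<ge> p" "n \<ge> p" for m n
      using d'[of p "m - p"] d'[of p "n - p"] that pe by (simp add: p_def)
    then show "\<exists>M. \<forall>m\<ge>M. \<forall>n\<ge>M. norm (f m - f n) < e" by blast
  qed
  then show c: "convergent f" by (simp add: Cauchy_convergent_iff)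
  then have "(\<lambda>m. f (j + m)) \<longlonglongrightarrow> lim f" using LIMSEQ_ignore_initial_segment[of f "lim f" j] by (simp add: convergent_LIMSEQ_iff add.commute)
  then have "(\<lambda>m. \<bar>f (j + m) - f j\<bar>) \<longlonglongrightarrow> \<bar>lim f - f j\<bar>" by (intro tendsto_intros)
  then show "\<bar>lim f - f j\<bar> \<le> 2 * (1/2) ^ j" by (rule LIMSEQ_le_const2) (use d' in auto)
qed

lemma ennreal_tendsto_0:
  fixes f g :: "nat \<Rightarrow> ennreal"
  assumes "g \<longlonglongrightarrow> 0" "\<And>k. f k \<le> g k" shows "f \<longlonglongrightarrow> 0"
  by (rule tendsto_sandwich[OF _ _ tendsto_const assms(1)]) (use assms(2) in auto)

lemma emeasure_gt_split:
  fixes u v w :: "real ^ 'n::finite \<Rightarrow> real"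
  assumes "u \<in> borel_measurable lebesgue" "v \<in> borel_measurable lebesgue"
    and "AE x in lebesgue. \<bar>w x\<bar> \<le> \<bar>u x\<bar> + \<bar>v x\<bar>"
  shows "emeasure lebesgue {x. \<bar>w x\<bar> > s + t} \<le> emeasure lebesgue {x. \<bar>u x\<bar> > s} + emeasure lebesgue {x. \<bar>v x\<bar> > t}"
proof -
  have m: "{x. \<bar>u x\<bar> > s} \<in> sets lebesgue" "{x. \<bar>v x\<bar> > t} \<in> sets lebesgue"
    by (intro sets_lebesgue_gt; use assms in measurable)+
  have "emeasure lebesgue {x. \<bar>w x\<bar> > s + t} \<le> emeasure lebesgue ({x. \<bar>u x\<bar> > s} \<union> {x. \<bar>v x\<bar> > t})"
    by (rule emeasure_mono_AE) (use assms(3) m in \<open>auto elim!: eventually_mono\<close>)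
  also have "\<dots> \<le> emeasure lebesgue {x. \<bar>u x\<bar> > s} + emeasure lebesgue {x. \<bar>v x\<bar> > t}"
    by (rule emeasure_subadditive[OF m])
  finally show ?thesis .
qed

lemma meas_tendsto_add:
  fixes F G :: "nat \<Rightarrow> real ^ 'n::finite \<Rightarrow> real"
  assumes F: "meas_tendsto F u" and G: "meas_tendsto G v"
    and [measurable]: "\<And>k. F k \<in> borel_measurable lebesgue" "\<And>k. G k \<in> borel_measurable lebesgue"
      "u \<in> borel_measurable lebesgue" "v \<in> borel_measurable lebesgue"
  shows "meas_tendsto (\<lambda>k x. F k x + G k x) (\<lambda>x. u x + v x)"
  unfolding meas_tendsto_def
proof (intro allI impI)
  fix e :: real assume "e > 0"
  then have e: "e / 2 > 0" by simp
  have "(\<lambda>k. emeasure lebesgue {x. \<bar>F k x - u x\<bar> > e / 2} + emeasure lebesgue {x. \<bar>G k x - v x\<bar> > e / 2}) \<longlonglongrightarrow> 0 + 0"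
    using F G e unfolding meas_tendsto_def by (intro tendsto_add) blast+
  then have l: "(\<lambda>k. emeasure lebesgue {x. \<bar>F k x - u x\<bar> > e / 2} + emeasure lebesgue {x. \<bar>G k x - v x\<bar> > e / 2}) \<longlonglongrightarrow> 0" by simp
  have "emeasure lebesgue {x. \<bar>F k x + G k x - (u x + v x)\<bar> > e / 2 + e / 2} \<le> emeasure lebesgue {x. \<bar>F k x - u x\<bar> > e / 2} + emeasure lebesgue {x. \<bar>G k x - v x\<bar> > e / 2}" for k
  proof (rule emeasure_gt_split)
    show "AE x in lebesgue. \<bar>F k x + G k x - (u x + v x)\<bar> \<le> \<bar>F k x - u x\<bar> + \<bar>G k x - v x\<bar>"
      by (intro AE_I2) linarith
  qed measurable
  then show "(\<lambda>k. emeasure lebesgue {x. \<bar>F k x + G k x - (u x + v x)\<bar> > e}) \<longlonglongrightarrow> 0"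
    by (intro ennreal_tendsto_0[OF l]) simp
qed

lemma meas_tendsto_cmult:
  fixes F :: "nat \<Rightarrow> real ^ 'n::finite \<Rightarrow> real"
  assumes F: "meas_tendsto F u"
  shows "meas_tendsto (\<lambda>k x. c * F k x) (\<lambda>x. c * u x)"
  unfolding meas_tendsto_def
proof (intro allI impI)
  fix e :: real assume e: "e > 0"
  show "(\<lambda>k. emeasure lebesgue {x. \<bar>c * F k x - c * u x\<bar> > e}) \<longlonglongrightarrow> 0"
  proof (cases "c = 0")
    case True
    then show ?thesis using e by simp
  next
    case False
    have "\<bar>c * F k x - c * u x\<bar> = \<bar>c\<bar> * \<bar>F k x - u x\<bar>" for k x
      by (simp add: abs_mult[symmetric] right_diff_distrib)
    then have "{x. \<bar>c * F k x - c * u x\<bar> > e} = {x. \<bar>F k x - u x\<bar> > e / \<bar>c\<bar>}" for k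
      using False by (simp add: field_simps)
    then show ?thesis using F e False unfolding meas_tendsto_def by simp
  qed
qed

definition trunc :: "(real ^ 'n::finite \<Rightarrow> real) \<Rightarrow> nat \<Rightarrow> real ^ 'n \<Rightarrow> real" where
  "trunc g m y = (if \<bar>g y\<bar> \<le> real m then g y else 0)"

text \<open>Where g is not cut off, g^2 \<le> m |g|, so the truncations lie in both L^1 and L^2 and
  can be fed to \<open>T\<close>.\<close>

lemma trunc_props:
  fixes g :: "real ^ 'n::finite \<Rightarrow> real"
  assumes g: "integrable lebesgue g"
  shows "trunc g m \<in> L2" "integrable lebesgue (trunc g m)" "\<bar>trunc g m y\<bar> \<le> \<bar>g y\<bar>"
    "(\<lambda>m. trunc g m y) \<longlonglongrightarrow> g y" "(\<lambda>m. LINT y|lebesgue. \<bar>trunc g m y - g y\<bar>) \<longlonglongrightarrow> 0"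
proof -
  note [measurable] = borel_measurable_integrable[OF g]
  have m [measurable]: "trunc g m \<in> borel_measurable lebesgue" for m unfolding trunc_def[abs_def] by measurable
  show le: "\<bar>trunc g m y\<bar> \<le> \<bar>g y\<bar>" for m y by (simp add: trunc_def)
  show "integrable lebesgue (trunc g m)" by (rule Bochner_Integration.integrable_bound[OF g m]) (use le in auto)
  have "integrable lebesgue (\<lambda>y. (trunc g m y)\<^sup>2)"
  proof (rule Bochner_Integration.integrable_bound)
    show "integrable lebesgue (\<lambda>y. real m * \<bar>g y\<bar>)" using g by simp
    show "AE y in lebesgue. norm ((trunc g m y)\<^sup>2) \<le> norm (real m * \<bar>g y\<bar>)"
    proof (intro AE_I2)
      fix y
      have "\<bar>g y\<bar> * \<bar>g y\<bar> \<le> real m * \<bar>g y\<bar>" if "\<bar>g y\<bar> \<le> real m"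
        using that by (rule mult_right_mono) simp
      then show "norm ((trunc g m y)\<^sup>2) \<le> norm (real m * \<bar>g y\<bar>)"
        by (auto simp: trunc_def power2_eq_square)
    qed
  qed measurable
  then show "trunc g m \<in> L2" using m by (simp add: L2_def)
  show lim: "(\<lambda>m. trunc g m y) \<longlonglongrightarrow> g y" for y
  proof -
    obtain m0 :: nat where "\<bar>g y\<bar> \<le> real m0" using real_arch_simple by blast
    then have "\<forall>m\<ge>m0. trunc g m y = g y" by (auto simp: trunc_def)
    then show ?thesis by (intro tendsto_eventually) (auto simp: eventually_sequentially)
  qed
  have "(\<lambda>m. LINT y|lebesgue. \<bar>trunc g m y - g y\<bar>) \<longlonglongrightarrow> (LINT y|(lebesgue :: (real ^ 'n) measure). (0::real))"
  proof (rule integral_dominated_convergence[where w = "\<lambda>y. \<bar>g y\<bar>"])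
    show "AE y in lebesgue. (\<lambda>m. \<bar>trunc g m y - g y\<bar>) \<longlonglongrightarrow> 0"
    proof (intro AE_I2)
      fix y
      have "(\<lambda>m. \<bar>trunc g m y - g y\<bar>) \<longlonglongrightarrow> \<bar>g y - g y\<bar>" by (intro tendsto_intros lim)
      then show "(\<lambda>m. \<bar>trunc g m y - g y\<bar>) \<longlonglongrightarrow> 0" by simp
    qed
    show "AE y in lebesgue. norm \<bar>trunc g m y - g y\<bar> \<le> \<bar>g y\<bar>" for m
      by (intro AE_I2) (auto simp: trunc_def)
  qed (use g in auto)
  then show "(\<lambda>m. LINT y|lebesgue. \<bar>trunc g m y - g y\<bar>) \<longlonglongrightarrow> 0" by simp
qed

context hormander_setting
begin

lemma T_diff_weak:
  assumes "f \<in> L2" "integrable lebesgue f" "g \<in> L2" "integrable lebesgue g" "0 < t"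
  shows "emeasure lebesgue {x. \<bar>T f x - T g x\<bar> > t} \<le> ennreal (W * (LINT x|lebesgue. \<bar>f x - g x\<bar>) / t)"
proof -
  have "emeasure lebesgue {x. \<bar>T f x - T g x\<bar> > t} = emeasure lebesgue {x. \<bar>T (\<lambda>y. f y - g y) x\<bar> > t}"
  proof (rule emeasure_eq_AE)
    show "AE x in lebesgue. x \<in> {x. \<bar>T f x - T g x\<bar> > t} \<longleftrightarrow> x \<in> {x. \<bar>T (\<lambda>y. f y - g y) x\<bar> > t}"
      using T_diff[OF assms(1,3)] by eventually_elim simp
    show "{x. \<bar>T f x - T g x\<bar> > t} \<in> sets lebesgue" "{x. \<bar>T (\<lambda>y. f y - g y) x\<bar> > t} \<in> sets lebesgue"
      using L2D(1)[OF T_L2[OF assms(1)]] L2D(1)[OF T_L2[OF assms(3)]] L2D(1)[OF T_L2[OF L2_diff[OF assms(1,3)]]]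
      by (auto intro!: sets_lebesgue_gt)
  qed
  also have "\<dots> \<le> ennreal (W * (LINT x|lebesgue. \<bar>f x - g x\<bar>) / t)"
    using assms by (intro weak_type_L2 L2_diff) auto
  finally show ?thesis .
qed

text \<open>Approximants with L^1 error 4^(-j) have increments above 2^(-j) only on sets of measure
  O(2^(-j)), by the weak type bound, so they converge almost everywhere. Comparison with this
  sequence at a late index shows that every other approximating sequence has the same limit in
  measure.\<close>

lemma L1_extension_exists:
  assumes g: "integrable lebesgue g" shows "\<exists>u. L1_extension_value T g u"
proof -
  have "\<exists>h. h \<in> L2 \<and> integrable lebesgue h \<and> (LINT y|lebesgue. \<bar>h y - g y\<bar>) \<le> (1/4) ^ j" for j :: nat
  proof -
    have "\<forall>\<^sub>F m in sequentially. (LINT y|lebesgue. \<bar>trunc g m y - g y\<bar>) < (1/4) ^ j"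
      by (rule order_tendstoD(2)[OF trunc_props(5)[OF g]]) simp
    then obtain m where "(LINT y|lebesgue. \<bar>trunc g m y - g y\<bar>) < (1/4) ^ j" by (auto simp: eventually_sequentially)
    then show ?thesis using trunc_props(1,2)[OF g] less_imp_le by blast
  qed
  then obtain h where h: "\<And>j. h j \<in> L2" "\<And>j. integrable lebesgue (h j)" "\<And>j. (LINT y|lebesgue. \<bar>h j y - g y\<bar>) \<le> (1/4) ^ j"
    by metis
  have Tm [measurable]: "T (h j) \<in> borel_measurable lebesgue" for j by (rule L2D(1)[OF T_L2[OF h(1)]])
  define u where "u x = lim (\<lambda>j. T (h j) x)" for x
  have um [measurable]: "u \<in> borel_measurable lebesgue" unfolding u_def by (rule borel_measurable_lim_metric) simp
  define D where "D j = {x. \<bar>T (h (Suc j)) x - T (h j) x\<bar> > (1/2) ^ j}" for j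
  have Dm [measurable]: "D j \<in> sets lebesgue" for j unfolding D_def by (intro sets_lebesgue_gt) measurable
  have D_le: "emeasure lebesgue (D j) \<le> ennreal (2 * W * (1/2) ^ j)" for j
  proof -
    have "(LINT y|lebesgue. \<bar>h (Suc j) y - h j y\<bar>) \<le> (LINT y|lebesgue. \<bar>h (Suc j) y - g y\<bar> + \<bar>h j y - g y\<bar>)"
      by (rule integral_mono) (use h g in auto)
    also have "\<dots> = (LINT y|lebesgue. \<bar>h (Suc j) y - g y\<bar>) + (LINT y|lebesgue. \<bar>h j y - g y\<bar>)"
      by (rule Bochner_Integration.integral_add) (use h g in auto)
    also have "\<dots> \<le> (1/4) ^ Suc j + (1/4) ^ j" by (intro add_mono h)
    also have "\<dots> \<le> 2 * (1/4) ^ j" by simp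
    finally have i: "(LINT y|lebesgue. \<bar>h (Suc j) y - h j y\<bar>) \<le> 2 * (1/4) ^ j" .
    have "emeasure lebesgue (D j) \<le> ennreal (W * (LINT y|lebesgue. \<bar>h (Suc j) y - h j y\<bar>) / (1/2) ^ j)"
      unfolding D_def by (rule T_diff_weak[OF h(1,2) h(1,2)]) simp
    also have "\<dots> \<le> ennreal (W * (2 * (1/4) ^ j) / (1/2) ^ j)"
      using W_pos by (intro ennreal_leI divide_right_mono mult_left_mono i) auto
    also have "W * (2 * (1/4) ^ j) / (1/2) ^ j = 2 * W * (1/2) ^ j"
    proof -
      have "(1/4::real) ^ j = (1/2) ^ j * (1/2) ^ j" by (simp flip: power_mult_distrib)
      then show ?thesis by simp
    qed
    finally show ?thesis .
  qed
  \<comment> \<open>Off the tail union \<open>B j\<close> every increment with index i \<ge> j is at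
    most 2^(-i), so the limit exists there and differs from the j-th term by at most 2 times
    2^(-j).\<close>
  define B where "B j = (\<Union>i. D (j + i))" for j
  have Bm [measurable]: "B j \<in> sets lebesgue" for j unfolding B_def by auto
  have B_le: "emeasure lebesgue (B j) \<le> ennreal (4 * W * (1/2) ^ j)" for j
  proof -
    have "emeasure lebesgue (B j) \<le> (\<Sum>i. emeasure lebesgue (D (j + i)))"
      unfolding B_def by (rule emeasure_subadditive_countably) auto
    also have "\<dots> \<le> (\<Sum>i. ennreal (2 * W * (1/2) ^ j * (1/2) ^ i))"
    proof (rule suminf_le[OF _ summableI summableI])
      fix i show "emeasure lebesgue (D (j + i)) \<le> ennreal (2 * W * (1/2) ^ j * (1/2) ^ i)"
        using D_le[of "j + i"] by (simp add: power_add mult.assoc)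
    qed
    also have "\<dots> = ennreal (\<Sum>i. 2 * W * (1/2) ^ j * (1/2) ^ i)"
      using W_pos by (intro suminf_ennreal2 summable_mult summable_geometric) auto
    also have "(\<Sum>i. 2 * W * (1/2) ^ j * (1/2::real) ^ i) = 4 * W * (1/2) ^ j"
      by (subst suminf_mult) (auto simp: suminf_geometric)
    finally show ?thesis .
  qed
  have hu: "emeasure lebesgue {x. \<bar>T (h j) x - u x\<bar> > e} \<le> ennreal (4 * W * (1/2) ^ j)" if e: "2 * (1/2) ^ j \<le> e" for j e
  proof -
    have "emeasure lebesgue {x. \<bar>T (h j) x - u x\<bar> > e} \<le> emeasure lebesgue (B j)"
    proof (rule emeasure_mono)
      show "{x. \<bar>T (h j) x - u x\<bar> > e} \<subseteq> B j"
      proof (rule ccontr)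
        assume "\<not> ?thesis"
        then obtain x where x: "\<bar>T (h j) x - u x\<bar> > e" "x \<notin> B j" by blast
        have "\<bar>T (h (Suc i)) x - T (h i) x\<bar> \<le> (1/2) ^ i" if "i \<ge> j" for i
        proof -
          have "x \<notin> D (j + (i - j))" using x(2) unfolding B_def by blast
          then show ?thesis using that by (simp add: D_def)
        qed
        then have "\<bar>u x - T (h j) x\<bar> \<le> 2 * (1/2) ^ j" unfolding u_def by (rule geometric_increments(2))
        then show False using x(1) e by linarith
      qed
    qed simp
    then show ?thesis using B_le by (rule order_trans)
  qed
  have "L1_extension_value T g u"
    unfolding L1_extension_value_def
  proof (intro conjI g um allI impI)
    fix G :: "nat \<Rightarrow> real ^ 'n \<Rightarrow> real" and e :: real
    assume G: "(\<forall>k. G k \<in> L2 \<and> integrable lebesgue (G k)) \<and> (\<lambda>k. LINT x|lebesgue. \<bar>G k x - g x\<bar>) \<longlonglongrightarrow> 0" and e: "0 < e"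
    have le: "emeasure lebesgue {x. \<bar>T (G k) x - u x\<bar> > e} \<le> ennreal (W * (LINT x|lebesgue. \<bar>G k x - g x\<bar>) / (e / 2))" for k
    proof -
      let ?I = "LINT x|lebesgue. \<bar>G k x - g x\<bar>"
      have I0: "0 \<le> ?I" by simp
      have Gk: "G k \<in> L2" "integrable lebesgue (G k)" using G by auto
      have Gm [measurable]: "T (G k) \<in> borel_measurable lebesgue" by (rule L2D(1)[OF T_L2[OF Gk(1)]])
      obtain j0 where j0: "(1/2::real) ^ j0 < e / 4" using real_arch_pow_inv[of "e / 4" "1/2"] e by auto
      have "emeasure lebesgue {x. \<bar>T (G k) x - u x\<bar> > e} \<le> ennreal (W * (?I + (1/4) ^ j) / (e / 2)) + ennreal (4 * W * (1/2) ^ j)" if "j \<ge> j0" for j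
      proof -
        have "(1/2::real) ^ j \<le> (1/2) ^ j0" using that by (intro power_decreasing) auto
        then have je: "2 * (1/2) ^ j \<le> e / 2" using j0 by linarith
        have "emeasure lebesgue {x. \<bar>T (G k) x - u x\<bar> > e / 2 + e / 2} \<le> emeasure lebesgue {x. \<bar>T (G k) x - T (h j) x\<bar> > e / 2} + emeasure lebesgue {x. \<bar>T (h j) x - u x\<bar> > e / 2}"
        proof (rule emeasure_gt_split)
          show "AE x in lebesgue. \<bar>T (G k) x - u x\<bar> \<le> \<bar>T (G k) x - T (h j) x\<bar> + \<bar>T (h j) x - u x\<bar>"
            by (intro AE_I2) linarith
        qed measurable
        also have "\<dots> \<le> ennreal (W * (LINT x|lebesgue. \<bar>G k x - h j x\<bar>) / (e / 2)) + ennreal (4 * W * (1/2) ^ j)"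
          using e by (intro add_mono hu je T_diff_weak Gk h) auto
        also have "\<dots> \<le> ennreal (W * (?I + (1/4) ^ j) / (e / 2)) + ennreal (4 * W * (1/2) ^ j)"
        proof (intro add_right_mono ennreal_leI divide_right_mono mult_left_mono)
          have "(LINT x|lebesgue. \<bar>G k x - h j x\<bar>) \<le> (LINT x|lebesgue. \<bar>G k x - g x\<bar> + \<bar>h j x - g x\<bar>)"
            by (rule integral_mono) (use h g Gk in auto)
          also have "\<dots> = ?I + (LINT x|lebesgue. \<bar>h j x - g x\<bar>)"
            by (rule Bochner_Integration.integral_add) (use h g Gk in auto)
          finally show "(LINT x|lebesgue. \<bar>G k x - h j x\<bar>) \<le> ?I + (1/4) ^ j" using h(3)[of j] by linarith
        qed (use W_pos e in auto)
        finally show ?thesis by simp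
      qed
      moreover have "(\<lambda>j. ennreal (W * (?I + (1/4) ^ j) / (e / 2)) + ennreal (4 * W * (1/2) ^ j)) \<longlonglongrightarrow> ennreal (W * (?I + 0) / (e / 2)) + ennreal (4 * W * 0)"
        using e by (intro tendsto_intros tendsto_ennrealI LIMSEQ_realpow_zero) auto
      ultimately have "emeasure lebesgue {x. \<bar>T (G k) x - u x\<bar> > e} \<le> ennreal (W * (?I + 0) / (e / 2)) + ennreal (4 * W * 0)"
        by (intro LIMSEQ_le_const) blast+
      then show ?thesis by simp
    qed
    have "(\<lambda>k. ennreal (W * (LINT x|lebesgue. \<bar>G k x - g x\<bar>) / (e / 2))) \<longlonglongrightarrow> ennreal (W * 0 / (e / 2))"
      using e G by (intro tendsto_ennrealI tendsto_intros) auto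
    then have "(\<lambda>k. ennreal (W * (LINT x|lebesgue. \<bar>G k x - g x\<bar>) / (e / 2))) \<longlonglongrightarrow> 0" by simp
    then show "(\<lambda>k. emeasure lebesgue {x. \<bar>T (G k) x - u x\<bar> > e}) \<longlonglongrightarrow> 0"
      by (rule ennreal_tendsto_0) (rule le)
  qed
  then show ?thesis by blast
qed

abbreviation S :: "(real ^ 'n \<Rightarrow> real) \<Rightarrow> real ^ 'n \<Rightarrow> real" where "S \<equiv> extend T"

text \<open>For g in L^2 the value T g itself has the extension property, by the weak type bound.
  Integrable functions are therefore treated alike, whichever branch of \<open>extend\<close>
  defines their image.\<close>

lemma S_value:
  assumes g: "integrable lebesgue g"
  shows "L1_extension_value T g (S g)"
proof (cases "g \<in> L2")
  case True
  show ?thesis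
    unfolding L1_extension_value_def
  proof (intro conjI g allI impI)
    show "S g \<in> borel_measurable lebesgue" using True L2D(1)[OF T_L2[OF True]] by (simp add: extend_def)
    fix G :: "nat \<Rightarrow> real ^ 'n \<Rightarrow> real" and e :: real
    assume G: "(\<forall>k. G k \<in> L2 \<and> integrable lebesgue (G k)) \<and> (\<lambda>k. LINT x|lebesgue. \<bar>G k x - g x\<bar>) \<longlonglongrightarrow> 0" and e: "0 < e"
    have le: "emeasure lebesgue {x. \<bar>T (G k) x - S g x\<bar> > e} \<le> ennreal (W * (LINT x|lebesgue. \<bar>G k x - g x\<bar>) / e)" for k
      using T_diff_weak[of "G k" g e] G True g e by (simp add: extend_def)
    have "(\<lambda>k. ennreal (W * (LINT x|lebesgue. \<bar>G k x - g x\<bar>) / e)) \<longlonglongrightarrow> ennreal (W * 0 / e)"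
      using e G by (intro tendsto_ennrealI tendsto_intros) auto
    then have "(\<lambda>k. ennreal (W * (LINT x|lebesgue. \<bar>G k x - g x\<bar>) / e)) \<longlonglongrightarrow> 0" by simp
    then show "(\<lambda>k. emeasure lebesgue {x. \<bar>T (G k) x - S g x\<bar> > e}) \<longlonglongrightarrow> 0"
      by (rule ennreal_tendsto_0) (rule le)
  qed
next
  case False
  note ex = L1_extension_exists[OF g]
  have "S g = (SOME u. L1_extension_value T g u)" using False ex by (simp add: extend_def)
  then show ?thesis using someI_ex[OF ex] by simp
qed

lemma S_measurable: "integrable lebesgue g \<Longrightarrow> S g \<in> borel_measurable lebesgue"
  using S_value by (simp add: L1_extension_value_def)

lemma S_tendsto:
  assumes "integrable lebesgue g" "\<And>k. G k \<in> L2" "\<And>k. integrable lebesgue (G k)"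
    "(\<lambda>k. LINT x|lebesgue. \<bar>G k x - g x\<bar>) \<longlonglongrightarrow> 0"
  shows "meas_tendsto (\<lambda>k. T (G k)) (S g)"
  using S_value[OF assms(1)] assms(2-) unfolding L1_extension_value_def meas_tendsto_def by blast

text \<open>Both sides are limits in measure of \<open>T\<close> applied to the same combinations of
  truncations, so they agree almost everywhere.\<close>

lemma S_lincomb:
  assumes f: "integrable lebesgue f" and g: "integrable lebesgue g"
  shows "AE x in lebesgue. S (\<lambda>y. f y + c * g y) x = S f x + c * S g x"
proof -
  let ?F = "trunc f" and ?G = "trunc g"
  have fg: "integrable lebesgue (\<lambda>y. f y + c * g y)" using f g by simp
  note tf = trunc_props[OF f] and tg = trunc_props[OF g]
  have FG: "(\<lambda>y. ?F k y + c * ?G k y) \<in> L2" "integrable lebesgue (\<lambda>y. ?F k y + c * ?G k y)" for k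
    using L2_lincomb[OF tf(1) tg(1)] tf(2) tg(2) by auto
  have m: "T (?F k) \<in> borel_measurable lebesgue" "T (?G k) \<in> borel_measurable lebesgue"
    "T (\<lambda>y. ?F k y + c * ?G k y) \<in> borel_measurable lebesgue" for k
    using L2D(1)[OF T_L2] tf(1) tg(1) FG(1) by auto
  have "(\<lambda>k. (LINT y|lebesgue. \<bar>?F k y - f y\<bar>) + \<bar>c\<bar> * (LINT y|lebesgue. \<bar>?G k y - g y\<bar>)) \<longlonglongrightarrow> 0 + \<bar>c\<bar> * 0"
    by (intro tendsto_intros tf tg)
  then have l: "(\<lambda>k. (LINT y|lebesgue. \<bar>?F k y - f y\<bar>) + \<bar>c\<bar> * (LINT y|lebesgue. \<bar>?G k y - g y\<bar>)) \<longlonglongrightarrow> 0" by simp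
  have "(LINT y|lebesgue. \<bar>?F k y + c * ?G k y - (f y + c * g y)\<bar>) \<le> (LINT y|lebesgue. \<bar>?F k y - f y\<bar>) + \<bar>c\<bar> * (LINT y|lebesgue. \<bar>?G k y - g y\<bar>)" for k
  proof -
    have "(LINT y|lebesgue. \<bar>?F k y + c * ?G k y - (f y + c * g y)\<bar>) \<le> (LINT y|lebesgue. \<bar>?F k y - f y\<bar> + \<bar>c\<bar> * \<bar>?G k y - g y\<bar>)"
    proof (rule integral_mono)
      fix y
      have "\<bar>?F k y + c * ?G k y - (f y + c * g y)\<bar> = \<bar>(?F k y - f y) + c * (?G k y - g y)\<bar>" by (simp add: algebra_simps)
      also have "\<dots> \<le> \<bar>?F k y - f y\<bar> + \<bar>c * (?G k y - g y)\<bar>" by (rule abs_triangle_ineq)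
      finally show "\<bar>?F k y + c * ?G k y - (f y + c * g y)\<bar> \<le> \<bar>?F k y - f y\<bar> + \<bar>c\<bar> * \<bar>?G k y - g y\<bar>" by (simp add: abs_mult)
    qed (use f g tf(2) tg(2) in auto)
    also have "\<dots> = (LINT y|lebesgue. \<bar>?F k y - f y\<bar>) + \<bar>c\<bar> * (LINT y|lebesgue. \<bar>?G k y - g y\<bar>)"
      using f g tf(2)[of k] tg(2)[of k] by (subst Bochner_Integration.integral_add) auto
    finally show ?thesis .
  qed
  then have "(\<lambda>k. LINT y|lebesgue. \<bar>?F k y + c * ?G k y - (f y + c * g y)\<bar>) \<longlonglongrightarrow> 0"
    by (intro tendsto_sandwich[OF _ _ tendsto_const l]) auto
  from S_tendsto[OF fg FG this] have 1: "meas_tendsto (\<lambda>k. T (\<lambda>y. ?F k y + c * ?G k y)) (S (\<lambda>y. f y + c * g y))" .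
  have "meas_tendsto (\<lambda>k x. T (?F k) x + c * T (?G k) x) (\<lambda>x. S f x + c * S g x)"
    using S_tendsto[OF f tf(1,2,5)] S_tendsto[OF g tg(1,2,5)] m(1,2) S_measurable[OF f] S_measurable[OF g]
    by (intro meas_tendsto_add meas_tendsto_cmult) auto
  moreover have "emeasure lebesgue {x. \<bar>T (?F k) x + c * T (?G k) x - v x\<bar> > e} = emeasure lebesgue {x. \<bar>T (\<lambda>y. ?F k y + c * ?G k y) x - v x\<bar> > e}"
    if "v \<in> borel_measurable lebesgue" for k v e
  proof (rule emeasure_eq_AE)
    show "AE x in lebesgue. x \<in> {x. \<bar>T (?F k) x + c * T (?G k) x - v x\<bar> > e} \<longleftrightarrow> x \<in> {x. \<bar>T (\<lambda>y. ?F k y + c * ?G k y) x - v x\<bar> > e}"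
      using T_lincomb[OF tf(1)[of k] tg(1)[of k], of c] by eventually_elim simp
  qed (use m that in \<open>auto intro!: sets_lebesgue_gt\<close>)
  ultimately have 2: "meas_tendsto (\<lambda>k. T (\<lambda>y. ?F k y + c * ?G k y)) (\<lambda>x. S f x + c * S g x)"
    unfolding meas_tendsto_def using S_measurable[OF f] S_measurable[OF g] by simp
  show ?thesis
    by (rule meas_tendsto_unique[OF _ _ _ 1 2]) (use m(3) S_measurable f g fg in auto)
qed

text \<open>The additional factor 2 pays for splitting the level between the truncations, whose weak
  type bound is uniform, and the convergence error.\<close>

lemma S_weak:
  assumes g: "integrable lebesgue g" and t: "0 < t"
  shows "emeasure lebesgue {x. \<bar>S g x\<bar> > t} \<le> ennreal (2 * W * (LINT x|lebesgue. \<bar>g x\<bar>) / t)"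
proof -
  note tg = trunc_props[OF g]
  have m: "T (trunc g k) \<in> borel_measurable lebesgue" for k using L2D(1)[OF T_L2] tg(1) by auto
  have le: "emeasure lebesgue {x. \<bar>S g x\<bar> > t} \<le> ennreal (W * (LINT x|lebesgue. \<bar>g x\<bar>) / (t / 2)) + emeasure lebesgue {x. \<bar>T (trunc g k) x - S g x\<bar> > t / 2}" for k
  proof -
    have "emeasure lebesgue {x. \<bar>S g x\<bar> > t / 2 + t / 2} \<le> emeasure lebesgue {x. \<bar>T (trunc g k) x\<bar> > t / 2} + emeasure lebesgue {x. \<bar>T (trunc g k) x - S g x\<bar> > t / 2}"
      by (rule emeasure_gt_split) (use m S_measurable[OF g] in \<open>auto intro!: AE_I2\<close>)
    also have "emeasure lebesgue {x. \<bar>T (trunc g k) x\<bar> > t / 2} \<le> ennreal (W * (LINT x|lebesgue. \<bar>trunc g k x\<bar>) / (t / 2))"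
      using t by (intro weak_type_L2 tg) auto
    also have "\<dots> \<le> ennreal (W * (LINT x|lebesgue. \<bar>g x\<bar>) / (t / 2))"
      using W_pos t g tg(2)[of k] tg(3) by (intro ennreal_leI divide_right_mono mult_left_mono integral_mono) auto
    finally show ?thesis by (simp add: add_right_mono)
  qed
  have "(\<lambda>k. emeasure lebesgue {x. \<bar>T (trunc g k) x - S g x\<bar> > t / 2}) \<longlonglongrightarrow> 0"
    using S_tendsto[OF g tg(1,2,5)] half_gt_zero[OF t] unfolding meas_tendsto_def by blast
  then have "(\<lambda>k. ennreal (W * (LINT x|lebesgue. \<bar>g x\<bar>) / (t / 2)) + emeasure lebesgue {x. \<bar>T (trunc g k) x - S g x\<bar> > t / 2}) \<longlonglongrightarrow> ennreal (W * (LINT x|lebesgue. \<bar>g x\<bar>) / (t / 2)) + 0"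
    by (intro tendsto_add tendsto_const)
  then have "emeasure lebesgue {x. \<bar>S g x\<bar> > t} \<le> ennreal (W * (LINT x|lebesgue. \<bar>g x\<bar>) / (t / 2)) + 0"
    by (rule LIMSEQ_le_const) (use le in blast)
  then show ?thesis by (simp add: mult_ac)
qed

lemma S_zero:
  assumes g: "integrable lebesgue g" and ae: "AE x in lebesgue. g x = 0"
  shows "AE x in lebesgue. S g x = 0"
proof -
  have "(LINT x|lebesgue. \<bar>g x\<bar>) = (LINT x|(lebesgue :: (real ^ 'n) measure). (0::real))"
    using ae g by (intro integral_cong_AE) auto
  then have 0: "emeasure lebesgue {x. \<bar>S g x\<bar> > t} = 0" if "0 < t" for t using S_weak[OF g that] by simp
  have "AE x in lebesgue. \<forall>j. \<not> \<bar>S g x\<bar> > 1 / real (Suc j)"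
    unfolding AE_all_countable
  proof
    fix j
    have "{x. \<bar>S g x\<bar> > 1 / real (Suc j)} \<in> null_sets lebesgue"
      using 0[of "1 / real (Suc j)"] S_measurable[OF g] by (auto intro!: null_setsI sets_lebesgue_gt simp del: of_nat_Suc)
    from AE_not_in[OF this] show "AE x in lebesgue. \<not> \<bar>S g x\<bar> > 1 / real (Suc j)" by simp
  qed
  then show ?thesis
  proof eventually_elim
    case (elim x)
    show ?case
    proof (rule ccontr)
      assume "S g x \<noteq> 0"
      then obtain j where "inverse (real (Suc j)) < \<bar>S g x\<bar>" using reals_Archimedean[of "\<bar>S g x\<bar>"] by auto
      then show False using elim[rule_format, of j] by (simp add: inverse_eq_divide)
    qed
  qed
qed

lemma S_representation:
  assumes g: "integrable lebesgue g" and s: "\<And>y. y \<notin> cbox a b \<Longrightarrow> g y = 0"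
  shows "AE x in lebesgue. x \<notin> cbox a b \<longrightarrow> S g x = (LINT y|lebesgue. k x y * g y)"
proof -
  note tg = trunc_props[OF g]
  note [measurable] = borel_measurable_integrable[OF g] borel_measurable_integrable[OF tg(2)]
  have m: "T (trunc g j) \<in> borel_measurable lebesgue" for j using L2D(1)[OF T_L2] tg(1) by auto
  have "AE x in lebesgue. \<forall>j. x \<notin> cbox a b \<longrightarrow> T (trunc g j) x = (LINT y|lebesgue. k x y * trunc g j y)"
    unfolding AE_all_countable by (intro allI kernel_representation tg) (simp add: trunc_def s)
  then have "AE x in lebesgue. x \<in> - cbox a b \<longrightarrow> (\<lambda>j. T (trunc g j) x) \<longlonglongrightarrow> (LINT y|lebesgue. k x y * g y)"
  proof eventually_elim
    case (elim x)
    show ?case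
    proof
      assume "x \<in> - cbox a b"
      then have x: "x \<notin> cbox a b" by simp
      have "(\<lambda>j. LINT y|lebesgue. k x y * trunc g j y) \<longlonglongrightarrow> (LINT y|lebesgue. k x y * g y)"
      proof (rule integral_dominated_convergence[where w = "\<lambda>y. \<bar>k x y * g y\<bar>"])
        show "integrable lebesgue (\<lambda>y. \<bar>k x y * g y\<bar>)" using k_integrable[OF g s x] by simp
        show "AE y in lebesgue. (\<lambda>j. k x y * trunc g j y) \<longlonglongrightarrow> k x y * g y" by (intro AE_I2 tendsto_intros tg)
        show "AE y in lebesgue. norm (k x y * trunc g j y) \<le> \<bar>k x y * g y\<bar>" for j
          using tg(3) by (intro AE_I2) (auto simp: abs_mult intro!: mult_left_mono)
      qed measurable
      then show "(\<lambda>j. T (trunc g j) x) \<longlonglongrightarrow> (LINT y|lebesgue. k x y * g y)" using elim x by simp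
    qed
  qed
  from meas_tendsto_pointwise[OF m S_measurable[OF g] S_tendsto[OF g tg(1,2,5)] this] show ?thesis by simp
qed

end

section \<open>The local estimate\<close>

text \<open>The dilates of a cube are concentric with it and hence not grid cubes. The j-th ancestor
  contains the centre and its side is half that of the dilate, so its triple covers the dilate.
  Bounds on triples thus reach all annuli of the Hoermander condition.\<close>

lemma dilate_in_triple_ancestor:
  fixes x :: "real ^ 'n::finite"
  shows "cube_set (dilate (2 ^ (j + 1)) (base.cel k x)) \<subseteq> cube_set (dilate 3 (base.cel (k + int j) x))"
proof
  fix y assume y: "y \<in> cube_set (dilate (2 ^ (j + 1)) (base.cel k x))"
  let ?P = "base.cel k x" and ?R = "base.cel (k + int j) x"
  have s: "side ?R = 2 ^ j * side ?P" by (simp add: base.side_cell power_int_add)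
  have s0: "side ?P > 0" by (simp add: base.side_cell)
  have "cube_set ?P \<subseteq> cube_set ?R" by (rule base.cell_mono) simp
  note b = cube_subset_bounds[OF this base.is_cube_cell]
  show "y \<in> cube_set (dilate 3 ?R)"
    unfolding cube_set_def dilate_def
  proof (clarsimp)
    fix i
    define z where "z = 2 ^ j * side ?P"
    have "fst ?P $ i - (2 * z) / 2 \<le> y $ i" "y $ i < fst ?P $ i + (2 * z) / 2"
      using y by (auto simp: cube_set_def dilate_def z_def mult.assoc)
    then show "fst ?R $ i - 3 * side ?R / 2 \<le> y $ i \<and> y $ i < fst ?R $ i + 3 * side ?R / 2"
      using b[of i] s s0 unfolding z_def[symmetric] by auto
  qed
qed

context hormander_setting
begin

text \<open>The kernel formula is available off closed boxes, but the function to be represented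
  lives off a tripled cube, whose complement is not a box. In this form the formula passes to finite
  unions of the sets \<open>M\<close>.\<close>

definition represented_on :: "(real ^ 'n) set \<Rightarrow> (real ^ 'n) set \<Rightarrow> bool" where
  "represented_on V M \<longleftrightarrow> (\<forall>g. integrable lebesgue g \<longrightarrow> (\<forall>y. y \<notin> M \<longrightarrow> g y = 0) \<longrightarrow>
     (AE x in lebesgue. x \<in> V \<longrightarrow> integrable lebesgue (\<lambda>y. k x y * g y) \<and> S g x = (LINT y|lebesgue. k x y * g y)))"

lemma represented_on_box:
  assumes "V \<inter> cbox a b = {}" shows "represented_on V (cbox a b)"
  unfolding represented_on_def
proof (intro allI impI)
  fix g :: "real ^ 'n \<Rightarrow> real" assume g: "integrable lebesgue g" "\<forall>y. y \<notin> cbox a b \<longrightarrow> g y = 0"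
  have "AE x in lebesgue. x \<notin> cbox a b \<longrightarrow> S g x = (LINT y|lebesgue. k x y * g y)"
    by (rule S_representation) (use g in auto)
  then show "AE x in lebesgue. x \<in> V \<longrightarrow> integrable lebesgue (\<lambda>y. k x y * g y) \<and> S g x = (LINT y|lebesgue. k x y * g y)"
  proof eventually_elim
    case (elim x)
    show ?case
    proof
      assume "x \<in> V"
      then have "x \<notin> cbox a b" using assms by blast
      then show "integrable lebesgue (\<lambda>y. k x y * g y) \<and> S g x = (LINT y|lebesgue. k x y * g y)"
        using elim k_integrable[of g a b x] g by blast
    qed
  qed
qed

lemma represented_on_union:
  assumes 1: "represented_on V M1" and 2: "represented_on V M2" and M: "M1 \<in> sets lebesgue"
  shows "represented_on V (M1 \<union> M2)"
  unfolding represented_on_def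
proof (intro allI impI)
  fix g :: "real ^ 'n \<Rightarrow> real" assume g: "integrable lebesgue g" "\<forall>y. y \<notin> M1 \<union> M2 \<longrightarrow> g y = 0"
  have M': "- M1 \<in> sets lebesgue" using sets.compl_sets[OF M] by (simp add: Compl_eq_Diff_UNIV)
  let ?a = "\<lambda>y. g y * indicat_real M1 y" and ?b = "\<lambda>y. g y * indicat_real (- M1) y"
  have ab: "integrable lebesgue ?a" "integrable lebesgue ?b"
    using g(1) M M' by (auto intro: integrable_real_mult_indicator)
  have eq: "g = (\<lambda>y. ?a y + 1 * ?b y)" by (auto split: split_indicator)
  have "AE x in lebesgue. x \<in> V \<longrightarrow> integrable lebesgue (\<lambda>y. k x y * ?a y) \<and> S ?a x = (LINT y|lebesgue. k x y * ?a y)"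
    using 1[unfolded represented_on_def, rule_format, of ?a] ab(1) by (auto split: split_indicator)
  moreover have "AE x in lebesgue. x \<in> V \<longrightarrow> integrable lebesgue (\<lambda>y. k x y * ?b y) \<and> S ?b x = (LINT y|lebesgue. k x y * ?b y)"
    using 2[unfolded represented_on_def, rule_format, of ?b] ab(2) g(2) by (auto split: split_indicator)
  moreover have "AE x in lebesgue. S g x = S ?a x + 1 * S ?b x"
    by (subst eq, rule S_lincomb[OF ab])
  ultimately show "AE x in lebesgue. x \<in> V \<longrightarrow> integrable lebesgue (\<lambda>y. k x y * g y) \<and> S g x = (LINT y|lebesgue. k x y * g y)"
  proof eventually_elim
    case (elim x)
    show ?case
    proof
      assume x: "x \<in> V"
      have ia: "integrable lebesgue (\<lambda>y. k x y * ?a y)" and ib: "integrable lebesgue (\<lambda>y. k x y * ?b y)" using elim x by blast+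
      have e: "(\<lambda>y. k x y * g y) = (\<lambda>y. k x y * ?a y + k x y * ?b y)" by (auto split: split_indicator)
      have "integrable lebesgue (\<lambda>y. k x y * g y)" unfolding e by (rule Bochner_Integration.integrable_add[OF ia ib])
      moreover have "(LINT y|lebesgue. k x y * g y) = (LINT y|lebesgue. k x y * ?a y) + (LINT y|lebesgue. k x y * ?b y)"
        unfolding e by (rule Bochner_Integration.integral_add[OF ia ib])
      ultimately show "integrable lebesgue (\<lambda>y. k x y * g y) \<and> S g x = (LINT y|lebesgue. k x y * g y)"
        using elim x by (metis mult_1)
    qed
  qed
qed

lemma represented_on_UN:
  assumes "finite I" "\<And>i. i \<in> I \<Longrightarrow> represented_on V (M i)" "\<And>i. i \<in> I \<Longrightarrow> M i \<in> sets lebesgue"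
  shows "represented_on V (\<Union>i\<in>I. M i)"
  using assms
proof (induction I rule: finite_induct)
  case empty
  show ?case
    unfolding represented_on_def
  proof (intro allI impI)
    fix g :: "real ^ 'n \<Rightarrow> real" assume g: "integrable lebesgue g" "\<forall>y. y \<notin> (\<Union>i\<in>{}. M i) \<longrightarrow> g y = 0"
    then have g0: "g = (\<lambda>_. 0)" by auto
    have "AE x in lebesgue. S g x = 0" by (rule S_zero[OF g(1)]) (simp add: g0)
    then show "AE x in lebesgue. x \<in> V \<longrightarrow> integrable lebesgue (\<lambda>y. k x y * g y) \<and> S g x = (LINT y|lebesgue. k x y * g y)"
      by eventually_elim (simp add: g0)
  qed
next
  case (insert i I)
  then show ?case using represented_on_union[of V "M i" "\<Union>i\<in>I. M i"] by simp
qed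

text \<open>The support outside the triple is covered by 2 n closed boxes, one for each face: there
  one coordinate is at most the lower or at least the upper bound of the triple. None of them meets
  \<open>P\<close>.\<close>

lemma represented_off_triple:
  assumes P: "is_cube P" and g: "integrable lebesgue g" "bounded {y. g y \<noteq> 0}" "\<And>y. y \<in> cube_set (dilate 3 P) \<Longrightarrow> g y = 0"
  shows "AE x in lebesgue. x \<in> cube_set P \<longrightarrow> integrable lebesgue (\<lambda>y. k x y * g y) \<and> S g x = (LINT y|lebesgue. k x y * g y)"
proof -
  obtain u v where uv: "{y. g y \<noteq> 0} \<subseteq> cbox u v" using bounded_subset_cbox_symmetric[OF g(2)] by blast
  have s: "side P > 0" using P by (simp add: is_cube_def)
  define L where "L i = cbox u (\<chi> j. if j = i then fst P $ i - 3 * side P / 2 else v $ j)" for i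
  define R where "R i = cbox (\<chi> j. if j = i then fst P $ i + 3 * side P / 2 else u $ j) v" for i
  have P_in: "fst P $ i - side P / 2 \<le> x $ i" "x $ i < fst P $ i + side P / 2" if "x \<in> cube_set P" for x i
    using that by (auto simp: cube_set_def)
  have "cube_set P \<inter> L i = {}" for i
  proof (rule ccontr)
    assume "cube_set P \<inter> L i \<noteq> {}"
    then obtain x where x: "x \<in> cube_set P" "x \<in> L i" by blast
    then have "x $ i \<le> fst P $ i - 3 * side P / 2" unfolding L_def mem_box_cart by (auto dest: spec[of _ i])
    then show False using P_in(1)[OF x(1), of i] s by linarith
  qed
  then have rL: "represented_on (cube_set P) (L i)" for i unfolding L_def by (intro represented_on_box) auto
  have "cube_set P \<inter> R i = {}" for i
  proof (rule ccontr)
    assume "cube_set P \<inter> R i \<noteq> {}"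
    then obtain x where x: "x \<in> cube_set P" "x \<in> R i" by blast
    then have "fst P $ i + 3 * side P / 2 \<le> x $ i" unfolding R_def mem_box_cart by (auto dest: spec[of _ i])
    then show False using P_in(2)[OF x(1), of i] s by linarith
  qed
  then have rR: "represented_on (cube_set P) (R i)" for i unfolding R_def by (intro represented_on_box) auto
  have "represented_on (cube_set P) (\<Union>i\<in>UNIV. L i \<union> R i)"
    by (intro represented_on_UN represented_on_union rL rR) (auto simp: L_def R_def)
  moreover have "g y = 0" if "y \<notin> (\<Union>i\<in>UNIV. L i \<union> R i)" for y
  proof (rule ccontr)
    assume gy: "g y \<noteq> 0"
    then have c: "u $ j \<le> y $ j" "y $ j \<le> v $ j" for j using uv by (auto simp: mem_box_cart)
    have "y \<notin> cube_set (dilate 3 P)" using gy g(3) by blast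
    then obtain i where "\<not> (fst P $ i - 3 * side P / 2 \<le> y $ i \<and> y $ i < fst P $ i + 3 * side P / 2)"
      by (auto simp: cube_set_def dilate_def)
    then have "y \<in> L i \<or> y \<in> R i" using c by (auto simp: L_def R_def mem_box_cart)
    then show False using that by blast
  qed
  ultimately show ?thesis using g(1) unfolding represented_on_def by blast
qed

text \<open>There are 3^n lattices and |3 Q| = 3^n |Q|, whence 9^n; at this level the cubes of large
  mean cover at most \<epsilon> / 2 of the measure of Q.\<close>

definition stop_level :: "real \<Rightarrow> real" where "stop_level \<epsilon> = 2 * 9 ^ CARD('n) / \<epsilon>"

text \<open>The three losses of the local estimate divided by \<sigma> N r: the oscillation on a
  cube, the level for S g, and the level for the part near a cube. The factor 96 times 6^n is 8
  \<open>W\<close> 3^n / N.\<close>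

definition local_const :: "real \<Rightarrow> real" where
  "local_const \<epsilon> = 2 * 2 ^ CARD('n) * stop_level \<epsilon> + 96 * 6 ^ CARD('n) * (1 / \<epsilon> + 1 + stop_level \<epsilon>)"

text \<open>\<open>E\<close> joins \<open>E1\<close>, where |S g| is large, and \<open>E2\<close>,
  the points in a lattice cube with large mean of A(|g| / r). If \<open>E\<close> fills at most half
  of \<open>P\<close>, a point of \<open>P\<close> off \<open>E2\<close> bounds the means over the
  triples of \<open>P\<close> and of all its ancestors: the former controls the near part in L^1,
  the latter the far part on every annulus.\<close>

lemma exceptional_set:
  assumes Q0: "Q0 \<in> base.cubes" and g: "integrable lebesgue g" "\<And>y. y \<notin> cube_set (dilate 3 Q0) \<Longrightarrow> g y = 0"
    and r: "modular_le A (dilate 3 Q0) g r" and \<epsilon>: "0 < \<epsilon>" "\<epsilon> \<le> 1"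
  shows "\<exists>E\<in>sets lebesgue. E \<subseteq> cube_set Q0 \<and> emeasure lebesgue E \<le> ennreal \<epsilon> * emeasure lebesgue (cube_set Q0) \<and>
    (AE x in lebesgue. x \<in> cube_set Q0 \<longrightarrow> x \<notin> E \<longrightarrow> \<bar>S g x\<bar> \<le> \<sigma> * N * local_const \<epsilon> * r) \<and>
    (\<forall>P\<in>base.cubes. cube_set P \<subseteq> cube_set Q0 \<longrightarrow>
       emeasure lebesgue (cube_set P \<inter> E) \<le> ennreal (1/2) * emeasure lebesgue (cube_set P) \<longrightarrow>
       (AE x in lebesgue. x \<in> cube_set P \<longrightarrow> \<bar>S (\<lambda>y. g y * indicat_real (- cube_set (dilate 3 P)) y) x\<bar> \<le> \<sigma> * N * local_const \<epsilon> * r))"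
proof -
  have r0: "0 < r" using r by (simp add: modular_le_def)
  note [measurable] = borel_measurable_integrable[OF g(1)]
  have Am [measurable]: "(\<lambda>y. A (\<bar>g y\<bar> / r)) \<in> borel_measurable lebesgue"
    using young_measurable_comp[OF A borel_measurable_integrable[OF g(1)], of r] r0 by simp
  define n3 n2 where "n3 = (3 ^ CARD('n) :: real)" and "n2 = (2 ^ CARD('n) :: real)"
  have n32: "n3 > 0" "n2 \<ge> 1" by (auto simp: n3_def n2_def)
  define \<alpha> where "\<alpha> = stop_level \<epsilon>"
  have \<alpha>: "\<alpha> \<ge> 1"
  proof -
    have "1 * 1 \<le> 2 * (9::real) ^ CARD('n)" by (intro mult_mono one_le_power) auto
    then show ?thesis using \<epsilon> unfolding \<alpha>_def stop_level_def by (simp add: field_simps)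
  qed
  have cQ0: "is_cube Q0" using Q0 by (rule base.is_cube_cubes)
  let ?V = "emeasure lebesgue (cube_set Q0)"
  define G where "G y = ennreal (A (\<bar>g y\<bar> / r))" for y
  have Gm [measurable]: "G \<in> borel_measurable lebesgue" unfolding G_def by measurable
  have G_int: "(\<integral>\<^sup>+y. G y \<partial>lebesgue) \<le> ennreal n3 * ?V"
  proof -
    have "(\<integral>\<^sup>+y. G y \<partial>lebesgue) = (\<integral>\<^sup>+y\<in>cube_set (dilate 3 Q0). G y \<partial>lebesgue)"
    proof (rule nn_integral_cong)
      fix y
      have "G y = 0" if "y \<notin> cube_set (dilate 3 Q0)" using g(2)[OF that] A by (simp add: G_def young_def)
      then show "G y = G y * indicator (cube_set (dilate 3 Q0)) y" by (auto split: split_indicator)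
    qed
    also have "\<dots> \<le> emeasure lebesgue (cube_set (dilate 3 Q0))" using r by (simp add: modular_le_def G_def)
    also have "\<dots> = ennreal n3 * ?V" using cQ0 by (simp add: emeasure_dilate n3_def)
    finally show ?thesis .
  qed
  have G_fin: "(\<integral>\<^sup>+y. G y \<partial>lebesgue) < top"
    by (rule le_less_trans[OF G_int]) (use cQ0 in \<open>simp add: ennreal_mult_less_top\<close>)
  define bad where "bad R \<longleftrightarrow> (\<integral>\<^sup>+y\<in>cube_set R. G y \<partial>lebesgue) > ennreal \<alpha> * emeasure lebesgue (cube_set R)" for R :: "'n cube"
  let ?I = "{l :: 'n \<Rightarrow> int. \<forall>i. l i \<in> {0, 1, 2}}"
  obtain \<beta> :: "nat \<Rightarrow> 'n \<Rightarrow> int" where \<beta>: "\<beta> ` {1..3 ^ CARD('n)} = ?I" using triple_index_enumeration by blast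
  define \<Omega> where "\<Omega> l = (\<Union>R\<in>triple.maximal_cubes l bad. cube_set R)" for l
  have \<Omega>m [measurable]: "\<Omega> l \<in> sets lebesgue" for l
    unfolding \<Omega>_def using triple.countable_maximal by (intro sets.countable_UN') auto
  have \<alpha>0: "0 < \<alpha>" using \<alpha> by simp
  have \<Omega>_le: "emeasure lebesgue (\<Omega> l) \<le> ennreal (n3 / \<alpha>) * ?V" for l
  proof -
    have "emeasure lebesgue (\<Omega> l) = ennreal (1 / \<alpha>) * (ennreal \<alpha> * emeasure lebesgue (\<Omega> l))"
      using \<alpha>0 by (simp flip: mult.assoc ennreal_mult')
    also have "\<dots> \<le> ennreal (1 / \<alpha>) * (\<integral>\<^sup>+y. G y \<partial>lebesgue)"
      unfolding \<Omega>_def bad_def[abs_def] by (intro mult_left_mono triple.calderon_zygmund_cubes(2)[OF Gm G_fin \<alpha>0]) auto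
    also have "\<dots> \<le> ennreal (1 / \<alpha>) * (ennreal n3 * ?V)" by (intro mult_left_mono G_int) auto
    also have "\<dots> = ennreal (n3 / \<alpha>) * ?V" using \<alpha>0 n32 by (simp flip: mult.assoc ennreal_mult')
    finally show ?thesis .
  qed
  define E2 where "E2 = cube_set Q0 \<inter> (\<Union>j\<in>{1..3 ^ CARD('n)}. \<Omega> (\<beta> j))"
  have E2m [measurable]: "E2 \<in> sets lebesgue" unfolding E2_def by auto
  have E2_le: "emeasure lebesgue E2 \<le> ennreal (\<epsilon> / 2) * ?V"
  proof -
    have "emeasure lebesgue E2 \<le> emeasure lebesgue (\<Union>j\<in>{1..3 ^ CARD('n)}. \<Omega> (\<beta> j))"
      by (rule emeasure_mono) (auto simp: E2_def)
    also have "\<dots> \<le> (\<Sum>j\<in>{1..3 ^ CARD('n)}. emeasure lebesgue (\<Omega> (\<beta> j)))"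
      by (rule emeasure_subadditive_finite) auto
    also have "\<dots> \<le> (\<Sum>j\<in>{1..(3::nat) ^ CARD('n)}. ennreal (n3 / \<alpha>) * ?V)" by (rule sum_mono) (rule \<Omega>_le)
    also have "\<dots> = ennreal n3 * (ennreal (n3 / \<alpha>) * ?V)"
    proof -
      have "of_nat (3 ^ CARD('n)) = ennreal n3" by (simp add: n3_def flip: ennreal_power)
      then show ?thesis by simp
    qed
    also have "\<dots> = ennreal (n3 * (n3 / \<alpha>)) * ?V"
      by (simp only: ennreal_mult'[OF less_imp_le[OF n32(1)]] mult.assoc)
    also have "n3 * (n3 / \<alpha>) = \<epsilon> / 2"
    proof -
      have n9: "n3 * n3 = 9 ^ CARD('n)" by (simp add: n3_def flip: power_mult_distrib)
      have "n3 * (n3 / \<alpha>) = (n3 * n3) / \<alpha>" by simp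
      then show ?thesis using \<epsilon> unfolding n9 by (simp add: \<alpha>_def stop_level_def)
    qed
    finally show ?thesis .
  qed
  \<comment> \<open>A point off \<open>E2\<close> in a base cube certifies the triple of that cube,
    whichever lattice the triple belongs to; this is why \<open>E2\<close> collects all
    lattices.\<close>
  have good_point: "\<not> bad (dilate 3 R)" if R: "R \<in> base.cubes" "x \<in> cube_set R" and x: "x \<in> cube_set Q0" "x \<notin> E2" for R x
  proof
    assume b: "bad (dilate 3 R)"
    obtain l where l: "\<forall>i. l i \<in> {0, 1, 2}" "dilate 3 R \<in> triple.cubes l" using triple_base_cube[OF R(1)] by blast
    obtain K0 where K0: "\<And>k x. bad (triple.cel l k x) \<Longrightarrow> k \<le> K0"
      using triple.calderon_zygmund_cubes(1)[OF Gm G_fin \<alpha>0, of l] unfolding bad_def by blast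
    have "\<exists>R'\<in>triple.maximal_cubes l bad. cube_set (dilate 3 R) \<subseteq> cube_set R'"
      by (rule triple.maximal_cubes_cover[where P = bad and K = K0]) (use K0 l b in auto)
    moreover have "x \<in> cube_set (dilate 3 R)" using R(2) dilate_mono[OF _ base.is_cube_cubes[OF R(1)], of 1 3] by auto
    ultimately have "x \<in> \<Omega> l" unfolding \<Omega>_def by blast
    moreover have "l \<in> \<beta> ` {1..3 ^ CARD('n)}" unfolding \<beta> using l(1) by simp
    ultimately show False using x unfolding E2_def by blast
  qed
  have L1: "(LINT y|lebesgue. \<bar>g y * indicat_real (cube_set R) y\<bar>) \<le> \<sigma> * r * (1 + c) * measure lebesgue (cube_set R)"
    if R: "is_cube R" and c: "0 \<le> c" and le: "(\<integral>\<^sup>+y\<in>cube_set R. G y \<partial>lebesgue) \<le> ennreal c * emeasure lebesgue (cube_set R)" for R c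
  proof -
    have i: "integrable lebesgue (\<lambda>y. \<bar>g y * indicat_real (cube_set R) y\<bar>)"
      by (intro integrable_abs integrable_real_mult_indicator g) auto
    have "ennreal (LINT y|lebesgue. \<bar>g y * indicat_real (cube_set R) y\<bar>) = (\<integral>\<^sup>+y. ennreal \<bar>g y * indicat_real (cube_set R) y\<bar> \<partial>lebesgue)"
      by (rule nn_integral_eq_integral[symmetric, OF i]) simp
    also have "\<dots> = (\<integral>\<^sup>+y\<in>cube_set R. ennreal \<bar>g y\<bar> \<partial>lebesgue)" by (intro nn_integral_cong) (auto split: split_indicator)
    also have "\<dots> \<le> ennreal (\<sigma> * r * (1 + c)) * emeasure lebesgue (cube_set R)"
      by (rule modular_le_L1[OF A \<sigma> _ c r0]) (use le in \<open>simp_all add: G_def\<close>)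
    also have "emeasure lebesgue (cube_set R) = ennreal (measure lebesgue (cube_set R))"
      using R by (simp add: emeasure_eq_ennreal_measure)
    also have "ennreal (\<sigma> * r * (1 + c)) * ennreal (measure lebesgue (cube_set R)) = ennreal (\<sigma> * r * (1 + c) * measure lebesgue (cube_set R))"
      using \<sigma> r0 c by (subst ennreal_mult') auto
    finally show ?thesis using \<sigma> r0 c by (subst (asm) ennreal_le_iff) auto
  qed
  \<comment> \<open>Chosen so that the weak type bound, with the L^1 norm of g at most 2 \<sigma> r
    3^n |Q0|, leaves measure at most (\<epsilon> / 2) |Q0|.\<close>
  define t0 where "t0 = 8 * W * \<sigma> * r * n3 / \<epsilon>"
  have t0: "t0 > 0" using W_pos \<sigma> r0 n32 \<epsilon> by (simp add: t0_def)
  have Sm [measurable]: "S g \<in> borel_measurable lebesgue" by (rule S_measurable[OF g(1)])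
  define E1 where "E1 = cube_set Q0 \<inter> {x. \<bar>S g x\<bar> > t0}"
  have E1m [measurable]: "E1 \<in> sets lebesgue" unfolding E1_def by (intro sets.Int sets_lebesgue_gt) measurable
  have E1_le: "emeasure lebesgue E1 \<le> ennreal (\<epsilon> / 2) * ?V"
  proof -
    have m: "measure lebesgue (cube_set (dilate 3 Q0)) = n3 * measure lebesgue (cube_set Q0)"
      using cQ0 by (simp add: measure_def emeasure_dilate enn2real_mult n3_def)
    have "(LINT y|lebesgue. \<bar>g y\<bar>) = (LINT y|lebesgue. \<bar>g y * indicat_real (cube_set (dilate 3 Q0)) y\<bar>)"
      using g(2) by (intro Bochner_Integration.integral_cong) (auto split: split_indicator)
    also have "\<dots> \<le> \<sigma> * r * (1 + 1) * measure lebesgue (cube_set (dilate 3 Q0))"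
      by (rule L1) (use r cQ0 in \<open>simp_all add: modular_le_def G_def\<close>)
    finally have gi: "(LINT y|lebesgue. \<bar>g y\<bar>) \<le> 2 * \<sigma> * r * n3 * measure lebesgue (cube_set Q0)" by (simp add: m mult_ac)
    have "emeasure lebesgue E1 \<le> emeasure lebesgue {x. \<bar>S g x\<bar> > t0}"
    proof (rule emeasure_mono)
      show "{x. \<bar>S g x\<bar> > t0} \<in> sets lebesgue" by (intro sets_lebesgue_gt) measurable
    qed (auto simp: E1_def)
    also have "\<dots> \<le> ennreal (2 * W * (LINT y|lebesgue. \<bar>g y\<bar>) / t0)" by (rule S_weak[OF g(1) t0])
    also have "\<dots> \<le> ennreal (2 * W * (2 * \<sigma> * r * n3 * measure lebesgue (cube_set Q0)) / t0)"
      using W_pos t0 by (intro ennreal_leI divide_right_mono mult_left_mono gi) auto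
    also have "2 * W * (2 * \<sigma> * r * n3 * measure lebesgue (cube_set Q0)) / t0 = \<epsilon> / 2 * measure lebesgue (cube_set Q0)"
      using W_pos \<sigma> r0 n32 \<epsilon> by (simp add: t0_def field_simps)
    also have "ennreal (\<epsilon> / 2 * measure lebesgue (cube_set Q0)) = ennreal (\<epsilon> / 2) * ?V"
      using \<epsilon> cQ0 by (subst ennreal_mult') (auto simp: emeasure_eq_ennreal_measure)
    finally show ?thesis .
  qed
  \<comment> \<open>Likewise, \<open>S\<close> of the part of g near \<open>P\<close> exceeds this
    level on at most a quarter of \<open>P\<close>.\<close>
  define t1 where "t1 = 8 * W * \<sigma> * r * (1 + \<alpha>) * n3"
  have t1: "t1 > 0" using W_pos \<sigma> r0 n32 \<alpha> by (simp add: t1_def)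
  \<comment> \<open>The bound of \<open>hormander_oscillation\<close> with the radius
    \<open>\<alpha> * n2 * r\<close> common to all annuli.\<close>
  define osc where "osc = 2 * (\<alpha> * n2 * r) * (\<sigma> * N)"
  have osc0: "osc \<ge> 0" using \<alpha> n32 r0 \<sigma> N_pos by (simp add: osc_def)
  have total: "t0 + t1 + osc = \<sigma> * N * local_const \<epsilon> * r"
  proof -
    have "n2 * n3 = 6 ^ CARD('n)" by (simp add: n2_def n3_def flip: power_mult_distrib)
    then have "6 ^ CARD('n) = n2 * n3" ..
    then show ?thesis
      unfolding local_const_def t0_def t1_def osc_def \<alpha>_def[symmetric] W_def n2_def[symmetric]
      using \<epsilon> by (simp add: field_simps)
  qed
  let ?E = "E1 \<union> E2"
  have Em [measurable]: "?E \<in> sets lebesgue" by simp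
  show ?thesis
  proof (intro bexI[of _ ?E] conjI ballI impI)
    show "?E \<in> sets lebesgue" by simp
    show "?E \<subseteq> cube_set Q0" by (auto simp: E1_def E2_def)
    have "emeasure lebesgue ?E \<le> emeasure lebesgue E1 + emeasure lebesgue E2" by (rule emeasure_subadditive) auto
    also have "\<dots> \<le> ennreal (\<epsilon> / 2) * ?V + ennreal (\<epsilon> / 2) * ?V" by (intro add_mono E1_le E2_le)
    also have "\<dots> = ennreal \<epsilon> * ?V" using \<epsilon> by (simp flip: distrib_right ennreal_plus)
    finally show "emeasure lebesgue ?E \<le> ennreal \<epsilon> * ?V" .
    show "AE x in lebesgue. x \<in> cube_set Q0 \<longrightarrow> x \<notin> ?E \<longrightarrow> \<bar>S g x\<bar> \<le> \<sigma> * N * local_const \<epsilon> * r"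
      using t1 osc0 by (intro AE_I2) (auto simp: E1_def total[symmetric])
  next
    fix P assume P: "P \<in> base.cubes" "cube_set P \<subseteq> cube_set Q0"
      and half: "emeasure lebesgue (cube_set P \<inter> ?E) \<le> ennreal (1/2) * emeasure lebesgue (cube_set P)"
    have cP: "is_cube P" using P(1) by (rule base.is_cube_cubes)
    define p where "p = measure lebesgue (cube_set P)"
    have p: "p > 0" "emeasure lebesgue (cube_set P) = ennreal p"
      using cP by (auto simp: p_def measure_cube_set is_cube_def emeasure_eq_ennreal_measure)
    have x0: "\<exists>x\<in>cube_set P. x \<notin> ?E"
    proof (rule ccontr)
      assume "\<not> ?thesis"
      then have e: "cube_set P \<inter> ?E = cube_set P" by blast
      have "ennreal p \<le> ennreal (1/2) * ennreal p" using half unfolding e p(2) .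
      also have "\<dots> = ennreal (1/2 * p)" by (rule ennreal_mult'[symmetric]) simp
      finally show False using p(1) by (subst (asm) ennreal_le_iff) auto
    qed
    then obtain x0 where x0: "x0 \<in> cube_set P" "x0 \<notin> ?E" by blast
    have ngood: "\<not> bad (dilate 3 R)" if "R \<in> base.cubes" "cube_set P \<subseteq> cube_set R" for R
      by (rule good_point[of R x0]) (use that x0 P in auto)
    let ?h = "\<lambda>y. g y * indicat_real (cube_set (dilate 3 P)) y"
    let ?g = "\<lambda>y. g y * indicat_real (- cube_set (dilate 3 P)) y"
    have nP: "- cube_set (dilate 3 P) \<in> sets lebesgue" using sets.compl_sets[of "cube_set (dilate 3 P)" lebesgue] by (simp add: Compl_eq_Diff_UNIV)
    have hi: "integrable lebesgue ?h" "integrable lebesgue ?g"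
      using g(1) nP by (auto intro: integrable_real_mult_indicator)
    note [measurable] = borel_measurable_integrable[OF hi(2)]
    have hS: "emeasure lebesgue {x. \<bar>S ?h x\<bar> > t1} \<le> ennreal (1/4 * p)"
    proof -
      have m: "measure lebesgue (cube_set (dilate 3 P)) = n3 * p"
        using cP by (simp add: measure_def emeasure_dilate enn2real_mult n3_def p_def)
      have "(LINT y|lebesgue. \<bar>?h y\<bar>) \<le> \<sigma> * r * (1 + \<alpha>) * measure lebesgue (cube_set (dilate 3 P))"
        by (rule L1) (use cP \<alpha> ngood[OF P(1)] in \<open>simp_all add: bad_def not_less\<close>)
      then have "2 * W * (LINT y|lebesgue. \<bar>?h y\<bar>) / t1 \<le> 2 * W * (\<sigma> * r * (1 + \<alpha>) * (n3 * p)) / t1"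
        using W_pos t1 unfolding m by (intro divide_right_mono mult_left_mono) auto
      also have "\<dots> = 1/4 * p"
      proof -
        have e: "2 * W * (\<sigma> * r * (1 + \<alpha>) * (n3 * p)) = 1/4 * p * t1" by (simp add: t1_def)
        show ?thesis unfolding e by (rule nonzero_mult_div_cancel_right) (use t1 in simp)
      qed
      finally show ?thesis using S_weak[OF hi(1) t1] by (meson ennreal_leI order_trans)
    qed
    \<comment> \<open>The mean over the triple of the ancestor is at most \<alpha>. Passing to the
      smaller dilate inside costs (3/2)^n \<le> 2^n, and the resulting factor is absorbed into the
      radius.\<close>
    have mod: "modular_le A (dilate (2 ^ Suc j) (dilate 2 P)) ?g (\<alpha> * n2 * r)" for j
    proof -
      obtain kk x where k: "P = base.cel kk x" using P(1) by (rule base.cubesE)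
      let ?R = "base.cel (kk + int (Suc j)) x" and ?D = "dilate (2 ^ (Suc j + 1)) P"
      have sub: "cube_set ?D \<subseteq> cube_set (dilate 3 ?R)" unfolding k by (rule dilate_in_triple_ancestor)
      have cD: "is_cube ?D" using cP by (intro is_cube_dilate) auto
      have PR: "cube_set P \<subseteq> cube_set ?R" unfolding k by (rule base.cell_mono) simp
      have "(\<integral>\<^sup>+y\<in>cube_set ?D. ennreal (A (\<bar>g y\<bar> / r)) \<partial>lebesgue) \<le> (\<integral>\<^sup>+y\<in>cube_set (dilate 3 ?R). G y \<partial>lebesgue)"
        using sub by (intro nn_integral_mono) (auto simp: G_def split: split_indicator)
      also have "\<dots> \<le> ennreal \<alpha> * emeasure lebesgue (cube_set (dilate 3 ?R))"
        using ngood[OF base.cell_in_cubes PR] by (simp add: bad_def not_less)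
      also have "emeasure lebesgue (cube_set (dilate 3 ?R)) \<le> ennreal n2 * emeasure lebesgue (cube_set ?D)"
      proof -
        define z where "z = 2 ^ Suc j * side P"
        have z0: "z > 0" using cP by (simp add: z_def is_cube_def)
        have "side ?R = z" by (simp add: k z_def base.side_cell power_int_add)
        then have "side (dilate 3 ?R) = 3 * z" by (simp add: dilate_def)
        moreover have "side ?D = 2 * z" by (simp add: dilate_def z_def)
        moreover have "is_cube (dilate 3 ?R)" by simp
        moreover have "(3 * z) ^ CARD('n) \<le> n2 * (2 * z) ^ CARD('n)"
        proof -
          have "(3 * z) ^ CARD('n) \<le> (2 * (2 * z)) ^ CARD('n)" using z0 by (intro power_mono) auto
          also have "(2 * (2 * z)) ^ CARD('n) = n2 * (2 * z) ^ CARD('n)"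
            unfolding n2_def by (rule power_mult_distrib)
          finally show ?thesis .
        qed
        ultimately show ?thesis
          using emeasure_cube_set[OF cD] emeasure_cube_set[of "dilate 3 ?R"] n32
          by (simp add: ennreal_leI flip: ennreal_mult')
      qed
      finally have le: "(\<integral>\<^sup>+y\<in>cube_set ?D. ennreal (A (\<bar>g y\<bar> / r)) \<partial>lebesgue) \<le> ennreal (\<alpha> * n2) * emeasure lebesgue (cube_set ?D)"
        using \<alpha>0 n32 by (simp add: ennreal_mult' mult.assoc mult_left_mono)
      have "1 * 1 \<le> \<alpha> * n2" using \<alpha> n32 by (intro mult_mono) auto
      then have "modular_le A ?D g (\<alpha> * n2 * r)"
        by (intro modular_le_scale[OF A _ r0 _ le]) (use g(1) in auto)
      then have "modular_le A ?D ?g (\<alpha> * n2 * r)"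
        by (rule modular_le_abs_mono[OF A]) (auto split: split_indicator)
      then show ?thesis by (simp add: mult.commute)
    qed
    have rep: "AE x in lebesgue. x \<in> cube_set P \<longrightarrow> integrable lebesgue (\<lambda>y. k x y * ?g y) \<and> S ?g x = (LINT y|lebesgue. k x y * ?g y)"
    proof (rule represented_off_triple[OF cP hi(2)])
      have "{y. ?g y \<noteq> 0} \<subseteq> cube_set (dilate 3 Q0)" using g(2) by auto
      then show "bounded {y. ?g y \<noteq> 0}" using bounded_subset bounded_cube_set by blast
    qed simp
    \<comment> \<open>Points where the kernel formula for the far part holds and the section of
      \<open>K\<close> agrees with its Borel version; the oscillation is estimated between such
      points.\<close>
    define nice where "nice x \<longleftrightarrow> (AE y in lebesgue. K x y = k x y) \<and>
        (x \<in> cube_set P \<longrightarrow> integrable lebesgue (\<lambda>y. k x y * ?g y) \<and> S ?g x = (LINT y|lebesgue. k x y * ?g y))" for x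
    have nice: "AE x in lebesgue. nice x"
      using Kk(1) rep by eventually_elim (simp add: nice_def)
    have close: "\<bar>S ?g x - S ?g x'\<bar> \<le> osc" if x: "nice x" "x \<in> cube_set P" and x': "nice x'" "x' \<in> cube_set P" for x x'
    proof -
      have i: "integrable lebesgue (\<lambda>y. k x y * ?g y)" "integrable lebesgue (\<lambda>y. k x' y * ?g y)"
        and e: "S ?g x = (LINT y|lebesgue. k x y * ?g y)" "S ?g x' = (LINT y|lebesgue. k x' y * ?g y)"
        using x x' unfolding nice_def by blast+
      have ae: "AE y in lebesgue. K x y = k x y" "AE y in lebesgue. K x' y = k x' y"
        using x(1) x'(1) unfolding nice_def by blast+
      have "S ?g x - S ?g x' = (LINT y|lebesgue. k x y * ?g y - k x' y * ?g y)"
        unfolding e by (rule Bochner_Integration.integral_diff[symmetric, OF i])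
      then have "ennreal \<bar>S ?g x - S ?g x'\<bar> = ennreal (norm (LINT y|lebesgue. k x y * ?g y - k x' y * ?g y))" by simp
      also have "\<dots> \<le> (\<integral>\<^sup>+y. ennreal (norm (k x y * ?g y - k x' y * ?g y)) \<partial>lebesgue)"
        by (rule integral_norm_bound_ennreal) (rule Bochner_Integration.integrable_diff[OF i])
      also have "\<dots> \<le> (\<integral>\<^sup>+y\<in>- cube_set (dilate 2 P). ennreal (\<bar>?g y\<bar> * \<bar>k x y - k x' y\<bar>) \<partial>lebesgue)"
      proof (rule nn_integral_mono)
        fix y
        have sub: "cube_set (dilate 2 P) \<subseteq> cube_set (dilate 3 P)" by (rule dilate_mono[OF _ cP]) simp
        have "norm (k x y * ?g y - k x' y * ?g y) = \<bar>?g y\<bar> * \<bar>k x y - k x' y\<bar>"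
          by (simp add: abs_mult[symmetric] algebra_simps)
        then show "ennreal (norm (k x y * ?g y - k x' y * ?g y)) \<le> ennreal (\<bar>?g y\<bar> * \<bar>k x y - k x' y\<bar>) * indicator (- cube_set (dilate 2 P)) y"
          using sub by (cases "y \<in> cube_set (dilate 2 P)") auto
      qed
      also have "\<dots> \<le> ennreal (2 * (\<alpha> * n2 * r)) * H1 K (complementary A)"
      proof (rule hormander_oscillation[OF A _ _ _ _ _ _ ae mod])
        show "is_cube (dilate 2 P)" using cP by simp
        show "x \<in> cube_set (dilate (1/2) (dilate 2 P))" using x by simp
        show "x' \<in> cube_set (dilate (1/2) (dilate 2 P))" using x' by simp
      qed measurable
      also have "\<dots> \<le> ennreal (2 * (\<alpha> * n2 * r)) * ennreal (\<sigma> * N)"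
        using H_le by (intro mult_left_mono) (auto simp: H_def)
      also have "\<dots> = ennreal osc" using \<alpha>0 n32 r0 by (simp add: osc_def ennreal_mult')
      finally show ?thesis using osc0 by (subst (asm) ennreal_le_iff) auto
    qed
    let ?X = "{x. \<bar>S ?h x\<bar> > t1}"
    have Xm: "?X \<in> sets lebesgue" using S_measurable[OF hi(1)] by (intro sets_lebesgue_gt) measurable
    \<comment> \<open>\<open>P\<close> loses at most one half to \<open>E\<close> and one quarter to
      \<open>?X\<close>, so a set of positive measure remains on which both S g and \<open>S\<close>
      of the near part are small. One good point of it anchors the far part, and the oscillation
      bound does the rest.\<close>
    let ?Y = "cube_set P - ?E - ?X"
    have Ym: "?Y \<in> sets lebesgue" by (intro sets.Diff Xm) auto
    have "emeasure lebesgue ?Y \<noteq> 0"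
    proof
      assume Y: "emeasure lebesgue ?Y = 0"
      have "emeasure lebesgue (cube_set P) \<le> emeasure lebesgue ((cube_set P \<inter> ?E) \<union> ?X \<union> ?Y)"
        by (rule emeasure_mono) (use Xm Ym in auto)
      also have "\<dots> \<le> emeasure lebesgue ((cube_set P \<inter> ?E) \<union> ?X) + emeasure lebesgue ?Y"
        by (rule emeasure_subadditive) (use Xm Ym in auto)
      also have "\<dots> \<le> emeasure lebesgue (cube_set P \<inter> ?E) + emeasure lebesgue ?X + 0"
        unfolding Y by (intro add_right_mono emeasure_subadditive) (use Xm in auto)
      also have "\<dots> \<le> ennreal (1/2) * ennreal p + ennreal (1/4 * p)"
        using half hS unfolding p(2) add_0_right by (rule add_mono)
      also have "\<dots> = ennreal (1/2 * p) + ennreal (1/4 * p)" by (subst ennreal_mult') auto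
      also have "\<dots> = ennreal (1/2 * p + 1/4 * p)" using p(1) by (intro ennreal_plus[symmetric]) auto
      finally show False using p by (subst (asm) p(2), subst (asm) ennreal_le_iff) auto
    qed
    moreover have "AE x in lebesgue. nice x \<and> S g x = S ?h x + 1 * S ?g x"
    proof -
      have "g = (\<lambda>y. ?h y + 1 * ?g y)" by (auto split: split_indicator)
      then have "AE x in lebesgue. S g x = S ?h x + 1 * S ?g x" using S_lincomb[OF hi, of 1] by simp
      with nice show ?thesis by eventually_elim simp
    qed
    ultimately obtain x' where x': "x' \<in> ?Y" "nice x'" "S g x' = S ?h x' + 1 * S ?g x'"
      using AE_ex_in_set[OF _ _ Ym, of "\<lambda>x. nice x \<and> S g x = S ?h x + 1 * S ?g x"] by blast
    have "\<bar>S g x'\<bar> \<le> t0" using x'(1) P(2) unfolding E1_def by auto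
    moreover have "\<bar>S ?h x'\<bar> \<le> t1" using x'(1) by auto
    ultimately have b: "\<bar>S ?g x'\<bar> \<le> t0 + t1" using x'(3) by linarith
    show "AE x in lebesgue. x \<in> cube_set P \<longrightarrow> \<bar>S ?g x\<bar> \<le> \<sigma> * N * local_const \<epsilon> * r"
      using nice
    proof eventually_elim
      case (elim x)
      show ?case
      proof
        assume "x \<in> cube_set P"
        then have "\<bar>S ?g x - S ?g x'\<bar> \<le> osc" using x' elim by (intro close) auto
        then show "\<bar>S ?g x\<bar> \<le> \<sigma> * N * local_const \<epsilon> * r" unfolding total[symmetric] using b by linarith
      qed
    qed
  qed
qed

end

section \<open>Commutators\<close>

text \<open>Pascal's rule for alternating sums, the inductive step of the binomial expansion below;
  there \<open>D h\<close> is the value of S at (b - c)^h F.\<close>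

lemma pascal_sum:
  fixes \<beta> :: real
  shows "(\<Sum>h\<le>m. real (m choose h) * (-1) ^ h * \<beta> ^ (Suc m - h) * D h) - (\<Sum>h\<le>m. real (m choose h) * (-1) ^ h * \<beta> ^ (m - h) * D (Suc h))
    = (\<Sum>h\<le>Suc m. real (Suc m choose h) * (-1) ^ h * \<beta> ^ (Suc m - h) * D h)"
proof -
  let ?f = "\<lambda>h. real (m choose h) * (-1) ^ h * \<beta> ^ (Suc m - h) * D h"
  let ?g = "\<lambda>h. real (m choose h) * (-1) ^ h * \<beta> ^ (m - h) * D (Suc h)"
  have "(\<Sum>h\<le>Suc m. real (Suc m choose h) * (-1) ^ h * \<beta> ^ (Suc m - h) * D h)
     = \<beta> ^ Suc m * D 0 + (\<Sum>h\<le>m. real (Suc m choose Suc h) * (-1) ^ Suc h * \<beta> ^ (m - h) * D (Suc h))"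
    by (subst sum.atMost_Suc_shift) simp
  also have "(\<Sum>h\<le>m. real (Suc m choose Suc h) * (-1) ^ Suc h * \<beta> ^ (m - h) * D (Suc h)) = (\<Sum>h\<le>m. ?f (Suc h) - ?g h)"
    by (rule sum.cong) (auto simp: algebra_simps)
  also have "\<dots> = (\<Sum>h\<le>m. ?f (Suc h)) - (\<Sum>h\<le>m. ?g h)" by (rule sum_subtractf)
  also have "\<beta> ^ Suc m * D 0 + ((\<Sum>h\<le>m. ?f (Suc h)) - (\<Sum>h\<le>m. ?g h)) = (\<Sum>h\<le>Suc m. ?f h) - (\<Sum>h\<le>m. ?g h)"
    by (subst sum.atMost_Suc_shift) simp
  also have "(\<Sum>h\<le>Suc m. ?f h) = (\<Sum>h\<le>m. ?f h)" by (simp add: binomial_eq_0)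
  finally show ?thesis by simp
qed

text \<open>The commutator unfolds into \<open>S\<close> applied to the products b^h F. Linearity of
  \<open>S\<close> has been established for integrable functions, so all these products are required
  to be integrable.\<close>

definition moments_integrable :: "nat \<Rightarrow> ('a::euclidean_space \<Rightarrow> real) \<Rightarrow> ('a \<Rightarrow> real) \<Rightarrow> bool" where
  "moments_integrable m b F \<longleftrightarrow> (\<forall>h\<le>m. integrable lebesgue (\<lambda>y. b y ^ h * F y))"

lemma moments_integrable_shift:
  assumes "moments_integrable m b F" shows "moments_integrable m (\<lambda>y. b y - c) F"
  unfolding moments_integrable_def
proof (intro allI impI)
  fix h assume h: "h \<le> m"
  have "(\<lambda>y. (b y - c) ^ h * F y) = (\<lambda>y. \<Sum>j\<le>h. real (h choose j) * (- c) ^ (h - j) * (b y ^ j * F y))"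
  proof
    fix y
    have "(b y + (- c)) ^ h = (\<Sum>j\<le>h. real (h choose j) * b y ^ j * (- c) ^ (h - j))" by (rule binomial_ring)
    then show "(b y - c) ^ h * F y = (\<Sum>j\<le>h. real (h choose j) * (- c) ^ (h - j) * (b y ^ j * F y))"
      by (simp add: sum_distrib_left mult_ac)
  qed
  moreover have "integrable lebesgue (\<lambda>y. \<Sum>j\<le>h. real (h choose j) * (- c) ^ (h - j) * (b y ^ j * F y))"
  proof (rule Bochner_Integration.integrable_sum)
    fix j assume "j \<in> {..h}"
    then have "integrable lebesgue (\<lambda>y. b y ^ j * F y)" using assms h by (simp add: moments_integrable_def)
    then show "integrable lebesgue (\<lambda>y. real (h choose j) * (- c) ^ (h - j) * (b y ^ j * F y))" by (rule integrable_mult_right)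
  qed
  ultimately show "integrable lebesgue (\<lambda>y. (b y - c) ^ h * F y)" by simp
qed

lemma moments_integrable_indicator:
  assumes "moments_integrable m b F" "M \<in> sets lebesgue"
  shows "moments_integrable m b (\<lambda>y. F y * indicat_real M y)"
  unfolding moments_integrable_def
proof (intro allI impI)
  fix h assume "h \<le> m"
  then have "integrable lebesgue (\<lambda>y. b y ^ h * F y)" using assms by (simp add: moments_integrable_def)
  then have "integrable lebesgue (\<lambda>y. (b y ^ h * F y) * indicat_real M y)"
    by (rule integrable_real_mult_indicator[OF assms(2)])
  then show "integrable lebesgue (\<lambda>y. b y ^ h * (F y * indicat_real M y))" by (simp add: mult.assoc)
qed

context hormander_setting
begin

text \<open>In the induction step b F = (b - c) F + c F splits the second term of the recursion; the
  multiples of c combine with the factor b(x) to b(x) - c, and Pascal's rule finishes.\<close>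

lemma commutator_shift:
  assumes "moments_integrable m b F"
  shows "AE x in lebesgue. commutator T b m F x =
    (\<Sum>h\<le>m. real (m choose h) * (-1) ^ h * (b x - c) ^ (m - h) * S (\<lambda>y. (b y - c) ^ h * F y) x)"
  using assms
proof (induction m arbitrary: F)
  case 0
  then show ?case by simp
next
  case (Suc m)
  have I1: "moments_integrable m b F" using Suc.prems by (simp add: moments_integrable_def)
  have I2: "moments_integrable m b (\<lambda>y. b y * F y)"
    unfolding moments_integrable_def
  proof (intro allI impI)
    fix h assume "h \<le> m"
    then have "integrable lebesgue (\<lambda>y. b y ^ Suc h * F y)" using Suc.prems unfolding moments_integrable_def by (metis Suc_le_mono)
    then show "integrable lebesgue (\<lambda>y. b y ^ h * (b y * F y))" by (simp add: mult_ac)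
  qed
  have J: "integrable lebesgue (\<lambda>y. (b y - c) ^ h * F y)" if "h \<le> Suc m" for h
    using moments_integrable_shift[OF Suc.prems, of c] that by (simp add: moments_integrable_def)
  let ?D = "\<lambda>h. S (\<lambda>y. (b y - c) ^ h * F y)"
  have "AE x in lebesgue. \<forall>h\<in>{..m}. S (\<lambda>y. (b y - c) ^ h * (b y * F y)) x = ?D (Suc h) x + c * ?D h x"
  proof (rule AE_finite_allI)
    fix h assume "h \<in> {..m}"
    then have j: "integrable lebesgue (\<lambda>y. (b y - c) ^ Suc h * F y)" "integrable lebesgue (\<lambda>y. (b y - c) ^ h * F y)"
      using J[of "Suc h"] J[of h] by (simp_all del: power_Suc)
    have "(\<lambda>y. (b y - c) ^ h * (b y * F y)) = (\<lambda>y. (b y - c) ^ Suc h * F y + c * ((b y - c) ^ h * F y))"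
      by (auto simp: algebra_simps)
    then show "AE x in lebesgue. S (\<lambda>y. (b y - c) ^ h * (b y * F y)) x = ?D (Suc h) x + c * ?D h x"
      using S_lincomb[OF j, of c] by simp
  qed simp
  with Suc.IH[OF I1] Suc.IH[OF I2] show ?case
  proof eventually_elim
    case (elim x)
    let ?w = "\<lambda>h. real (m choose h) * (-1) ^ h * (b x - c) ^ (m - h)"
    have "commutator T b (Suc m) F x = b x * (\<Sum>h\<le>m. ?w h * ?D h x) - (\<Sum>h\<le>m. ?w h * S (\<lambda>y. (b y - c) ^ h * (b y * F y)) x)"
      using elim by simp
    also have "(\<Sum>h\<le>m. ?w h * S (\<lambda>y. (b y - c) ^ h * (b y * F y)) x) = (\<Sum>h\<le>m. ?w h * (?D (Suc h) x + c * ?D h x))"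
      using elim(3) by (intro sum.cong) auto
    also have "b x * (\<Sum>h\<le>m. ?w h * ?D h x) - (\<Sum>h\<le>m. ?w h * (?D (Suc h) x + c * ?D h x))
       = (\<Sum>h\<le>m. (b x - c) * (?w h * ?D h x)) - (\<Sum>h\<le>m. ?w h * ?D (Suc h) x)"
      by (simp add: sum_distrib_left sum_subtractf[symmetric] algebra_simps)
    also have "(\<Sum>h\<le>m. (b x - c) * (?w h * ?D h x)) = (\<Sum>h\<le>m. real (m choose h) * (-1) ^ h * (b x - c) ^ (Suc m - h) * ?D h x)"
      by (rule sum.cong) (auto simp: Suc_diff_le mult_ac)
    also have "(\<Sum>h\<le>m. real (m choose h) * (-1) ^ h * (b x - c) ^ (Suc m - h) * ?D h x) - (\<Sum>h\<le>m. ?w h * ?D (Suc h) x)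
       = (\<Sum>h\<le>Suc m. real (Suc m choose h) * (-1) ^ h * (b x - c) ^ (Suc m - h) * ?D h x)"
      by (rule pascal_sum)
    finally show ?case .
  qed
qed

lemma commutator_bound:
  assumes "moments_integrable m b F"
  shows "AE x in lebesgue. \<bar>commutator T b m F x\<bar> \<le>
    (\<Sum>h\<le>m. real (m choose h) * (\<bar>b x - c\<bar> ^ (m - h) * \<bar>S (\<lambda>y. (b y - c) ^ h * F y) x\<bar>))"
  using commutator_shift[OF assms, of c]
proof eventually_elim
  case (elim x)
  have "\<bar>commutator T b m F x\<bar> \<le> (\<Sum>h\<le>m. \<bar>real (m choose h) * (-1) ^ h * (b x - c) ^ (m - h) * S (\<lambda>y. (b y - c) ^ h * F y) x\<bar>)"
    unfolding elim by (rule sum_abs)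
  then show ?case by (simp add: abs_mult power_abs mult.assoc)
qed

lemma commutator_add:
  assumes "moments_integrable m b F" "moments_integrable m b G"
  shows "AE x in lebesgue. commutator T b m (\<lambda>y. F y + G y) x = commutator T b m F x + commutator T b m G x"
proof -
  have FG: "moments_integrable m b (\<lambda>y. F y + G y)"
    using assms by (simp add: moments_integrable_def distrib_left)
  have "AE x in lebesgue. \<forall>h\<in>{..m}. S (\<lambda>y. (b y - 0) ^ h * (F y + G y)) x = S (\<lambda>y. (b y - 0) ^ h * F y) x + S (\<lambda>y. (b y - 0) ^ h * G y) x"
  proof (rule AE_finite_allI)
    fix h assume "h \<in> {..m}"
    then have "integrable lebesgue (\<lambda>y. (b y - 0) ^ h * F y)" "integrable lebesgue (\<lambda>y. (b y - 0) ^ h * G y)"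
      using assms by (auto simp: moments_integrable_def)
    from S_lincomb[OF this, of 1]
    show "AE x in lebesgue. S (\<lambda>y. (b y - 0) ^ h * (F y + G y)) x = S (\<lambda>y. (b y - 0) ^ h * F y) x + S (\<lambda>y. (b y - 0) ^ h * G y) x"
      by (simp add: distrib_left)
  qed simp
  with commutator_shift[OF FG, of 0] commutator_shift[OF assms(1), of 0] commutator_shift[OF assms(2), of 0]
  show ?thesis
  proof eventually_elim
    case (elim x)
    show ?case unfolding elim(1-3) sum.distrib[symmetric] using elim(4) by (intro sum.cong) (auto simp: distrib_left)
  qed
qed

end

section \<open>The recursion\<close>

lemma luxemburg_cong_abs:
  assumes "\<And>x. x \<in> cube_set Q \<Longrightarrow> \<bar>f x\<bar> = \<bar>g x\<bar>" shows "luxemburg E Q f = luxemburg E Q g"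
proof -
  have "(\<integral>\<^sup>+x\<in>cube_set Q. E (\<bar>f x\<bar> / r) \<partial>lebesgue) = (\<integral>\<^sup>+x\<in>cube_set Q. E (\<bar>g x\<bar> / r) \<partial>lebesgue)" for r
    using assms by (intro nn_integral_cong) (auto split: split_indicator)
  then show ?thesis by (simp add: luxemburg_def)
qed

lemma triple_subset:
  assumes "cube_set R \<subseteq> cube_set Q" "is_cube R"
  shows "cube_set (dilate 3 R) \<subseteq> cube_set (dilate 3 Q)"
proof
  fix y assume y: "y \<in> cube_set (dilate 3 R)"
  note b = cube_subset_bounds[OF assms]
  have s: "side R > 0" using assms by (simp add: is_cube_def)
  show "y \<in> cube_set (dilate 3 Q)"
    unfolding cube_set_def dilate_def
  proof clarsimp
    fix i
    have "fst R $ i - 3 * side R / 2 \<le> y $ i" "y $ i < fst R $ i + 3 * side R / 2"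
      using y by (auto simp: cube_set_def dilate_def)
    then show "fst Q $ i - 3 * side Q / 2 \<le> y $ i \<and> y $ i < fst Q $ i + 3 * side Q / 2"
      using b(1)[of i] b(2)[of i] s by argo
  qed
qed

text \<open>The contribution of one cube to the sum of all m + 1 sparse operators, before the
  indicator of the cube is attached.\<close>

definition level_bound :: "(real \<Rightarrow> real) \<Rightarrow> nat \<Rightarrow> (real ^ 'n \<Rightarrow> real) \<Rightarrow> (real ^ 'n \<Rightarrow> real) \<Rightarrow> 'n::finite cube \<Rightarrow> real ^ 'n \<Rightarrow> ennreal" where
  "level_bound A m b f Q x = (\<Sum>h=0..m. of_nat (m choose h) * (ennreal (\<bar>b x - avg b Q\<bar> ^ (m - h)) *
     luxemburg (\<lambda>t. ennreal (A t)) Q (\<lambda>y. f y * \<bar>b y - avg b Q\<bar> ^ h)))"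

context hormander_setting
begin

text \<open>If the average \<nu> is positive, 2 \<nu> is an admissible radius, which costs the
  factor 2. If \<nu> = 0, arbitrarily small radii are admissible, so g = 0 almost everywhere and the
  empty set serves.\<close>

lemma exceptional_set_luxemburg:
  assumes Q0: "Q0 \<in> base.cubes" and gm [measurable]: "g \<in> borel_measurable lebesgue"
    and g0: "\<And>y. y \<notin> cube_set (dilate 3 Q0) \<Longrightarrow> g y = 0"
    and fin: "luxemburg (\<lambda>t. ennreal (A t)) (dilate 3 Q0) g < top" and \<epsilon>: "0 < \<epsilon>" "\<epsilon> \<le> 1"
  shows "integrable lebesgue g" (is ?I)
    "\<exists>E\<in>sets lebesgue. E \<subseteq> cube_set Q0 \<and> emeasure lebesgue E \<le> ennreal \<epsilon> * emeasure lebesgue (cube_set Q0) \<and>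
    (AE x in lebesgue. x \<in> cube_set Q0 \<longrightarrow> x \<notin> E \<longrightarrow> ennreal \<bar>S g x\<bar> \<le> ennreal (2 * \<sigma> * N * local_const \<epsilon>) * luxemburg (\<lambda>t. ennreal (A t)) (dilate 3 Q0) g) \<and>
    (\<forall>P\<in>base.cubes. cube_set P \<subseteq> cube_set Q0 \<longrightarrow>
       emeasure lebesgue (cube_set P \<inter> E) \<le> ennreal (1/2) * emeasure lebesgue (cube_set P) \<longrightarrow>
       (AE x in lebesgue. x \<in> cube_set P \<longrightarrow> ennreal \<bar>S (\<lambda>y. g y * indicat_real (- cube_set (dilate 3 P)) y) x\<bar> \<le> ennreal (2 * \<sigma> * N * local_const \<epsilon>) * luxemburg (\<lambda>t. ennreal (A t)) (dilate 3 Q0) g))"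
    (is ?E)
proof -
  let ?Q = "dilate 3 Q0" and ?C = "\<sigma> * N * local_const \<epsilon>"
  have cQ: "is_cube ?Q" using base.is_cube_cubes[OF Q0] by simp
  obtain \<nu> where \<nu>: "luxemburg (\<lambda>t. ennreal (A t)) ?Q g = ennreal \<nu>" "0 \<le> \<nu>"
    using fin by (cases "luxemburg (\<lambda>t. ennreal (A t)) ?Q g") auto
  have mod: "modular_le A ?Q g r" if "r > \<nu>" for r
    by (rule luxemburg_modular[OF cQ A]) (use \<nu> that in \<open>simp add: ennreal_less_iff\<close>)
  have L1: "(\<integral>\<^sup>+y. ennreal \<bar>g y\<bar> \<partial>lebesgue) \<le> ennreal (\<sigma> * r * (1 + 1)) * emeasure lebesgue (cube_set ?Q)" if "r > \<nu>" for r
  proof -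
    have "(\<integral>\<^sup>+y. ennreal \<bar>g y\<bar> \<partial>lebesgue) = (\<integral>\<^sup>+y\<in>cube_set ?Q. ennreal \<bar>g y\<bar> \<partial>lebesgue)"
      using g0 by (intro nn_integral_cong) (auto split: split_indicator)
    also have "\<dots> \<le> ennreal (\<sigma> * r * (1 + 1)) * emeasure lebesgue (cube_set ?Q)"
      by (rule modular_le_L1[OF A \<sigma>]) (use mod[OF that] in \<open>simp_all add: modular_le_def\<close>)
    finally show ?thesis .
  qed
  have "(\<integral>\<^sup>+y. ennreal (norm (g y)) \<partial>lebesgue) < top"
    using L1[of "\<nu> + 1"] cQ by (auto intro!: le_less_trans[OF L1[of "\<nu> + 1"]] simp: ennreal_mult_less_top)
  then show gi: ?I by (simp add: integrable_iff_bounded gm top.not_eq_extremum)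
  have lc: "local_const \<epsilon> \<ge> 0" using \<epsilon> by (simp add: local_const_def stop_level_def)
  show ?E
  proof (cases "\<nu> = 0")
    case False
    then have "2 * \<nu> > \<nu>" using \<nu>(2) by simp
    note E = exceptional_set[OF Q0 gi g0 mod[OF this] \<epsilon>]
    have le: "ennreal z \<le> ennreal (2 * \<sigma> * N * local_const \<epsilon>) * luxemburg (\<lambda>t. ennreal (A t)) ?Q g" if "z \<le> ?C * (2 * \<nu>)" for z
    proof -
      have "ennreal z \<le> ennreal ((2 * \<sigma> * N * local_const \<epsilon>) * \<nu>)" using that by (intro ennreal_leI) (simp add: mult_ac)
      also have "\<dots> = ennreal (2 * \<sigma> * N * local_const \<epsilon>) * ennreal \<nu>"
        using \<sigma> N_pos lc by (intro ennreal_mult') auto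
      finally show ?thesis by (simp add: \<nu>(1))
    qed
    from E obtain E where E: "E \<in> sets lebesgue" "E \<subseteq> cube_set Q0" "emeasure lebesgue E \<le> ennreal \<epsilon> * emeasure lebesgue (cube_set Q0)"
      "AE x in lebesgue. x \<in> cube_set Q0 \<longrightarrow> x \<notin> E \<longrightarrow> \<bar>S g x\<bar> \<le> ?C * (2 * \<nu>)"
      "\<forall>P\<in>base.cubes. cube_set P \<subseteq> cube_set Q0 \<longrightarrow> emeasure lebesgue (cube_set P \<inter> E) \<le> ennreal (1/2) * emeasure lebesgue (cube_set P) \<longrightarrow>
       (AE x in lebesgue. x \<in> cube_set P \<longrightarrow> \<bar>S (\<lambda>y. g y * indicat_real (- cube_set (dilate 3 P)) y) x\<bar> \<le> ?C * (2 * \<nu>))"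
      by blast
    show ?thesis
    proof (intro bexI[OF _ E(1)] conjI E(2,3) ballI impI)
      show "AE x in lebesgue. x \<in> cube_set Q0 \<longrightarrow> x \<notin> E \<longrightarrow> ennreal \<bar>S g x\<bar> \<le> ennreal (2 * \<sigma> * N * local_const \<epsilon>) * luxemburg (\<lambda>t. ennreal (A t)) ?Q g"
        using E(4) by eventually_elim (use le in blast)
      fix P assume "P \<in> base.cubes" "cube_set P \<subseteq> cube_set Q0" "emeasure lebesgue (cube_set P \<inter> E) \<le> ennreal (1/2) * emeasure lebesgue (cube_set P)"
      then have "AE x in lebesgue. x \<in> cube_set P \<longrightarrow> \<bar>S (\<lambda>y. g y * indicat_real (- cube_set (dilate 3 P)) y) x\<bar> \<le> ?C * (2 * \<nu>)"
        using E(5) by blast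
      then show "AE x in lebesgue. x \<in> cube_set P \<longrightarrow> ennreal \<bar>S (\<lambda>y. g y * indicat_real (- cube_set (dilate 3 P)) y) x\<bar> \<le> ennreal (2 * \<sigma> * N * local_const \<epsilon>) * luxemburg (\<lambda>t. ennreal (A t)) ?Q g"
        by eventually_elim (use le in blast)
    qed
  next
    case True
    define V where "V = measure lebesgue (cube_set ?Q)"
    have V: "emeasure lebesgue (cube_set ?Q) = ennreal V" "V \<ge> 0" using cQ by (auto simp: V_def emeasure_eq_ennreal_measure)
    have "(\<integral>\<^sup>+y. ennreal \<bar>g y\<bar> \<partial>lebesgue) \<le> 0 + ennreal e" if e: "e > 0" for e
    proof -
      define r where "r = e / (2 * \<sigma> * (V + 1))"
      have r: "r > 0" using e \<sigma> V by (simp add: r_def)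
      have "\<sigma> * r * (1 + 1) * V \<le> \<sigma> * r * (1 + 1) * (V + 1)" using \<sigma> r by (intro mult_left_mono) auto
      also have "\<dots> = r * (2 * \<sigma> * (V + 1))" by simp
      also have "\<dots> = e" using \<sigma> V by (simp add: r_def)
      finally have "\<sigma> * r * (1 + 1) * V \<le> e" .
      then have "ennreal (\<sigma> * r * (1 + 1) * V) \<le> ennreal e" by (rule ennreal_leI)
      moreover have "ennreal (\<sigma> * r * (1 + 1)) * emeasure lebesgue (cube_set ?Q) = ennreal (\<sigma> * r * (1 + 1) * V)"
        unfolding V(1) using \<sigma> r by (intro ennreal_mult'[symmetric]) auto
      ultimately show ?thesis using L1[of r] r True by simp
    qed
    then have "(\<integral>\<^sup>+y. ennreal \<bar>g y\<bar> \<partial>lebesgue) \<le> 0" by (rule ennreal_le_epsilon)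
    then have "AE y in lebesgue. ennreal \<bar>g y\<bar> = 0" by (subst (asm) le_zero_eq, subst (asm) nn_integral_0_iff_AE) auto
    then have ae: "AE y in lebesgue. g y = 0" by eventually_elim (simp add: ennreal_eq_0_iff)
    show ?thesis
    proof (intro bexI[of _ "{}"] conjI ballI impI)
      show "AE x in lebesgue. x \<in> cube_set Q0 \<longrightarrow> x \<notin> {} \<longrightarrow> ennreal \<bar>S g x\<bar> \<le> ennreal (2 * \<sigma> * N * local_const \<epsilon>) * luxemburg (\<lambda>t. ennreal (A t)) ?Q g"
        using S_zero[OF gi ae] by eventually_elim simp
      fix P :: "'n cube"
      have nP: "- cube_set (dilate 3 P) \<in> sets lebesgue" using sets.compl_sets[of "cube_set (dilate 3 P)" lebesgue] by (simp add: Compl_eq_Diff_UNIV)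
      have "AE x in lebesgue. S (\<lambda>y. g y * indicat_real (- cube_set (dilate 3 P)) y) x = 0"
        by (rule S_zero[OF integrable_real_mult_indicator[OF nP gi]]) (use ae in eventually_elim, simp)
      then show "AE x in lebesgue. x \<in> cube_set P \<longrightarrow> ennreal \<bar>S (\<lambda>y. g y * indicat_real (- cube_set (dilate 3 P)) y) x\<bar> \<le> ennreal (2 * \<sigma> * N * local_const \<epsilon>) * luxemburg (\<lambda>t. ennreal (A t)) ?Q g"
        by eventually_elim simp
    qed auto
  qed
qed

text \<open>The m + 1 exceptional sets together have density at most 1/4 of 2^(-n), half the
  selection threshold in \<open>recursion_step\<close>. That threshold in turn leaves density at
  most 1/2 in a selected cube, because its parent was not selected.\<close>

definition eps :: "nat \<Rightarrow> real" where "eps m = 1 / (2 ^ (CARD('n) + 2) * real (m + 1))"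

definition step_const :: "nat \<Rightarrow> ennreal" where "step_const m = ennreal (2 * \<sigma> * N * local_const (eps m))"

lemma eps: "0 < eps m" "eps m \<le> 1"
proof -
  show "0 < eps m" by (simp add: eps_def)
  have "1 * 1 \<le> (2::real) ^ (CARD('n) + 2) * real (m + 1)" by (intro mult_mono one_le_power) auto
  then show "eps m \<le> 1" by (simp add: eps_def)
qed

lemma step_const_pos: "step_const m > 0"
proof -
  have "local_const (eps m) > 0"
    unfolding local_const_def stop_level_def using eps[of m] by (intro add_pos_pos mult_pos_pos divide_pos_pos) auto
  then show ?thesis unfolding step_const_def using \<sigma> N_pos by simp
qed

text \<open>Since t^h \<le> 1 + t^m and f is bounded, an infinite average for h forces one for m.
  The term with h = m carries the prefactor |b(x) - b_Q|^0 = 1, so it is not 0 times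
  infinity.\<close>

lemma level_bound_top:
  assumes fM: "\<And>y. \<bar>f y\<bar> \<le> M" and Q: "is_cube Q" and [measurable]: "f \<in> borel_measurable lebesgue" "b \<in> borel_measurable lebesgue"
    and inf: "h \<le> m" "luxemburg (\<lambda>t. ennreal (A t)) Q (\<lambda>y. f y * \<bar>b y - avg b Q\<bar> ^ h) = top"
  shows "level_bound A m b f Q x = top"
proof -
  let ?c = "avg b Q"
  have "luxemburg (\<lambda>t. ennreal (A t)) Q (\<lambda>y. f y * \<bar>b y - ?c\<bar> ^ m) = top"
  proof (rule ccontr)
    assume "\<not> ?thesis"
    then have "luxemburg (\<lambda>t. ennreal (A t)) Q (\<lambda>y. f y * \<bar>b y - ?c\<bar> ^ m) < top" by (simp add: top.not_eq_extremum)
    then obtain \<nu> where "luxemburg (\<lambda>t. ennreal (A t)) Q (\<lambda>y. f y * \<bar>b y - ?c\<bar> ^ m) = ennreal \<nu>" "0 \<le> \<nu>"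
      by (cases "luxemburg (\<lambda>t. ennreal (A t)) Q (\<lambda>y. f y * \<bar>b y - ?c\<bar> ^ m)") auto
    then have 1: "modular_le A Q (\<lambda>y. f y * \<bar>b y - ?c\<bar> ^ m) (\<nu> + 1)"
      by (intro luxemburg_modular[OF Q A]) (simp add: ennreal_less_iff)
    have 2: "modular_le A Q f ((\<bar>M\<bar> + 1) / \<sigma>)"
    proof (rule modular_le_bounded[OF A \<sigma>])
      show "\<bar>f y\<bar> \<le> \<bar>M\<bar> + 1" for y using fM[of y] by linarith
    qed simp
    define r where "r = max (\<nu> + 1) ((\<bar>M\<bar> + 1) / \<sigma>)"
    have 1: "modular_le A Q (\<lambda>y. \<bar>f y * \<bar>b y - ?c\<bar> ^ m\<bar>) r"
      by (rule modular_le_abs_mono[OF A modular_le_mono[OF A 1]]) (auto simp: r_def)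
    have 2: "modular_le A Q (\<lambda>y. \<bar>f y\<bar>) r"
      by (rule modular_le_abs_mono[OF A modular_le_mono[OF A 2]]) (auto simp: r_def)
    have "modular_le A Q (\<lambda>y. \<bar>f y\<bar> + \<bar>f y * \<bar>b y - ?c\<bar> ^ m\<bar>) (2 * r)"
      by (rule modular_le_add[OF A 2 1]) measurable
    then have "modular_le A Q (\<lambda>y. f y * \<bar>b y - ?c\<bar> ^ h) (2 * r)"
    proof (rule modular_le_abs_mono[OF A])
      fix y
      let ?t = "\<bar>b y - ?c\<bar>"
      have "?t ^ h \<le> 1 + ?t ^ m"
      proof (cases "?t \<le> 1")
        case True
        then have "?t ^ h \<le> 1" by (intro power_le_one) auto
        moreover have "0 \<le> ?t ^ m" by simp
        ultimately show ?thesis by linarith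
      next
        case False
        then have "?t ^ h \<le> ?t ^ m" using inf(1) by (intro power_increasing) auto
        then show ?thesis by linarith
      qed
      then have "\<bar>f y\<bar> * ?t ^ h \<le> \<bar>f y\<bar> * (1 + ?t ^ m)" by (rule mult_left_mono) simp
      then show "\<bar>f y * ?t ^ h\<bar> \<le> \<bar>\<bar>f y\<bar> + \<bar>f y * ?t ^ m\<bar>\<bar>" by (simp add: abs_mult distrib_left)
    qed
    from modular_le_luxemburg[OF Q this] show False using inf(2) by (simp add: top_unique)
  qed
  then have "top = of_nat (m choose m) * (ennreal (\<bar>b x - ?c\<bar> ^ (m - m)) * luxemburg (\<lambda>t. ennreal (A t)) Q (\<lambda>y. f y * \<bar>b y - ?c\<bar> ^ m))" by simp
  also have "\<dots> \<le> level_bound A m b f Q x"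
    unfolding level_bound_def by (rule member_le_sum[where f = "\<lambda>h. of_nat (m choose h) * (ennreal (\<bar>b x - ?c\<bar> ^ (m - h)) * luxemburg (\<lambda>t. ennreal (A t)) Q (\<lambda>y. f y * \<bar>b y - ?c\<bar> ^ h))"]) auto
  finally show ?thesis by (simp add: top_unique)
qed

end

context hormander_setting
begin

abbreviation localized :: "(real ^ 'n \<Rightarrow> real) \<Rightarrow> 'n cube \<Rightarrow> real ^ 'n \<Rightarrow> real" where
  "localized f Q \<equiv> (\<lambda>y. f y * indicat_real (cube_set (dilate 3 Q)) y)"

text \<open>An infinite Luxemburg average makes the bound trivial, and then no children are chosen.
  Otherwise finiteness makes the functions f (b - c)^h on the triple integrable, so that the
  binomial expansion is legitimate.\<close>

lemma recursion_step:
  assumes Q0: "Q0 \<in> base.cubes" and fM: "\<And>y. \<bar>f y\<bar> \<le> M"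
    and [measurable]: "f \<in> borel_measurable lebesgue" "b \<in> borel_measurable lebesgue"
  shows "\<exists>Ch. Ch \<subseteq> base.cubes \<and> disjoint_family_on cube_set Ch \<and>
    (\<forall>R\<in>Ch. cube_set R \<subseteq> cube_set Q0 \<and> side R < side Q0) \<and>
    emeasure lebesgue (\<Union>R\<in>Ch. cube_set R) \<le> ennreal (1/2) * emeasure lebesgue (cube_set Q0) \<and>
    (AE x in lebesgue. x \<in> cube_set Q0 \<longrightarrow> x \<notin> (\<Union>R\<in>Ch. cube_set R) \<longrightarrow>
       ennreal \<bar>commutator T b m (localized f Q0) x\<bar> \<le> step_const m * level_bound A m b f (dilate 3 Q0) x) \<and>
    (\<forall>R\<in>Ch. AE x in lebesgue. x \<in> cube_set R \<longrightarrow>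
       ennreal \<bar>commutator T b m (localized f Q0) x\<bar> \<le>
         step_const m * level_bound A m b f (dilate 3 Q0) x + ennreal \<bar>commutator T b m (localized f R) x\<bar>)"
proof -
  let ?Q = "dilate 3 Q0" and ?c = "avg b (dilate 3 Q0)"
  let ?lux = "\<lambda>h. luxemburg (\<lambda>t. ennreal (A t)) ?Q (\<lambda>y. f y * \<bar>b y - ?c\<bar> ^ h)"
  have cQ0: "is_cube Q0" using Q0 by (rule base.is_cube_cubes)
  have cQ: "is_cube ?Q" using cQ0 by simp
  show ?thesis
  proof (cases "\<exists>h\<le>m. ?lux h = top")
    case True
    then obtain h where "h \<le> m" "?lux h = top" by blast
    then have "level_bound A m b f ?Q x = top" for x
      by (intro level_bound_top[OF fM cQ]) auto
    then have "step_const m * level_bound A m b f ?Q x = top" for x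
      using step_const_pos[of m] by (simp add: ennreal_mult_top)
    then show ?thesis by (intro exI[of _ "{}"]) (simp add: disjoint_family_on_def)
  next
    case False
    let ?F = "localized f Q0"
    let ?g = "\<lambda>h y. (b y - ?c) ^ h * ?F y"
    have lux_eq: "luxemburg (\<lambda>t. ennreal (A t)) ?Q (?g h) = ?lux h" for h
      by (rule luxemburg_cong_abs) (simp add: abs_mult power_abs mult.commute)
    have fin: "luxemburg (\<lambda>t. ennreal (A t)) ?Q (?g h) < top" if "h \<le> m" for h
      unfolding lux_eq using False that by (auto simp: top.not_eq_extremum[symmetric])
    have gm: "?g h \<in> borel_measurable lebesgue" for h by measurable
    have g0: "?g h y = 0" if "y \<notin> cube_set ?Q" for h y using that by simp
    have gi: "integrable lebesgue (?g h)" if "h \<le> m" for h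
      by (rule exceptional_set_luxemburg(1)[OF Q0 gm g0 fin[OF that] eps])
    have momF: "moments_integrable m b ?F"
    proof -
      have "moments_integrable m (\<lambda>y. b y - ?c) ?F" using gi by (simp add: moments_integrable_def)
      from moments_integrable_shift[OF this, of "- ?c"] show ?thesis by simp
    qed
    define C where "C = step_const m"
    define exc where "exc h E \<longleftrightarrow> E \<in> sets lebesgue \<and> E \<subseteq> cube_set Q0 \<and> emeasure lebesgue E \<le> ennreal (eps m) * emeasure lebesgue (cube_set Q0) \<and>
      (AE x in lebesgue. x \<in> cube_set Q0 \<longrightarrow> x \<notin> E \<longrightarrow> ennreal \<bar>S (?g h) x\<bar> \<le> C * ?lux h) \<and>
      (\<forall>P\<in>base.cubes. cube_set P \<subseteq> cube_set Q0 \<longrightarrow>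
         emeasure lebesgue (cube_set P \<inter> E) \<le> ennreal (1/2) * emeasure lebesgue (cube_set P) \<longrightarrow>
         (AE x in lebesgue. x \<in> cube_set P \<longrightarrow> ennreal \<bar>S (\<lambda>y. ?g h y * indicat_real (- cube_set (dilate 3 P)) y) x\<bar> \<le> C * ?lux h))" for h E
    define E where "E h = (SOME E. exc h E)" for h
    have exc: "exc h (E h)" if "h \<le> m" for h
      unfolding E_def
    proof (rule someI_ex)
      show "\<exists>E. exc h E"
        using exceptional_set_luxemburg(2)[OF Q0 gm g0 fin[OF that] eps]
        unfolding exc_def lux_eq C_def step_const_def Bex_def .
    qed
    have E: "E h \<in> sets lebesgue" "E h \<subseteq> cube_set Q0" "emeasure lebesgue (E h) \<le> ennreal (eps m) * emeasure lebesgue (cube_set Q0)"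
      "AE x in lebesgue. x \<in> cube_set Q0 \<longrightarrow> x \<notin> E h \<longrightarrow> ennreal \<bar>S (?g h) x\<bar> \<le> C * ?lux h" if "h \<le> m" for h
      using exc[OF that] unfolding exc_def by - (elim conjE, assumption)+
    have E5: "AE x in lebesgue. x \<in> cube_set P \<longrightarrow> ennreal \<bar>S (\<lambda>y. ?g h y * indicat_real (- cube_set (dilate 3 P)) y) x\<bar> \<le> C * ?lux h"
      if "h \<le> m" "P \<in> base.cubes" "cube_set P \<subseteq> cube_set Q0" "emeasure lebesgue (cube_set P \<inter> E h) \<le> ennreal (1/2) * emeasure lebesgue (cube_set P)" for h P
    proof -
      have "\<forall>P\<in>base.cubes. cube_set P \<subseteq> cube_set Q0 \<longrightarrow>
         emeasure lebesgue (cube_set P \<inter> E h) \<le> ennreal (1/2) * emeasure lebesgue (cube_set P) \<longrightarrow>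
         (AE x in lebesgue. x \<in> cube_set P \<longrightarrow> ennreal \<bar>S (\<lambda>y. ?g h y * indicat_real (- cube_set (dilate 3 P)) y) x\<bar> \<le> C * ?lux h)"
        using exc[OF that(1)] unfolding exc_def by (elim conjE)
      then show ?thesis using that(2-4) by (elim ballE impE) auto
    qed
    define U where "U = (\<Union>h\<in>{..m}. E h)"
    have Um [measurable]: "U \<in> sets lebesgue" unfolding U_def using E(1) by auto
    have UQ: "U \<subseteq> cube_set Q0" unfolding U_def using E(2) by blast
    define p where "p = (2 ^ CARD('n) :: real)"
    have p: "p \<ge> 1" by (simp add: p_def)
    have U_le: "emeasure lebesgue U \<le> ennreal (1 / (4 * p)) * emeasure lebesgue (cube_set Q0)"
    proof -
      have "emeasure lebesgue U \<le> (\<Sum>h\<in>{..m}. emeasure lebesgue (E h))"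
        unfolding U_def using E(1) by (intro emeasure_subadditive_finite) auto
      also have "\<dots> \<le> (\<Sum>h\<in>{..m}. ennreal (eps m) * emeasure lebesgue (cube_set Q0))" by (intro sum_mono E(3)) simp
      also have "\<dots> = ennreal (real (m + 1)) * (ennreal (eps m) * emeasure lebesgue (cube_set Q0))"
        by (simp flip: ennreal_of_nat_eq_real_of_nat)
      also have "\<dots> = ennreal (real (m + 1) * eps m) * emeasure lebesgue (cube_set Q0)"
        by (simp only: ennreal_mult'[OF of_nat_0_le_iff] mult.assoc)
      also have "real (m + 1) * eps m = 1 / (4 * p)" by (simp add: eps_def p_def)
      finally show ?thesis .
    qed
    obtain k0 x0 where k0: "Q0 = base.cel k0 x0" using Q0 by (rule base.cubesE)
    \<comment> \<open>The threshold 1 / (2 p) is twice the density 1 / (4 p) allowed for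
      \<open>U\<close> in Q0, so the selected cubes fill at most half of Q0. It is also 1 / p times
      1/2, so that with p = 2^n a selected cube still satisfies the hypothesis of density at most
      1/2.\<close>
    define P where "P R \<longleftrightarrow> cube_set R \<subseteq> cube_set Q0 \<and> emeasure lebesgue (cube_set R \<inter> U) > ennreal (1 / (2 * p)) * emeasure lebesgue (cube_set R)" for R :: "'n cube"
    define Ch where "Ch = base.maximal_cubes P"
    have PK: "k \<le> k0" if "P (base.cel k x)" for k x
      using that base.cell_subset_le unfolding P_def k0 by blast
    have ChP: "R \<in> base.cubes" "P R" "is_cube R" if "R \<in> Ch" for R
      using base.maximal_cubesD[of R P] base.is_cube_cubes that unfolding Ch_def by blast+
    have nPQ0: "\<not> P Q0"
    proof
      assume "P Q0"
      then have "ennreal (1 / (2 * p)) * emeasure lebesgue (cube_set Q0) < emeasure lebesgue (cube_set Q0 \<inter> U)" by (simp add: P_def)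
      also have "\<dots> \<le> emeasure lebesgue U" by (rule emeasure_mono) auto
      also have "\<dots> \<le> ennreal (1 / (4 * p)) * emeasure lebesgue (cube_set Q0)" by (rule U_le)
      also have "\<dots> \<le> ennreal (1 / (2 * p)) * emeasure lebesgue (cube_set Q0)"
        using p by (intro mult_right_mono ennreal_leI) (auto simp: field_simps)
      finally show False by simp
    qed
    have lt: "side R < side Q0" if "R \<in> Ch" for R
    proof -
      have "side R \<le> side Q0" using ChP[OF that] base.cube_side_le[of R Q0] unfolding P_def by blast
      moreover have "side R \<noteq> side Q0"
      proof
        assume "side R = side Q0"
        then have "R = Q0" using base.cubes_subset_antisym[of R Q0] ChP[OF that] Q0 unfolding P_def by simp
        then show False using nPQ0 ChP(2)[OF that] by simp
      qed
      ultimately show ?thesis by simp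
    qed
    \<comment> \<open>A selected cube is strictly smaller than Q0, so its parent still lies in Q0
      and can only have failed the density test.\<close>
    have half: "emeasure lebesgue (cube_set R \<inter> U) \<le> ennreal (1/2) * emeasure lebesgue (cube_set R)" if R: "R \<in> Ch" for R
    proof -
      obtain k x where k: "R = base.cel k x" using ChP(1)[OF R] by (rule base.cubesE)
      let ?R = "base.cel (k + 1) x"
      have x: "x \<in> cube_set Q0" using ChP(2)[OF R] base.self_cell[of x k] unfolding P_def k by blast
      have "Q0 = base.cel k0 x" using base.cell_eq[of x k0 x0] x unfolding k0 by simp
      moreover have "k + 1 \<le> k0"
      proof -
        have "side (base.cel k x) < side (base.cel k0 x0)" using lt[OF R] unfolding k0 k .
        then have "\<not> side (base.cel k0 x0) \<le> side (base.cel k x)" by (simp only: not_le)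
        then have "\<not> k0 \<le> k" by (simp only: base.cell_side_mono not_False_eq_True)
        then show ?thesis by simp
      qed
      ultimately have sub0: "cube_set ?R \<subseteq> cube_set Q0" using base.cell_mono[of "k + 1" k0 x] by simp
      have sub: "cube_set R \<subseteq> cube_set ?R" unfolding k by (rule base.cell_mono) simp
      have "?R \<noteq> R" unfolding k using base.cell_inj by fastforce
      then have "\<not> P ?R" using base.maximal_cubes_max[of R P ?R] R sub unfolding Ch_def by auto
      then have nb: "emeasure lebesgue (cube_set ?R \<inter> U) \<le> ennreal (1 / (2 * p)) * emeasure lebesgue (cube_set ?R)"
        using sub0 unfolding P_def by (simp add: not_less)
      have "emeasure lebesgue (cube_set R \<inter> U) \<le> emeasure lebesgue (cube_set ?R \<inter> U)"
        using sub by (intro emeasure_mono) auto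
      also note nb
      also have "emeasure lebesgue (cube_set ?R) = ennreal p * emeasure lebesgue (cube_set R)"
        unfolding k by (simp add: emeasure_cube_set base.side_cell power_int_add p_def power_mult_distrib flip: ennreal_mult')
      also have "ennreal (1 / (2 * p)) * (ennreal p * emeasure lebesgue (cube_set R)) = ennreal (1 / (2 * p) * p) * emeasure lebesgue (cube_set R)"
        using p by (subst ennreal_mult') (auto simp: mult.assoc)
      also have "1 / (2 * p) * p = 1/2" using p by simp
      finally show ?thesis .
    qed
    have cover: "x \<in> (\<Union>R\<in>Ch. cube_set R)" if "P (base.cel k x)" for k x
    proof -
      have "\<exists>R\<in>base.maximal_cubes P. cube_set (base.cel k x) \<subseteq> cube_set R"
        by (rule base.maximal_cubes_cover[where P = P and K = k0]) (use PK that in auto)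
      then show ?thesis using base.self_cell[of x k] unfolding Ch_def by blast
    qed
    have cCh: "countable Ch" unfolding Ch_def by (rule base.countable_maximal)
    have dCh: "disjoint_family_on cube_set Ch" unfolding Ch_def by (rule base.disjoint_maximal)
    have UCh [measurable]: "(\<Union>R\<in>Ch. cube_set R) \<in> sets lebesgue" by (intro sets.countable_UN' cCh) auto
    have meas: "emeasure lebesgue (\<Union>R\<in>Ch. cube_set R) \<le> ennreal (1/2) * emeasure lebesgue (cube_set Q0)"
    proof -
      have "emeasure lebesgue (\<Union>R\<in>Ch. cube_set R) \<le> ennreal (2 * p) * emeasure lebesgue (\<Union>R\<in>Ch. cube_set R \<inter> U)"
      proof (rule emeasure_UN_packing[OF cCh])
        show "disjoint_family_on (\<lambda>R. cube_set R \<inter> U) Ch" using dCh unfolding disjoint_family_on_def by blast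
        fix R assume "R \<in> Ch"
        then have "ennreal (1 / (2 * p)) * emeasure lebesgue (cube_set R) \<le> emeasure lebesgue (cube_set R \<inter> U)"
          using ChP(2) unfolding P_def by (simp add: less_imp_le)
        then have "ennreal (2 * p) * (ennreal (1 / (2 * p)) * emeasure lebesgue (cube_set R)) \<le> ennreal (2 * p) * emeasure lebesgue (cube_set R \<inter> U)"
          by (rule mult_left_mono) simp
        then show "emeasure lebesgue (cube_set R) \<le> ennreal (2 * p) * emeasure lebesgue (cube_set R \<inter> U)"
          using p by (simp flip: mult.assoc ennreal_mult')
      qed auto
      also have "emeasure lebesgue (\<Union>R\<in>Ch. cube_set R \<inter> U) \<le> emeasure lebesgue U" by (rule emeasure_mono) auto
      also note U_le
      also have "ennreal (2 * p) * (ennreal (1 / (4 * p)) * emeasure lebesgue (cube_set Q0)) = ennreal (2 * p * (1 / (4 * p))) * emeasure lebesgue (cube_set Q0)"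
        using p by (subst ennreal_mult') (auto simp: mult.assoc)
      also have "2 * p * (1 / (4 * p)) = 1/2" using p by simp
      finally show ?thesis by (simp add: mult_left_mono)
    qed
    \<comment> \<open>By \<open>density_null\<close> almost every point of \<open>U\<close> lies in
      a selected cube, so almost everywhere off the children all m + 1 pointwise bounds are
      available.\<close>
    have null: "AE x in lebesgue. x \<in> U \<longrightarrow> x \<in> (\<Union>R\<in>Ch. cube_set R)"
    proof -
      have "emeasure lebesgue (U - (\<Union>R\<in>Ch. cube_set R)) = 0"
      proof (rule base.density_null[of _ "1 / (2 * p)" k0])
        show "U - (\<Union>R\<in>Ch. cube_set R) \<in> sets lebesgue" by (intro sets.Diff Um UCh)
        show "1 / (2 * p) < 1" "0 \<le> 1 / (2 * p)" using p by auto
        fix k x assume x: "x \<in> U - (\<Union>R\<in>Ch. cube_set R)" and k: "k \<le> k0"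
        have "x \<in> cube_set Q0" using x UQ by blast
        then have "Q0 = base.cel k0 x" using base.cell_eq[of x k0 x0] unfolding k0 by simp
        then have sub: "cube_set (base.cel k x) \<subseteq> cube_set Q0" using base.cell_mono[OF k, of x] by simp
        have "\<not> P (base.cel k x)" using cover[of k x] x by blast
        then have "emeasure lebesgue (cube_set (base.cel k x) \<inter> U) \<le> ennreal (1 / (2 * p)) * emeasure lebesgue (cube_set (base.cel k x))"
          using sub unfolding P_def by (simp add: not_less)
        moreover have "emeasure lebesgue ((U - (\<Union>R\<in>Ch. cube_set R)) \<inter> cube_set (base.cel k x)) \<le> emeasure lebesgue (cube_set (base.cel k x) \<inter> U)"
          by (rule emeasure_mono) auto
        ultimately show "emeasure lebesgue ((U - (\<Union>R\<in>Ch. cube_set R)) \<inter> cube_set (base.cel k x)) \<le> ennreal (1 / (2 * p)) * emeasure lebesgue (cube_set (base.cel k x))"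
          by (rule order_trans[rotated])
      qed
      then have "U - (\<Union>R\<in>Ch. cube_set R) \<in> null_sets lebesgue" by (intro null_setsI sets.Diff Um UCh)
      from AE_not_in[OF this] show ?thesis by eventually_elim blast
    qed
    have sum_bound: "ennreal (\<Sum>h\<le>m. real (m choose h) * (\<bar>b x - ?c\<bar> ^ (m - h) * \<bar>s h\<bar>)) \<le> C * level_bound A m b f ?Q x"
      if s: "\<And>h. h \<le> m \<Longrightarrow> ennreal \<bar>s h\<bar> \<le> C * ?lux h" for s x
    proof -
      have "ennreal (\<Sum>h\<le>m. real (m choose h) * (\<bar>b x - ?c\<bar> ^ (m - h) * \<bar>s h\<bar>)) = (\<Sum>h\<le>m. of_nat (m choose h) * (ennreal (\<bar>b x - ?c\<bar> ^ (m - h)) * ennreal \<bar>s h\<bar>))"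
        by (subst sum_ennreal[symmetric]) (auto simp: ennreal_mult' ennreal_of_nat_eq_real_of_nat)
      also have "\<dots> \<le> (\<Sum>h\<le>m. of_nat (m choose h) * (ennreal (\<bar>b x - ?c\<bar> ^ (m - h)) * (C * ?lux h)))"
        by (intro sum_mono mult_left_mono s) auto
      also have "\<dots> = C * level_bound A m b f ?Q x"
        unfolding level_bound_def atLeast0AtMost sum_distrib_left by (intro sum.cong) (auto simp: mult_ac)
      finally show ?thesis .
    qed
    show ?thesis
    proof (intro exI[of _ Ch] conjI ballI)
      show "Ch \<subseteq> base.cubes" using ChP(1) by blast
      show "disjoint_family_on cube_set Ch" by (rule dCh)
      show "cube_set R \<subseteq> cube_set Q0" "side R < side Q0" if "R \<in> Ch" for R using ChP(2)[OF that] lt[OF that] by (auto simp: P_def)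
      show "emeasure lebesgue (\<Union>R\<in>Ch. cube_set R) \<le> ennreal (1/2) * emeasure lebesgue (cube_set Q0)" by (rule meas)
      have "AE x in lebesgue. \<forall>h\<in>{..m}. x \<in> cube_set Q0 \<longrightarrow> x \<notin> E h \<longrightarrow> ennreal \<bar>S (?g h) x\<bar> \<le> C * ?lux h"
        using E(4) by (intro AE_finite_allI) auto
      with null commutator_bound[OF momF, of ?c]
      show "AE x in lebesgue. x \<in> cube_set Q0 \<longrightarrow> x \<notin> (\<Union>R\<in>Ch. cube_set R) \<longrightarrow>
         ennreal \<bar>commutator T b m ?F x\<bar> \<le> step_const m * level_bound A m b f ?Q x"
      proof eventually_elim
        case (elim x)
        show ?case
        proof (intro impI)
          assume x: "x \<in> cube_set Q0" "x \<notin> (\<Union>R\<in>Ch. cube_set R)"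
          then have "x \<notin> U" using elim(1) by blast
          then have s: "ennreal \<bar>S (?g h) x\<bar> \<le> C * ?lux h" if "h \<le> m" for h
            using elim(3) x(1) that unfolding U_def by auto
          have "ennreal \<bar>commutator T b m ?F x\<bar> \<le> ennreal (\<Sum>h\<le>m. real (m choose h) * (\<bar>b x - ?c\<bar> ^ (m - h) * \<bar>S (?g h) x\<bar>))"
            by (rule ennreal_leI[OF elim(2)])
          also have "\<dots> \<le> C * level_bound A m b f ?Q x" by (rule sum_bound[OF s])
          finally show "ennreal \<bar>commutator T b m ?F x\<bar> \<le> step_const m * level_bound A m b f ?Q x" unfolding C_def .
        qed
      qed
    next
      fix R assume R: "R \<in> Ch"
      have sub: "cube_set R \<subseteq> cube_set Q0" using ChP(2)[OF R] by (simp add: P_def)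
      have sub3: "cube_set (dilate 3 R) \<subseteq> cube_set ?Q" by (rule triple_subset[OF sub ChP(3)[OF R]])
      have nR: "- cube_set (dilate 3 R) \<in> sets lebesgue" using sets.compl_sets[of "cube_set (dilate 3 R)" lebesgue] by (simp add: Compl_eq_Diff_UNIV)
      \<comment> \<open>The part of f on 3 Q0 outside 3 R. Its products with (b - c)^h obey the far
        bound on R, because each \<open>E h\<close> fills at most half of R.\<close>
      let ?G = "\<lambda>y. ?F y * indicat_real (- cube_set (dilate 3 R)) y"
      have FR: "localized f R = (\<lambda>y. ?F y * indicat_real (cube_set (dilate 3 R)) y)"
        by (rule ext) (use sub3 in \<open>auto split: split_indicator\<close>)
      have momR: "moments_integrable m b (localized f R)"
        unfolding FR by (rule moments_integrable_indicator[OF momF]) simp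
      have momG: "moments_integrable m b ?G" by (rule moments_integrable_indicator[OF momF nR])
      have Feq: "?F = (\<lambda>y. localized f R y + ?G y)"
        by (rule ext) (use sub3 in \<open>auto split: split_indicator\<close>)
      have add: "AE x in lebesgue. commutator T b m ?F x = commutator T b m (localized f R) x + commutator T b m ?G x"
        using commutator_add[OF momR momG] unfolding Feq[symmetric] .
      have hE: "emeasure lebesgue (cube_set R \<inter> E h) \<le> ennreal (1/2) * emeasure lebesgue (cube_set R)" if "h \<le> m" for h
      proof -
        have "emeasure lebesgue (cube_set R \<inter> E h) \<le> emeasure lebesgue (cube_set R \<inter> U)"
        proof (rule emeasure_mono)
          show "cube_set R \<inter> E h \<subseteq> cube_set R \<inter> U" using that by (auto simp: U_def)
        qed simp
        then show ?thesis using half[OF R] by (rule order_trans)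
      qed
      have "AE x in lebesgue. \<forall>h\<in>{..m}. x \<in> cube_set R \<longrightarrow> ennreal \<bar>S (\<lambda>y. (b y - ?c) ^ h * ?G y) x\<bar> \<le> C * ?lux h"
      proof (rule AE_finite_allI)
        fix h assume h: "h \<in> {..m}"
        have e: "(\<lambda>y. (b y - ?c) ^ h * ?G y) = (\<lambda>y. ?g h y * indicat_real (- cube_set (dilate 3 R)) y)" by (simp add: mult.assoc)
        show "AE x in lebesgue. x \<in> cube_set R \<longrightarrow> ennreal \<bar>S (\<lambda>y. (b y - ?c) ^ h * ?G y) x\<bar> \<le> C * ?lux h"
          unfolding e by (rule E5[OF _ ChP(1)[OF R] sub hE]) (use h in auto)
      qed simp
      with add commutator_bound[OF momG, of ?c]
      show "AE x in lebesgue. x \<in> cube_set R \<longrightarrow> ennreal \<bar>commutator T b m ?F x\<bar> \<le>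
         step_const m * level_bound A m b f ?Q x + ennreal \<bar>commutator T b m (localized f R) x\<bar>"
      proof eventually_elim
        case (elim x)
        show ?case
        proof
          assume x: "x \<in> cube_set R"
          then have s: "ennreal \<bar>S (\<lambda>y. (b y - ?c) ^ h * ?G y) x\<bar> \<le> C * ?lux h" if "h \<le> m" for h
            using elim(3) that by auto
          have "\<bar>commutator T b m ?F x\<bar> \<le> \<bar>commutator T b m ?G x\<bar> + \<bar>commutator T b m (localized f R) x\<bar>"
            unfolding elim(1) by linarith
          then have "ennreal \<bar>commutator T b m ?F x\<bar> \<le> ennreal \<bar>commutator T b m ?G x\<bar> + ennreal \<bar>commutator T b m (localized f R) x\<bar>"
            by (simp add: ennreal_leI flip: ennreal_plus)
          also have "ennreal \<bar>commutator T b m ?G x\<bar> \<le> ennreal (\<Sum>h\<le>m. real (m choose h) * (\<bar>b x - ?c\<bar> ^ (m - h) * \<bar>S (\<lambda>y. (b y - ?c) ^ h * ?G y) x\<bar>))"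
            by (rule ennreal_leI[OF elim(2)])
          also have "\<dots> \<le> C * level_bound A m b f ?Q x" by (rule sum_bound[OF s])
          finally show "ennreal \<bar>commutator T b m ?F x\<bar> \<le>
              step_const m * level_bound A m b f ?Q x + ennreal \<bar>commutator T b m (localized f R) x\<bar>"
            unfolding C_def by (simp add: add_right_mono)
        qed
      qed
    qed
  qed
qed

end

section \<open>Sparse domination\<close>

lemma dilate_third [simp]: "dilate (1/3) (dilate 3 Q) = Q"
  by simp

lemma inj_dilate_3: "inj (dilate 3)"
  by (rule inj_on_inverseI[of _ "dilate (1/3)"]) (rule dilate_third)

text \<open>Only the geometry of the iteration: sparseness and finiteness of the chains follow from
  these conditions, without reference to the operator.\<close>

locale stopping_tree =
  fixes St :: "'n::finite cube set" and ch :: "'n cube \<Rightarrow> 'n cube set"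
  assumes St: "St \<subseteq> base.cubes" "disjoint_family_on cube_set St" "(\<Union>Q\<in>St. cube_set Q) = UNIV"
    and ch: "Q \<in> base.cubes \<Longrightarrow> ch Q \<subseteq> base.cubes" "Q \<in> base.cubes \<Longrightarrow> disjoint_family_on cube_set (ch Q)"
      "Q \<in> base.cubes \<Longrightarrow> R \<in> ch Q \<Longrightarrow> cube_set R \<subseteq> cube_set Q" "Q \<in> base.cubes \<Longrightarrow> R \<in> ch Q \<Longrightarrow> side R < side Q"
      "Q \<in> base.cubes \<Longrightarrow> emeasure lebesgue (\<Union>R\<in>ch Q. cube_set R) \<le> ennreal (1/2) * emeasure lebesgue (cube_set Q)"
begin

primrec lev :: "nat \<Rightarrow> 'n cube set" where
  "lev 0 = St"
| "lev (Suc k) = (\<Union>Q\<in>lev k. ch Q)"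

definition forest :: "'n cube set" where "forest = (\<Union>k. lev k)"

definition core :: "'n cube \<Rightarrow> (real ^ 'n) set" where "core Q = cube_set Q - (\<Union>R\<in>ch Q. cube_set R)"

lemma lev_cubes: "lev k \<subseteq> base.cubes"
proof (induction k)
  case (Suc k)
  then show ?case using ch(1) by (simp add: UN_subset_iff) blast
qed (use St in simp)

lemma lev_cubesD: "Q \<in> lev k \<Longrightarrow> Q \<in> base.cubes"
  using lev_cubes by blast

lemma countable_lev: "countable (lev k)"
  by (rule countable_subset[OF lev_cubes base.countable_cubes])

lemma forest_cubes: "Q \<in> forest \<Longrightarrow> Q \<in> base.cubes"
  unfolding forest_def using lev_cubesD by blast

lemma countable_forest: "countable forest"
  unfolding forest_def using countable_lev by blast

lemma countable_ch: "Q \<in> base.cubes \<Longrightarrow> countable (ch Q)"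
  by (rule countable_subset[OF ch(1) base.countable_cubes])

lemma disjoint_lev: "disjoint_family_on cube_set (lev k)"
proof (induction k)
  case (Suc k)
  show ?case
    unfolding disjoint_family_on_def
  proof (intro ballI impI)
    fix P R assume P: "P \<in> lev (Suc k)" and R: "R \<in> lev (Suc k)" and ne: "P \<noteq> R"
    obtain Q1 where Q1: "Q1 \<in> lev k" "P \<in> ch Q1" using P by auto
    obtain Q2 where Q2: "Q2 \<in> lev k" "R \<in> ch Q2" using R by auto
    show "cube_set P \<inter> cube_set R = {}"
    proof (cases "Q1 = Q2")
      case True
      then show ?thesis using ch(2)[OF lev_cubesD[OF Q1(1)]] Q1 Q2 ne unfolding disjoint_family_on_def by blast
    next
      case False
      then have "cube_set Q1 \<inter> cube_set Q2 = {}" using Suc Q1 Q2 unfolding disjoint_family_on_def by blast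
      then show ?thesis using ch(3)[OF lev_cubesD[OF Q1(1)] Q1(2)] ch(3)[OF lev_cubesD[OF Q2(1)] Q2(2)] by blast
    qed
  qed
qed (use St in simp)

lemma lev_ancestor: "R \<in> lev (a + Suc d) \<Longrightarrow> \<exists>Q\<in>lev a. \<exists>P\<in>ch Q. cube_set R \<subseteq> cube_set P"
proof (induction d arbitrary: R)
  case 0
  then show ?case by auto
next
  case (Suc d)
  then obtain R' where R': "R' \<in> lev (a + Suc d)" "R \<in> ch R'" by auto
  then obtain Q P where "Q \<in> lev a" "P \<in> ch Q" "cube_set R' \<subseteq> cube_set P" using Suc.IH[of R'] by blast
  moreover have "cube_set R \<subseteq> cube_set R'" by (rule ch(3)[OF lev_cubesD[OF R'(1)] R'(2)])
  ultimately show ?case by blast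
qed

lemma lev_root: "Q \<in> lev k \<Longrightarrow> \<exists>P\<in>St. cube_set Q \<subseteq> cube_set P"
proof (cases k)
  case (Suc d)
  assume "Q \<in> lev k"
  then obtain P R where "P \<in> lev 0" "R \<in> ch P" "cube_set Q \<subseteq> cube_set R"
    using lev_ancestor[of Q 0 d] Suc by auto
  moreover from this have "P \<in> base.cubes" using St(1) by auto
  ultimately show ?thesis using ch(3)[of P R] by auto
qed auto

text \<open>Within one generation the cubes themselves are disjoint. Otherwise the later cube lies
  in a child of its ancestor in the earlier generation, and cores exclude children.\<close>

lemma core_disjoint_aux:
  assumes "Q \<in> lev a" "R \<in> lev c" "a \<le> c" "Q \<noteq> R" shows "core Q \<inter> core R = {}"
proof (cases "a = c")
  case True
  then have "cube_set Q \<inter> cube_set R = {}" using disjoint_lev[of a] assms unfolding disjoint_family_on_def by blast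
  then show ?thesis by (auto simp: core_def)
next
  case False
  then have "c = a + Suc (c - a - 1)" using assms by simp
  then obtain Q' P where Q': "Q' \<in> lev a" "P \<in> ch Q'" "cube_set R \<subseteq> cube_set P"
    using lev_ancestor[of R a "c - a - 1"] assms by metis
  have PQ: "cube_set P \<subseteq> cube_set Q'" by (rule ch(3)[OF lev_cubesD[OF Q'(1)] Q'(2)])
  show ?thesis
  proof (rule ccontr)
    assume "core Q \<inter> core R \<noteq> {}"
    then obtain z where z: "z \<in> core Q" "z \<in> core R" by blast
    then have zz: "z \<in> cube_set Q" "z \<in> cube_set P" using Q'(3) by (auto simp: core_def)
    then have "Q = Q'" using disjoint_lev[of a] assms(1) Q'(1) PQ unfolding disjoint_family_on_def by blast
    then show False using z(1) zz Q'(2) by (auto simp: core_def)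
  qed
qed

lemma core_disjoint: "Q \<in> forest \<Longrightarrow> R \<in> forest \<Longrightarrow> Q \<noteq> R \<Longrightarrow> core Q \<inter> core R = {}"
proof -
  assume "Q \<in> forest" "R \<in> forest" and ne: "Q \<noteq> R"
  then obtain a c where "Q \<in> lev a" "R \<in> lev c" unfolding forest_def by blast
  then show ?thesis using core_disjoint_aux[of Q a R c] core_disjoint_aux[of R c Q a] ne by (cases "a \<le> c") auto
qed

lemma core_sets: "Q \<in> base.cubes \<Longrightarrow> core Q \<in> sets lebesgue"
  unfolding core_def by (intro sets.Diff sets.countable_UN' countable_ch) auto

lemma core_measure:
  assumes Q: "Q \<in> base.cubes"
  shows "1/2 * measure lebesgue (cube_set Q) \<le> measure lebesgue (core Q)"
proof -
  have cQ: "is_cube Q" by (rule base.is_cube_cubes[OF Q])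
  let ?U = "\<Union>R\<in>ch Q. cube_set R"
  have U: "?U \<in> sets lebesgue" by (intro sets.countable_UN' countable_ch Q) auto
  have sub: "?U \<subseteq> cube_set Q" using ch(3)[OF Q] by blast
  have Qf: "cube_set Q \<in> fmeasurable lebesgue" using cQ by (intro fmeasurableI) auto
  have Uf: "?U \<in> fmeasurable lebesgue" by (rule fmeasurableI2[OF Qf sub U])
  have "ennreal (measure lebesgue ?U) \<le> ennreal (1/2) * ennreal (measure lebesgue (cube_set Q))"
    using ch(5)[OF Q] by (simp only: emeasure_eq_measure2[OF Qf] emeasure_eq_measure2[OF Uf])
  also have "\<dots> = ennreal (1/2 * measure lebesgue (cube_set Q))" by (rule ennreal_mult'[symmetric]) simp
  finally have "measure lebesgue ?U \<le> 1/2 * measure lebesgue (cube_set Q)" by (subst (asm) ennreal_le_iff) auto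
  moreover have "measure lebesgue (core Q) = measure lebesgue (cube_set Q) - measure lebesgue ?U"
    unfolding core_def by (rule measurable_measure_Diff[OF Qf U sub])
  ultimately show ?thesis by linarith
qed

text \<open>The decay is localised to one starting cube because generation 0 fills the whole space;
  cubes descending from other starting cubes do not meet \<open>P\<close>.\<close>

lemma lev_decay:
  assumes P: "P \<in> St"
  shows "emeasure lebesgue ((\<Union>Q\<in>lev k. cube_set Q) \<inter> cube_set P) \<le> ennreal ((1/2) ^ k) * emeasure lebesgue (cube_set P)"
proof (induction k)
  case 0
  have "emeasure lebesgue ((\<Union>Q\<in>lev 0. cube_set Q) \<inter> cube_set P) \<le> emeasure lebesgue (cube_set P)"
    by (rule emeasure_mono) auto
  then show ?case by simp
next
  case (Suc k)
  have Um: "(\<Union>R\<in>ch Q. cube_set R) \<in> sets lebesgue" if "Q \<in> lev k" for Q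
    by (intro sets.countable_UN' countable_ch lev_cubesD[OF that]) auto
  have "(\<Union>Q\<in>lev (Suc k). cube_set Q) \<inter> cube_set P = (\<Union>Q\<in>lev k. (\<Union>R\<in>ch Q. cube_set R) \<inter> cube_set P)" by auto
  also have "emeasure lebesgue \<dots> \<le> ennreal (1/2) * emeasure lebesgue (\<Union>Q\<in>lev k. cube_set Q \<inter> cube_set P)"
  proof (rule emeasure_UN_packing[OF countable_lev])
    show "disjoint_family_on (\<lambda>Q. cube_set Q \<inter> cube_set P) (lev k)" using disjoint_lev[of k] unfolding disjoint_family_on_def by blast
    fix Q assume Q: "Q \<in> lev k"
    show "(\<Union>R\<in>ch Q. cube_set R) \<inter> cube_set P \<in> sets lebesgue" by (intro sets.Int Um Q) auto
    obtain P' where P': "P' \<in> St" "cube_set Q \<subseteq> cube_set P'" using lev_root[OF Q] by blast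
    have sub: "(\<Union>R\<in>ch Q. cube_set R) \<subseteq> cube_set Q" using ch(3)[OF lev_cubesD[OF Q]] by blast
    show "emeasure lebesgue ((\<Union>R\<in>ch Q. cube_set R) \<inter> cube_set P) \<le> ennreal (1/2) * emeasure lebesgue (cube_set Q \<inter> cube_set P)"
    proof (cases "P' = P")
      case True
      then have "(\<Union>R\<in>ch Q. cube_set R) \<inter> cube_set P = (\<Union>R\<in>ch Q. cube_set R)" "cube_set Q \<inter> cube_set P = cube_set Q"
        using P'(2) sub by blast+
      then show ?thesis using ch(5)[OF lev_cubesD[OF Q]] by simp
    next
      case False
      then have "cube_set P' \<inter> cube_set P = {}" using St(2) P P'(1) unfolding disjoint_family_on_def by blast
      then have "(\<Union>R\<in>ch Q. cube_set R) \<inter> cube_set P = {}" using P'(2) sub by blast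
      then show ?thesis by simp
    qed
  qed auto
  also have "(\<Union>Q\<in>lev k. cube_set Q \<inter> cube_set P) = (\<Union>Q\<in>lev k. cube_set Q) \<inter> cube_set P" by blast
  also have "ennreal (1/2) * emeasure lebesgue ((\<Union>Q\<in>lev k. cube_set Q) \<inter> cube_set P)
     \<le> ennreal (1/2) * (ennreal ((1/2) ^ k) * emeasure lebesgue (cube_set P))"
    by (rule mult_left_mono[OF Suc.IH]) simp
  also have "\<dots> = ennreal (1/2 * (1/2) ^ k) * emeasure lebesgue (cube_set P)"
  proof -
    have "ennreal (1/2 * (1/2) ^ k) = ennreal (1/2) * ennreal ((1/2) ^ k)" by (rule ennreal_mult') simp
    then show ?thesis by (simp only: mult.assoc)
  qed
  finally show ?case by simp
qed

lemma AE_leaves: "AE x in lebesgue. \<exists>k. x \<notin> (\<Union>Q\<in>lev k. cube_set Q)"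
proof -
  have "AE x in lebesgue. x \<in> cube_set P \<longrightarrow> (\<exists>k. x \<notin> (\<Union>Q\<in>lev k. cube_set Q))" if P: "P \<in> St" for P
  proof -
    have cP: "is_cube P" using P St(1) base.is_cube_cubes by blast
    let ?Z = "\<Inter>k. (\<Union>Q\<in>lev k. cube_set Q) \<inter> cube_set P"
    have Vm: "(\<Union>Q\<in>lev k. cube_set Q) \<inter> cube_set P \<in> sets lebesgue" for k
      by (intro sets.Int sets.countable_UN' countable_lev) auto
    have Zm: "?Z \<in> sets lebesgue" using Vm by (intro sets.countable_INT) auto
    have le: "emeasure lebesgue ?Z \<le> ennreal ((1/2) ^ k) * emeasure lebesgue (cube_set P)" for k
      by (rule order_trans[OF emeasure_mono[OF _ Vm[of k]] lev_decay[OF P]]) blast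
    have "(\<lambda>k. ennreal ((1/2) ^ k * measure lebesgue (cube_set P))) \<longlonglongrightarrow> ennreal (0 * measure lebesgue (cube_set P))"
      by (intro tendsto_ennrealI tendsto_mult tendsto_const LIMSEQ_realpow_zero) auto
    then have "emeasure lebesgue ?Z \<le> ennreal (0 * measure lebesgue (cube_set P))"
    proof (rule LIMSEQ_le_const, intro exI allI impI)
      fix k
      have "ennreal ((1/2) ^ k) * emeasure lebesgue (cube_set P) = ennreal ((1/2) ^ k * measure lebesgue (cube_set P))"
        using cP by (simp add: emeasure_eq_ennreal_measure ennreal_mult')
      then show "emeasure lebesgue ?Z \<le> ennreal ((1/2) ^ k * measure lebesgue (cube_set P))" using le[of k] by simp
    qed
    then have "?Z \<in> null_sets lebesgue" using Zm by (intro null_setsI) auto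
    from AE_not_in[OF this] show ?thesis by eventually_elim blast
  qed
  moreover have "countable St" using countable_lev[of 0] by simp
  ultimately have "AE x in lebesgue. \<forall>P\<in>St. x \<in> cube_set P \<longrightarrow> (\<exists>k. x \<notin> (\<Union>Q\<in>lev k. cube_set Q))"
    by (subst AE_ball_countable) auto
  then show ?thesis by eventually_elim (use St(3) in blast)
qed

text \<open>The descent follows the children containing x and must stop, since x is in no cube of
  generation k + d. The side bound shows that the cube added at each step is new, so the sum over
  the set counts every term of the chain.\<close>

lemma finite_chain_bound:
  fixes \<Phi> B :: "'n cube \<Rightarrow> ennreal"
  assumes stop: "\<And>Q. Q \<in> forest \<Longrightarrow> x \<in> cube_set Q \<Longrightarrow> x \<notin> (\<Union>R\<in>ch Q. cube_set R) \<Longrightarrow> \<Phi> Q \<le> C * B Q"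
    and step: "\<And>Q R. Q \<in> forest \<Longrightarrow> R \<in> ch Q \<Longrightarrow> x \<in> cube_set R \<Longrightarrow> \<Phi> Q \<le> C * B Q + \<Phi> R"
    and Q: "Q \<in> lev k" "x \<in> cube_set Q" and out: "x \<notin> (\<Union>Q\<in>lev (k + d). cube_set Q)"
  shows "\<exists>X. finite X \<and> X \<subseteq> {R \<in> forest. x \<in> cube_set R \<and> side R \<le> side Q} \<and> \<Phi> Q \<le> C * (\<Sum>R\<in>X. B R)"
  using Q out
proof (induction d arbitrary: Q k)
  case 0
  then show ?case by auto
next
  case (Suc d)
  have QF: "Q \<in> forest" using Suc.prems(1) by (auto simp: forest_def)
  show ?case
  proof (cases "x \<in> (\<Union>R\<in>ch Q. cube_set R)")
    case False
    then show ?thesis using stop[OF QF Suc.prems(2)] QF Suc.prems(2) by (intro exI[of _ "{Q}"]) simp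
  next
    case True
    then obtain R where R: "R \<in> ch Q" "x \<in> cube_set R" by blast
    have "R \<in> lev (Suc k)" using R(1) Suc.prems(1) by auto
    moreover have "x \<notin> (\<Union>Q\<in>lev (Suc k + d). cube_set Q)" using Suc.prems(3) by simp
    ultimately obtain X where X: "finite X" "X \<subseteq> {P \<in> forest. x \<in> cube_set P \<and> side P \<le> side R}" "\<Phi> R \<le> C * (\<Sum>P\<in>X. B P)"
      using Suc.IH[of R "Suc k"] R(2) by blast
    have lt: "side R < side Q" by (rule ch(4)[OF lev_cubesD[OF Suc.prems(1)] R(1)])
    then have "Q \<notin> X" using X(2) by auto
    have "\<Phi> Q \<le> C * B Q + \<Phi> R" by (rule step[OF QF R])
    also have "\<dots> \<le> C * B Q + C * (\<Sum>P\<in>X. B P)" by (rule add_left_mono[OF X(3)])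
    also have "\<dots> = C * (\<Sum>P\<in>insert Q X. B P)" using X(1) \<open>Q \<notin> X\<close> by (simp add: distrib_left)
    finally have "\<Phi> Q \<le> C * (\<Sum>P\<in>insert Q X. B P)" .
    moreover have "insert Q X \<subseteq> {P \<in> forest. x \<in> cube_set P \<and> side P \<le> side Q}"
      using X(2) lt QF Suc.prems(2) by auto
    ultimately show ?thesis using X(1) by (intro exI[of _ "insert Q X"]) simp
  qed
qed

text \<open>The core has at least half the measure of its cube, which is a 3^(-n) part of its
  triple. The disjoint sets for the triples are the cores of the original cubes, disjoint across the
  whole forest and not just within one lattice.\<close>

lemma sparse_triples: "sparse_family (dilate 3 ` {Q \<in> forest. dilate 3 Q \<in> triple.cubes l})"
  unfolding sparse_family_def
proof (intro exI[of _ "1 / (2 * 3 ^ CARD('n))"] conjI)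
  let ?S = "dilate 3 ` {Q \<in> forest. dilate 3 Q \<in> triple.cubes l}"
  have "1 * 1 < 2 * (3::real) ^ CARD('n)" by (intro mult_less_le_imp_less one_le_power) auto
  then show "1 / (2 * 3 ^ CARD('n)) < (1::real)" by simp
  show "0 < 1 / (2 * (3::real) ^ CARD('n))" by simp
  show "eta_sparse (1 / (2 * 3 ^ CARD('n))) ?S"
    unfolding eta_sparse_def
  proof (intro conjI exI[of _ "triple.cubes l"] exI[of _ "\<lambda>Q. core (dilate (1/3) Q)"] ballI impI)
    show "dyadic_lattice (triple.cubes l)" by (rule triple.dyadic_lattice_cubes)
    show "?S \<subseteq> triple.cubes l" by auto
    fix Q' assume "Q' \<in> ?S"
    then obtain Q where Q: "Q \<in> forest" "Q' = dilate 3 Q" by auto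
    have cQ: "Q \<in> base.cubes" "is_cube Q" using forest_cubes[OF Q(1)] base.is_cube_cubes by blast+
    have e: "dilate (1/3) Q' = Q" unfolding Q(2) by (rule dilate_third)
    show "core (dilate (1/3) Q') \<in> sets lebesgue" unfolding e by (rule core_sets[OF cQ(1)])
    show "core (dilate (1/3) Q') \<subseteq> cube_set Q'"
      unfolding e Q(2) using dilate_mono[OF _ cQ(2), of 1 3] by (auto simp: core_def)
    have "measure lebesgue (cube_set Q') = 3 ^ CARD('n) * measure lebesgue (cube_set Q)"
      unfolding Q(2) using cQ(2) by (simp add: measure_def emeasure_dilate enn2real_mult)
    then show "1 / (2 * 3 ^ CARD('n)) * measure lebesgue (cube_set Q') \<le> measure lebesgue (core (dilate (1/3) Q'))"
      unfolding e using core_measure[OF cQ(1)] by simp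
    fix R' assume "R' \<in> ?S" and ne: "Q' \<noteq> R'"
    then obtain R where R: "R \<in> forest" "R' = dilate 3 R" by auto
    have eR: "dilate (1/3) R' = R" unfolding R(2) by (rule dilate_third)
    show "core (dilate (1/3) Q') \<inter> core (dilate (1/3) R') = {}"
      unfolding e eR by (rule core_disjoint[OF Q(1) R(1)]) (use ne Q R in auto)
  qed
qed

text \<open>Each triple is charged to every lattice that contains it, at least one; overcounting is
  harmless for an upper bound. A finite chain is one of the finite subfamilies whose supremum is the
  unconditional sum.\<close>

lemma chain_le_sparse:
  fixes \<beta> :: "nat \<Rightarrow> 'n \<Rightarrow> int"
  assumes X: "finite X" "X \<subseteq> {R \<in> forest. x \<in> cube_set R}"
    and \<beta>: "\<beta> ` {1..3 ^ CARD('n)} = {l :: 'n \<Rightarrow> int. \<forall>i. l i \<in> {0, 1, 2}}"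
  shows "(\<Sum>R\<in>X. level_bound A m b f (dilate 3 R) x) \<le>
    (\<Sum>j=1..3 ^ CARD('n). \<Sum>h=0..m. of_nat (m choose h) *
       sparse_op A m h (dilate 3 ` {Q \<in> forest. dilate 3 Q \<in> triple.cubes (\<beta> j)}) b f x)"
proof -
  let ?L = "\<lambda>R. level_bound A m b f (dilate 3 R) x"
  let ?J = "{1..(3::nat) ^ CARD('n)}"
  let ?X = "\<lambda>j. {R \<in> X. dilate 3 R \<in> triple.cubes (\<beta> j)}"
  have "(\<Sum>R\<in>X. ?L R) \<le> (\<Sum>R\<in>X. \<Sum>j\<in>?J. if dilate 3 R \<in> triple.cubes (\<beta> j) then ?L R else 0)"
  proof (rule sum_mono)
    fix R assume "R \<in> X"
    then have "R \<in> base.cubes" using X(2) forest_cubes by blast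
    then obtain l where l: "\<forall>i. l i \<in> {0, 1, 2}" "dilate 3 R \<in> triple.cubes l" using triple_base_cube by blast
    have "l \<in> \<beta> ` ?J" unfolding \<beta> using l(1) by simp
    then obtain j where j: "j \<in> ?J" "l = \<beta> j" by blast
    have "?L R = (if dilate 3 R \<in> triple.cubes (\<beta> j) then ?L R else 0)" using l(2) j(2) by simp
    also have "\<dots> \<le> (\<Sum>j\<in>?J. if dilate 3 R \<in> triple.cubes (\<beta> j) then ?L R else 0)"
      by (rule member_le_sum[OF j(1)]) auto
    finally show "?L R \<le> (\<Sum>j\<in>?J. if dilate 3 R \<in> triple.cubes (\<beta> j) then ?L R else 0)" .
  qed
  also have "\<dots> = (\<Sum>j\<in>?J. \<Sum>R\<in>X. if dilate 3 R \<in> triple.cubes (\<beta> j) then ?L R else 0)" by (rule sum.swap)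
  also have "\<dots> = (\<Sum>j\<in>?J. \<Sum>R\<in>?X j. ?L R)"
    by (intro sum.cong refl sum.inter_filter[symmetric] X(1))
  also have "\<dots> \<le> (\<Sum>j\<in>?J. \<Sum>h=0..m. of_nat (m choose h) *
       sparse_op A m h (dilate 3 ` {Q \<in> forest. dilate 3 Q \<in> triple.cubes (\<beta> j)}) b f x)"
  proof (rule sum_mono)
    fix j
    let ?S = "dilate 3 ` {Q \<in> forest. dilate 3 Q \<in> triple.cubes (\<beta> j)}"
    let ?t = "\<lambda>h Q. ennreal (\<bar>b x - avg b Q\<bar> ^ (m - h)) * luxemburg (\<lambda>t. ennreal (A t)) Q (\<lambda>y. f y * \<bar>b y - avg b Q\<bar> ^ h)"
    have "(\<Sum>R\<in>?X j. ?L R) = (\<Sum>R\<in>?X j. \<Sum>h=0..m. of_nat (m choose h) * (?t h (dilate 3 R) * indicator (cube_set (dilate 3 R)) x))"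
    proof (rule sum.cong[OF refl])
      fix R assume "R \<in> ?X j"
      then have "is_cube R" "x \<in> cube_set R" using X(2) forest_cubes base.is_cube_cubes by blast+
      then have "x \<in> cube_set (dilate 3 R)" using dilate_mono[of 1 3 R] by auto
      then show "?L R = (\<Sum>h=0..m. of_nat (m choose h) * (?t h (dilate 3 R) * indicator (cube_set (dilate 3 R)) x))"
        unfolding level_bound_def by simp
    qed
    also have "\<dots> = (\<Sum>h=0..m. \<Sum>R\<in>?X j. of_nat (m choose h) * (?t h (dilate 3 R) * indicator (cube_set (dilate 3 R)) x))"
      by (rule sum.swap)
    also have "\<dots> \<le> (\<Sum>h=0..m. of_nat (m choose h) * sparse_op A m h ?S b f x)"
    proof (rule sum_mono)
      fix h
      have "(\<Sum>R\<in>?X j. of_nat (m choose h) * (?t h (dilate 3 R) * indicator (cube_set (dilate 3 R)) x))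
        = of_nat (m choose h) * (\<Sum>R\<in>?X j. ?t h (dilate 3 R) * indicator (cube_set (dilate 3 R)) x)"
        by (rule sum_distrib_left[symmetric])
      also have "(\<Sum>R\<in>?X j. ?t h (dilate 3 R) * indicator (cube_set (dilate 3 R)) x) = (\<Sum>Q\<in>dilate 3 ` ?X j. ?t h Q * indicator (cube_set Q) x)"
        by (subst sum.reindex) (auto intro: inj_on_subset[OF inj_dilate_3])
      also have "\<dots> \<le> sparse_op A m h ?S b f x"
        unfolding sparse_op_def
      proof (subst nonneg_infsum_complete)
        show "(\<Sum>Q\<in>dilate 3 ` ?X j. ?t h Q * indicator (cube_set Q) x)
          \<le> (SUP F\<in>{F. finite F \<and> F \<subseteq> ?S}. \<Sum>Q\<in>F. ?t h Q * indicator (cube_set Q) x)"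
        proof (rule SUP_upper)
          have "dilate 3 ` ?X j \<subseteq> ?S" using X(2) by blast
          then show "dilate 3 ` ?X j \<in> {F. finite F \<and> F \<subseteq> ?S}" using X(1) by simp
        qed
      qed simp
      finally show "(\<Sum>R\<in>?X j. of_nat (m choose h) * (?t h (dilate 3 R) * indicator (cube_set (dilate 3 R)) x)) \<le> of_nat (m choose h) * sparse_op A m h ?S b f x"
        by (simp add: mult_left_mono)
    qed
    finally show "(\<Sum>R\<in>?X j. ?L R) \<le> (\<Sum>h=0..m. of_nat (m choose h) * sparse_op A m h ?S b f x)" .
  qed
  finally show ?thesis .
qed

end

context hormander_setting
begin

text \<open>Children are chosen once for every base cube, and countability of the forest lets the
  almost everywhere statements hold at once. At such a point the chain starts from a cube whose
  triple contains the support of f, so localising to it changes nothing.\<close>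

lemma sparse_domination:
  assumes fM: "\<And>y. \<bar>f y\<bar> \<le> M" and fb: "bounded {y. f y \<noteq> 0}"
    and [measurable]: "f \<in> borel_measurable lebesgue" "b \<in> borel_measurable lebesgue"
  shows "\<exists>Sf :: nat \<Rightarrow> 'n cube set. (\<forall>j. sparse_family (Sf j)) \<and>
    (AE x in lebesgue. ennreal \<bar>commutator T b m f x\<bar> \<le> step_const m *
       (\<Sum>j=1..3 ^ CARD('n). \<Sum>h=0..m. of_nat (m choose h) * sparse_op A m h (Sf j) b f x))"
proof -
  define stp where "stp Q Ch \<longleftrightarrow> Ch \<subseteq> base.cubes \<and> disjoint_family_on cube_set Ch \<and>
    (\<forall>R\<in>Ch. cube_set R \<subseteq> cube_set Q \<and> side R < side Q) \<and>
    emeasure lebesgue (\<Union>R\<in>Ch. cube_set R) \<le> ennreal (1/2) * emeasure lebesgue (cube_set Q) \<and>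
    (AE x in lebesgue. x \<in> cube_set Q \<longrightarrow> x \<notin> (\<Union>R\<in>Ch. cube_set R) \<longrightarrow>
       ennreal \<bar>commutator T b m (localized f Q) x\<bar> \<le> step_const m * level_bound A m b f (dilate 3 Q) x) \<and>
    (\<forall>R\<in>Ch. AE x in lebesgue. x \<in> cube_set R \<longrightarrow>
       ennreal \<bar>commutator T b m (localized f Q) x\<bar> \<le>
         step_const m * level_bound A m b f (dilate 3 Q) x + ennreal \<bar>commutator T b m (localized f R) x\<bar>)" for Q Ch
  define ch where "ch Q = (SOME Ch. stp Q Ch)" for Q
  have stp: "stp Q (ch Q)" if "Q \<in> base.cubes" for Q
    unfolding ch_def
  proof (rule someI_ex)
    show "\<exists>Ch. stp Q Ch" using recursion_step[OF that fM assms(3,4)] unfolding stp_def .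
  qed
  obtain st :: "real ^ 'n \<Rightarrow> 'n cube" where st0: "(\<forall>x. st x \<in> base.cubes \<and> x \<in> cube_set (st x) \<and> {y. f y \<noteq> 0} \<subseteq> cube_set (dilate 3 (st x))) \<and>
     (\<forall>x y. y \<in> cube_set (st x) \<longrightarrow> st y = st x)"
    using base.starting_cubes[OF fb] by (elim exE) (rule that)
  have st: "st x \<in> base.cubes" "x \<in> cube_set (st x)" "{y. f y \<noteq> 0} \<subseteq> cube_set (dilate 3 (st x))" "y \<in> cube_set (st x) \<Longrightarrow> st y = st x" for x y
    using st0 by (blast, blast, blast, blast)
  interpret stopping_tree "range st" ch
  proof
    show "range st \<subseteq> base.cubes" using st(1) by blast
    show "disjoint_family_on cube_set (range st)"
      unfolding disjoint_family_on_def
    proof (intro ballI impI)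
      fix P R assume "P \<in> range st" "R \<in> range st" "P \<noteq> R"
      then obtain x y where xy: "P = st x" "R = st y" "st x \<noteq> st y" by auto
      show "cube_set P \<inter> cube_set R = {}"
      proof (rule ccontr)
        assume "cube_set P \<inter> cube_set R \<noteq> {}"
        then obtain z where "z \<in> cube_set (st x)" "z \<in> cube_set (st y)" using xy by blast
        then have "st z = st x" "st z = st y" by (auto dest: st(4))
        then show False using xy(3) by simp
      qed
    qed
    show "(\<Union>Q\<in>range st. cube_set Q) = UNIV" using st(2) by blast
    fix Q R :: "'n cube" assume Q: "Q \<in> base.cubes"
    show "ch Q \<subseteq> base.cubes" "disjoint_family_on cube_set (ch Q)"
      "emeasure lebesgue (\<Union>R\<in>ch Q. cube_set R) \<le> ennreal (1/2) * emeasure lebesgue (cube_set Q)"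
      using stp[OF Q] unfolding stp_def by - (elim conjE, assumption)+
    have "\<forall>R\<in>ch Q. cube_set R \<subseteq> cube_set Q \<and> side R < side Q"
      using stp[OF Q] unfolding stp_def by (elim conjE)
    then show "R \<in> ch Q \<Longrightarrow> cube_set R \<subseteq> cube_set Q" "R \<in> ch Q \<Longrightarrow> side R < side Q" by blast+
  qed
  obtain \<beta> :: "nat \<Rightarrow> 'n \<Rightarrow> int" where \<beta>: "\<beta> ` {1..3 ^ CARD('n)} = {l. \<forall>i. l i \<in> {0, 1, 2}}"
    using triple_index_enumeration by blast
  define Sf where "Sf j = dilate 3 ` {Q \<in> forest. dilate 3 Q \<in> triple.cubes (\<beta> j)}" for j
  have ae1: "AE x in lebesgue. \<forall>Q\<in>forest. x \<in> cube_set Q \<longrightarrow> x \<notin> (\<Union>R\<in>ch Q. cube_set R) \<longrightarrow>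
       ennreal \<bar>commutator T b m (localized f Q) x\<bar> \<le> step_const m * level_bound A m b f (dilate 3 Q) x"
  proof (subst AE_ball_countable[OF countable_forest], intro ballI)
    fix Q assume Q: "Q \<in> forest"
    show "AE x in lebesgue. x \<in> cube_set Q \<longrightarrow> x \<notin> (\<Union>R\<in>ch Q. cube_set R) \<longrightarrow>
       ennreal \<bar>commutator T b m (localized f Q) x\<bar> \<le> step_const m * level_bound A m b f (dilate 3 Q) x"
      using stp[OF forest_cubes[OF Q]] unfolding stp_def by (elim conjE)
  qed
  have ae2: "AE x in lebesgue. \<forall>Q\<in>forest. \<forall>R\<in>ch Q. x \<in> cube_set R \<longrightarrow>
       ennreal \<bar>commutator T b m (localized f Q) x\<bar> \<le>
         step_const m * level_bound A m b f (dilate 3 Q) x + ennreal \<bar>commutator T b m (localized f R) x\<bar>"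
  proof (subst AE_ball_countable[OF countable_forest], intro ballI)
    fix Q assume Q: "Q \<in> forest"
    have "\<forall>R\<in>ch Q. AE x in lebesgue. x \<in> cube_set R \<longrightarrow>
       ennreal \<bar>commutator T b m (localized f Q) x\<bar> \<le>
         step_const m * level_bound A m b f (dilate 3 Q) x + ennreal \<bar>commutator T b m (localized f R) x\<bar>"
      using stp[OF forest_cubes[OF Q]] unfolding stp_def by (elim conjE)
    then show "AE x in lebesgue. \<forall>R\<in>ch Q. x \<in> cube_set R \<longrightarrow>
       ennreal \<bar>commutator T b m (localized f Q) x\<bar> \<le>
         step_const m * level_bound A m b f (dilate 3 Q) x + ennreal \<bar>commutator T b m (localized f R) x\<bar>"
      by (subst AE_ball_countable[OF countable_ch[OF forest_cubes[OF Q]]])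
  qed
  have "AE x in lebesgue. ennreal \<bar>commutator T b m f x\<bar> \<le> step_const m *
       (\<Sum>j=1..3 ^ CARD('n). \<Sum>h=0..m. of_nat (m choose h) * sparse_op A m h (Sf j) b f x)"
    using ae1 ae2 AE_leaves
  proof eventually_elim
    case (elim x)
    obtain d where d: "x \<notin> (\<Union>Q\<in>lev (0 + d). cube_set Q)" using elim(3) by auto
    let ?\<Phi> = "\<lambda>Q. ennreal \<bar>commutator T b m (localized f Q) x\<bar>"
    let ?B = "\<lambda>Q. level_bound A m b f (dilate 3 Q) x"
    have "\<exists>X. finite X \<and> X \<subseteq> {R \<in> forest. x \<in> cube_set R \<and> side R \<le> side (st x)} \<and> ?\<Phi> (st x) \<le> step_const m * (\<Sum>R\<in>X. ?B R)"
    proof (rule finite_chain_bound[where \<Phi> = ?\<Phi> and B = ?B and C = "step_const m", OF _ _ _ st(2) d])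
      show "?\<Phi> Q \<le> step_const m * ?B Q" if "Q \<in> forest" "x \<in> cube_set Q" "x \<notin> (\<Union>R\<in>ch Q. cube_set R)" for Q
        by (rule elim(1)[rule_format, OF that])
      show "?\<Phi> Q \<le> step_const m * ?B Q + ?\<Phi> R" if "Q \<in> forest" "R \<in> ch Q" "x \<in> cube_set R" for Q R
        by (rule elim(2)[rule_format, OF that])
    qed simp
    then obtain X where X: "finite X" "X \<subseteq> {R \<in> forest. x \<in> cube_set R}" "?\<Phi> (st x) \<le> step_const m * (\<Sum>R\<in>X. ?B R)" by blast
    have "localized f (st x) = f"
    proof
      fix y show "localized f (st x) y = f y" using st(3)[of x] by (auto split: split_indicator)
    qed
    then have "ennreal \<bar>commutator T b m f x\<bar> \<le> step_const m * (\<Sum>R\<in>X. ?B R)" using X(3) by simp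
    also have "\<dots> \<le> step_const m * (\<Sum>j=1..3 ^ CARD('n). \<Sum>h=0..m. of_nat (m choose h) * sparse_op A m h (Sf j) b f x)"
      unfolding Sf_def by (intro mult_left_mono chain_le_sparse[OF X(1,2) \<beta>]) simp
    finally show ?case .
  qed
  moreover have "sparse_family (Sf j)" for j unfolding Sf_def by (rule sparse_triples)
  ultimately show ?thesis by blast
qed

end

section \<open>From the stated hypotheses to the working setting\<close>

lemma Cc_infinity_bounded:
  assumes "f \<in> (Cc_infinity :: (real ^ 'n::finite \<Rightarrow> real) set)"
  shows "f \<in> borel_measurable lebesgue" "\<exists>M. \<forall>y. \<bar>f y\<bar> \<le> M" "bounded {y. f y \<noteq> 0}"
proof -
  have c: "continuous_on UNIV f" and k: "compact (supp f)"
    using assms unfolding Cc_infinity_def by (auto dest: spec[of _ 0])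
  have "f \<in> borel_measurable borel" by (rule borel_measurable_continuous_onI[OF c])
  then show "f \<in> borel_measurable lebesgue" by (simp add: measurable_completion)
  have sub: "{y. f y \<noteq> 0} \<subseteq> supp f" unfolding supp_def by (rule closure_subset)
  then show "bounded {y. f y \<noteq> 0}" using compact_imp_bounded[OF k] bounded_subset by blast
  have "compact (f ` supp f)" by (rule compact_continuous_image[OF continuous_on_subset[OF c] k]) simp
  then obtain M where M: "\<And>z. z \<in> f ` supp f \<Longrightarrow> norm z \<le> M" using compact_imp_bounded bounded_iff by metis
  have "\<bar>f y\<bar> \<le> \<bar>M\<bar>" for y
  proof (cases "f y = 0")
    case False
    then have "y \<in> supp f" using sub by blast
    then have "norm (f y) \<le> M" by (intro M) blast
    then show ?thesis by simp
  qed simp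
  then show "\<exists>M. \<forall>y. \<bar>f y\<bar> \<le> M" by blast
qed

lemma L1_loc_measurable:
  fixes b :: "real ^ 'n::finite \<Rightarrow> real"
  assumes "b \<in> L1_loc" shows "b \<in> borel_measurable lebesgue"
proof (rule borel_measurable_LIMSEQ_real)
  fix i :: nat
  have "b absolutely_integrable_on (cball 0 (real i))" using assms unfolding L1_loc_def by simp
  then show "(\<lambda>z. indicat_real (cball 0 (real i)) z *\<^sub>R b z) \<in> borel_measurable lebesgue"
    unfolding set_integrable_def by (rule borel_measurable_integrable)
next
  fix z :: "real ^ 'n"
  obtain m :: nat where "norm z \<le> real m" using real_arch_simple by blast
  then have "\<forall>i\<ge>m. indicat_real (cball 0 (real i)) z *\<^sub>R b z = b z" by (auto simp: indicator_def)
  then show "(\<lambda>i. indicat_real (cball 0 (real i)) z *\<^sub>R b z) \<longlonglongrightarrow> b z"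
    by (intro tendsto_eventually) (auto simp: eventually_sequentially)
qed

text \<open>The bound 0 is treated apart because the Calderon-Zygmund height t / N requires N > 0.
  Each branch of \<open>extend\<close> then gives 0 almost everywhere, on the L^1 branch as the
  limit in measure of functions vanishing almost everywhere.\<close>

lemma commutator_zero:
  fixes T :: "(real ^ 'n::finite \<Rightarrow> real) \<Rightarrow> real ^ 'n \<Rightarrow> real"
  assumes "L2_operator T 0" shows "AE x in lebesgue. commutator T b m f x = 0"
proof (induction m arbitrary: f)
  case 0
  interpret L2_operator T 0 by (rule assms)
  have T0: "AE x in lebesgue. T g x = 0" if "g \<in> L2" for g
  proof -
    have "(LINT x|lebesgue. (T g x)\<^sup>2) \<le> 0" using T_bound[OF that] by simp
    moreover have "0 \<le> (LINT x|lebesgue. (T g x)\<^sup>2)" by simp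
    ultimately have "(LINT x|lebesgue. (T g x)\<^sup>2) = 0" by linarith
    then have "AE x in lebesgue. (T g x)\<^sup>2 = 0"
      using integral_nonneg_eq_0_iff_AE[OF L2D(2)[OF T_L2[OF that]]] by simp
    then show ?thesis by simp
  qed
  have "AE x in lebesgue. extend T f x = 0"
  proof (cases "f \<in> L2")
    case True
    then show ?thesis using T0 by (simp add: extend_def)
  next
    case False
    show ?thesis
    proof (cases "\<exists>u. L1_extension_value T f u")
      case True
      define u where "u = (SOME u. L1_extension_value T f u)"
      have u: "L1_extension_value T f u" unfolding u_def by (rule someI_ex[OF True])
      have e: "extend T f = u" using False True by (simp add: extend_def u_def)
      have fi: "integrable lebesgue f" and um: "u \<in> borel_measurable lebesgue" using u by (auto simp: L1_extension_value_def)
      note t = trunc_props[OF fi]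
      have mt: "meas_tendsto (\<lambda>k. T (trunc f k)) u"
        using u t(1,2,5) unfolding L1_extension_value_def meas_tendsto_def by blast
      have "AE x in lebesgue. \<forall>k. T (trunc f k) x = 0" unfolding AE_all_countable using T0 t(1) by blast
      then have "AE x in lebesgue. x \<in> UNIV \<longrightarrow> (\<lambda>k. T (trunc f k) x) \<longlonglongrightarrow> 0" by eventually_elim simp
      from meas_tendsto_pointwise[OF L2D(1)[OF T_L2[OF t(1)]] um mt this] show ?thesis by (simp add: e)
    next
      case no: False
      have "extend T f = (\<lambda>_. 0)"
        unfolding extend_def if_not_P[OF False] by (rule if_not_P[OF no])
      then show ?thesis by simp
    qed
  qed
  then show ?case by simp
next
  case (Suc m)
  show ?case using Suc[of f] Suc[of "\<lambda>y. b y * f y"] by eventually_elim simp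
qed

text \<open>For almost every x the sections of \<open>K\<close> and of its Borel version agree
  almost everywhere, so the kernel integrals against test functions coincide.\<close>

lemma hormander_operator_kernel:
  fixes T :: "(real ^ 'n::finite \<Rightarrow> real) \<Rightarrow> real ^ 'n \<Rightarrow> real"
  assumes T: "hormander_operator E K T" and N: "L2_operator T N"
  shows "\<exists>k ck. kernel_operator T N k ck \<and>
    (AE x in lebesgue. AE y in lebesgue. K x y = k x y) \<and> (AE y in lebesgue. AE x in lebesgue. K x y = k x y)"
proof -
  have sm: "\<And>f. f \<in> Cc_infinity \<Longrightarrow> AE x in lebesgue. x \<notin> supp f \<longrightarrow> T f x = (LINT y|lebesgue. K x y * f y)"
    and loc: "\<And>C. compact C \<Longrightarrow> C \<subseteq> {(x, y). x \<noteq> y} \<Longrightarrow> (\<lambda>(x, y). K x y) absolutely_integrable_on C"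
    using T unfolding hormander_operator_def by blast+
  obtain ck where ck: "\<And>x y. x \<noteq> y \<Longrightarrow> \<bar>K x y\<bar> \<le> ck / norm (x - y) ^ CARD('n)"
    using T unfolding hormander_operator_def by blast
  obtain k where k: "(\<lambda>(x, y). k x y) \<in> borel_measurable (borel \<Otimes>\<^sub>M borel)"
    "\<forall>x y. x \<noteq> y \<longrightarrow> \<bar>k x y\<bar> \<le> ck / norm (x - y) ^ CARD('n)"
    "AE x in lebesgue. AE y in lebesgue. K x y = k x y" "AE y in lebesgue. AE x in lebesgue. K x y = k x y"
    using ex_borel_kernel[OF loc ck] by blast
  interpret L2_operator T N by (rule N)
  have "kernel_operator T N k ck"
  proof
    show "(\<lambda>(x, y). k x y) \<in> borel_measurable (borel \<Otimes>\<^sub>M borel)" by (rule k(1))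
    show "\<bar>k x y\<bar> \<le> ck / norm (x - y) ^ CARD('n)" if "x \<noteq> y" for x y using k(2) that by blast
    fix f :: "real ^ 'n \<Rightarrow> real" assume f: "f \<in> Cc_infinity"
    note fm = Cc_infinity_bounded(1)[OF f]
    show "AE x in lebesgue. x \<notin> supp f \<longrightarrow> T f x = (LINT y|lebesgue. k x y * f y)"
      using sm[OF f] k(3)
    proof eventually_elim
      case (elim x)
      have "k x \<in> borel_measurable borel" using measurable_Pair2[OF k(1), of x] by simp
      then have "k x \<in> borel_measurable lebesgue" by (simp add: measurable_completion)
      then have km: "(\<lambda>y. k x y * f y) \<in> borel_measurable lebesgue" using fm by (intro borel_measurable_times)
      have ae: "AE y in lebesgue. k x y * f y = K x y * f y" using elim(2) by eventually_elim simp
      have "(LINT y|lebesgue. k x y * f y) = (LINT y|lebesgue. K x y * f y)"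
        by (rule integral_cong_AE[OF km borel_measurable_AE[OF km ae] ae])
      then show ?case using elim(1) by simp
    qed
  qed
  then show ?thesis using k(3,4) by blast
qed

text \<open>The constant in \<open>step_const\<close> without the factor \<sigma> N, restated
  outside the locale in terms of n and m. The leading 2 comes from the passage to the Luxemburg
  infimum.\<close>

definition domination_const :: "nat \<Rightarrow> nat \<Rightarrow> real" where
  "domination_const n m = (let \<epsilon> = 1 / (2 ^ (n + 2) * real (m + 1)); \<alpha> = 2 * 9 ^ n / \<epsilon> in
     2 * (2 * 2 ^ n * \<alpha> + 96 * 6 ^ n * (1 / \<epsilon> + 1 + \<alpha>)))"

lemma domination_const_pos: "0 < domination_const n m"
  unfolding domination_const_def Let_def by (intro mult_pos_pos add_pos_pos divide_pos_pos) auto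

lemma (in hormander_setting) step_const_eq: "step_const m = ennreal (domination_const CARD('n) m * (\<sigma> * N))"
  unfolding step_const_def local_const_def stop_level_def eps_def domination_const_def Let_def
  by (rule arg_cong[where f = ennreal]) (simp only: mult_ac)

lemma sparse_domination_hormander:
  fixes T :: "(real ^ 'n::finite \<Rightarrow> real) \<Rightarrow> real ^ 'n \<Rightarrow> real"
  assumes A: "young A" and Y: "class_Y p0 p1 cA0 cA1 tA A" and T: "hormander_operator (complementary A) K T"
    and f: "f \<in> Cc_infinity" and b: "b \<in> L1_loc"
  shows "\<exists>S :: nat \<Rightarrow> 'n cube set. (\<forall>j. sparse_family (S j)) \<and>
    (AE x in lebesgue. ennreal \<bar>commutator T b m f x\<bar> \<le>
       ennreal (domination_const CARD('n) m) * (ennreal (max cA0 cA1) * (H K (complementary A) + ennreal (opnorm_L2 T))) *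
       (\<Sum>j=1..3 ^ CARD('n). \<Sum>h=0..m. of_nat (m choose h) * sparse_op A m h (S j) b f x))"
proof -
  have HT: "L2_bounded_linear T" "H K (complementary A) < \<infinity>" using T by (auto simp: hormander_operator_def)
  obtain Hr where Hr: "H K (complementary A) = ennreal Hr" "0 \<le> Hr" using HT(2) by (cases "H K (complementary A)") auto
  \<comment> \<open>\<open>ennreal\<close> sends negative numbers to 0, so the positive part of the
    norm gives the same right-hand side, and no separate proof that the supremum is nonnegative is
    called for.\<close>
  define w where "w = max 0 (opnorm_L2 T)"
  have w: "0 \<le> w" "opnorm_L2 T \<le> w" unfolding w_def by simp_all
  have ew: "ennreal (opnorm_L2 T) = ennreal w"
    by (cases "0 \<le> opnorm_L2 T") (simp_all add: w_def max_def ennreal_neg)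
  obtain \<sigma> where sg: "0 < \<sigma>" "\<sigma> \<le> cA1" "A \<sigma> = 1" by (rule young_unit[OF A Y])
  have c1: "1 \<le> cA1" using Y by (simp add: class_Y_def)
  \<comment> \<open>This N dominates the norm and satisfies H_K \<le> \<sigma> N, while \<sigma> N =
    \<sigma> w + H_K. Then \<sigma> \<le> cA1 and 1 \<le> cA1 bring in the maximum of the class
    constants.\<close>
  define N where "N = w + Hr / \<sigma>"
  have q: "0 \<le> Hr / \<sigma>" using Hr sg by simp
  then have N: "0 \<le> N" "opnorm_L2 T \<le> N" using w unfolding N_def by linarith+
  have HN: "Hr \<le> \<sigma> * N" using w sg by (simp add: N_def distrib_left)
  note fm = Cc_infinity_bounded(1)[OF f] and fb = Cc_infinity_bounded(3)[OF f]
  obtain M where M: "\<And>y. \<bar>f y\<bar> \<le> M" using Cc_infinity_bounded(2)[OF f] by blast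
  note bm = L1_loc_measurable[OF b]
  have NT: "L2_operator T N" by (rule L2_operator_of_bounded_linear[OF HT(1) N(2)])
  show ?thesis
  proof (cases "N = 0")
    case True
    have "AE x in lebesgue. commutator T b m f x = 0" using commutator_zero NT True by blast
    moreover have "sparse_family ({} :: 'n cube set)"
      unfolding sparse_family_def eta_sparse_def
      by (intro exI[of _ "1/2"]) (auto intro!: exI[of _ base.cubes] base.dyadic_lattice_cubes)
    ultimately show ?thesis by (intro exI[of _ "\<lambda>_. {}"]) (auto elim: eventually_mono)
  next
    case False
    then have N0: "0 < N" using N by simp
    obtain k ck where k: "kernel_operator T N k ck" "AE x in lebesgue. AE y in lebesgue. K x y = k x y" "AE y in lebesgue. AE x in lebesgue. K x y = k x y"
      using hormander_operator_kernel[OF T NT] by blast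
    interpret kernel_operator T N k ck by (rule k(1))
    interpret hormander_setting T N k ck K A \<sigma>
    proof
      show "H K (complementary A) \<le> ennreal (\<sigma> * N)" unfolding Hr(1) by (rule ennreal_leI[OF HN])
    qed (use A sg k N0 in auto)
    obtain Sf :: "nat \<Rightarrow> 'n cube set" where Sf: "\<forall>j. sparse_family (Sf j)"
      "AE x in lebesgue. ennreal \<bar>commutator T b m f x\<bar> \<le> step_const m *
       (\<Sum>j=1..3 ^ CARD('n). \<Sum>h=0..m. of_nat (m choose h) * sparse_op A m h (Sf j) b f x)"
      using sparse_domination[OF M fb fm bm] by blast
    have "\<sigma> * N = \<sigma> * w + Hr" using sg by (simp add: N_def field_simps)
    also have "\<dots> \<le> max cA0 cA1 * w + max cA0 cA1 * Hr"
    proof (rule add_mono)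
      show "\<sigma> * w \<le> max cA0 cA1 * w" using sg w by (intro mult_right_mono) auto
      have "1 * Hr \<le> max cA0 cA1 * Hr" using c1 Hr by (intro mult_right_mono) auto
      then show "Hr \<le> max cA0 cA1 * Hr" by simp
    qed
    finally have le: "\<sigma> * N \<le> max cA0 cA1 * (Hr + w)" by (simp add: algebra_simps)
    have "step_const m \<le> ennreal (domination_const CARD('n) m * (max cA0 cA1 * (Hr + w)))"
      unfolding step_const_eq using domination_const_pos by (intro ennreal_leI mult_left_mono le) (simp add: less_imp_le)
    also have "\<dots> = ennreal (domination_const CARD('n) m) * (ennreal (max cA0 cA1) * (H K (complementary A) + ennreal (opnorm_L2 T)))"
    proof -
      have "ennreal (Hr + w) = ennreal Hr + ennreal w" using Hr w by (intro ennreal_plus) auto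
      moreover have "ennreal (max cA0 cA1 * (Hr + w)) = ennreal (max cA0 cA1) * ennreal (Hr + w)"
        using c1 by (intro ennreal_mult') auto
      moreover have "ennreal (domination_const CARD('n) m * (max cA0 cA1 * (Hr + w))) = ennreal (domination_const CARD('n) m) * ennreal (max cA0 cA1 * (Hr + w))"
        by (intro ennreal_mult' less_imp_le domination_const_pos)
      ultimately show ?thesis unfolding Hr(1) ew by simp
    qed
    finally have step: "step_const m \<le> ennreal (domination_const CARD('n) m) * (ennreal (max cA0 cA1) * (H K (complementary A) + ennreal (opnorm_L2 T)))" .
    have "AE x in lebesgue. ennreal \<bar>commutator T b m f x\<bar> \<le>
       ennreal (domination_const CARD('n) m) * (ennreal (max cA0 cA1) * (H K (complementary A) + ennreal (opnorm_L2 T))) *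
       (\<Sum>j=1..3 ^ CARD('n). \<Sum>h=0..m. of_nat (m choose h) * sparse_op A m h (Sf j) b f x)"
      using Sf(2)
    proof eventually_elim
      case (elim x)
      show ?case by (rule order_trans[OF elim mult_right_mono[OF step]]) simp
    qed
    with Sf(1) show ?thesis by blast
  qed
qed

theorem theorem1p1:
  shows "\<exists>(c_nm :: nat \<Rightarrow> real) (c_npp :: real \<Rightarrow> real \<Rightarrow> real).
    (\<forall>m. 0 < c_nm m) \<and> (\<forall>p0 p1. 0 < c_npp p0 p1) \<and>
    (\<forall>(p0 :: real) (p1 :: real) (A :: real \<Rightarrow> real) (cA0 :: real) (cA1 :: real) (tA :: real)
       (T :: (real ^ ('n::finite) \<Rightarrow> real) \<Rightarrow> real ^ 'n \<Rightarrow> real)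
       (K :: real ^ 'n \<Rightarrow> real ^ 'n \<Rightarrow> real) (m :: nat).
      1 \<le> p0 \<and> p0 \<le> p1 \<and> young A \<and> class_Y p0 p1 cA0 cA1 tA A \<and>
      hormander_operator (complementary A) K T \<longrightarrow>
      (\<forall>f\<in>Cc_infinity. \<forall>b\<in>L1_loc.
        \<exists>S :: nat \<Rightarrow> 'n cube set.
          (\<forall>j\<in>{1..3 ^ CARD('n)}. sparse_family (S j)) \<and>
          (AE x in lebesgue.
            ennreal \<bar>commutator T b m f x\<bar> \<le>
              ennreal (c_nm m) *
              (ennreal (c_npp p0 p1 * max cA0 cA1) * (H K (complementary A) + ennreal (opnorm_L2 T))) *
              (\<Sum>j=1..3 ^ CARD('n). \<Sum>h=0..m. of_nat (m choose h) * sparse_op A m h (S j) b f x))))"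
\<comment> \<open>The estimate holds with \<open>max cA0 cA1\<close> itself as the factor, so the
  function \<open>c_npp\<close> is taken to be constantly 1.\<close>
proof (intro exI[of _ "domination_const CARD('n)"] exI[of _ "\<lambda>_ _. 1"] conjI allI impI ballI)
  show "0 < domination_const CARD('n) m" for m by (rule domination_const_pos)
  show "0 < (1 :: real)" by simp
  fix p0 p1 :: real and A :: "real \<Rightarrow> real" and cA0 cA1 tA :: real
    and T :: "(real ^ 'n \<Rightarrow> real) \<Rightarrow> real ^ 'n \<Rightarrow> real" and K :: "real ^ 'n \<Rightarrow> real ^ 'n \<Rightarrow> real"
    and m :: nat and f b :: "real ^ 'n \<Rightarrow> real"
  assume h: "1 \<le> p0 \<and> p0 \<le> p1 \<and> young A \<and> class_Y p0 p1 cA0 cA1 tA A \<and> hormander_operator (complementary A) K T"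
    and f: "f \<in> Cc_infinity" and b: "b \<in> L1_loc"
  then show "\<exists>S :: nat \<Rightarrow> 'n cube set.
          (\<forall>j\<in>{1..3 ^ CARD('n)}. sparse_family (S j)) \<and>
          (AE x in lebesgue.
            ennreal \<bar>commutator T b m f x\<bar> \<le>
              ennreal (domination_const CARD('n) m) *
              (ennreal (1 * max cA0 cA1) * (H K (complementary A) + ennreal (opnorm_L2 T))) *
              (\<Sum>j=1..3 ^ CARD('n). \<Sum>h=0..m. of_nat (m choose h) * sparse_op A m h (S j) b f x))"
    using sparse_domination_hormander[of A p0 p1 cA0 cA1 tA K T f b m] by (simp only: mult_1) blast
qed

end
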